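(* Let $H\in(1/2,3/4)$, and let $\theta=(\mu_1,\dots,\mu_p,\alpha)^t\in\mathbb{R}^p\times(0,\infty)$ be the parameter vector of the fractional Ornstein Uhlenbeck process $$dX_t=\Big(\sum_{i=1}^p\mu_i\varphi_i(t)-\alpha X_t\Big)dt+\sigma\, dB_t^H,\qquad X_0=\xi_0 .$$ Then the least squares estimator $\hat\theta_n:=Q_n^{-1}P_n$ converges in probability to $\theta$ as $n\to\infty$.
   Context: $B^H=(B^H_t)_{t\in\mathbb{R}}$ is a fractional Brownian motion with Hurst parameter $H$, i.e. the continuous centered Gaussian process with $\mathrm{E}[B_t^HB_s^H]=\frac12(|t|^{2H}+|s|^{2H}-|t-s|^{2H})$. $\sigma>0$ is known. $\xi_0$ is a random variable independent of $B^H$. The functions $\varphi_1,\dots,\varphi_p:\mathbb{R}\to\mathbb{R}$ are bounded, periodic with period $1$, and orthonormal: $\int_0^1\varphi_i(t)\varphi_j(t)\,dt=\delta_{ij}$. The parameters satisfy $\mu_i\in\mathbb{R}$, $\alpha>0$. The process $X=(X_t)_{t\ge0}$ is the almost surely continuous solution of the equation, i.e. $X_t=\xi_0+\int_0^t(\sum_i\mu_i\varphi_i(s)-\alpha X_s)ds+\sigma B^H_t$. All integrals with respect to $B^H$ are divergence (Skorohod) integrals, i.e. defined by the adjoint of the Malliavin derivative with respect to $B^H$ (for deterministic integrands, Wiener integrals). Integrals with respect to $X$ are defined through the equation: $\int_0^n u_t\,dX_t=\int_0^n u_t(\sum_i\mu_i\varphi_i(t)-\alpha X_t)dt+\sigma\int_0^n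 u_t\,dB_t^H$. For $n\in\mathbb{N}$ set $$P_n:=\Big(\int_0^n\varphi_1(t)dX_t,\dots,\int_0^n\varphi_p(t)dX_t,-\int_0^nX_tdX_t\Big)^t,\qquad Q_n:=\begin{pmatrix} nI_p & -a_n\\ -a_n^t & b_n\end{pmatrix},$$ where $I_p$ is the $p\times p$ identity matrix, $a_n^t:=\big(\int_0^n\varphi_1(t)X_tdt,\dots,\int_0^n\varphi_p(t)X_tdt\big)$ and $b_n:=\int_0^nX_t^2dt$. The estimator $\hat\theta_n=Q_n^{-1}P_n$ is defined when $Q_n$ is invertible, which holds almost surely for all large enough $n$. *)

theory Defs
  imports "HOL-Probability.Probability"
begin

section \<open>Fractional Brownian motion\<close>

text \<open>Constants count as (degenerate) Gaussian variables; they need a separate clause because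
  \<^const>\<open>normal_density\<close> is only meaningful for positive standard deviation.\<close>

definition gaussian_rv :: "'a measure \<Rightarrow> ('a \<Rightarrow> real) \<Rightarrow> bool" where
  "gaussian_rv M Z \<longleftrightarrow> Z \<in> borel_measurable M \<and>
     ((\<exists>m. AE \<omega> in M. Z \<omega> = m) \<or>
      (\<exists>m s. s > 0 \<and> distributed M lborel Z (\<lambda>x. ennreal (normal_density m s x))))"

definition gaussian_process :: "'a measure \<Rightarrow> ('t \<Rightarrow> 'a \<Rightarrow> real) \<Rightarrow> bool" where
  "gaussian_process M B \<longleftrightarrow>
     (\<forall>T c. finite T \<longrightarrow> gaussian_rv M (\<lambda>\<omega>. \<Sum>t\<in>T. c t * B t \<omega>))"

definition fractional_brownian_motion ::
    "'a measure \<Rightarrow> real \<Rightarrow> (real \<Rightarrow> 'a \<Rightarrow> real) \<Rightarrow> bool" where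
  "fractional_brownian_motion M H B \<longleftrightarrow>
     gaussian_process M B \<and>
     (\<forall>t. (\<integral>\<omega>. B t \<omega> \<partial>M) = 0) \<and>
     (\<forall>t s. (\<integral>\<omega>. B t \<omega> * B s \<omega> \<partial>M) =
        (\<bar>t\<bar> powr (2 * H) + \<bar>s\<bar> powr (2 * H) - \<bar>t - s\<bar> powr (2 * H)) / 2) \<and>
     (AE \<omega> in M. continuous_on UNIV (\<lambda>t. B t \<omega>))"

section \<open>The Hilbert space of the process\<close>

text \<open>The inner product is fixed by requiring that \<open>fbm_step t\<close> and \<open>fbm_step s\<close> have inner
  product \<open>E[B t * B s]\<close>, where \<open>fbm_step t\<close> is the indicator of \<open>(0,t]\<close>, oriented so that
  negative times are allowed. For \<open>1/2 < H < 1\<close> this covariance is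
  \<open>H (2H-1) \<integral>\<^sub>0\<^sup>t \<integral>\<^sub>0\<^sup>s \<bar>r-q\<bar>\<^bsup>2H-2\<^esup> dq dr\<close>, which gives the formula below on all functions for
  which the double integral converges absolutely. Only \<open>1/2 < H < 1\<close> is meant.\<close>

definition fbm_step :: "real \<Rightarrow> real \<Rightarrow> real" where
  "fbm_step t r = indicator {0<..t} r - indicator {t<..0} r"

definition fbm_inner :: "real \<Rightarrow> (real \<Rightarrow> real) \<Rightarrow> (real \<Rightarrow> real) \<Rightarrow> real" where
  "fbm_inner H f g = H * (2 * H - 1) *
     (\<integral>(r, s). f r * g s * \<bar>r - s\<bar> powr (2 * H - 2) \<partial>(lborel \<Otimes>\<^sub>M lborel))"

section \<open>Malliavin derivative of smooth cylindrical variables\<close>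

definition partial_deriv :: "nat \<Rightarrow> ((nat \<Rightarrow> real) \<Rightarrow> real) \<Rightarrow> (nat \<Rightarrow> real) \<Rightarrow> real" where
  "partial_deriv i f x = deriv (\<lambda>y. f (x(i := y))) (x i)"

definition iter_partial :: "nat list \<Rightarrow> ((nat \<Rightarrow> real) \<Rightarrow> real) \<Rightarrow> (nat \<Rightarrow> real) \<Rightarrow> real" where
  "iter_partial is f = foldr partial_deriv is f"

text \<open>Infinitely differentiable functions of \<open>k\<close> real variables that are bounded together with all
  their partial derivatives. Since \<open>k\<close> varies, such a function is represented as a function on
  sequences that depends on the coordinates below \<open>k\<close> only.\<close>

definition bounded_smooth :: "nat \<Rightarrow> ((nat \<Rightarrow> real) \<Rightarrow> real) \<Rightarrow> bool" where
  "bounded_smooth k f \<longleftrightarrow>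
     (\<forall>x y. (\<forall>i<k. x i = y i) \<longrightarrow> f x = f y) \<and>
     (\<forall>is. set is \<subseteq> {..<k} \<longrightarrow>
        continuous_on UNIV (iter_partial is f) \<and>
        bounded (range (iter_partial is f)) \<and>
        (\<forall>i<k. \<forall>x. (\<lambda>y. iter_partial is f (x(i := y))) differentiable (at (x i))))"

text \<open>The underlying information is \<open>\<sigma>(\<xi>) \<or> \<sigma>(B)\<close>, where the variable \<open>\<xi>\<close> is independent of
  \<open>B\<close>. The Malliavin derivative with respect to \<open>B\<close> treats \<open>\<sigma>(\<xi>)\<close>-measurable variables as
  constants: a smooth variable is \<open>G * f (B t\<^sub>0, \<dots>, B t\<^bsub>k-1\<^esub>)\<close> with bounded \<open>\<sigma>(\<xi>)\<close>-measurable \<open>G\<close>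
  and \<open>f\<close> as above (finite sums of these are not needed, the duality below being linear).\<close>

definition initial_algebra :: "'a measure \<Rightarrow> ('a \<Rightarrow> real) \<Rightarrow> 'a measure" where
  "initial_algebra M \<xi> = vimage_algebra (space M) \<xi> borel"

definition full_algebra ::
    "'a measure \<Rightarrow> (real \<Rightarrow> 'a \<Rightarrow> real) \<Rightarrow> ('a \<Rightarrow> real) \<Rightarrow> 'a measure" where
  "full_algebra M B \<xi> = sigma (space M)
     ({\<xi> -` A \<inter> space M | A. A \<in> sets borel} \<union> {B t -` A \<inter> space M | t A. A \<in> sets borel})"

definition smooth_data ::
    "'a measure \<Rightarrow> ('a \<Rightarrow> real) \<Rightarrow> ('a \<Rightarrow> real) \<Rightarrow> nat \<Rightarrow> ((nat \<Rightarrow> real) \<Rightarrow> real) \<Rightarrow> bool" where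
  "smooth_data M \<xi> G k f \<longleftrightarrow>
     G \<in> borel_measurable (initial_algebra M \<xi>) \<and> bounded (G ` space M) \<and> bounded_smooth k f"

definition smooth_variable ::
    "(real \<Rightarrow> 'a \<Rightarrow> real) \<Rightarrow> ('a \<Rightarrow> real) \<Rightarrow> (nat \<Rightarrow> real) \<Rightarrow> ((nat \<Rightarrow> real) \<Rightarrow> real) \<Rightarrow>
     'a \<Rightarrow> real" where
  "smooth_variable B G t f \<omega> = G \<omega> * f (\<lambda>i. B (t i) \<omega>)"

definition malliavin_deriv ::
    "(real \<Rightarrow> 'a \<Rightarrow> real) \<Rightarrow> ('a \<Rightarrow> real) \<Rightarrow> nat \<Rightarrow> (nat \<Rightarrow> real) \<Rightarrow>
     ((nat \<Rightarrow> real) \<Rightarrow> real) \<Rightarrow> 'a \<Rightarrow> real \<Rightarrow> real" where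
  "malliavin_deriv B G k t f \<omega> r =
     (\<Sum>i<k. G \<omega> * partial_deriv i f (\<lambda>j. B (t j) \<omega>) * fbm_step (t i) r)"

section \<open>Divergence\<close>

text \<open>\<open>Y\<close> is the divergence of \<open>u\<close>: the adjoint relation \<open>E[F Y] = E[\<langle>D F, u\<rangle>]\<close>, with
  \<open>Y\<close> square integrable and \<open>u\<close> a square integrable random element of the function space.\<close>

definition is_divergence ::
    "'a measure \<Rightarrow> real \<Rightarrow> (real \<Rightarrow> 'a \<Rightarrow> real) \<Rightarrow> ('a \<Rightarrow> real) \<Rightarrow>
     ('a \<Rightarrow> real \<Rightarrow> real) \<Rightarrow> ('a \<Rightarrow> real) \<Rightarrow> bool" where
  "is_divergence M H B \<xi> u Y \<longleftrightarrow>
     (\<lambda>(\<omega>, r). u \<omega> r) \<in> borel_measurable (full_algebra M B \<xi> \<Otimes>\<^sub>M borel) \<and>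
     integrable (M \<Otimes>\<^sub>M (lborel \<Otimes>\<^sub>M lborel))
       (\<lambda>(\<omega>, r, s). u \<omega> r * u \<omega> s * \<bar>r - s\<bar> powr (2 * H - 2)) \<and>
     Y \<in> borel_measurable (full_algebra M B \<xi>) \<and>
     integrable M (\<lambda>\<omega>. (Y \<omega>)\<^sup>2) \<and>
     (\<forall>G k t f. smooth_data M \<xi> G k f \<longrightarrow>
        (\<integral>\<omega>. smooth_variable B G t f \<omega> * Y \<omega> \<partial>M) =
        (\<integral>\<omega>. fbm_inner H (malliavin_deriv B G k t f \<omega>) (u \<omega>) \<partial>M))"

text \<open>No moments of \<open>\<xi>\<close> are assumed, so an integrand involving \<open>\<xi>\<close> need not be square
  integrable. As usual, the divergence is extended by localisation, here along an increasing
  sequence of \<open>\<sigma>(\<xi>)\<close>-measurable events of the form, say, \<open>\<bar>\<xi>\<bar> \<le> k\<close>. The integrand only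
  matters up to almost everywhere equality, whence the jointly measurable versions \<open>v k\<close>.\<close>

definition has_skorohod_integral ::
    "'a measure \<Rightarrow> real \<Rightarrow> (real \<Rightarrow> 'a \<Rightarrow> real) \<Rightarrow> ('a \<Rightarrow> real) \<Rightarrow>
     ('a \<Rightarrow> real \<Rightarrow> real) \<Rightarrow> ('a \<Rightarrow> real) \<Rightarrow> bool" where
  "has_skorohod_integral M H B \<xi> u Y \<longleftrightarrow>
     Y \<in> borel_measurable (full_algebra M B \<xi>) \<and>
     (\<exists>A v. incseq A \<and> (\<forall>k. A k \<in> sets (initial_algebra M \<xi>)) \<and>
        (AE \<omega> in M. \<omega> \<in> (\<Union>k. A k)) \<and>
        (\<forall>k::nat. (AE \<omega> in M. AE r in lborel. v k \<omega> r = indicator (A k) \<omega> * u \<omega> r) \<and>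
             is_divergence M H B \<xi> (v k) (\<lambda>\<omega>. indicator (A k) \<omega> * Y \<omega>)))"

text \<open>The integral over \<open>[0,T]\<close>. It is determined up to a null set only; the choice picks a
  version.\<close>

definition skorohod_integral ::
    "'a measure \<Rightarrow> real \<Rightarrow> (real \<Rightarrow> 'a \<Rightarrow> real) \<Rightarrow> ('a \<Rightarrow> real) \<Rightarrow> real \<Rightarrow>
     (real \<Rightarrow> 'a \<Rightarrow> real) \<Rightarrow> 'a \<Rightarrow> real" where
  "skorohod_integral M H B \<xi> T u =
     (SOME Y. has_skorohod_integral M H B \<xi> (\<lambda>\<omega> t. indicator {0..T} t * u t \<omega>) Y)"

section \<open>The fractional Ornstein-Uhlenbeck process and the least squares estimator\<close>

definition periodic_mean :: "('p::finite \<Rightarrow> real \<Rightarrow> real) \<Rightarrow> real^'p \<Rightarrow> real \<Rightarrow> real" where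
  "periodic_mean \<phi> \<mu> t = (\<Sum>i\<in>UNIV. \<mu> $ i * \<phi> i t)"

definition fou_process ::
    "'a measure \<Rightarrow> (real \<Rightarrow> 'a \<Rightarrow> real) \<Rightarrow> real \<Rightarrow> ('p::finite \<Rightarrow> real \<Rightarrow> real) \<Rightarrow> real^'p \<Rightarrow>
     real \<Rightarrow> ('a \<Rightarrow> real) \<Rightarrow> (real \<Rightarrow> 'a \<Rightarrow> real) \<Rightarrow> bool" where
  "fou_process M B \<sigma> \<phi> \<mu> \<alpha> \<xi> X \<longleftrightarrow>
     (\<forall>t\<ge>0. X t \<in> borel_measurable M) \<and>
     (AE \<omega> in M. continuous_on {0..} (\<lambda>t. X t \<omega>)) \<and>
     (AE \<omega> in M. \<forall>t\<ge>0. X t \<omega> =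
        \<xi> \<omega> + (LINT s:{0..t}|lborel. periodic_mean \<phi> \<mu> s - \<alpha> * X s \<omega>) + \<sigma> * B t \<omega>)"

definition fou_integral ::
    "'a measure \<Rightarrow> real \<Rightarrow> (real \<Rightarrow> 'a \<Rightarrow> real) \<Rightarrow> real \<Rightarrow> ('p::finite \<Rightarrow> real \<Rightarrow> real) \<Rightarrow>
     real^'p \<Rightarrow> real \<Rightarrow> ('a \<Rightarrow> real) \<Rightarrow> (real \<Rightarrow> 'a \<Rightarrow> real) \<Rightarrow> real \<Rightarrow>
     (real \<Rightarrow> 'a \<Rightarrow> real) \<Rightarrow> 'a \<Rightarrow> real" where
  "fou_integral M H B \<sigma> \<phi> \<mu> \<alpha> \<xi> X T u \<omega> =
     (LINT t:{0..T}|lborel. u t \<omega> * (periodic_mean \<phi> \<mu> t - \<alpha> * X t \<omega>)) +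
     \<sigma> * skorohod_integral M H B \<xi> T u \<omega>"

text \<open>Vectors and matrices of size \<open>p + 1\<close> are indexed by \<open>'p option\<close>, with \<open>None\<close> as the last
  index.\<close>

definition parameter_vector :: "real^'p \<Rightarrow> real \<Rightarrow> real^('p::finite option)" where
  "parameter_vector \<mu> \<alpha> = (\<chi> j. case j of Some i \<Rightarrow> \<mu> $ i | None \<Rightarrow> \<alpha>)"

definition lse_P ::
    "'a measure \<Rightarrow> real \<Rightarrow> (real \<Rightarrow> 'a \<Rightarrow> real) \<Rightarrow> real \<Rightarrow> ('p::finite \<Rightarrow> real \<Rightarrow> real) \<Rightarrow>
     real^'p \<Rightarrow> real \<Rightarrow> ('a \<Rightarrow> real) \<Rightarrow> (real \<Rightarrow> 'a \<Rightarrow> real) \<Rightarrow> nat \<Rightarrow>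
     'a \<Rightarrow> real^('p option)" where
  "lse_P M H B \<sigma> \<phi> \<mu> \<alpha> \<xi> X n \<omega> = (\<chi> j. case j of
       Some i \<Rightarrow> fou_integral M H B \<sigma> \<phi> \<mu> \<alpha> \<xi> X (real n) (\<lambda>t \<omega>. \<phi> i t) \<omega>
     | None \<Rightarrow> - fou_integral M H B \<sigma> \<phi> \<mu> \<alpha> \<xi> X (real n) X \<omega>)"

definition lse_a ::
    "('p::finite \<Rightarrow> real \<Rightarrow> real) \<Rightarrow> (real \<Rightarrow> 'a \<Rightarrow> real) \<Rightarrow> nat \<Rightarrow> 'a \<Rightarrow> real^'p" where
  "lse_a \<phi> X n \<omega> = (\<chi> i. LINT t:{0..real n}|lborel. \<phi> i t * X t \<omega>)"

definition lse_b :: "(real \<Rightarrow> 'a \<Rightarrow> real) \<Rightarrow> nat \<Rightarrow> 'a \<Rightarrow> real" where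
  "lse_b X n \<omega> = (LINT t:{0..real n}|lborel. (X t \<omega>)\<^sup>2)"

definition lse_Q ::
    "('p::finite \<Rightarrow> real \<Rightarrow> real) \<Rightarrow> (real \<Rightarrow> 'a \<Rightarrow> real) \<Rightarrow> nat \<Rightarrow>
     'a \<Rightarrow> real^('p option)^('p option)" where
  "lse_Q \<phi> X n \<omega> = (\<chi> j k. case (j, k) of
       (Some i, Some l) \<Rightarrow> (if i = l then real n else 0)
     | (Some i, None) \<Rightarrow> - lse_a \<phi> X n \<omega> $ i
     | (None, Some l) \<Rightarrow> - lse_a \<phi> X n \<omega> $ l
     | (None, None) \<Rightarrow> lse_b X n \<omega>)"

definition least_squares_estimator ::
    "'a measure \<Rightarrow> real \<Rightarrow> (real \<Rightarrow> 'a \<Rightarrow> real) \<Rightarrow> real \<Rightarrow> ('p::finite \<Rightarrow> real \<Rightarrow> real) \<Rightarrow>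
     real^'p \<Rightarrow> real \<Rightarrow> ('a \<Rightarrow> real) \<Rightarrow> (real \<Rightarrow> 'a \<Rightarrow> real) \<Rightarrow> nat \<Rightarrow>
     'a \<Rightarrow> real^('p option)" where
  "least_squares_estimator M H B \<sigma> \<phi> \<mu> \<alpha> \<xi> X n \<omega> =
     matrix_inv (lse_Q \<phi> X n \<omega>) *v lse_P M H B \<sigma> \<phi> \<mu> \<alpha> \<xi> X n \<omega>"

text \<open>Path properties hold almost surely only and the probability space need not be complete, so
  path functionals are random variables only after completion.\<close>

definition tendsto_in_probability ::
    "'a measure \<Rightarrow> (nat \<Rightarrow> 'a \<Rightarrow> 'b::{metric_space, second_countable_topology}) \<Rightarrow> 'b \<Rightarrow> bool" where
  "tendsto_in_probability M Z l \<longleftrightarrow>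
     (\<forall>n. Z n \<in> borel_measurable (completion M)) \<and>
     (\<forall>\<epsilon>>0. (\<lambda>n. measure (completion M) {\<omega> \<in> space M. dist (Z n \<omega>) l > \<epsilon>}) \<longlonglongrightarrow> 0)"

end

theory Submission
  imports Defs "HOL-Real_Asymp.Real_Asymp"
begin

text \<open>Along almost every path the equation has the explicit solution
  \<open>X t = \<xi> * exp (- \<alpha> * t) + h t + \<sigma> * Z t\<close>, where \<open>h\<close> is bounded and deterministic and \<open>Z\<close> solves
  \<open>Z t = B t - \<alpha> * \<integral>\<^sub>0\<^sup>t Z\<close>. The divergence is determined by duality against the functions
  \<open>cos (\<Sum> l\<^sub>j * B t\<^sub>j + c)\<close>, and Gaussian integration by parts identifies that of \<open>Z\<close> on \<open>[0, T]\<close> as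
  \<open>(Z T\<^sup>2 - E (Z T\<^sup>2)) / 2 + \<alpha> * \<integral>\<^sub>0\<^sup>T (Z\<^sup>2 - E (Z\<^sup>2))\<close>. Second moments of order \<open>n\<^bsup>2H\<^esup>\<close> then show that
  all divergences on \<open>[0, n]\<close> are negligible against \<open>n\<close> in probability, and so are the integrals of \<open>Z\<close>
  against bounded functions. The estimation error is \<open>Q\<^sub>n\<close>-inverse applied to
  these divergences. By Bessel's inequality and the previous estimates, the Schur complement of
  \<open>n * I\<close> in \<open>Q\<^sub>n\<close>, divided by \<open>n\<close>, is eventually bounded below by \<open>\<sigma>\<^sup>2 * exp (- 2 * \<alpha>) / 2\<close>.
  A subsequence argument turns this into a statement about single paths.\<close>

text \<open>No moment of \<xi> is assumed, so neither X nor its divergence need be integrable. Terms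
  containing \<xi> are therefore never estimated in mean: along one path \<xi> is a constant, and
  only its coefficients, which are functionals of B alone, get second moments. This is what forces
  the passage to single paths. The Skorohod integral is a choice among the solutions of a duality
  relation with unspecified localising events. An explicit candidate is useful only together with
  almost sure uniqueness across all such events. Cosines serve as test functions because they are
  bounded with all their derivatives and still determine finite measures on finite-dimensional
  spaces. The order of growth is that of the variance of B at time n, which is o(n^2) as H < 1. It
  passes to every average below because the covariance of Z is nonnegative for H > 1/2, so that
  weights can be replaced by their bounds.\<close>

section \<open>Finite measures determined by integrals of cosines\<close>

text \<open>The phase 0 yields the real part of the characteristic function and the phase -pi/2 the
  imaginary part; s = c = 0 shows that the total masses agree. After division by the common mass
  Levy's uniqueness theorem applies, which leaves the case of mass 0 to be treated apart.\<close>

lemma finite_measure_eqI_cos: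
  fixes \<mu> \<nu> :: "real measure"
  assumes fin: "finite_measure \<mu>" "finite_measure \<nu>"
    and sets [measurable_cong, simp]: "sets \<mu> = sets borel" "sets \<nu> = sets borel"
    and eq: "\<And>s c. (\<integral>x. cos (s * x + c) \<partial>\<mu>) = (\<integral>x. cos (s * x + c) \<partial>\<nu>)"
  shows "\<mu> = \<nu>"
proof -
  interpret \<mu>: finite_measure \<mu> by fact
  interpret \<nu>: finite_measure \<nu> by fact
  have sp [simp]: "space \<mu> = UNIV" "space \<nu> = UNIV"
    using sets_eq_imp_space_eq[OF sets(1)] sets_eq_imp_space_eq[OF sets(2)] by auto
  define m where "m = measure \<mu> UNIV"
  have m': "m = measure \<nu> UNIV"
    using eq[of 0 0] by (simp add: m_def)
  show ?thesis
  proof (cases "m = 0")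
    case True
    have "emeasure \<mu> A = emeasure \<nu> A" if "A \<in> sets \<mu>" for A
    proof -
      have "measure \<mu> A \<le> m" "measure \<nu> A \<le> m"
        using \<mu>.finite_measure_mono[of A UNIV] \<nu>.finite_measure_mono[of A UNIV] that
        unfolding m_def[symmetric] m'[symmetric] by auto
      then have "measure \<mu> A = 0" "measure \<nu> A = 0"
        using True by (auto intro: antisym)
      then show ?thesis by (simp add: \<mu>.emeasure_eq_measure \<nu>.emeasure_eq_measure)
    qed
    then show ?thesis by (intro measure_eqI) auto
  next
    case False
    then have m0: "m > 0" by (simp add: m_def less_le)
    have real_distr: "real_distribution (density \<kappa> (\<lambda>_. ennreal (1 / m)))"
      if "finite_measure \<kappa>" "sets \<kappa> = sets borel" "m = measure \<kappa> UNIV" for \<kappa> :: "real measure"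
    proof -
      interpret finite_measure \<kappa> by fact
      have [simp]: "space \<kappa> = UNIV" using sets_eq_imp_space_eq[OF that(2)] by auto
      have "prob_space (density \<kappa> (\<lambda>_. ennreal (1 / m)))"
        using m0 that by (intro prob_spaceI)
          (auto simp: emeasure_density_const emeasure_eq_measure simp flip: ennreal_mult)
      then show ?thesis using that
        by (auto simp: real_distribution_def real_distribution_axioms_def)
    qed
    have char: "char (density \<kappa> (\<lambda>_. ennreal (1 / m))) t =
        Complex ((\<integral>x. cos (t * x + 0) \<partial>\<kappa>) / m) ((\<integral>x. cos (t * x + (- pi / 2)) \<partial>\<kappa>) / m)"
      if "finite_measure \<kappa>" "sets \<kappa> = sets borel" "m = measure \<kappa> UNIV" for \<kappa> :: "real measure" and t
    proof -
      note [measurable_cong] = that(2)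
      interpret finite_measure \<kappa> by fact
      have 1: "integrable \<kappa> (\<lambda>x. iexp (t * x))"
        by (intro integrable_const_bound[where B=1]) auto
      have "char (density \<kappa> (\<lambda>_. ennreal (1 / m))) t = (\<integral>x. (1/m) *\<^sub>R iexp (t * x) \<partial>\<kappa>)"
        unfolding char_def using m0 by (subst integral_density) auto
      also have "... = (1/m) *\<^sub>R (\<integral>x. iexp (t * x) \<partial>\<kappa>)" by (rule integral_scaleR_right)
      finally have 2: "char (density \<kappa> (\<lambda>_. ennreal (1 / m))) t = (1/m) *\<^sub>R (\<integral>x. iexp (t * x) \<partial>\<kappa>)" .
      have "Re (\<integral>x. iexp (t * x) \<partial>\<kappa>) = (\<integral>x. cos (t * x + 0) \<partial>\<kappa>)"
        using integral_Re[OF 1] by (simp add: Re_exp)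
      moreover have "Im (\<integral>x. iexp (t * x) \<partial>\<kappa>) = (\<integral>x. cos (t * x + (- pi / 2)) \<partial>\<kappa>)"
        using integral_Im[OF 1] by (simp add: Im_exp cos_diff)
      ultimately show ?thesis unfolding 2 by (simp add: complex_eq_iff)
    qed
    have "density \<mu> (\<lambda>_. ennreal (1 / m)) = density \<nu> (\<lambda>_. ennreal (1 / m))"
    proof (intro Levy_uniqueness real_distr ext)
      fix t
      show "char (density \<mu> (\<lambda>_. ennreal (1 / m))) t = char (density \<nu> (\<lambda>_. ennreal (1 / m))) t"
        unfolding char[OF fin(1) sets(1) m_def] char[OF fin(2) sets(2) m'] eq ..
    qed (use fin m' m_def in \<open>auto simp only: sets\<close>)
    then have *: "ennreal (1 / m) * emeasure \<mu> A = ennreal (1 / m) * emeasure \<nu> A" if "A \<in> sets borel" for A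
      using that by (metis emeasure_density_const sets)
    have "emeasure \<mu> A = emeasure \<nu> A" if "A \<in> sets \<mu>" for A
      using *[of A] that m0
      by (auto simp: ennreal_mult_cancel_left)
    then show ?thesis by (intro measure_eqI) auto
  qed
qed

text \<open>The constant 1 keeps the density between 0 and 2. It costs the first summand on the
  right, which is removed later by comparison with the constant phase 0.\<close>

lemma integral_distr_density_one_plus_cos:
  fixes p \<theta> y :: "'a => real" and h :: "real => real"
  assumes "finite_measure \<mu>"
    and [measurable]: "p \<in> borel_measurable \<mu>" "\<theta> \<in> borel_measurable \<mu>" "y \<in> borel_measurable \<mu>"
      "h \<in> borel_measurable borel"
    and p: "\<And>w. 0 \<le> p w" "\<And>w. p w \<le> 1" and h: "\<And>x. \<bar>h x\<bar> \<le> 1"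
  shows "(\<integral>x. h x \<partial>distr (density \<mu> (\<lambda>w. ennreal (p w * (1 + cos (\<theta> w))))) borel y) =
     (\<integral>w. p w * h (y w) \<partial>\<mu>) + (\<integral>w. p w * (h (y w) * cos (\<theta> w)) \<partial>\<mu>)"
    and "finite_measure (distr (density \<mu> (\<lambda>w. ennreal (p w * (1 + cos (\<theta> w))))) borel y)"
proof -
  interpret finite_measure \<mu> by fact
  have nn: "0 \<le> p w * (1 + cos (\<theta> w))" for w
  proof (rule mult_nonneg_nonneg)
    show "0 \<le> 1 + cos (\<theta> w)" using cos_ge_minus_one[of "\<theta> w"] by linarith
  qed (rule p)
  have b: "\<bar>p w * h x\<bar> \<le> 1" for w x
    unfolding abs_mult using p[of w] h[of x] by (auto intro: mult_le_one)
  have b2: "\<bar>p w * (h x * cos z)\<bar> \<le> 1" for w x z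
    using b[of w x] abs_cos_le_one[of z] mult_le_one[of "\<bar>p w * h x\<bar>" "\<bar>cos z\<bar>"]
    by (simp add: abs_mult mult_ac)
  have "(\<integral>x. h x \<partial>distr (density \<mu> (\<lambda>w. ennreal (p w * (1 + cos (\<theta> w))))) borel y) =
     (\<integral>w. p w * h (y w) + p w * (h (y w) * cos (\<theta> w)) \<partial>\<mu>)"
    using nn by (simp add: integral_distr integral_density algebra_simps)
  also have "... = (\<integral>w. p w * h (y w) \<partial>\<mu>) + (\<integral>w. p w * (h (y w) * cos (\<theta> w)) \<partial>\<mu>)"
    by (intro Bochner_Integration.integral_add integrable_const_bound[where B=1]) (use b b2 in auto)
  finally show "(\<integral>x. h x \<partial>distr (density \<mu> (\<lambda>w. ennreal (p w * (1 + cos (\<theta> w))))) borel y) =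
     (\<integral>w. p w * h (y w) \<partial>\<mu>) + (\<integral>w. p w * (h (y w) * cos (\<theta> w)) \<partial>\<mu>)" .
  have le: "p w * (1 + cos (\<theta> w)) \<le> 2" for w
    using mult_mono[of "p w" 1 "1 + cos (\<theta> w)" 2] p cos_le_one[of "\<theta> w"] cos_ge_minus_one[of "\<theta> w"]
    by auto
  have "emeasure (density \<mu> (\<lambda>w. ennreal (p w * (1 + cos (\<theta> w))))) (space \<mu>) \<le>
      (\<integral>\<^sup>+w. ennreal 2 \<partial>\<mu>)"
  proof (subst emeasure_density)
    show "(\<integral>\<^sup>+w. ennreal (p w * (1 + cos (\<theta> w))) * indicator (space \<mu>) w \<partial>\<mu>) \<le> (\<integral>\<^sup>+w. ennreal 2 \<partial>\<mu>)"
      by (rule nn_integral_mono) (use le ennreal_leI in \<open>auto split: split_indicator simp del: ennreal_numeral\<close>)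
  qed measurable
  also have "... < \<infinity>"
    by (simp add: emeasure_eq_measure ennreal_mult_less_top del: ennreal_numeral)
  finally show "finite_measure (distr (density \<mu> (\<lambda>w. ennreal (p w * (1 + cos (\<theta> w))))) borel y)"
    by (intro finite_measure.finite_measure_distr finite_measureI) auto
qed


lemma emeasure_distr_PiM_box:
  fixes Y :: "nat => 'a => real" and A :: "nat => real set"
  assumes "finite_measure \<mu>" and [measurable]: "\<And>i. Y i \<in> borel_measurable \<mu>" "\<And>i. A i \<in> sets borel"
  shows "emeasure (distr \<mu> (Pi\<^sub>M {..<k} (\<lambda>_. borel)) (\<lambda>w. \<lambda>i\<in>{..<k}. Y i w)) (Pi\<^sub>E {..<k} A) =
      ennreal (\<integral>w. (\<Prod>i<k. indicator (A i) (Y i w)) \<partial>\<mu>)"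
proof -
  interpret finite_measure \<mu> by fact
  have [measurable]: "Pi\<^sub>E {..<k} A \<in> sets (Pi\<^sub>M {..<k} (\<lambda>_. borel))"
    by (intro sets_PiM_I_finite) auto
  have prodind: "(\<Prod>i<k. indicator (A i) (Y i w)) = (indicator {w'. \<forall>i<k. Y i w' \<in> A i} w :: real)" for w
    by (auto simp: indicator_def prod_zero_iff)
  have "emeasure (distr \<mu> (Pi\<^sub>M {..<k} (\<lambda>_. borel)) (\<lambda>w. \<lambda>i\<in>{..<k}. Y i w)) (Pi\<^sub>E {..<k} A) =
      emeasure \<mu> ((\<lambda>w. \<lambda>i\<in>{..<k}. Y i w) -` Pi\<^sub>E {..<k} A \<inter> space \<mu>)"
    by (rule emeasure_distr) measurable
  also have "(\<lambda>w. \<lambda>i\<in>{..<k}. Y i w) -` Pi\<^sub>E {..<k} A \<inter> space \<mu> = {w'. \<forall>i<k. Y i w' \<in> A i} \<inter> space \<mu>"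
    unfolding set_eq_iff vimage_eq Int_iff PiE_iff mem_Collect_eq Ball_def lessThan_iff by simp
  also have "emeasure \<mu> ... = ennreal (\<integral>w. indicator {w'. \<forall>i<k. Y i w' \<in> A i} w \<partial>\<mu>)"
    unfolding emeasure_eq_measure by (subst Int_commute) (simp add: Int_commute)
  finally show ?thesis unfolding prodind .
qed

text \<open>Coordinates are converted one at a time from trigonometric functions to indicators. The
  weight \<open>1 + cos\<close> is nonnegative, so that each conversion is an instance of the one-dimensional
  statement for finite measures.\<close>

lemma distr_PiM_eqI_cos:
  fixes Y :: "nat => 'a => real" and Y' :: "nat => 'b => real"
  assumes fin: "finite_measure \<mu>" "finite_measure \<nu>"
    and [measurable]: "\<And>i. Y i \<in> borel_measurable \<mu>" "\<And>i. Y' i \<in> borel_measurable \<nu>"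
    and eq: "\<And>l c. (\<integral>w. cos ((\<Sum>i<k. l i * Y i w) + c) \<partial>\<mu>) =
                   (\<integral>w. cos ((\<Sum>i<k. l i * Y' i w) + c) \<partial>\<nu>)"
  shows "distr \<mu> (Pi\<^sub>M {..<k} (\<lambda>_. borel)) (\<lambda>w. \<lambda>i\<in>{..<k}. Y i w) =
         distr \<nu> (Pi\<^sub>M {..<k} (\<lambda>_. borel)) (\<lambda>w. \<lambda>i\<in>{..<k}. Y' i w)"
proof -
  interpret \<mu>: finite_measure \<mu> by fact
  interpret \<nu>: finite_measure \<nu> by fact
  \<comment> \<open>Here m counts the coordinates that have already been turned into indicators; the
    remaining ones are still inside the cosine. The claim for m = 0 is the hypothesis, the claim for
    m = k is equality on boxes.\<close>
  have P: "m \<le> k ==> (\<And>i. A i \<in> sets borel) ==>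
      (\<integral>w. (\<Prod>i<m. indicator (A i) (Y i w)) * cos ((\<Sum>i=m..<k. l i * Y i w) + c) \<partial>\<mu>) =
      (\<integral>w. (\<Prod>i<m. indicator (A i) (Y' i w)) * cos ((\<Sum>i=m..<k. l i * Y' i w) + c) \<partial>\<nu>)"
    for m l c and A :: "nat => real set"
  proof (induction m arbitrary: l c)
    case 0
    then show ?case using eq[of l c] by (simp add: atLeast0LessThan)
  next
    case (Suc m)
    have [measurable]: "A i \<in> sets borel" for i by (rule Suc.prems)
    define p where "p = (\<lambda>w. \<Prod>i<m. indicator (A i) (Y i w) :: real)"
    define p' where "p' = (\<lambda>w. \<Prod>i<m. indicator (A i) (Y' i w) :: real)"
    define \<theta> where "\<theta> = (\<lambda>l w. \<Sum>i=Suc m..<k. l i * Y i w)"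
    define \<theta>' where "\<theta>' = (\<lambda>l w. \<Sum>i=Suc m..<k. l i * Y' i w)"
    have [measurable]: "p \<in> borel_measurable \<mu>" "\<And>l. \<theta> l \<in> borel_measurable \<mu>"
      "p' \<in> borel_measurable \<nu>" "\<And>l. \<theta>' l \<in> borel_measurable \<nu>"
      unfolding p_def \<theta>_def p'_def \<theta>'_def by measurable
    have p: "0 \<le> p w" "p w \<le> 1" for w
      unfolding p_def by (auto intro!: prod_nonneg prod_le_1 simp: indicator_def)
    have p': "0 \<le> p' w" "p' w \<le> 1" for w
      unfolding p'_def by (auto intro!: prod_nonneg prod_le_1 simp: indicator_def)
    have split: "(\<Sum>i=m..<k. (l(m := s)) i * y i) = s * y m + (\<Sum>i=Suc m..<k. l i * y i)"
      for l :: "nat => real" and s and y :: "nat => real"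
      using Suc.prems(1) by (subst sum.atLeast_Suc_lessThan) auto
    have IH: "(\<integral>w. p w * cos (s * Y m w + \<theta> l w + c) \<partial>\<mu>) = (\<integral>w. p' w * cos (s * Y' m w + \<theta>' l w + c) \<partial>\<nu>)"
      for s l c
      using Suc.IH[of "l(m := s)" c] Suc.prems(1) Suc.prems(2)
      unfolding split p_def \<theta>_def p'_def \<theta>'_def by (simp add: split)
    define \<kappa> where "\<kappa> = (\<lambda>l c. distr (density \<mu> (\<lambda>w. ennreal (p w * (1 + cos (\<theta> l w + c))))) borel (Y m))"
    define \<kappa>' where "\<kappa>' = (\<lambda>l c. distr (density \<nu> (\<lambda>w. ennreal (p' w * (1 + cos (\<theta>' l w + c))))) borel (Y' m))"
    have cos_int: "integrable \<mu> (\<lambda>w. p w * cos (g w))" if [measurable]: "g \<in> borel_measurable \<mu>" for g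
      using p abs_cos_le_one by (intro \<mu>.integrable_const_bound[where B=1]) (auto simp: abs_mult intro!: mult_le_one)
    have cos_int': "integrable \<nu> (\<lambda>w. p' w * cos (g w))" if [measurable]: "g \<in> borel_measurable \<nu>" for g
      using p' abs_cos_le_one by (intro \<nu>.integrable_const_bound[where B=1]) (auto simp: abs_mult intro!: mult_le_one)
    \<comment> \<open>A product of cosines is half the sum of the cosines of sum and difference. The
      difference negates the remaining coefficients, so the induction hypothesis must hold for all
      \<open>l\<close> and \<open>c\<close>.\<close>
    have prod_cos: "p * (cos (s * y + d) * cos (z l + c)) =
        (p * cos (s * y + z l + (d + c)) + p * cos (s * y + z (\<lambda>i. - l i) + (d - c))) / 2"
      if "z (\<lambda>i. - l i) = - z l" for p s y d c :: real and l :: "nat => real" and z :: "(nat => real) => real"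
    proof -
      have e: "s * y + z l + (d + c) = (s * y + d) + (z l + c)"
        "s * y + z (\<lambda>i. - l i) + (d - c) = (s * y + d) - (z l + c)"
        by (simp_all add: that algebra_simps)
      have "p * (a * b) = (p * (a * b - u * v) + p * (a * b + u * v)) / 2" for a b u v :: real
        by (simp add: algebra_simps)
      then show ?thesis unfolding e cos_add[of "s * y + d"] cos_diff[of "s * y + d"] .
    qed
    have eqk: "\<kappa> l c = \<kappa>' l c" for l c
    proof (rule finite_measure_eqI_cos)
      show "finite_measure (\<kappa> l c)" "finite_measure (\<kappa>' l c)"
        unfolding \<kappa>_def \<kappa>'_def
        by (rule integral_distr_density_one_plus_cos(2)[where h="\<lambda>_. 0"]; use p p' fin in simp)+
      fix s d
      have "(\<integral>x. cos (s * x + d) \<partial>\<kappa> l c) =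
         (\<integral>w. p w * cos (s * Y m w + d) \<partial>\<mu>) + (\<integral>w. p w * (cos (s * Y m w + d) * cos (\<theta> l w + c)) \<partial>\<mu>)"
        unfolding \<kappa>_def by (rule integral_distr_density_one_plus_cos(1)) (use p fin in auto)
      also have "(\<integral>w. p w * (cos (s * Y m w + d) * cos (\<theta> l w + c)) \<partial>\<mu>) =
         ((\<integral>w. p w * cos (s * Y m w + \<theta> l w + (d + c)) \<partial>\<mu>) +
          (\<integral>w. p w * cos (s * Y m w + \<theta> (\<lambda>i. - l i) w + (d - c)) \<partial>\<mu>)) / 2"
        by (subst prod_cos[where z="\<lambda>l. \<theta> l _"]) (auto simp: \<theta>_def sum_negf cos_int intro!: Bochner_Integration.integral_add)
      finally have 1: "(\<integral>x. cos (s * x + d) \<partial>\<kappa> l c) = (\<integral>w. p w * cos (s * Y m w + \<theta> (\<lambda>_. 0) w + d) \<partial>\<mu>) +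
         ((\<integral>w. p w * cos (s * Y m w + \<theta> l w + (d + c)) \<partial>\<mu>) +
          (\<integral>w. p w * cos (s * Y m w + \<theta> (\<lambda>i. - l i) w + (d - c)) \<partial>\<mu>)) / 2" by (simp add: \<theta>_def)
      have "(\<integral>x. cos (s * x + d) \<partial>\<kappa>' l c) =
         (\<integral>w. p' w * cos (s * Y' m w + d) \<partial>\<nu>) + (\<integral>w. p' w * (cos (s * Y' m w + d) * cos (\<theta>' l w + c)) \<partial>\<nu>)"
        unfolding \<kappa>'_def by (rule integral_distr_density_one_plus_cos(1)) (use p' fin in auto)
      also have "(\<integral>w. p' w * (cos (s * Y' m w + d) * cos (\<theta>' l w + c)) \<partial>\<nu>) =
         ((\<integral>w. p' w * cos (s * Y' m w + \<theta>' l w + (d + c)) \<partial>\<nu>) +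
          (\<integral>w. p' w * cos (s * Y' m w + \<theta>' (\<lambda>i. - l i) w + (d - c)) \<partial>\<nu>)) / 2"
        by (subst prod_cos[where z="\<lambda>l. \<theta>' l _"]) (auto simp: \<theta>'_def sum_negf cos_int' intro!: Bochner_Integration.integral_add)
      finally have 2: "(\<integral>x. cos (s * x + d) \<partial>\<kappa>' l c) = (\<integral>w. p' w * cos (s * Y' m w + \<theta>' (\<lambda>_. 0) w + d) \<partial>\<nu>) +
         ((\<integral>w. p' w * cos (s * Y' m w + \<theta>' l w + (d + c)) \<partial>\<nu>) +
          (\<integral>w. p' w * cos (s * Y' m w + \<theta>' (\<lambda>i. - l i) w + (d - c)) \<partial>\<nu>)) / 2" by (simp add: \<theta>'_def)
      show "(\<integral>x. cos (s * x + d) \<partial>\<kappa> l c) = (\<integral>x. cos (s * x + d) \<partial>\<kappa>' l c)"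
        unfolding 1 2 IH ..
    qed (simp_all add: \<kappa>_def \<kappa>'_def)
    have ind: "(\<integral>w. p w * indicator (A m) (Y m w) \<partial>\<mu>) + (\<integral>w. p w * (indicator (A m) (Y m w) * cos (\<theta> l w + c)) \<partial>\<mu>) =
       (\<integral>w. p' w * indicator (A m) (Y' m w) \<partial>\<nu>) + (\<integral>w. p' w * (indicator (A m) (Y' m w) * cos (\<theta>' l w + c)) \<partial>\<nu>)" for l c
    proof -
      have "(\<integral>x. indicator (A m) x \<partial>\<kappa> l c) = (\<integral>w. p w * indicator (A m) (Y m w) \<partial>\<mu>) + (\<integral>w. p w * (indicator (A m) (Y m w) * cos (\<theta> l w + c)) \<partial>\<mu>)"
        unfolding \<kappa>_def by (rule integral_distr_density_one_plus_cos(1)) (use p fin in \<open>auto simp: indicator_def\<close>)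
      moreover have "(\<integral>x. indicator (A m) x \<partial>\<kappa>' l c) = (\<integral>w. p' w * indicator (A m) (Y' m w) \<partial>\<nu>) + (\<integral>w. p' w * (indicator (A m) (Y' m w) * cos (\<theta>' l w + c)) \<partial>\<nu>)"
        unfolding \<kappa>'_def by (rule integral_distr_density_one_plus_cos(1)) (use p' fin in \<open>auto simp: indicator_def\<close>)
      ultimately show ?thesis using eqk[of l c] by simp
    qed
    \<comment> \<open>With zero coefficients and phase 0 the weight is 2, so \<open>ind\<close>
      identifies the summands without cosine; subtracting them leaves the cosine terms.\<close>
    have "(\<integral>w. p w * (indicator (A m) (Y m w) * cos (\<theta> l w + c)) \<partial>\<mu>) = (\<integral>w. p' w * (indicator (A m) (Y' m w) * cos (\<theta>' l w + c)) \<partial>\<nu>)"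
      using ind[of l c] ind[of "\<lambda>_. 0" 0] by (simp add: \<theta>_def \<theta>'_def)
    then show ?case
      unfolding p_def p'_def \<theta>_def \<theta>'_def prod.lessThan_Suc mult.assoc .
  qed
  show ?thesis
  proof (rule measure_eqI_PiM_finite)
    fix A :: "nat => real set" assume A: "\<And>i. i \<in> {..<k} ==> A i \<in> sets borel"
    define A' where "A' = (\<lambda>i. if i < k then A i else UNIV)"
    have [measurable]: "A' i \<in> sets borel" for i using A by (auto simp: A'_def)
    have PE: "Pi\<^sub>E {..<k} A = Pi\<^sub>E {..<k} A'" by (intro PiE_cong) (auto simp: A'_def)
    show "emeasure (distr \<mu> (Pi\<^sub>M {..<k} (\<lambda>_. borel)) (\<lambda>w. \<lambda>i\<in>{..<k}. Y i w)) (Pi\<^sub>E {..<k} A) =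
       emeasure (distr \<nu> (Pi\<^sub>M {..<k} (\<lambda>_. borel)) (\<lambda>w. \<lambda>i\<in>{..<k}. Y' i w)) (Pi\<^sub>E {..<k} A)"
      unfolding PE emeasure_distr_PiM_box[where Y=Y, OF fin(1) assms(3) \<open>\<And>i. A' i \<in> sets borel\<close>]
        emeasure_distr_PiM_box[where Y=Y', OF fin(2) assms(4) \<open>\<And>i. A' i \<in> sets borel\<close>]
      using P[of k A' "\<lambda>_. 0" 0] by simp
  next
    show "range (\<lambda>_::nat. Pi\<^sub>E {..<k} (\<lambda>_. UNIV :: real set)) \<subseteq> prod_algebra {..<k} (\<lambda>_. borel)"
      by (auto intro!: prod_algebraI_finite)
    show "(\<Union>i::nat. Pi\<^sub>E {..<k} (\<lambda>_. UNIV :: real set)) = space (Pi\<^sub>M {..<k} (\<lambda>_. borel))"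
      by (simp add: space_PiM)
    interpret d: finite_measure "distr \<mu> (Pi\<^sub>M {..<k} (\<lambda>_. borel)) (\<lambda>w. \<lambda>i\<in>{..<k}. Y i w)"
      by (rule \<mu>.finite_measure_distr) measurable
    show "emeasure (distr \<mu> (Pi\<^sub>M {..<k} (\<lambda>_. borel)) (\<lambda>w. \<lambda>i\<in>{..<k}. Y i w)) (Pi\<^sub>E {..<k} (\<lambda>_. UNIV)) \<noteq> \<infinity>" for i :: nat
      by (simp add: d.emeasure_eq_measure)
  qed simp_all
qed

section \<open>Square integrable variables\<close>

lemma integrable_mult_of_square:
  fixes f g :: "'a => real"
  assumes [measurable]: "f \<in> borel_measurable M" "g \<in> borel_measurable M"
    and f: "integrable M (\<lambda>x. (f x)\<^sup>2)" and g: "integrable M (\<lambda>x. (g x)\<^sup>2)"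
  shows "integrable M (\<lambda>x. f x * g x)"
proof (rule Bochner_Integration.integrable_bound)
  show "integrable M (\<lambda>x. (f x)\<^sup>2 + (g x)\<^sup>2)" using f g by simp
  have "\<bar>a * b\<bar> \<le> a\<^sup>2 + b\<^sup>2" for a b :: real
  proof -
    have "2 * (\<bar>a\<bar> * \<bar>b\<bar>) \<le> a\<^sup>2 + b\<^sup>2"
      using sum_squares_bound[of "\<bar>a\<bar>" "\<bar>b\<bar>"] by (simp add: mult.assoc)
    moreover have "0 \<le> \<bar>a\<bar> * \<bar>b\<bar>" by simp
    ultimately show ?thesis unfolding abs_mult by linarith
  qed
  then show "AE x in M. norm (f x * g x) \<le> norm ((f x)\<^sup>2 + (g x)\<^sup>2)"
    by (auto simp: abs_mult)
qed simp

lemma integrable_square_add: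
  fixes f g :: "'a => real"
  assumes "f \<in> borel_measurable M" "g \<in> borel_measurable M"
    and "integrable M (\<lambda>x. (f x)\<^sup>2)" "integrable M (\<lambda>x. (g x)\<^sup>2)"
  shows "integrable M (\<lambda>x. (f x + g x)\<^sup>2)" "integrable M (\<lambda>x. (f x - g x)\<^sup>2)"
  using assms integrable_mult_of_square[OF assms]
  by (simp_all add: power2_sum power2_diff mult.assoc)

lemma integral_mult_square_le:
  fixes f g :: "'a => real"
  assumes m [measurable]: "f \<in> borel_measurable M" "g \<in> borel_measurable M"
    and f: "integrable M (\<lambda>x. (f x)\<^sup>2)" and g: "integrable M (\<lambda>x. (g x)\<^sup>2)"
  shows "(\<integral>x. f x * g x \<partial>M)\<^sup>2 \<le> (\<integral>x. (f x)\<^sup>2 \<partial>M) * (\<integral>x. (g x)\<^sup>2 \<partial>M)"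
proof (cases "(\<integral>x. (f x)\<^sup>2 \<partial>M) = 0")
  case True
  then have "AE x in M. (f x)\<^sup>2 = 0"
    using f by (subst (asm) integral_nonneg_eq_0_iff_AE) auto
  then have "(\<integral>x. f x * g x \<partial>M) = (\<integral>x. 0 \<partial>M)" by (intro integral_cong_AE) auto
  then show ?thesis by (simp add: True)
next
  case False
  define A where "A = (\<integral>x. (f x)\<^sup>2 \<partial>M)"
  define P where "P = (\<integral>x. f x * g x \<partial>M)"
  have A: "A > 0" using False by (simp add: A_def less_le)
  have fg: "integrable M (\<lambda>x. f x * g x)" by (rule integrable_mult_of_square[OF m f g])
  \<comment> \<open>The factor \<open>P / A\<close> minimises the mean square of
    \<open>g - t * f\<close> over t; nonnegativity of the minimum is the Cauchy-Schwarz
    inequality.\<close>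
  have "0 \<le> (\<integral>x. (g x - P / A * f x)\<^sup>2 \<partial>M)" by simp
  also have "(\<lambda>x. (g x - P / A * f x)\<^sup>2) = (\<lambda>x. (g x)\<^sup>2 + ((P / A)\<^sup>2 * (f x)\<^sup>2 - 2 * (P / A) * (f x * g x)))"
    by (auto simp: power2_eq_square algebra_simps)
  also have "(\<integral>x. (g x)\<^sup>2 + ((P / A)\<^sup>2 * (f x)\<^sup>2 - 2 * (P / A) * (f x * g x)) \<partial>M) =
      (\<integral>x. (g x)\<^sup>2 \<partial>M) + ((P / A)\<^sup>2 * A - 2 * (P / A) * P)"
    using f g fg by (simp add: A_def P_def)
  also have "(P / A)\<^sup>2 * A - 2 * (P / A) * P = - P\<^sup>2 / A"
    using A by (simp add: field_simps power2_eq_square)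
  finally show ?thesis using A by (simp add: field_simps A_def P_def)
qed

lemma abs_integral_mult_le:
  fixes f g :: "'a => real"
  assumes "f \<in> borel_measurable M" "g \<in> borel_measurable M"
    and "integrable M (\<lambda>x. (f x)\<^sup>2)" "integrable M (\<lambda>x. (g x)\<^sup>2)"
  shows "\<bar>\<integral>x. f x * g x \<partial>M\<bar> \<le> sqrt (\<integral>x. (f x)\<^sup>2 \<partial>M) * sqrt (\<integral>x. (g x)\<^sup>2 \<partial>M)"
  using real_sqrt_le_mono[OF integral_mult_square_le[OF assms]] by (simp add: real_sqrt_mult)

context prob_space begin

lemma integrable_of_square:
  fixes f :: "'a => real"
  assumes [measurable]: "f \<in> borel_measurable M" and "integrable M (\<lambda>x. (f x)\<^sup>2)"
  shows "integrable M f"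
  using integrable_mult_of_square[of f M "\<lambda>_. 1"] assms by simp

lemma integral_abs_le_sqrt:
  fixes f :: "'a => real"
  assumes [measurable]: "f \<in> borel_measurable M" and "integrable M (\<lambda>x. (f x)\<^sup>2)"
  shows "(\<integral>x. \<bar>f x\<bar> \<partial>M) \<le> sqrt (\<integral>x. (f x)\<^sup>2 \<partial>M)"
  using abs_integral_mult_le[of "\<lambda>x. \<bar>f x\<bar>" M "\<lambda>_. 1"] assms by (simp add: prob_space)

end

lemma abs_cos_diff_le: "\<bar>cos a - cos b\<bar> \<le> \<bar>a - b :: real\<bar>"
proof -
  have "\<bar>cos a - cos b\<bar> = 2 * (\<bar>sin ((a + b) / 2)\<bar> * \<bar>sin ((b - a) / 2)\<bar>)"
    by (simp add: cos_diff_cos abs_mult)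
  also have "... \<le> 2 * (1 * \<bar>(b - a) / 2\<bar>)"
    by (intro mult_left_mono mult_mono abs_sin_x_le_abs_x) auto
  finally show ?thesis by simp
qed

section \<open>Centered normal variables\<close>

text \<open>The law is described as that of a multiple of a standard normal variable rather than by
  a density, so that variance 0 needs no separate clause and limits may degenerate.\<close>

definition centered_normal :: "'a measure => real => ('a => real) => bool" where
  "centered_normal M v W \<longleftrightarrow> v \<ge> 0 \<and> W \<in> borel_measurable M \<and>
     distr M borel W = distr std_normal_distribution borel (\<lambda>x. sqrt v * x)"

lemma integral_cos_std_normal:
  "(\<integral>x. cos (t * x + c) \<partial>std_normal_distribution) = cos c * exp (- (t\<^sup>2) / 2)"
proof -
  interpret real_distribution std_normal_distribution by (rule real_dist_normal_dist)
  have 1: "integrable std_normal_distribution (\<lambda>x. iexp (t * x))"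
    by (intro integrable_const_bound[where B=1]) auto
  have ch: "(\<integral>x. iexp (t * x) \<partial>std_normal_distribution) = complex_of_real (exp (- (t\<^sup>2) / 2))"
    using char_std_normal_distribution by (simp add: char_def fun_eq_iff)
  have c: "(\<integral>x. cos (t * x) \<partial>std_normal_distribution) = exp (- (t\<^sup>2) / 2)"
    using integral_Re[OF 1] ch by (simp add: Re_exp)
  have s: "(\<integral>x. sin (t * x) \<partial>std_normal_distribution) = 0"
    using integral_Im[OF 1] ch by (simp add: Im_exp)
  have i: "integrable std_normal_distribution (\<lambda>x. cos (t * x) * cos c)"
       "integrable std_normal_distribution (\<lambda>x. sin (t * x) * sin c)"
    by (intro integrable_const_bound[where B=1]; auto simp: abs_mult intro!: mult_le_one)+
  have "(\<integral>x. cos (t * x + c) \<partial>std_normal_distribution) =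
      (\<integral>x. cos (t * x) * cos c \<partial>std_normal_distribution) - (\<integral>x. sin (t * x) * sin c \<partial>std_normal_distribution)"
    unfolding cos_add using i by (rule Bochner_Integration.integral_diff)
  also have "... = cos c * exp (- (t\<^sup>2) / 2)"
    by (simp only: integral_mult_left_zero c s) simp
  finally show ?thesis .
qed

lemma
  fixes g :: "real => real"
  assumes W: "centered_normal M v W" and [measurable]: "g \<in> borel_measurable borel"
  shows centered_normal_integral: "(\<integral>w. g (W w) \<partial>M) = (\<integral>x. g (sqrt v * x) \<partial>std_normal_distribution)"
    and centered_normal_integrable_iff: "integrable M (\<lambda>w. g (W w)) \<longleftrightarrow>
      integrable std_normal_distribution (\<lambda>x. g (sqrt v * x))"
proof -
  have [measurable]: "W \<in> borel_measurable M" using W by (simp add: centered_normal_def)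
  have d: "distr M borel W = distr std_normal_distribution borel (\<lambda>x. sqrt v * x)"
    using W by (simp add: centered_normal_def)
  show "(\<integral>w. g (W w) \<partial>M) = (\<integral>x. g (sqrt v * x) \<partial>std_normal_distribution)"
    using arg_cong[OF d, of "\<lambda>D. \<integral>x. g x \<partial>D"] by (simp add: integral_distr)
  show "integrable M (\<lambda>w. g (W w)) \<longleftrightarrow> integrable std_normal_distribution (\<lambda>x. g (sqrt v * x))"
    using arg_cong[OF d, of "\<lambda>D. integrable D g"] by (simp add: integrable_distr_eq)
qed

lemma centered_normal_cos:
  assumes "centered_normal M v W"
  shows "(\<integral>w. cos (s * W w + c) \<partial>M) = cos c * exp (- (s\<^sup>2 * v) / 2)"
proof -
  have "(\<integral>w. cos (s * W w + c) \<partial>M) = (\<integral>x. cos ((s * sqrt v) * x + c) \<partial>std_normal_distribution)"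
    using centered_normal_integral[OF assms, of "\<lambda>x. cos (s * x + c)"] by (simp add: mult.assoc)
  also have "... = cos c * exp (- (s\<^sup>2 * v) / 2)"
    using assms unfolding integral_cos_std_normal by (simp add: centered_normal_def power_mult_distrib)
  finally show ?thesis .
qed

lemma centered_normal_moments:
  assumes W: "centered_normal M v W"
  shows "integrable M (\<lambda>w. W w ^ k)" "(\<integral>w. W w \<partial>M) = 0"
    "(\<integral>w. (W w)\<^sup>2 \<partial>M) = v" "(\<integral>w. (W w) ^ 4 \<partial>M) = 3 * v\<^sup>2"
proof -
  have v: "v \<ge> 0" using W by (simp add: centered_normal_def)
  show "integrable M (\<lambda>w. W w ^ k)"
    by (subst centered_normal_integrable_iff[OF W, of "\<lambda>x. x ^ k"])
       (auto simp: power_mult_distrib integrable_std_normal_distribution_moment)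
  show "(\<integral>w. W w \<partial>M) = 0"
    using centered_normal_integral[OF W, of "\<lambda>x. x"] integral_std_normal_distribution_moment_odd[of 1] by simp
  show "(\<integral>w. (W w)\<^sup>2 \<partial>M) = v"
    using centered_normal_integral[OF W, of "\<lambda>x. x\<^sup>2"] std_normal_distribution_even_moments(1)[of 1] v
    by (simp add: power_mult_distrib)
  have "(\<integral>w. (W w) ^ 4 \<partial>M) = sqrt v ^ 4 * 3"
    using centered_normal_integral[OF W, of "\<lambda>x. x ^ 4"] std_normal_distribution_even_moments(1)[of 2]
    by (simp add: power_mult_distrib fact_numeral)
  also have "sqrt v ^ 4 = ((sqrt v)\<^sup>2)\<^sup>2" by simp
  finally show "(\<integral>w. (W w) ^ 4 \<partial>M) = 3 * v\<^sup>2" using v by simp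
qed

lemma centered_normal_measurable [measurable_dest]:
  "centered_normal M v W ==> W \<in> borel_measurable M"
  by (simp add: centered_normal_def)

context prob_space begin

lemma centered_normalI_cos:
  assumes v: "v \<ge> 0" and [measurable]: "W \<in> borel_measurable M"
    and cos: "\<And>s c. (\<integral>w. cos (s * W w + c) \<partial>M) = cos c * exp (- (s\<^sup>2 * v) / 2)"
  shows "centered_normal M v W"
proof -
  interpret N: real_distribution std_normal_distribution by (rule real_dist_normal_dist)
  have "distr M borel W = distr std_normal_distribution borel (\<lambda>x. sqrt v * x)"
  proof (rule finite_measure_eqI_cos)
    fix s c
    have "(\<integral>x. cos (s * (sqrt v * x) + c) \<partial>std_normal_distribution) = cos c * exp (- (s\<^sup>2 * v) / 2)"
      using integral_cos_std_normal[of "s * sqrt v" c] v by (simp add: mult.assoc power_mult_distrib)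
    then show "(\<integral>x. cos (s * x + c) \<partial>distr M borel W) =
        (\<integral>x. cos (s * x + c) \<partial>distr std_normal_distribution borel (\<lambda>x. sqrt v * x))"
      by (simp add: integral_distr cos)
  qed (auto intro!: finite_measure_distr N.finite_measure_distr)
  then show ?thesis using v by (simp add: centered_normal_def)
qed

text \<open>In the degenerate clause the almost sure constant must be the mean 0, so the variance is
  0. Otherwise division by the standard deviation gives a standard normal variable.\<close>

lemma centered_normal_of_gaussian_rv:
  assumes W: "gaussian_rv M W" and mean: "expectation W = 0"
  shows "centered_normal M (expectation (\<lambda>w. (W w)\<^sup>2)) W"
proof -
  have [measurable]: "W \<in> borel_measurable M" using W by (simp add: gaussian_rv_def)
  consider m where "AE w in M. W w = m"
    | m s where "s > 0" "distributed M lborel W (\<lambda>x. ennreal (normal_density m s x))"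
    using W by (auto simp: gaussian_rv_def)
  then show ?thesis
  proof cases
    case 1
    have "expectation W = expectation (\<lambda>_. m)" by (rule integral_cong_AE) (use 1 in auto)
    then have m: "m = 0" using mean by (simp add: prob_space)
    have z: "expectation (\<lambda>w. (W w)\<^sup>2) = 0"
      using integral_cong_AE[of "\<lambda>w. (W w)\<^sup>2" M "\<lambda>_. 0"] 1 m by auto
    show ?thesis unfolding z
    proof (rule centered_normalI_cos)
      fix s c
      have "(\<integral>w. cos (s * W w + c) \<partial>M) = (\<integral>w. cos c \<partial>M)"
        by (rule integral_cong_AE) (use 1 m in auto)
      then show "(\<integral>w. cos (s * W w + c) \<partial>M) = cos c * exp (- (s\<^sup>2 * 0) / 2)" by (simp add: prob_space)
    qed auto
  next
    case 2
    have m: "m = 0" using normal_distributed_expectation[OF 2] mean by simp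
    define U where "U = (\<lambda>w. W w / s)"
    have [measurable]: "U \<in> borel_measurable M" unfolding U_def by measurable
    have "distributed M lborel U std_normal_density"
      using normal_standard_normal_convert[OF 2(1), of W m] 2(2) unfolding m U_def by simp
    then have U: "distr M borel U = std_normal_distribution"
      using distr_cong[of M M borel lborel U U] by (simp add: distributed_def)
    have "W = (\<lambda>w. s * U w)" using 2 by (auto simp: U_def)
    then have "distr M borel W = distr (distr M borel U) borel (\<lambda>x. s * x)"
      by (subst distr_distr) (auto simp: comp_def)
    then have "centered_normal M (s\<^sup>2) W" unfolding U centered_normal_def using 2 by simp
    moreover from this have "expectation (\<lambda>w. (W w)\<^sup>2) = s\<^sup>2" by (rule centered_normal_moments)
    ultimately show ?thesis by simp
  qed
qed

text \<open>The variances converge by Cauchy-Schwarz. Since the cosine is 1-Lipschitz, the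
  trigonometric integrals converge as well, and the formula that characterises normality survives in
  the limit.\<close>

lemma centered_normal_L2_limit:
  assumes W: "\<And>n::nat. centered_normal M (v n) (W n)"
    and [measurable]: "V \<in> borel_measurable M" and V: "integrable M (\<lambda>w. (V w)\<^sup>2)"
    and lim: "(\<lambda>n. expectation (\<lambda>w. (W n w - V w)\<^sup>2)) \<longlonglongrightarrow> 0"
  shows "centered_normal M (expectation (\<lambda>w. (V w)\<^sup>2)) V"
proof -
  define u where "u = expectation (\<lambda>w. (V w)\<^sup>2)"
  define e where "e = (\<lambda>n. expectation (\<lambda>w. (W n w - V w)\<^sup>2))"
  have [measurable]: "W n \<in> borel_measurable M" for n using W by (simp add: centered_normal_def)
  have WW: "integrable M (\<lambda>w. (W n w)\<^sup>2)" for n by (rule centered_normal_moments[OF W])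
  have D: "integrable M (\<lambda>w. (W n w - V w)\<^sup>2)" for n
    by (intro integrable_square_add WW V) auto
  have e0: "(\<lambda>n. sqrt (e n)) \<longlonglongrightarrow> 0"
    using tendsto_real_sqrt[OF lim] by (simp add: e_def)
  have "v \<longlonglongrightarrow> u"
  proof (rule Lim_null[THEN iffD2], rule Lim_null_comparison)
    have "v n - u = e n + 2 * expectation (\<lambda>w. V w * (W n w - V w))" for n
    proof -
      have "v n = expectation (\<lambda>w. (W n w)\<^sup>2)" by (rule centered_normal_moments(3)[OF W, symmetric])
      also have "... = expectation (\<lambda>w. (V w)\<^sup>2 + ((W n w - V w)\<^sup>2 + 2 * (V w * (W n w - V w))))"
        by (intro Bochner_Integration.integral_cong) (auto simp: power2_eq_square algebra_simps)
      also have "... = u + (e n + 2 * expectation (\<lambda>w. V w * (W n w - V w)))"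
        using V D integrable_mult_of_square[OF _ _ V D] by (simp add: u_def e_def)
      finally show ?thesis by simp
    qed
    moreover have "\<bar>expectation (\<lambda>w. V w * (W n w - V w))\<bar> \<le> sqrt u * sqrt (e n)" for n
      unfolding u_def e_def by (intro abs_integral_mult_le V D) auto
    moreover have "e n \<ge> 0" for n by (simp add: e_def)
    ultimately have "norm (v n - u) \<le> e n + 2 * (sqrt u * sqrt (e n))" for n
      by (smt (verit) real_norm_def)
    then show "\<forall>\<^sub>F n in sequentially. norm (v n - u) \<le> e n + 2 * (sqrt u * sqrt (e n))" by simp
    show "(\<lambda>n. e n + 2 * (sqrt u * sqrt (e n))) \<longlonglongrightarrow> 0"
      using tendsto_add[OF lim[folded e_def] tendsto_mult_left[OF tendsto_mult_left[OF e0]], of 2 "sqrt u"] by simp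
  qed
  show ?thesis
    unfolding u_def[symmetric]
  proof (rule centered_normalI_cos)
    fix s c
    have "(\<lambda>n. \<integral>w. cos (s * W n w + c) \<partial>M) \<longlonglongrightarrow> (\<integral>w. cos (s * V w + c) \<partial>M)"
    proof (rule Lim_null[THEN iffD2], rule Lim_null_comparison)
      have "norm ((\<integral>w. cos (s * W n w + c) \<partial>M) - (\<integral>w. cos (s * V w + c) \<partial>M)) \<le> \<bar>s\<bar> * sqrt (e n)" for n
      proof -
        have i: "integrable M (\<lambda>w. cos (s * W n w + c))" "integrable M (\<lambda>w. cos (s * V w + c))"
          by (intro integrable_const_bound[where B=1]; simp)+
        have "(\<integral>w. cos (s * W n w + c) \<partial>M) - (\<integral>w. cos (s * V w + c) \<partial>M) =
            (\<integral>w. cos (s * W n w + c) - cos (s * V w + c) \<partial>M)" using i by simp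
        also have "norm ... \<le> (\<integral>w. \<bar>cos (s * W n w + c) - cos (s * V w + c)\<bar> \<partial>M)"
          unfolding real_norm_def by (rule integral_abs_bound)
        also have "... \<le> (\<integral>w. \<bar>s\<bar> * \<bar>W n w - V w\<bar> \<partial>M)"
        proof (rule integral_mono)
          show "\<bar>cos (s * W n w + c) - cos (s * V w + c)\<bar> \<le> \<bar>s\<bar> * \<bar>W n w - V w\<bar>" for w
            using abs_cos_diff_le[of "s * W n w + c" "s * V w + c"]
            by (simp add: abs_mult[symmetric] right_diff_distrib)
          show "integrable M (\<lambda>w. \<bar>s\<bar> * \<bar>W n w - V w\<bar>)"
            using integrable_of_square[OF _ D] by auto
        qed (use i in auto)
        also have "... \<le> \<bar>s\<bar> * sqrt (e n)"
          unfolding e_def using integral_abs_le_sqrt[OF _ D] by (auto intro!: mult_left_mono)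
        finally show ?thesis .
      qed
      then show "\<forall>\<^sub>F n in sequentially. norm ((\<integral>w. cos (s * W n w + c) \<partial>M) - (\<integral>w. cos (s * V w + c) \<partial>M)) \<le> \<bar>s\<bar> * sqrt (e n)"
        by simp
      show "(\<lambda>n. \<bar>s\<bar> * sqrt (e n)) \<longlonglongrightarrow> 0" using tendsto_mult_left[OF e0, of "\<bar>s\<bar>"] by simp
    qed
    moreover have "(\<lambda>n. cos c * exp (- (s\<^sup>2 * v n) / 2)) \<longlonglongrightarrow> cos c * exp (- (s\<^sup>2 * u) / 2)"
      by (intro tendsto_intros \<open>v \<longlonglongrightarrow> u\<close>) auto
    ultimately show "(\<integral>w. cos (s * V w + c) \<partial>M) = cos c * exp (- (s\<^sup>2 * u) / 2)"
      unfolding centered_normal_cos[OF W] by (rule LIMSEQ_unique)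
  qed (auto simp: u_def)
qed

end

section \<open>Gaussian integration by parts\<close>

lemma tendsto_funI:
  fixes G :: "'b => 'i => 'c::topological_space"
  assumes "\<And>i. ((\<lambda>u. G u i) \<longlongrightarrow> l i) F"
  shows "(G \<longlongrightarrow> l) F"
  using assms limitin_componentwise[of "\<lambda>_. euclidean :: 'c topology" UNIV G l F]
  unfolding euclidean_product_topology limitin_canonical_iff by simp

text \<open>The chain rule for continuous partial derivatives. The coordinates are moved one after
  the other, and the mean value theorem controls each move; the derivatives are continuous in the
  product topology, so convergence of the intermediate points is checked coordinatewise.\<close>

lemma has_real_derivative_along_line:
  fixes f :: "(nat => real) => real"
  assumes dep: "\<And>x y. (\<And>i. i < k ==> x i = y i) ==> f x = f y"
    and d: "\<And>i x. i < k ==> ((\<lambda>y. f (x(i := y))) has_real_derivative f' i x) (at (x i))"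
    and cont: "\<And>i. i < k ==> continuous_on UNIV (f' i)"
  shows "((\<lambda>u. f (\<lambda>i. b i + c i * u)) has_real_derivative
           (\<Sum>i<k. c i * f' i (\<lambda>i. b i + c i * u0))) (at u0)"
proof -
  define x0 where "x0 = (\<lambda>i. b i + c i * u0)"
  \<comment> \<open>In \<open>pt j u\<close> the first j coordinates have already moved to the
    parameter u while the others still stand at u0.\<close>
  define pt where "pt = (\<lambda>j u i. b i + c i * (if i < j then u else u0))"
  have "j \<le> k ==> ((\<lambda>u. f (pt j u)) has_real_derivative (\<Sum>i<j. c i * f' i x0)) (at u0)" for j
  proof (induction j)
    case 0
    then show ?case by (simp add: pt_def)
  next
    case (Suc j)
    define E where "E = (\<lambda>u. f (pt (Suc j) u) - f (pt j u))"
    have j: "j < k" using Suc.prems by simp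
    have mvt: "\<exists>z. \<bar>z - x0 j\<bar> \<le> \<bar>c j\<bar> * \<bar>u - u0\<bar> \<and> E u = (c j * (u - u0)) * f' j ((pt j u)(j := z))" for u
    proof -
      define g where "g = (\<lambda>y. f ((pt j u)(j := y)))"
      have g: "(g has_real_derivative f' j ((pt j u)(j := y))) (at y)" for y
        using d[OF j, of "(pt j u)(j := y)"] by (simp add: g_def)
      have s: "pt (Suc j) u = (pt j u)(j := b j + c j * u)" "pt j u = (pt j u)(j := x0 j)"
        by (auto simp: pt_def fun_eq_iff less_Suc_eq x0_def)
      have E: "E u = g (b j + c j * u) - g (x0 j)" unfolding E_def g_def using s by metis
      have bound: "\<bar>z - x0 j\<bar> \<le> \<bar>c j\<bar> * \<bar>u - u0\<bar>"
        if "min (x0 j) (b j + c j * u) \<le> z" "z \<le> max (x0 j) (b j + c j * u)" for z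
      proof -
        have "\<bar>z - x0 j\<bar> \<le> \<bar>(b j + c j * u) - x0 j\<bar>" using that by (auto simp: min_def max_def split: if_splits)
        also have "... = \<bar>c j\<bar> * \<bar>u - u0\<bar>" by (simp add: x0_def abs_mult[symmetric] right_diff_distrib)
        finally show ?thesis .
      qed
      consider "x0 j < b j + c j * u" | "b j + c j * u < x0 j" | "x0 j = b j + c j * u" by linarith
      then show ?thesis
      proof cases
        case 1
        from MVT2[OF this, of g "\<lambda>y. f' j ((pt j u)(j := y))"] g obtain z where
          "z > x0 j" "z < b j + c j * u" "g (b j + c j * u) - g (x0 j) = ((b j + c j * u) - x0 j) * f' j ((pt j u)(j := z))"
          by blast
        then show ?thesis using bound[of z] E by (intro exI[of _ z]) (auto simp: x0_def algebra_simps)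
      next
        case 2
        from MVT2[OF this, of g "\<lambda>y. f' j ((pt j u)(j := y))"] g obtain z where
          "z > b j + c j * u" "z < x0 j" "g (x0 j) - g (b j + c j * u) = (x0 j - (b j + c j * u)) * f' j ((pt j u)(j := z))"
          by blast
        then show ?thesis using bound[of z] E by (intro exI[of _ z]) (auto simp: x0_def algebra_simps)
      next
        case 3
        then show ?thesis using bound[of "x0 j"] E by (intro exI[of _ "x0 j"]) (auto simp: x0_def algebra_simps)
      qed
    qed
    then obtain \<zeta> where \<zeta>: "\<And>u. \<bar>\<zeta> u - x0 j\<bar> \<le> \<bar>c j\<bar> * \<bar>u - u0\<bar>"
      "\<And>u. E u = (c j * (u - u0)) * f' j ((pt j u)(j := \<zeta> u))" by metis
    \<comment> \<open>The intermediate point of the mean value theorem is squeezed to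
      \<open>x0 j\<close> by the bound in \<zeta>; the earlier coordinates converge because they are
      affine in u.\<close>
    have "((\<lambda>u. (pt j u)(j := \<zeta> u)) \<longlongrightarrow> x0) (at u0)"
    proof (rule tendsto_funI)
      fix i
      show "((\<lambda>u. ((pt j u)(j := \<zeta> u)) i) \<longlongrightarrow> x0 i) (at u0)"
      proof (cases "i = j")
        case True
        have "((\<lambda>u. \<bar>c j\<bar> * \<bar>u - u0\<bar>) \<longlongrightarrow> \<bar>c j\<bar> * \<bar>u0 - u0\<bar>) (at u0)" by (intro tendsto_intros)
        then have "((\<lambda>u. \<bar>c j\<bar> * \<bar>u - u0\<bar>) \<longlongrightarrow> 0) (at u0)" by simp
        then have "((\<lambda>u. \<zeta> u - x0 j) \<longlongrightarrow> 0) (at u0)"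
          by (rule Lim_null_comparison[rotated]) (simp add: \<zeta>)
        then show ?thesis using True by (simp add: Lim_null[symmetric])
      next
        case False
        have "((\<lambda>u. b i + c i * u) \<longlongrightarrow> b i + c i * u0) (at u0)" by (intro tendsto_intros)
        then show ?thesis using False by (cases "i < j") (auto simp: pt_def x0_def)
      qed
    qed
    then have "((\<lambda>u. f' j ((pt j u)(j := \<zeta> u))) \<longlongrightarrow> f' j x0) (at u0)"
      using continuous_on_tendsto_compose[OF cont[OF j]] by auto
    then have "((\<lambda>u. c j * f' j ((pt j u)(j := \<zeta> u))) \<longlongrightarrow> c j * f' j x0) (at u0)"
      by (rule tendsto_mult_left)
    moreover have "E u0 = 0" by (simp add: \<zeta>)
    moreover have "\<forall>\<^sub>F u in at u0. c j * f' j ((pt j u)(j := \<zeta> u)) = (E u - E u0) / (u - u0)"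
      by (rule eventually_at_filter[THEN iffD2]) (simp add: \<zeta> \<open>E u0 = 0\<close>)
    ultimately have "((\<lambda>u. (E u - E u0) / (u - u0)) \<longlongrightarrow> c j * f' j x0) (at u0)"
      by (rule_tac Lim_transform_eventually)
    then have "(E has_real_derivative c j * f' j x0) (at u0)"
      by (simp add: has_field_derivative_iff)
    from DERIV_add[OF Suc.IH this] j show ?case by (simp add: E_def)
  qed
  from this[of k] have "((\<lambda>u. f (pt k u)) has_real_derivative (\<Sum>i<k. c i * f' i x0)) (at u0)" by simp
  moreover have "f (pt k u) = f (\<lambda>i. b i + c i * u)" for u
    by (rule dep) (simp add: pt_def)
  ultimately show ?thesis by (simp add: x0_def)
qed

text \<open>The standard normal density solves y' = - x * y, so the difference of the two integrands
  is the derivative of \<open>h\<close> times the density. Linear growth of \<open>h\<close> makes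
  this product vanish at both ends.\<close>

lemma stein_std_normal:
  fixes h h' :: "real => real"
  assumes d: "\<And>x. (h has_real_derivative h' x) (at x)" and c: "continuous_on UNIV h'"
    and b: "\<And>x. \<bar>h x\<bar> \<le> C * (1 + \<bar>x\<bar>)" "\<And>x. \<bar>h' x\<bar> \<le> C * (1 + \<bar>x\<bar>)"
  shows "(\<integral>x. h x * x \<partial>std_normal_distribution) = (\<integral>x. h' x \<partial>std_normal_distribution)"
proof -
  let ?\<phi> = std_normal_density
  have h: "continuous_on UNIV h" by (meson DERIV_isCont continuous_at_imp_continuous_on d)
  have [measurable]: "h \<in> borel_measurable borel" "h' \<in> borel_measurable borel"
    using h c by (auto intro: borel_measurable_continuous_onI)
  have C: "C \<ge> 0" using b(1)[of 0] by simp
  have i0: "integrable lborel (\<lambda>x. ?\<phi> x * \<bar>x\<bar> ^ k)" for k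
    by (rule integrable_std_normal_moment_abs)
  have i1: "integrable lborel (\<lambda>x. ?\<phi> x * (h x * x))"
  proof (rule Bochner_Integration.integrable_bound)
    show "integrable lborel (\<lambda>x. C * (?\<phi> x * \<bar>x\<bar> ^ 1) + C * (?\<phi> x * \<bar>x\<bar> ^ 2))"
      using i0 by (intro Bochner_Integration.integrable_add integrable_mult_right)
    have "\<bar>?\<phi> x * (h x * x)\<bar> \<le> C * (?\<phi> x * \<bar>x\<bar> ^ 1) + C * (?\<phi> x * \<bar>x\<bar> ^ 2)" for x
    proof -
      have "\<bar>?\<phi> x * (h x * x)\<bar> = ?\<phi> x * (\<bar>h x\<bar> * \<bar>x\<bar>)" by (simp add: abs_mult)
      also have "... \<le> ?\<phi> x * ((C * (1 + \<bar>x\<bar>)) * \<bar>x\<bar>)" by (intro mult_left_mono mult_right_mono b) auto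
      finally show ?thesis by (simp add: algebra_simps power2_eq_square)
    qed
    then show "AE x in lborel. norm (?\<phi> x * (h x * x)) \<le> norm (C * (?\<phi> x * \<bar>x\<bar> ^ 1) + C * (?\<phi> x * \<bar>x\<bar> ^ 2))"
      using order_trans[OF _ abs_ge_self] by (intro AE_I2) (simp only: real_norm_def, blast)
  qed simp
  have i2: "integrable lborel (\<lambda>x. ?\<phi> x * h' x)"
  proof (rule Bochner_Integration.integrable_bound)
    show "integrable lborel (\<lambda>x. C * (?\<phi> x * \<bar>x\<bar> ^ 0) + C * (?\<phi> x * \<bar>x\<bar> ^ 1))"
      using i0 by (intro Bochner_Integration.integrable_add integrable_mult_right)
    have "\<bar>?\<phi> x * h' x\<bar> \<le> C * (?\<phi> x * \<bar>x\<bar> ^ 0) + C * (?\<phi> x * \<bar>x\<bar> ^ 1)" for x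
    proof -
      have "\<bar>?\<phi> x * h' x\<bar> = ?\<phi> x * \<bar>h' x\<bar>" by (simp add: abs_mult)
      also have "... \<le> ?\<phi> x * (C * (1 + \<bar>x\<bar>))" by (intro mult_left_mono b) auto
      finally show ?thesis by (simp add: algebra_simps)
    qed
    then show "AE x in lborel. norm (?\<phi> x * h' x) \<le> norm (C * (?\<phi> x * \<bar>x\<bar> ^ 0) + C * (?\<phi> x * \<bar>x\<bar> ^ 1))"
      using order_trans[OF _ abs_ge_self] by (intro AE_I2) (simp only: real_norm_def, blast)
  qed simp
  define F where "F = (\<lambda>x. h x * ?\<phi> x)"
  define f where "f = (\<lambda>x. ?\<phi> x * h' x - ?\<phi> x * (h x * x))"
  have dphi: "(?\<phi> has_real_derivative - x * ?\<phi> x) (at x)" for x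
    unfolding std_normal_density_def by (auto intro!: derivative_eq_intros simp: field_simps)
  have dF: "(F has_real_derivative f x) (at x)" for x
    unfolding F_def f_def by (auto intro!: derivative_eq_intros d dphi simp: algebra_simps)
  have cphi: "continuous_on UNIV ?\<phi>" by (meson DERIV_isCont continuous_at_imp_continuous_on dphi)
  have cf: "continuous_on UNIV f"
    unfolding f_def by (intro continuous_intros cphi c h)
  have lim: "((\<lambda>x. F x) \<longlongrightarrow> 0) at_top" "((\<lambda>x. F x) \<longlongrightarrow> 0) at_bot"
  proof -
    have bd: "norm (F x) \<le> C * (1 + \<bar>x\<bar>) * (1 / sqrt (2 * pi) * exp (- x\<^sup>2 / 2))" for x
      unfolding F_def std_normal_density_def using b(1)[of x]
      by (simp add: abs_mult mult_right_mono divide_right_mono)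
    show "((\<lambda>x. F x) \<longlongrightarrow> 0) at_top"
      by (rule Lim_null_comparison[OF always_eventually[OF allI[OF bd]]]) real_asymp
    show "((\<lambda>x. F x) \<longlongrightarrow> 0) at_bot"
      by (rule Lim_null_comparison[OF always_eventually[OF allI[OF bd]]]) real_asymp
  qed
  have "(LBINT x=-\<infinity>..\<infinity>. f x) = 0 - 0"
  proof (rule interval_integral_FTC_integrable[where F=F])
    show "(F has_vector_derivative f x) (at x)" for x
      using dF by (simp add: has_real_derivative_iff_has_vector_derivative)
    show "isCont f x" for x using cf by (simp add: continuous_on_eq_continuous_at)
    show "set_integrable lborel (einterval (-\<infinity>) \<infinity>) f"
      using i1 i2 by (simp add: f_def set_integrable_def einterval_eq)
    show "((F \<circ> real_of_ereal) \<longlongrightarrow> 0) (at_right (-\<infinity>))" "((F \<circ> real_of_ereal) \<longlongrightarrow> 0) (at_left \<infinity>)"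
      using lim by (simp_all add: ereal_tendsto_simps1)
  qed simp
  then have "(\<integral>x. f x \<partial>lborel) = 0"
    by (simp add: interval_lebesgue_integral_def set_lebesgue_integral_def einterval_eq)
  then have "(\<integral>x. ?\<phi> x * h' x \<partial>lborel) = (\<integral>x. ?\<phi> x * (h x * x) \<partial>lborel)"
    unfolding f_def using i1 i2 by simp
  then show ?thesis by (simp add: integral_density)
qed

text \<open>Rescaling of the standard case by \<open>sqrt v\<close>: one factor comes from W itself,
  the other from the chain rule, and together they give the variance.\<close>

lemma stein_centered_normal:
  fixes g g' :: "real => real"
  assumes W: "centered_normal M v W"
    and d: "\<And>x. (g has_real_derivative g' x) (at x)" and c: "continuous_on UNIV g'"
    and b: "\<And>x. \<bar>g x\<bar> \<le> C * (1 + \<bar>x\<bar>)" "\<And>x. \<bar>g' x\<bar> \<le> C * (1 + \<bar>x\<bar>)"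
  shows "(\<integral>w. g (W w) * W w \<partial>M) = v * (\<integral>w. g' (W w) \<partial>M)"
proof -
  have v: "v \<ge> 0" using W by (simp add: centered_normal_def)
  have g: "continuous_on UNIV g" by (meson DERIV_isCont continuous_at_imp_continuous_on d)
  have [measurable]: "g \<in> borel_measurable borel" "g' \<in> borel_measurable borel"
    using g c by (auto intro: borel_measurable_continuous_onI)
  have C: "C \<ge> 0" using b(1)[of 0] by simp
  \<comment> \<open>The factor \<open>1 + sqrt v\<close> absorbs the rescaled argument in the growth
    bound; \<open>1 + sqrt v + v\<close> dominates both prefactors, \<open>sqrt v\<close> for the
    function and v for its derivative.\<close>
  define K where "K = C * (1 + sqrt v) * (1 + sqrt v + v)"
  have K: "k * (C * (1 + \<bar>sqrt v * x\<bar>)) \<le> K * (1 + \<bar>x\<bar>)" if "0 \<le> k" "k \<le> 1 + sqrt v + v" for k x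
  proof -
    have "1 + \<bar>sqrt v * x\<bar> \<le> (1 + sqrt v) * (1 + \<bar>x\<bar>)" using v by (simp add: abs_mult algebra_simps)
    then have "C * (1 + \<bar>sqrt v * x\<bar>) \<le> C * ((1 + sqrt v) * (1 + \<bar>x\<bar>))" using C by (rule mult_left_mono)
    then have "k * (C * (1 + \<bar>sqrt v * x\<bar>)) \<le> (1 + sqrt v + v) * (C * ((1 + sqrt v) * (1 + \<bar>x\<bar>)))"
      by (rule mult_mono[OF that(2)]) (use that C v in auto)
    then show ?thesis by (simp add: K_def mult_ac)
  qed
  have "(\<integral>x. (sqrt v * g (sqrt v * x)) * x \<partial>std_normal_distribution) = (\<integral>x. v * g' (sqrt v * x) \<partial>std_normal_distribution)"
  proof (rule stein_std_normal[where C=K])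
    fix x
    have "((\<lambda>x. g (sqrt v * x)) has_real_derivative g' (sqrt v * x) * sqrt v) (at x)"
      by (rule DERIV_chain2[OF d]) (auto intro!: derivative_eq_intros)
    note D = DERIV_cmult[OF this, of "sqrt v"]
    have "sqrt v * (g' (sqrt v * x) * sqrt v) = (sqrt v * sqrt v) * g' (sqrt v * x)" by (simp only: mult_ac)
    also have "sqrt v * sqrt v = v" using v by (rule real_sqrt_mult_self[THEN trans, OF abs_of_nonneg])
    finally show "((\<lambda>x. sqrt v * g (sqrt v * x)) has_real_derivative v * g' (sqrt v * x)) (at x)"
      using D by (simp only:)
    show "\<bar>sqrt v * g (sqrt v * x)\<bar> \<le> K * (1 + \<bar>x\<bar>)"
      using mult_left_mono[OF b(1)[of "sqrt v * x"], of "sqrt v"] K[of "sqrt v" x] v by (simp add: abs_mult)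
    show "\<bar>v * g' (sqrt v * x)\<bar> \<le> K * (1 + \<bar>x\<bar>)"
      using mult_left_mono[OF b(2)[of "sqrt v * x"], of v] K[of v x] v by (simp add: abs_mult)
  next
    show "continuous_on UNIV (\<lambda>x. v * g' (sqrt v * x))"
      by (intro continuous_intros continuous_on_compose2[OF c]) auto
  qed
  moreover have "(\<integral>w. g (W w) * W w \<partial>M) = (\<integral>x. (sqrt v * g (sqrt v * x)) * x \<partial>std_normal_distribution)"
    using centered_normal_integral[OF W, of "\<lambda>x. g x * x"] by (simp add: mult_ac)
  moreover have "(\<integral>w. g' (W w) \<partial>M) = (\<integral>x. g' (sqrt v * x) \<partial>std_normal_distribution)"
    using centered_normal_integral[OF W, of g'] by simp
  ultimately show ?thesis by simp
qed

section \<open>Linear spaces of centered normal variables\<close>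

text \<open>Joint normality is expressed through closure under linear combinations: every
  combination of members is a member and hence normal. No multivariate normal law has to be
  introduced.\<close>

locale gaussian_space = prob_space M for M :: "'a measure" +
  fixes \<G> :: "('a => real) set"
  assumes normal: "W \<in> \<G> ==> \<exists>v. centered_normal M v W"
    and scale: "W \<in> \<G> ==> (\<lambda>w. a * W w) \<in> \<G>"
    and add: "V \<in> \<G> ==> W \<in> \<G> ==> (\<lambda>w. V w + W w) \<in> \<G>"
begin

lemma normal_var: "W \<in> \<G> ==> centered_normal M (expectation (\<lambda>w. (W w)\<^sup>2)) W"
  using normal centered_normal_moments(3) by metis

lemma meas [measurable_dest]: "W \<in> \<G> ==> W \<in> borel_measurable M"
  using normal_var by (auto simp: centered_normal_def)

lemma sq: "W \<in> \<G> ==> integrable M (\<lambda>w. (W w)\<^sup>2)"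
  by (rule centered_normal_moments(1)[OF normal_var])

lemma int: "W \<in> \<G> ==> integrable M W"
  using centered_normal_moments(1)[OF normal_var, of W 1] by simp

lemma prod_int: "V \<in> \<G> ==> W \<in> \<G> ==> integrable M (\<lambda>w. V w * W w)"
  using meas sq by (intro integrable_mult_of_square) auto

lemma diff: "V \<in> \<G> ==> W \<in> \<G> ==> (\<lambda>w. V w - W w) \<in> \<G>"
  using add[of V "\<lambda>w. - 1 * W w"] scale[of W "-1"] by simp

lemma sum_in:
  assumes "\<G> \<noteq> {}" "\<And>i. i \<in> I ==> U i \<in> \<G>"
  shows "(\<lambda>w. \<Sum>i\<in>I. U i w) \<in> \<G>"
proof -
  obtain W where "W \<in> \<G>" using assms by auto
  have "(\<lambda>w. 0) \<in> \<G>" using scale[OF \<open>W \<in> \<G>\<close>, of 0] by simp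
  then show ?thesis using assms(2)
    by (induction I rule: infinite_finite_induct) (auto intro: add)
qed

text \<open>Polarisation expresses \<open>(V w)\<^sup>2 * (W w)\<^sup>2\<close> through fourth
  powers of V + W, V - W, V and W. Each of these is normal, with fourth moment three times the
  squared variance.\<close>

lemma wick:
  assumes V: "V \<in> \<G>" and W: "W \<in> \<G>"
  shows "integrable M (\<lambda>w. (V w)\<^sup>2 * (W w)\<^sup>2)"
    "expectation (\<lambda>w. (V w)\<^sup>2 * (W w)\<^sup>2) =
       expectation (\<lambda>w. (V w)\<^sup>2) * expectation (\<lambda>w. (W w)\<^sup>2) + 2 * (expectation (\<lambda>w. V w * W w))\<^sup>2"
proof -
  have p: "(\<lambda>w. V w + W w) \<in> \<G>" "(\<lambda>w. V w - W w) \<in> \<G>" using V W by (auto intro: add diff)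
  note i4 = centered_normal_moments(1)[OF normal_var, where k=4]
  note e4 = centered_normal_moments(4)[OF normal_var]
  have pt: "(V w)\<^sup>2 * (W w)\<^sup>2 = ((V w + W w)^4 + (V w - W w)^4 - 2 * V w ^ 4 - 2 * W w ^ 4) / 12" for w
    by (simp add: power4_eq_xxxx power2_eq_square algebra_simps)
  show "integrable M (\<lambda>w. (V w)\<^sup>2 * (W w)\<^sup>2)"
    unfolding pt using i4 p V W by (auto intro!: integrable_divide)
  define a c b where "a = expectation (\<lambda>w. (V w)\<^sup>2)" and "c = expectation (\<lambda>w. (W w)\<^sup>2)"
    and "b = expectation (\<lambda>w. V w * W w)"
  have VW: "integrable M (\<lambda>w. (V w)\<^sup>2)" "integrable M (\<lambda>w. (W w)\<^sup>2)" "integrable M (\<lambda>w. V w * W w)"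
    using V W sq prod_int by auto
  have s: "expectation (\<lambda>w. (V w + W w)\<^sup>2) = a + c + 2 * b" "expectation (\<lambda>w. (V w - W w)\<^sup>2) = a + c - 2 * b"
    using VW by (simp_all add: power2_sum power2_diff mult.assoc a_def b_def c_def)
  have "expectation (\<lambda>w. (V w)\<^sup>2 * (W w)\<^sup>2) =
     (3 * (a + c + 2 * b)\<^sup>2 + 3 * (a + c - 2 * b)\<^sup>2 - 2 * (3 * a\<^sup>2) - 2 * (3 * c\<^sup>2)) / 12"
    unfolding pt using i4[OF p(1)] i4[OF p(2)] i4[OF V] i4[OF W]
    by (simp add: e4[OF p(1)] e4[OF p(2)] e4[OF V] e4[OF W] s a_def[symmetric] c_def[symmetric])
  also have "... = a * c + 2 * b\<^sup>2" by (simp add: power2_eq_square algebra_simps)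
  finally show "expectation (\<lambda>w. (V w)\<^sup>2 * (W w)\<^sup>2) = expectation (\<lambda>w. (V w)\<^sup>2) * expectation (\<lambda>w. (W w)\<^sup>2) + 2 * (expectation (\<lambda>w. V w * W w))\<^sup>2"
    by (simp add: a_def b_def c_def)
qed

text \<open>Uncorrelated jointly normal variables are independent. The independence is stated as
  equality of laws with a pair on the product space, in which W is evaluated at its own sample
  point, so that Fubini's theorem becomes available. Both trigonometric integrals depend only on the
  sum of the variances.\<close>

lemma orthogonal_distr_eq:
  fixes V :: "nat => 'a => real"
  assumes V: "\<And>i. i < k ==> V i \<in> \<G>" and W: "W \<in> \<G>"
    and orth: "\<And>i. i < k ==> expectation (\<lambda>w. V i w * W w) = 0"
  shows "distr M (Pi\<^sub>M {..<Suc k} (\<lambda>_. borel)) (\<lambda>w. \<lambda>i\<in>{..<Suc k}. if i < k then V i w else W w) =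
    distr (M \<Otimes>\<^sub>M M) (Pi\<^sub>M {..<Suc k} (\<lambda>_. borel))
      (\<lambda>w. \<lambda>i\<in>{..<Suc k}. if i < k then V i (fst w) else W (snd w))"
proof (rule distr_PiM_eqI_cos)
  interpret MM: pair_prob_space M M ..
  show "finite_measure M" "finite_measure (M \<Otimes>\<^sub>M M)" by unfold_locales
  have [measurable]: "W \<in> borel_measurable M" using W by (rule meas)
  have Vm [measurable]: "i < k ==> V i \<in> borel_measurable M" for i using V by (blast intro: meas)
  show "(\<lambda>w. if i < k then V i w else W w) \<in> borel_measurable M" for i by (cases "i < k") auto
  show "(\<lambda>w. if i < k then V i (fst w) else W (snd w)) \<in> borel_measurable (M \<Otimes>\<^sub>M M)" for i
    by (cases "i < k") auto
  fix l :: "nat => real" and c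
  define U where "U = (\<lambda>w. \<Sum>i<k. l i * V i w)"
  define s where "s = l k"
  have ne: "\<G> \<noteq> {}" using W by auto
  have U: "U \<in> \<G>" unfolding U_def by (rule sum_in[OF ne]) (auto intro!: scale V)
  have [measurable]: "U \<in> borel_measurable M" using U by (rule meas)
  have UW: "expectation (\<lambda>w. U w * W w) = 0"
    unfolding U_def sum_distrib_right mult.assoc
    by (subst Bochner_Integration.integral_sum) (auto intro!: prod_int V W simp: orth)
  define u q where "u = expectation (\<lambda>w. (U w)\<^sup>2)" and "q = expectation (\<lambda>w. (W w)\<^sup>2)"
  have "(\<lambda>w. U w + s * W w) \<in> \<G>" using U W by (intro add scale)
  note n = normal_var[OF this]
  have "expectation (\<lambda>w. (U w + s * W w)\<^sup>2) = expectation (\<lambda>w. (U w)\<^sup>2 + (s\<^sup>2 * (W w)\<^sup>2 + 2 * s * (U w * W w)))"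
    by (intro Bochner_Integration.integral_cong) (auto simp: power2_eq_square algebra_simps)
  also have "... = u + s\<^sup>2 * q"
    using sq[OF U] sq[OF W] prod_int[OF U W] UW by (simp add: u_def q_def)
  finally have var: "expectation (\<lambda>w. (U w + s * W w)\<^sup>2) = u + s\<^sup>2 * q" .
  have Mi: "prob_space M" by unfold_locales
  have 1: "expectation (\<lambda>w. cos (1 * (U w + s * W w) + c)) = cos c * exp (- (1\<^sup>2 * (u + s\<^sup>2 * q)) / 2)"
    using centered_normal_cos[OF n] unfolding var .
  have 2: "(\<integral>w. cos (U (fst w) + s * W (snd w) + c) \<partial>(M \<Otimes>\<^sub>M M)) = cos c * exp (- (u + s\<^sup>2 * q) / 2)"
  proof -
    have "(\<integral>w. cos (U (fst w) + s * W (snd w) + c) \<partial>(M \<Otimes>\<^sub>M M)) =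
        (\<integral>x. \<integral>y. cos (U (fst (x, y)) + s * W (snd (x, y)) + c) \<partial>M \<partial>M)"
      by (rule MM.integral_fst'[symmetric]) (rule MM.P.integrable_const_bound[where B=1]; simp)
    also have "... = (\<integral>x. \<integral>y. cos (s * W y + (U x + c)) \<partial>M \<partial>M)" by (simp add: add_ac)
    also have "... = (\<integral>x. cos (1 * U x + c) * exp (- (s\<^sup>2 * q) / 2) \<partial>M)"
      unfolding centered_normal_cos[OF normal_var[OF W]] q_def by simp
    also have "... = cos c * exp (- u / 2) * exp (- (s\<^sup>2 * q) / 2)"
      using centered_normal_cos[OF normal_var[OF U], of 1 c] by (simp add: u_def)
    also have "... = cos c * exp (- (u + s\<^sup>2 * q) / 2)"
      by (simp add: mult.assoc exp_add[symmetric] add_divide_distrib)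
    finally show ?thesis .
  qed
  have "(\<integral>w. cos ((\<Sum>i<Suc k. l i * (if i < k then V i w else W w)) + c) \<partial>M) =
      (\<integral>w. cos (1 * (U w + s * W w) + c) \<partial>M)"
    by (simp add: U_def s_def)
  also have "... = (\<integral>w. cos (U (fst w) + s * W (snd w) + c) \<partial>(M \<Otimes>\<^sub>M M))"
    unfolding 1 2 by simp
  also have "... = (\<integral>w. cos ((\<Sum>i<Suc k. l i * (if i < k then V i (fst w) else W (snd w))) + c) \<partial>(M \<Otimes>\<^sub>M M))"
    by (simp add: U_def s_def)
  finally show "(\<integral>w. cos ((\<Sum>i<Suc k. l i * (if i < k then V i w else W w)) + c) \<partial>M) =
    (\<integral>w. cos ((\<Sum>i<Suc k. l i * (if i < k then V i (fst w) else W (snd w))) + c) \<partial>(M \<Otimes>\<^sub>M M))" .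
qed

text \<open>Each \<open>U i\<close> is split by linear regression into a multiple of W and a rest
  \<open>V i\<close> uncorrelated with W. The rest may then be taken independent of W and held
  fixed, which leaves the one-dimensional formula along a line in the direction of the regression
  coefficients.\<close>

lemma stein:
  fixes f :: "(nat => real) => real" and U :: "nat => 'a => real"
  assumes U: "\<And>i. i < k ==> U i \<in> \<G>" and W: "W \<in> \<G>"
    and dep: "\<And>x y. (\<And>i. i < k ==> x i = y i) ==> f x = f y"
    and d: "\<And>i x. i < k ==> ((\<lambda>y. f (x(i := y))) has_real_derivative f' i x) (at (x i))"
    and f: "continuous_on UNIV f" and f': "\<And>i. i < k ==> continuous_on UNIV (f' i)"
    and b: "\<And>x. \<bar>f x\<bar> \<le> C * (1 + (\<Sum>i<k. \<bar>x i\<bar>))" "\<And>i x. i < k ==> \<bar>f' i x\<bar> \<le> C * (1 + (\<Sum>i<k. \<bar>x i\<bar>))"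
  shows "expectation (\<lambda>w. f (\<lambda>i. U i w) * W w) =
    (\<Sum>i<k. expectation (\<lambda>w. f' i (\<lambda>j. U j w)) * expectation (\<lambda>w. U i w * W w))"
proof (cases "expectation (\<lambda>w. (W w)\<^sup>2) = 0")
  case True
  then have AE: "AE w in M. W w = 0"
    using sq[OF W] by (subst (asm) integral_nonneg_eq_0_iff_AE) auto
  have [measurable]: "W \<in> borel_measurable M" using W by (rule meas)
  have z: "expectation (\<lambda>w. h w * W w) = 0" for h
    by (rule integral_eq_zero_AE) (use AE in auto)
  show ?thesis by (simp add: z)
next
  case False
  interpret MM: pair_prob_space M M ..
  define v where "v = expectation (\<lambda>w. (W w)\<^sup>2)"
  have v: "v > 0" using False by (simp add: v_def less_le)
  have nW: "centered_normal M v W" unfolding v_def by (rule normal_var[OF W])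
  have Wm [measurable]: "W \<in> borel_measurable M" using W by (rule meas)
  have Um [measurable]: "i < k ==> U i \<in> borel_measurable M" for i using U by (blast intro: meas)
  have C: "C \<ge> 0" using b(1)[of "\<lambda>_. 0"] by simp
  \<comment> \<open>The partial derivatives inherit the dependence on the first k coordinates, by
    uniqueness of derivatives.\<close>
  have dep': "f' i x = f' i y" if "i < k" "\<And>j. j < k ==> x j = y j" for i x y
  proof (rule DERIV_unique)
    show "((\<lambda>z. f (x(i := z))) has_real_derivative f' i x) (at (x i))" by (rule d[OF that(1)])
    have "(\<lambda>z. f (x(i := z))) = (\<lambda>z. f (y(i := z)))" using that by (intro ext dep) auto
    then show "((\<lambda>z. f (x(i := z))) has_real_derivative f' i y) (at (x i))"
      using d[OF that(1), of y] that by simp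
  qed
  \<comment> \<open>The regression coefficients of \<open>U i\<close> on W, chosen to make
    \<open>V i\<close> orthogonal to W.\<close>
  define c where "c = (\<lambda>i. if i < k then expectation (\<lambda>w. U i w * W w) / v else 0)"
  define V where "V = (\<lambda>i w. U i w - c i * W w)"
  have V: "V i \<in> \<G>" if "i < k" for i unfolding V_def using that by (intro diff scale U W)
  have Vm [measurable]: "i < k ==> V i \<in> borel_measurable M" for i using V by (blast intro: meas)
  have orth: "expectation (\<lambda>w. V i w * W w) = 0" if "i < k" for i
  proof -
    have "expectation (\<lambda>w. V i w * W w) = expectation (\<lambda>w. U i w * W w - c i * (W w)\<^sup>2)"
      by (simp add: V_def left_diff_distrib power2_eq_square mult.assoc)
    also have "... = expectation (\<lambda>w. U i w * W w) - c i * v"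
      using prod_int[OF U[OF that] W] sq[OF W] by (simp add: v_def)
    finally show ?thesis using v that by (simp add: c_def)
  qed
  \<comment> \<open>Reconstructs the vector U from the coordinates of V and from W, which is stored
    at index k. The value 0 from k on is harmless because \<open>f\<close> and \<open>f'\<close> see
    only the first k coordinates.\<close>
  define ext where "ext = (\<lambda>x i. if i < k then x i + c i * x k else (0::real))"
  have "(\<lambda>x. ext x) \<in> Pi\<^sub>M {..<Suc k} (\<lambda>_. borel) \<rightarrow>\<^sub>M Pi\<^sub>M UNIV (\<lambda>_. borel)"
  proof (rule measurable_PiM_single')
    show "(\<lambda>x. ext x i) \<in> borel_measurable (Pi\<^sub>M {..<Suc k} (\<lambda>_. borel))" for i
    proof (cases "i < k")
      case True
      then have "(\<lambda>x. x i + c i * x k) \<in> borel_measurable (Pi\<^sub>M {..<Suc k} (\<lambda>_. borel))"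
        by (intro borel_measurable_add borel_measurable_times borel_measurable_const measurable_component_singleton) auto
      then show ?thesis using True by (simp only: ext_def if_True)
    qed (simp only: ext_def if_False borel_measurable_const)
  qed auto
  then have ext_meas: "(\<lambda>x. ext x) \<in> borel_measurable (Pi\<^sub>M {..<Suc k} (\<lambda>_. borel))"
    by (simp only: measurable_cong_sets[OF refl sets_PiM_equal_borel])
  have meas_ext: "(\<lambda>x. g (ext x)) \<in> borel_measurable (Pi\<^sub>M {..<Suc k} (\<lambda>_. borel))"
    if "continuous_on UNIV g" for g :: "(nat => real) => real"
    using measurable_compose[OF ext_meas borel_measurable_continuous_onI[OF that]] .
  let ?T1 = "\<lambda>w. \<lambda>i\<in>{..<Suc k}. if i < k then V i w else W w"
  let ?T2 = "\<lambda>w. \<lambda>i\<in>{..<Suc k}. if i < k then V i (fst w) else W (snd w)"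
  have T [measurable]: "?T1 \<in> M \<rightarrow>\<^sub>M Pi\<^sub>M {..<Suc k} (\<lambda>_. borel)" "?T2 \<in> M \<Otimes>\<^sub>M M \<rightarrow>\<^sub>M Pi\<^sub>M {..<Suc k} (\<lambda>_. borel)"
  proof -
    show "?T1 \<in> M \<rightarrow>\<^sub>M Pi\<^sub>M {..<Suc k} (\<lambda>_. borel)"
    proof (rule measurable_restrict)
      show "(\<lambda>w. if i < k then V i w else W w) \<in> borel_measurable M" for i by (cases "i < k") auto
    qed
    show "?T2 \<in> M \<Otimes>\<^sub>M M \<rightarrow>\<^sub>M Pi\<^sub>M {..<Suc k} (\<lambda>_. borel)"
    proof (rule measurable_restrict)
      show "(\<lambda>w. if i < k then V i (fst w) else W (snd w)) \<in> borel_measurable (M \<Otimes>\<^sub>M M)" for i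
        by (cases "i < k") auto
    qed
  qed
  have D: "distr M (Pi\<^sub>M {..<Suc k} (\<lambda>_. borel)) ?T1 = distr (M \<Otimes>\<^sub>M M) (Pi\<^sub>M {..<Suc k} (\<lambda>_. borel)) ?T2"
    by (rule orthogonal_distr_eq[OF V W orth])
  have transfer: "(\<integral>w. \<Phi> (?T1 w) \<partial>M) = (\<integral>w. \<Phi> (?T2 w) \<partial>(M \<Otimes>\<^sub>M M))"
     "integrable M (\<lambda>w. \<Phi> (?T1 w)) = integrable (M \<Otimes>\<^sub>M M) (\<lambda>w. \<Phi> (?T2 w))"
    if "\<Phi> \<in> borel_measurable (Pi\<^sub>M {..<Suc k} (\<lambda>_. borel))" for \<Phi> :: "(nat => real) => real"
    using arg_cong[OF D, of "\<lambda>D. integral\<^sup>L D \<Phi>"] arg_cong[OF D, of "\<lambda>D. integrable D \<Phi>"] that T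
    by (simp_all add: integral_distr integrable_distr_eq)
  have e1: "f (\<lambda>i. U i w) = f (ext (?T1 w))" for w
    by (rule dep) (simp add: ext_def V_def)
  have e1': "f' i (\<lambda>j. U j w) = f' i (ext (?T1 w))" if "i < k" for i w
    by (rule dep'[OF that]) (simp add: ext_def V_def)
  have e2: "f (\<lambda>i. V i x + c i * W y) = f (ext (?T2 (x, y)))" for x y
    by (rule dep) (simp add: ext_def)
  have e2': "f' i (\<lambda>j. V j x + c j * W y) = f' i (ext (?T2 (x, y)))" if "i < k" for i x y
    by (rule dep'[OF that]) (simp add: ext_def)
  have kk: "?T1 w k = W w" "?T2 w' k = W (snd w')" for w w' by auto
  have Uabs: "integrable M (\<lambda>w. C * (1 + (\<Sum>i<k. \<bar>U i w\<bar>)))"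
    by (rule integrable_mult_right, rule Bochner_Integration.integrable_add, rule integrable_const,
        intro Bochner_Integration.integrable_sum integrable_abs int U) auto
  have UWabs: "integrable M (\<lambda>w. C * (\<bar>W w\<bar> + (\<Sum>i<k. \<bar>U i w * W w\<bar>)))"
    by (intro integrable_mult_right Bochner_Integration.integrable_add Bochner_Integration.integrable_sum integrable_abs int U prod_int W) auto
  have mf [measurable]: "(\<lambda>w. f (\<lambda>i. U i w)) \<in> borel_measurable M"
    unfolding e1 by (rule measurable_compose[OF T(1) meas_ext[OF f]])
  have mf' [measurable]: "(\<lambda>w. f' i (\<lambda>i. U i w)) \<in> borel_measurable M" if "i < k" for i
    unfolding e1'[OF that] by (rule measurable_compose[OF T(1) meas_ext[OF f'[OF that]]])
  have I0: "integrable M (\<lambda>w. f (\<lambda>i. U i w) * W w)"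
  proof (rule Bochner_Integration.integrable_bound[OF UWabs])
    have "\<bar>f (\<lambda>i. U i w) * W w\<bar> \<le> \<bar>C * (\<bar>W w\<bar> + (\<Sum>i<k. \<bar>U i w * W w\<bar>))\<bar>" for w
    proof -
      have "\<bar>f (\<lambda>i. U i w) * W w\<bar> \<le> (C * (1 + (\<Sum>i<k. \<bar>U i w\<bar>))) * \<bar>W w\<bar>"
        unfolding abs_mult by (intro mult_right_mono b) auto
      also have "... = C * (\<bar>W w\<bar> + (\<Sum>i<k. \<bar>U i w * W w\<bar>))"
        by (simp add: abs_mult algebra_simps sum_distrib_left)
      finally show ?thesis by linarith
    qed
    then show "AE w in M. norm (f (\<lambda>i. U i w) * W w) \<le> norm (C * (\<bar>W w\<bar> + (\<Sum>i<k. \<bar>U i w * W w\<bar>)))" by simp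
  qed measurable
  have I1: "integrable M (\<lambda>w. f' i (\<lambda>j. U j w))" if "i < k" for i
  proof (rule Bochner_Integration.integrable_bound[OF Uabs])
    have "\<bar>f' i (\<lambda>j. U j w)\<bar> \<le> \<bar>C * (1 + (\<Sum>i<k. \<bar>U i w\<bar>))\<bar>" for w
      using b(2)[OF that, of "\<lambda>j. U j w"] by linarith
    then show "AE w in M. norm (f' i (\<lambda>j. U j w)) \<le> norm (C * (1 + (\<Sum>i<k. \<bar>U i w\<bar>)))" by simp
  qed (use that in measurable)
  have P0: "(\<lambda>x. f (ext x) * x k) \<in> borel_measurable (Pi\<^sub>M {..<Suc k} (\<lambda>_. borel))"
    using meas_ext[OF f] by measurable
  note tr0 = transfer[OF P0]
  note tr1 = transfer[OF meas_ext[OF f']]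
  have J0: "integrable (M \<Otimes>\<^sub>M M) (\<lambda>w. f (ext (?T2 w)) * ?T2 w k)"
    using I0 tr0(2) unfolding e1 kk by (simp only:)
  have J1: "integrable (M \<Otimes>\<^sub>M M) (\<lambda>w. f' i (ext (?T2 w)))" if "i < k" for i
    using I1[OF that] tr1(2)[OF that] unfolding e1'[OF that] by (simp only:)
  have inner: "(\<integral>y. f (\<lambda>i. V i x + c i * W y) * W y \<partial>M) =
      v * (\<integral>y. (\<Sum>i<k. c i * f' i (\<lambda>i. V i x + c i * W y)) \<partial>M)" for x
  proof -
    \<comment> \<open>One constant for both growth bounds: the leading factor is at least 1, as the
      function requires, and at least the sum of the \<open>\<bar>c i\<bar>\<close>, as its
      directional derivative requires.\<close>
    define K where "K = (1 + (\<Sum>i<k. \<bar>c i\<bar>)) * (C * (1 + (\<Sum>i<k. \<bar>V i x\<bar>) + (\<Sum>i<k. \<bar>c i\<bar>)))"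
    have le: "C * (1 + (\<Sum>i<k. \<bar>V i x + c i * q\<bar>)) \<le> (C * (1 + (\<Sum>i<k. \<bar>V i x\<bar>) + (\<Sum>i<k. \<bar>c i\<bar>))) * (1 + \<bar>q\<bar>)" for q
    proof -
      have "(\<Sum>i<k. \<bar>V i x + c i * q\<bar>) \<le> (\<Sum>i<k. \<bar>V i x\<bar> + \<bar>c i\<bar> * \<bar>q\<bar>)"
        by (intro sum_mono) (metis abs_mult abs_triangle_ineq)
      also have "... = (\<Sum>i<k. \<bar>V i x\<bar>) + (\<Sum>i<k. \<bar>c i\<bar>) * \<bar>q\<bar>"
        by (simp add: sum.distrib sum_distrib_right)
      finally have "(\<Sum>i<k. \<bar>V i x + c i * q\<bar>) \<le> (\<Sum>i<k. \<bar>V i x\<bar>) + (\<Sum>i<k. \<bar>c i\<bar>) * \<bar>q\<bar>" .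
      moreover have "1 + a \<le> (1 + S + T) * (1 + u)" if "a \<le> S + T * u" "0 \<le> S" "0 \<le> T" "0 \<le> u" for a S T u :: real
      proof -
        have "0 \<le> S * u" using that by simp
        moreover have "(1 + S + T) * (1 + u) = 1 + S + T + u + S * u + T * u" by (simp add: algebra_simps)
        ultimately show ?thesis using that by linarith
      qed
      ultimately have "1 + (\<Sum>i<k. \<bar>V i x + c i * q\<bar>) \<le> (1 + (\<Sum>i<k. \<bar>V i x\<bar>) + (\<Sum>i<k. \<bar>c i\<bar>)) * (1 + \<bar>q\<bar>)"
        by (simp add: sum_nonneg)
      from mult_left_mono[OF this C] show ?thesis by (simp add: mult.assoc)
    qed
    have K0: "C * (1 + (\<Sum>i<k. \<bar>V i x\<bar>) + (\<Sum>i<k. \<bar>c i\<bar>)) \<ge> 0"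
      using C sum_nonneg[of "{..<k}" "\<lambda>i. \<bar>V i x\<bar>"] sum_nonneg[of "{..<k}" "\<lambda>i. \<bar>c i\<bar>"] by simp
    show ?thesis
    proof (rule stein_centered_normal[OF nW, where C=K])
      show "((\<lambda>q. f (\<lambda>i. V i x + c i * q)) has_real_derivative (\<Sum>i<k. c i * f' i (\<lambda>i. V i x + c i * q))) (at q)" for q
        by (rule has_real_derivative_along_line[OF dep d f']) auto
      show "continuous_on UNIV (\<lambda>q. \<Sum>i<k. c i * f' i (\<lambda>i. V i x + c i * q))"
      proof (intro continuous_intros)
        fix i assume "i \<in> {..<k}"
        then show "continuous_on UNIV (\<lambda>q. f' i (\<lambda>i. V i x + c i * q))"
          by (intro continuous_on_compose2[OF f'] continuous_on_coordinatewise_then_product continuous_intros) auto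
      qed
      fix q
      have 1: "\<bar>f (\<lambda>i. V i x + c i * q)\<bar> \<le> (C * (1 + (\<Sum>i<k. \<bar>V i x\<bar>) + (\<Sum>i<k. \<bar>c i\<bar>))) * (1 + \<bar>q\<bar>)"
        by (rule order_trans[OF b(1) le])
      also have "... \<le> K * (1 + \<bar>q\<bar>)"
        unfolding K_def using K0 sum_nonneg[of "{..<k}" "\<lambda>i. \<bar>c i\<bar>"]
        by (intro mult_right_mono) (simp_all add: distrib_right)
      finally show "\<bar>f (\<lambda>i. V i x + c i * q)\<bar> \<le> K * (1 + \<bar>q\<bar>)" .
      have "\<bar>\<Sum>i<k. c i * f' i (\<lambda>i. V i x + c i * q)\<bar> \<le> (\<Sum>i<k. \<bar>c i\<bar> * \<bar>f' i (\<lambda>i. V i x + c i * q)\<bar>)"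
        by (rule order_trans[OF sum_abs]) (simp add: abs_mult)
      also have "... \<le> (\<Sum>i<k. \<bar>c i\<bar> * ((C * (1 + (\<Sum>i<k. \<bar>V i x\<bar>) + (\<Sum>i<k. \<bar>c i\<bar>))) * (1 + \<bar>q\<bar>)))"
        by (intro sum_mono mult_left_mono order_trans[OF b(2) le]) auto
      also have "... = (\<Sum>i<k. \<bar>c i\<bar>) * (C * (1 + (\<Sum>i<k. \<bar>V i x\<bar>) + (\<Sum>i<k. \<bar>c i\<bar>))) * (1 + \<bar>q\<bar>)"
        by (simp add: sum_distrib_right mult.assoc)
      also have "... \<le> K * (1 + \<bar>q\<bar>)"
        unfolding K_def using K0 by (intro mult_right_mono) auto
      finally show "\<bar>\<Sum>i<k. c i * f' i (\<lambda>i. V i x + c i * q)\<bar> \<le> K * (1 + \<bar>q\<bar>)" .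
    qed
  qed
  have r1: "(\<integral>x. \<integral>y. (\<Sum>i<k. c i * f' i (\<lambda>i. V i x + c i * W y)) \<partial>M \<partial>M) =
      (\<integral>x. \<integral>y. (\<Sum>i<k. c i * f' i (ext (?T2 (x, y)))) \<partial>M \<partial>M)"
    by (intro Bochner_Integration.integral_cong refl sum.cong) (simp only: lessThan_iff e2')
  have r2: "(\<integral>x. \<integral>y. (\<Sum>i<k. c i * f' i (ext (?T2 (x, y)))) \<partial>M \<partial>M) = (\<integral>w. (\<Sum>i<k. c i * f' i (ext (?T2 w))) \<partial>(M \<Otimes>\<^sub>M M))"
    by (rule MM.integral_fst') (intro Bochner_Integration.integrable_sum integrable_mult_right J1, simp)
  have r3: "(\<integral>w. (\<Sum>i<k. c i * f' i (ext (?T2 w))) \<partial>(M \<Otimes>\<^sub>M M)) = (\<Sum>i<k. c i * (\<integral>w. f' i (ext (?T2 w)) \<partial>(M \<Otimes>\<^sub>M M)))"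
    by (subst Bochner_Integration.integral_sum) (auto intro!: integrable_mult_right J1)
  have r4: "(\<Sum>i<k. c i * (\<integral>w. f' i (ext (?T2 w)) \<partial>(M \<Otimes>\<^sub>M M))) = (\<Sum>i<k. c i * (\<integral>w. f' i (\<lambda>j. U j w) \<partial>M))"
    by (intro sum.cong refl) (simp only: lessThan_iff tr1(1)[symmetric] e1')
  have rhs: "(\<integral>x. \<integral>y. (\<Sum>i<k. c i * f' i (\<lambda>i. V i x + c i * W y)) \<partial>M \<partial>M) =
      (\<Sum>i<k. c i * (\<integral>w. f' i (\<lambda>j. U j w) \<partial>M))"
    by (rule r1[THEN trans, OF r2[THEN trans, OF r3[THEN trans, OF r4]]])
  have "expectation (\<lambda>w. f (\<lambda>i. U i w) * W w) = (\<integral>w. f (ext (?T1 w)) * ?T1 w k \<partial>M)"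
    by (simp only: e1 kk)
  also have "... = (\<integral>w. f (ext (?T2 w)) * ?T2 w k \<partial>(M \<Otimes>\<^sub>M M))" by (rule tr0)
  also have "... = (\<integral>x. \<integral>y. f (ext (?T2 (x, y))) * ?T2 (x, y) k \<partial>M \<partial>M)"
    by (rule MM.integral_fst'[symmetric, OF J0])
  also have "... = (\<integral>x. \<integral>y. f (\<lambda>i. V i x + c i * W y) * W y \<partial>M \<partial>M)"
    by (simp only: e2 kk(2)) (simp only: snd_conv)
  also have "... = v * (\<integral>x. \<integral>y. (\<Sum>i<k. c i * f' i (\<lambda>i. V i x + c i * W y)) \<partial>M \<partial>M)"
    unfolding inner by simp
  finally show ?thesis using v unfolding rhs by (simp add: c_def sum_distrib_left mult_ac)
qed

end

section \<open>The kernel of fractional Brownian motion\<close>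

text \<open>The odd extension of the power function. Up to constants it is the antiderivative of an
  even power and the derivative of an even power of one degree more, so it connects the kernel with
  the covariance.\<close>

definition signed_powr :: "real => real => real" where
  "signed_powr p x = max x 0 powr p - max (- x) 0 powr p"

lemma signed_powr_minus: "signed_powr p (- x) = - signed_powr p x"
  by (simp add: signed_powr_def)

lemma continuous_on_signed_powr: "p > 0 ==> continuous_on S f ==> continuous_on S (\<lambda>x. signed_powr p (f x))"
  unfolding signed_powr_def by (intro continuous_intros continuous_on_powr') auto

lemma continuous_on_abs_powr:
  fixes f :: "'a::topological_space => real"
  shows "p > 0 ==> continuous_on S f ==> continuous_on S (\<lambda>x. \<bar>f x\<bar> powr p)"
  by (intro continuous_intros continuous_on_powr') auto

lemma abs_signed_powr: "p > 0 ==> \<bar>signed_powr p x\<bar> = \<bar>x\<bar> powr p"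
  by (cases "x \<ge> 0") (auto simp: signed_powr_def max_def)

lemma DERIV_compose_minus:
  assumes "(f has_real_derivative D) (at (- x))"
  shows "((\<lambda>x. f (- x)) has_real_derivative - D) (at x)"
proof -
  have "((\<lambda>x. - x) has_real_derivative -1) (at x)" by (auto intro!: derivative_eq_intros)
  from DERIV_chain2[OF assms this] show ?thesis by simp
qed

lemma integrable_indicator_Icc [simp]: "integrable lborel (indicator {a..b} :: real => real)"
  by (rule integrable_real_indicator) (auto simp: emeasure_lborel_Icc_eq)

lemma has_real_derivative_signed_powr:
  assumes "x \<noteq> 0"
  shows "(signed_powr p has_real_derivative p * \<bar>x\<bar> powr (p - 1)) (at x)"
proof (cases "x > 0")
  case True
  have "((\<lambda>x. x powr p) has_real_derivative p * x powr (p - 1)) (at x)"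
    using True by (rule has_real_derivative_powr)
  then have "(signed_powr p has_real_derivative p * x powr (p - 1)) (at x)"
    by (rule DERIV_cong_ev[THEN iffD1, rotated -1, OF _ refl _ refl])
       (use eventually_nhds_in_open[of "{0<..}" x] True in \<open>auto elim!: eventually_mono simp: signed_powr_def\<close>)
  then show ?thesis using True by simp
next
  case False
  then have x: "x < 0" using assms by simp
  have "((\<lambda>y. y powr p) has_real_derivative p * (- x) powr (p - 1)) (at (- x))"
    using x by (intro has_real_derivative_powr) simp
  from DERIV_minus[OF DERIV_compose_minus[OF this]]
  have "((\<lambda>x. - ((- x) powr p)) has_real_derivative p * (- x) powr (p - 1)) (at x)" by simp
  then have "(signed_powr p has_real_derivative p * (- x) powr (p - 1)) (at x)"
    by (rule DERIV_cong_ev[THEN iffD1, rotated -1, OF _ refl _ refl])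
       (use eventually_nhds_in_open[of "{..<0}" x] x in \<open>auto elim!: eventually_mono simp: signed_powr_def\<close>)
  then show ?thesis using x by simp
qed

lemma has_real_derivative_abs_powr:
  assumes "x \<noteq> 0"
  shows "((\<lambda>x. \<bar>x\<bar> powr p) has_real_derivative p * signed_powr (p - 1) x) (at x)"
proof (cases "x > 0")
  case True
  have "((\<lambda>x. x powr p) has_real_derivative p * x powr (p - 1)) (at x)"
    using True by (rule has_real_derivative_powr)
  then have "((\<lambda>x. \<bar>x\<bar> powr p) has_real_derivative p * x powr (p - 1)) (at x)"
    by (rule DERIV_cong_ev[THEN iffD1, rotated -1, OF _ refl _ refl])
       (use eventually_nhds_in_open[of "{0<..}" x] True in \<open>auto elim!: eventually_mono\<close>)
  then show ?thesis using True by (simp add: signed_powr_def)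
next
  case False
  then have x: "x < 0" using assms by simp
  have "((\<lambda>y. y powr p) has_real_derivative p * (- x) powr (p - 1)) (at (- x))"
    using x by (intro has_real_derivative_powr) simp
  from DERIV_compose_minus[OF this]
  have "((\<lambda>x. \<bar>x\<bar> powr p) has_real_derivative - (p * (- x) powr (p - 1))) (at x)"
    by (rule DERIV_cong_ev[THEN iffD1, rotated -1, OF _ refl _ refl])
       (use eventually_nhds_in_open[of "{..<0}" x] x in \<open>auto elim!: eventually_mono\<close>)
  then show ?thesis using x by (simp add: signed_powr_def)
qed

text \<open>The finite exceptional set is there for the points at which a power with absolute value
  has a corner or a singular derivative.\<close>

lemma set_lebesgue_integral_FTC_strong:
  fixes F f :: "real => real"
  assumes ab: "a \<le> b" and S: "finite S" and c: "continuous_on {a..b} F" "continuous_on {a..b} f"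
    and d: "\<And>x. x \<notin> S ==> a < x ==> x < b ==> (F has_real_derivative f x) (at x)"
  shows "(LINT x:{a..b}|lborel. f x) = F b - F a"
proof -
  have "(f has_integral F b - F a) {a..b}"
    by (rule fundamental_theorem_of_calculus_interior_strong[OF S ab])
       (use d c in \<open>auto simp: has_real_derivative_iff_has_vector_derivative[symmetric]\<close>)
  moreover have "set_integrable lborel {a..b} f"
    by (rule borel_integrable_atLeastAtMost') (rule c)
  ultimately show ?thesis
    by (simp add: set_borel_integral_eq_integral(2) integral_unique)
qed

section \<open>Bounded functions of compact support\<close>

text \<open>Support and bound are kept as parameters because they enter the error estimates. The
  interval is symmetric since \<open>fbm_step\<close> covers negative times too.\<close>

definition admissible :: "real => real => (real => real) => bool" where
  "admissible T C f \<longleftrightarrow> f \<in> borel_measurable borel \<and> T \<ge> 0 \<and> C \<ge> 0 \<and> (\<forall>x. \<bar>f x\<bar> \<le> C * indicator {-T..T} x)"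

lemma admissible_measurable [measurable_dest]: "admissible T C f ==> f \<in> borel_measurable borel"
  by (simp add: admissible_def)

lemma admissible_bound:
  assumes "admissible T C f"
  shows "\<bar>f x\<bar> \<le> C" "\<bar>f x\<bar> \<le> C * indicator {-T..T} x"
proof -
  show b: "\<bar>f x\<bar> \<le> C * indicator {-T..T} x" using assms by (simp add: admissible_def)
  also have "... \<le> C" using assms by (simp add: admissible_def indicator_def)
  finally show "\<bar>f x\<bar> \<le> C" .
qed

lemma admissible_mono:
  assumes f: "admissible T C f" and le: "T \<le> T'" "C \<le> C'"
  shows "admissible T' C' f"
proof -
  have "\<bar>f x\<bar> \<le> C' * indicator {-T'..T'} x" for x
  proof -
    have "\<bar>f x\<bar> \<le> C * indicator {-T..T} x" by (rule admissible_bound[OF f])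
    also have "... \<le> C' * indicator {-T'..T'} x"
      using le f by (intro mult_mono) (auto simp: indicator_def admissible_def)
    finally show ?thesis .
  qed
  then show ?thesis using f le by (simp add: admissible_def)
qed

lemma admissible_integrable:
  assumes f: "admissible T C f" shows "integrable lborel f"
proof (rule Bochner_Integration.integrable_bound)
  show "integrable lborel (\<lambda>x. C * indicator {-T..T} x)" by simp
  show "AE x in lborel. norm (f x) \<le> norm (C * indicator {-T..T} x)"
    using admissible_bound(2)[OF f] by (intro AE_I2) (smt (verit) real_norm_def)
qed (use f in \<open>simp add: admissible_def\<close>)

lemma admissible_integral_bound:
  assumes f: "admissible T C f" shows "(\<integral>x. \<bar>f x\<bar> \<partial>lborel) \<le> 2 * T * C"
proof -
  have "(\<integral>x. \<bar>f x\<bar> \<partial>lborel) \<le> (\<integral>x. C * indicator {-T..T} x \<partial>lborel)"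
    by (intro integral_mono integrable_abs admissible_integrable[OF f] admissible_bound(2)[OF f]) simp
  also have "... = 2 * T * C" using f by (simp add: admissible_def)
  finally show ?thesis .
qed

lemma admissible_add:
  assumes "admissible T C f" "admissible T' C' g"
  shows "admissible (max T T') (C + C') (\<lambda>x. f x + g x)"
  using admissible_mono[OF assms(1), of "max T T'" C] admissible_mono[OF assms(2), of "max T T'" C']
  unfolding admissible_def
  by (auto simp: distrib_right intro!: order_trans[OF abs_triangle_ineq] add_mono)

lemma admissible_scale:
  assumes "admissible T C f" shows "admissible T (\<bar>a\<bar> * C) (\<lambda>x. a * f x)"
  using assms unfolding admissible_def
  by (auto simp: abs_mult mult.assoc intro!: mult_left_mono)

lemma admissible_diff:
  assumes "admissible T C f" "admissible T' C' g"
  shows "admissible (max T T') (C + C') (\<lambda>x. f x - g x)"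
  using admissible_add[OF assms(1) admissible_scale[OF assms(2), of "-1"]] by simp

lemma admissible_fbm_step: "admissible \<bar>t\<bar> 1 (fbm_step t)"
  unfolding admissible_def fbm_step_def by (auto simp: indicator_def)

lemma admissible_sum:
  assumes "finite I" "\<And>i. i \<in> I ==> \<exists>T C. admissible T C (f i)"
  shows "\<exists>T C. admissible T C (\<lambda>x. \<Sum>i\<in>I. f i x)"
  using assms
proof (induction I rule: finite_induct)
  case empty
  have "admissible 0 0 (\<lambda>x. 0)" by (simp add: admissible_def)
  then show ?case by auto
next
  case (insert i I)
  then obtain T C T' C' where "admissible T C (f i)" "admissible T' C' (\<lambda>x. \<Sum>i\<in>I. f i x)" by blast
  from admissible_add[OF this] insert show ?case by auto
qed

locale hurst =
  fixes H :: real
  assumes H_gt: "1/2 < H" and H_lt: "H < 1"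
begin

definition kernel :: "real => real => real" where
  "kernel r s = \<bar>r - s\<bar> powr (2 * H - 2)"

lemma kernel_measurable [measurable]: "(\<lambda>(r, s). kernel r s) \<in> borel_measurable (borel \<Otimes>\<^sub>M borel)"
  unfolding kernel_def by measurable

lemma kernel_nonneg [simp]: "0 \<le> kernel r s" by (simp add: kernel_def)

lemma kernel_sym: "kernel r s = kernel s r" by (simp add: kernel_def abs_minus_commute)

text \<open>The singularity at r = s is integrable since 2H - 2 > -1. The antiderivative is
  continuous across s, so the fundamental theorem applies with s as the only exceptional
  point.\<close>

lemma
  assumes "a \<le> b"
  shows kernel_integrable: "integrable lborel (\<lambda>r. indicator {a..b} r * kernel r s)"
    and kernel_integral: "(\<integral>r. indicator {a..b} r * kernel r s \<partial>lborel) =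
      (signed_powr (2 * H - 1) (b - s) - signed_powr (2 * H - 1) (a - s)) / (2 * H - 1)"
proof -
  define F where "F = (\<lambda>r. signed_powr (2 * H - 1) (r - s) / (2 * H - 1))"
  have p: "2 * H - 1 > 0" using H_gt by simp
  have "((\<lambda>r. kernel r s) has_integral F b - F a) {a..b}"
  proof (rule fundamental_theorem_of_calculus_interior_strong[where S="{s}"])
    show "continuous_on {a..b} F"
      unfolding F_def by (intro continuous_intros continuous_on_signed_powr p) (use p in auto)
    fix x assume "x \<in> {a<..<b} - {s}"
    then have "x - s \<noteq> 0" by auto
    from has_real_derivative_signed_powr[OF this, of "2 * H - 1"]
    have "(signed_powr (2 * H - 1) has_real_derivative (2 * H - 1) * kernel x s) (at (x + - s))"
      by (simp add: kernel_def)
    then have "((\<lambda>r. signed_powr (2 * H - 1) (r + - s)) has_real_derivative (2 * H - 1) * kernel x s) (at x)"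
      by (simp only: DERIV_shift)
    from DERIV_cdivide[OF this, of "2 * H - 1"] have "(F has_real_derivative kernel x s) (at x)"
      unfolding F_def using p by simp
    then show "(F has_vector_derivative kernel x s) (at x)"
      by (simp add: has_real_derivative_iff_has_vector_derivative)
  qed (use assms in auto)
  then have "((\<lambda>r. if r \<in> {a..b} then kernel r s else 0) has_integral F b - F a) UNIV"
    by (simp only: has_integral_restrict_UNIV)
  moreover have "(\<lambda>r. if r \<in> {a..b} then kernel r s else 0) = (\<lambda>r. indicator {a..b} r * kernel r s)"
    by (auto simp: fun_eq_iff)
  ultimately have nn: "(\<integral>\<^sup>+r. ennreal (indicator {a..b} r * kernel r s) \<partial>lborel) = ennreal (F b - F a)"
    by (intro nn_integral_has_integral_lborel) (simp_all add: kernel_def)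
  have le: "F a \<le> F b"
  proof -
    have "0 \<le> F b - F a"
      using \<open>((\<lambda>r. kernel r s) has_integral F b - F a) {a..b}\<close> by (rule has_integral_nonneg) simp
    then show ?thesis by simp
  qed
  have "has_bochner_integral lborel (\<lambda>r. indicator {a..b} r * kernel r s) (F b - F a)"
    using nn le by (intro has_bochner_integral_nn_integral) auto
  then show "integrable lborel (\<lambda>r. indicator {a..b} r * kernel r s)"
    "(\<integral>r. indicator {a..b} r * kernel r s \<partial>lborel) =
      (signed_powr (2 * H - 1) (b - s) - signed_powr (2 * H - 1) (a - s)) / (2 * H - 1)"
    by (auto simp: has_bochner_integral_iff F_def diff_divide_distrib)
qed

text \<open>Bounds the integral of \<open>kernel r s\<close> in r over [-T, T] for s in that
  interval: both endpoints are at distance at most 2T from s, and each contributes one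
  power.\<close>

definition kernel_bound :: "real => real" where
  "kernel_bound T = 2 * (2 * T) powr (2 * H - 1) / (2 * H - 1)"

lemma kernel_bound_nonneg: "0 \<le> kernel_bound T"
  using H_gt by (simp add: kernel_bound_def)

lemma kernel_integral_le:
  assumes "s \<in> {-T..T}"
  shows "(\<integral>r. indicator {-T..T} r * kernel r s \<partial>lborel) \<le> kernel_bound T"
proof -
  have p: "2 * H - 1 > 0" using H_gt by simp
  have b: "\<bar>signed_powr (2 * H - 1) x\<bar> \<le> (2 * T) powr (2 * H - 1)" if "\<bar>x\<bar> \<le> 2 * T" for x
    unfolding abs_signed_powr[OF p] using that p by (intro powr_mono2) auto
  have "signed_powr (2 * H - 1) (T - s) - signed_powr (2 * H - 1) (- T - s) \<le> 2 * (2 * T) powr (2 * H - 1)"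
    using b[of "T - s"] b[of "- T - s"] assms by auto
  then show ?thesis
    using assms p by (subst kernel_integral) (auto simp: kernel_bound_def intro!: divide_right_mono)
qed

lemma admissible_kernel_integrable:
  assumes f: "admissible T C f"
  shows "integrable lborel (\<lambda>r. f r * kernel r s)"
proof (rule Bochner_Integration.integrable_bound)
  have T: "- T \<le> T" using f by (simp add: admissible_def)
  note [measurable] = admissible_measurable[OF f]
  show "integrable lborel (\<lambda>r. C * (indicator {-T..T} r * kernel r s))"
    by (intro integrable_mult_right kernel_integrable T)
  have "\<bar>f r * kernel r s\<bar> \<le> \<bar>C * (indicator {-T..T} r * kernel r s)\<bar>" for r
  proof -
    have "\<bar>f r * kernel r s\<bar> \<le> (C * indicator {-T..T} r) * kernel r s"
      unfolding abs_mult using admissible_bound(2)[OF f, of r] by (intro mult_mono) auto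
    then show ?thesis by (simp add: mult.assoc)
  qed
  then show "AE r in lborel. norm (f r * kernel r s) \<le> norm (C * (indicator {-T..T} r * kernel r s))" by simp
  show "(\<lambda>r. f r * kernel r s) \<in> borel_measurable lborel" unfolding kernel_def by measurable
qed

lemma admissible_kernel_bound:
  assumes f: "admissible T C f" and s: "s \<in> {-T..T}"
  shows "(\<integral>r. \<bar>f r * kernel r s\<bar> \<partial>lborel) \<le> C * kernel_bound T"
proof -
  have T: "- T \<le> T" "0 \<le> C" using f by (auto simp: admissible_def)
  have "(\<integral>r. \<bar>f r * kernel r s\<bar> \<partial>lborel) \<le> (\<integral>r. C * (indicator {-T..T} r * kernel r s) \<partial>lborel)"
  proof (rule integral_mono)
    show "integrable lborel (\<lambda>r. \<bar>f r * kernel r s\<bar>)" by (intro integrable_abs admissible_kernel_integrable[OF f])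
    show "integrable lborel (\<lambda>r. C * (indicator {-T..T} r * kernel r s))"
      by (intro integrable_mult_right kernel_integrable T)
    fix r
    have "\<bar>f r * kernel r s\<bar> \<le> (C * indicator {-T..T} r) * kernel r s"
      unfolding abs_mult using admissible_bound(2)[OF f, of r] by (intro mult_mono) auto
    then show "\<bar>f r * kernel r s\<bar> \<le> C * (indicator {-T..T} r * kernel r s)" by (simp add: mult.assoc)
  qed
  also have "... \<le> C * kernel_bound T"
    using kernel_integral_le[OF s] T by (simp add: mult_left_mono)
  finally show ?thesis .
qed

text \<open>The slice \<open>f * kernel\<close> is bounded uniformly on \<open>[-T, T]\<close> only; this suffices because the
  other factor is supported there.\<close>

lemma admissible_kernel_pair:
  assumes f: "admissible T C f" and g: "admissible T D g"
  shows "integrable (lborel \<Otimes>\<^sub>M lborel) (\<lambda>(r, s). f r * g s * kernel r s)"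
    and "(\<integral>(r, s). f r * g s * kernel r s \<partial>(lborel \<Otimes>\<^sub>M lborel)) =
      (\<integral>s. g s * (\<integral>r. f r * kernel r s \<partial>lborel) \<partial>lborel)"
    and "\<bar>\<integral>(r, s). f r * g s * kernel r s \<partial>(lborel \<Otimes>\<^sub>M lborel)\<bar> \<le> C * kernel_bound T * (\<integral>s. \<bar>g s\<bar> \<partial>lborel)"
proof -
  note [measurable] = admissible_measurable[OF f] admissible_measurable[OF g]
  have CD: "0 \<le> C" "0 \<le> D" "0 \<le> T" using f g by (auto simp: admissible_def)
  have le: "\<bar>g s\<bar> * (\<integral>r. \<bar>f r * kernel r s\<bar> \<partial>lborel) \<le> C * kernel_bound T * \<bar>g s\<bar>" for s
  proof (cases "s \<in> {-T..T}")
    case True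
    then show ?thesis using mult_left_mono[OF admissible_kernel_bound[OF f True], of "\<bar>g s\<bar>"] by (simp add: mult_ac)
  next
    case False
    then have "g s = 0" using admissible_bound(2)[OF g, of s] by simp
    then show ?thesis by simp
  qed
  have m: "(\<lambda>(s, r). f r * g s * kernel r s) \<in> borel_measurable (lborel \<Otimes>\<^sub>M lborel)"
    unfolding kernel_def by measurable
  have ab: "(\<integral>r. norm (case (s, r) of (s, r) => f r * g s * kernel r s) \<partial>lborel) = \<bar>g s\<bar> * (\<integral>r. \<bar>f r * kernel r s\<bar> \<partial>lborel)" for s
    by (subst integral_mult_right_zero[symmetric]) (simp add: abs_mult mult_ac)
  have mi: "(\<lambda>s. \<bar>g s\<bar> * (\<integral>r. \<bar>f r * kernel r s\<bar> \<partial>lborel)) \<in> borel_measurable lborel"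
    unfolding kernel_def by measurable
  have gi: "integrable lborel (\<lambda>s. C * kernel_bound T * \<bar>g s\<bar>)"
    by (intro integrable_mult_right integrable_abs admissible_integrable[OF g])
  have i1: "integrable lborel (\<lambda>s. \<bar>g s\<bar> * (\<integral>r. \<bar>f r * kernel r s\<bar> \<partial>lborel))"
  proof (rule Bochner_Integration.integrable_bound[OF gi mi])
    have "0 \<le> \<bar>g s\<bar> * (\<integral>r. \<bar>f r * kernel r s\<bar> \<partial>lborel)" for s by simp
    then show "AE s in lborel. norm (\<bar>g s\<bar> * (\<integral>r. \<bar>f r * kernel r s\<bar> \<partial>lborel)) \<le> norm (C * kernel_bound T * \<bar>g s\<bar>)"
      using le by (intro AE_I2) (smt (verit) real_norm_def)
  qed
  have int: "integrable (lborel \<Otimes>\<^sub>M lborel) (\<lambda>(s, r). f r * g s * kernel r s)"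
  proof (rule lborel_pair.Fubini_integrable[OF m])
    show "integrable lborel (\<lambda>s. \<integral>r. norm (case (s, r) of (s, r) => f r * g s * kernel r s) \<partial>lborel)"
      unfolding ab by (rule i1)
    show "AE s in lborel. integrable lborel (\<lambda>r. case (s, r) of (s, r) => f r * g s * kernel r s)"
      using admissible_kernel_integrable[OF f] integrable_mult_right
      by (intro AE_I2) (simp add: mult.assoc mult.left_commute[of _ "g _"])
  qed
  show int': "integrable (lborel \<Otimes>\<^sub>M lborel) (\<lambda>(r, s). f r * g s * kernel r s)"
    using lborel_pair.integrable_product_swap[OF int] by (simp add: case_prod_beta')
  have in_eq: "(\<integral>r. f r * g s * kernel r s \<partial>lborel) = g s * (\<integral>r. f r * kernel r s \<partial>lborel)" for s
    by (subst integral_mult_right_zero[symmetric]) (simp add: mult_ac)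
  show eq: "(\<integral>(r, s). f r * g s * kernel r s \<partial>(lborel \<Otimes>\<^sub>M lborel)) =
      (\<integral>s. g s * (\<integral>r. f r * kernel r s \<partial>lborel) \<partial>lborel)"
    using lborel_pair.integral_snd[OF int'] by (simp only: in_eq)
  have "\<bar>\<integral>s. g s * (\<integral>r. f r * kernel r s \<partial>lborel) \<partial>lborel\<bar> \<le> (\<integral>s. \<bar>g s * (\<integral>r. f r * kernel r s \<partial>lborel)\<bar> \<partial>lborel)"
    by (rule integral_abs_bound)
  also have "... \<le> (\<integral>s. C * kernel_bound T * \<bar>g s\<bar> \<partial>lborel)"
  proof (rule integral_mono_AE[OF _ gi])
    have b: "\<bar>g s * (\<integral>r. f r * kernel r s \<partial>lborel)\<bar> \<le> C * kernel_bound T * \<bar>g s\<bar>" for s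
      unfolding abs_mult
      by (rule order_trans[OF mult_left_mono[OF integral_abs_bound abs_ge_zero] le])
    show "integrable lborel (\<lambda>s. \<bar>g s * (\<integral>r. f r * kernel r s \<partial>lborel)\<bar>)"
    proof (rule Bochner_Integration.integrable_bound[OF gi])
      show "(\<lambda>s. \<bar>g s * (\<integral>r. f r * kernel r s \<partial>lborel)\<bar>) \<in> borel_measurable lborel"
        unfolding kernel_def by measurable
      show "AE s in lborel. norm \<bar>g s * (\<integral>r. f r * kernel r s \<partial>lborel)\<bar> \<le> norm (C * kernel_bound T * \<bar>g s\<bar>)"
        using b by (intro AE_I2) (smt (verit) real_norm_def)
    qed
    show "AE s in lborel. \<bar>g s * (\<integral>r. f r * kernel r s \<partial>lborel)\<bar> \<le> C * kernel_bound T * \<bar>g s\<bar>"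
      using b by (intro AE_I2)
  qed
  also have "... = C * kernel_bound T * (\<integral>s. \<bar>g s\<bar> \<partial>lborel)" by simp
  finally show "\<bar>\<integral>(r, s). f r * g s * kernel r s \<partial>(lborel \<Otimes>\<^sub>M lborel)\<bar> \<le> C * kernel_bound T * (\<integral>s. \<bar>g s\<bar> \<partial>lborel)"
    unfolding eq .
qed

section \<open>The inner product on bounded functions of compact support\<close>

definition adm :: "(real => real) => bool" where "adm f \<longleftrightarrow> (\<exists>T C. admissible T C f)"

lemma adm_common:
  assumes "adm f" "adm g" obtains T C D where "admissible T C f" "admissible T D g"
proof -
  obtain T C T' D where "admissible T C f" "admissible T' D g" using assms by (auto simp: adm_def)
  then have "admissible (max T T') C f" "admissible (max T T') D g" by (auto intro: admissible_mono)
  then show ?thesis by (rule that)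
qed

lemma adm_intros:
  "adm f ==> adm g ==> adm (\<lambda>x. f x + g x)"
  "adm f ==> adm g ==> adm (\<lambda>x. f x - g x)"
  "adm f ==> adm (\<lambda>x. a * f x)"
  "adm (fbm_step t)"
  using admissible_add admissible_diff admissible_scale admissible_fbm_step unfolding adm_def by blast+

lemma adm_sum: "finite I ==> (\<And>i. i \<in> I ==> adm (f i)) ==> adm (\<lambda>x. \<Sum>i\<in>I. f i x)"
  unfolding adm_def by (rule admissible_sum)

lemma fbm_inner_altdef:
  "fbm_inner H f g = H * (2 * H - 1) * (\<integral>(r, s). f r * g s * kernel r s \<partial>(lborel \<Otimes>\<^sub>M lborel))"
  by (simp add: fbm_inner_def kernel_def)

lemma fbm_inner_integrable:
  assumes "adm f" "adm g"
  shows "integrable (lborel \<Otimes>\<^sub>M lborel) (\<lambda>(r, s). f r * g s * kernel r s)"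
proof -
  obtain T C D where "admissible T C f" "admissible T D g" by (rule adm_common[OF assms])
  then show ?thesis by (rule admissible_kernel_pair)
qed

lemma fbm_inner_add_right:
  assumes "adm f" "adm g" "adm h"
  shows "fbm_inner H f (\<lambda>x. g x + h x) = fbm_inner H f g + fbm_inner H f h"
proof -
  have "(\<integral>(r, s). f r * (g s + h s) * kernel r s \<partial>(lborel \<Otimes>\<^sub>M lborel)) =
     (\<integral>x. (case x of (r, s) => f r * g s * kernel r s) + (case x of (r, s) => f r * h s * kernel r s) \<partial>(lborel \<Otimes>\<^sub>M lborel))"
    by (intro Bochner_Integration.integral_cong) (auto simp: algebra_simps)
  also have "... = (\<integral>(r, s). f r * g s * kernel r s \<partial>(lborel \<Otimes>\<^sub>M lborel)) + (\<integral>(r, s). f r * h s * kernel r s \<partial>(lborel \<Otimes>\<^sub>M lborel))"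
    by (intro Bochner_Integration.integral_add fbm_inner_integrable assms)
  finally show ?thesis by (simp add: fbm_inner_altdef distrib_left)
qed

lemma fbm_inner_scale_right: "fbm_inner H f (\<lambda>x. a * g x) = a * fbm_inner H f g"
proof -
  have "(\<integral>(r, s). f r * (a * g s) * kernel r s \<partial>(lborel \<Otimes>\<^sub>M lborel)) =
     (\<integral>x. a * (case x of (r, s) => f r * g s * kernel r s) \<partial>(lborel \<Otimes>\<^sub>M lborel))"
    by (intro Bochner_Integration.integral_cong) (auto simp: mult_ac)
  then show ?thesis by (simp add: fbm_inner_altdef mult_ac)
qed

lemma fbm_inner_sym:
  assumes "adm f" "adm g" shows "fbm_inner H f g = fbm_inner H g f"
proof -
  have "(\<integral>(r, s). f r * g s * kernel r s \<partial>(lborel \<Otimes>\<^sub>M lborel)) =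
      (\<integral>(s, r). f r * g s * kernel r s \<partial>(lborel \<Otimes>\<^sub>M lborel))"
    using fbm_inner_integrable[OF assms, THEN borel_measurable_integrable]
    by (subst lborel_pair.integral_product_swap[symmetric]) (auto simp: case_prod_beta')
  also have "... = (\<integral>(r, s). g r * f s * kernel r s \<partial>(lborel \<Otimes>\<^sub>M lborel))"
    by (intro Bochner_Integration.integral_cong) (auto simp: kernel_sym mult_ac)
  finally show ?thesis by (simp add: fbm_inner_altdef)
qed

lemma fbm_inner_sum_right:
  assumes "adm f" "finite I" "\<And>i. i \<in> I ==> adm (g i)"
  shows "fbm_inner H f (\<lambda>x. \<Sum>i\<in>I. g i x) = (\<Sum>i\<in>I. fbm_inner H f (g i))"
  using assms(2,3)
proof (induction I rule: finite_induct)
  case empty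
  show ?case using fbm_inner_scale_right[of f 0 "\<lambda>_. 0"] by simp
next
  case (insert i I)
  then have "fbm_inner H f (\<lambda>x. g i x + (\<Sum>i\<in>I. g i x)) = fbm_inner H f (g i) + fbm_inner H f (\<lambda>x. \<Sum>i\<in>I. g i x)"
    by (intro fbm_inner_add_right assms(1) adm_sum) auto
  then show ?case using insert by simp
qed

lemma fbm_inner_diff_right:
  assumes "adm f" "adm g" "adm h"
  shows "fbm_inner H f (\<lambda>x. g x - h x) = fbm_inner H f g - fbm_inner H f h"
  using fbm_inner_add_right[OF assms(1,2) adm_intros(3)[OF assms(3), of "-1"]] fbm_inner_scale_right[of f "-1" h]
  by simp

text \<open>One argument enters through its supremum, the other through its L^1 norm. Hence step
  functions that are uniformly bounded and close in L^1 are also close for the inner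
  product.\<close>

lemma fbm_inner_bound:
  assumes "admissible T C f" "admissible T D g"
  shows "\<bar>fbm_inner H f g\<bar> \<le> H * (2 * H - 1) * (C * kernel_bound T * (\<integral>s. \<bar>g s\<bar> \<partial>lborel))"
  unfolding fbm_inner_altdef abs_mult using admissible_kernel_pair(3)[OF assms] H_gt
  by (simp add: mult_left_mono)

text \<open>This is both the kernel, with its constant H(2H-1), integrated against
  \<open>fbm_step t\<close>, and the derivative of \<open>cov t\<close>.\<close>

definition step_slice :: "real => real => real" where
  "step_slice t s = H * (signed_powr (2 * H - 1) (t - s) + signed_powr (2 * H - 1) s)"

lemma continuous_on_step_slice: "continuous_on S (step_slice t)"
  unfolding step_slice_def[abs_def] using H_gt by (intro continuous_intros continuous_on_signed_powr) auto

lemma step_slice_measurable [measurable]: "step_slice t \<in> borel_measurable borel"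
  by (rule borel_measurable_continuous_onI[OF continuous_on_step_slice])

lemma fbm_step_kernel:
  "H * (2 * H - 1) * (\<integral>r. fbm_step t r * kernel r s \<partial>lborel) = step_slice t s"
proof -
  have p: "2 * H - 1 \<noteq> 0" using H_gt by simp
  have AE0: "AE r in lborel. r \<noteq> 0 \<and> r \<noteq> t" by (intro AE_conjI AE_lborel_singleton)
  show ?thesis
  proof (cases "t \<ge> 0")
    case True
    have "(\<integral>r. fbm_step t r * kernel r s \<partial>lborel) = (\<integral>r. indicator {0..t} r * kernel r s \<partial>lborel)"
    proof (rule integral_cong_AE)
      show "AE r in lborel. fbm_step t r * kernel r s = indicator {0..t} r * kernel r s"
        using AE0 by eventually_elim (use True in \<open>auto simp: fbm_step_def indicator_def\<close>)
    qed (unfold fbm_step_def kernel_def, measurable)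
    then show ?thesis using True p signed_powr_minus[of "2 * H - 1" s]
      by (simp add: kernel_integral step_slice_def)
  next
    case False
    have "(\<integral>r. fbm_step t r * kernel r s \<partial>lborel) = (\<integral>r. - (indicator {t..0} r * kernel r s) \<partial>lborel)"
    proof (rule integral_cong_AE)
      show "AE r in lborel. fbm_step t r * kernel r s = - (indicator {t..0} r * kernel r s)"
        using AE0 by eventually_elim (use False in \<open>auto simp: fbm_step_def indicator_def\<close>)
    qed (unfold fbm_step_def kernel_def, measurable)
    also have "... = - (\<integral>r. indicator {t..0} r * kernel r s \<partial>lborel)" by simp
    finally show ?thesis using False p signed_powr_minus[of "2 * H - 1" s]
      by (simp add: kernel_integral step_slice_def) (simp add: algebra_simps)
  qed
qed

lemma fbm_inner_step:
  assumes "adm g" shows "fbm_inner H (fbm_step t) g = (\<integral>s. step_slice t s * g s \<partial>lborel)"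
proof -
  obtain T C D where TCD: "admissible T C (fbm_step t)" "admissible T D g"
    using adm_common[OF adm_intros(4) assms] by blast
  have "fbm_inner H (fbm_step t) g = (\<integral>s. H * (2 * H - 1) * (g s * (\<integral>r. fbm_step t r * kernel r s \<partial>lborel)) \<partial>lborel)"
    unfolding fbm_inner_altdef admissible_kernel_pair(2)[OF TCD] by simp
  also have "... = (\<integral>s. step_slice t s * g s \<partial>lborel)"
    unfolding fbm_step_kernel[symmetric] by (simp add: mult_ac)
  finally show ?thesis .
qed

definition cov :: "real => real => real" where
  "cov t s = (\<bar>t\<bar> powr (2 * H) + \<bar>s\<bar> powr (2 * H) - \<bar>t - s\<bar> powr (2 * H)) / 2"

lemma cov_derivative:
  assumes "u \<noteq> 0" "u \<noteq> t" shows "(cov t has_real_derivative step_slice t u) (at u)"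
proof -
  have 1: "((\<lambda>u. \<bar>u\<bar> powr (2 * H)) has_real_derivative 2 * H * signed_powr (2 * H - 1) u) (at u)"
    by (rule has_real_derivative_abs_powr[OF assms(1)])
  have "t - u \<noteq> 0" using assms by simp
  then have d: "((\<lambda>x. \<bar>x\<bar> powr (2 * H)) has_real_derivative 2 * H * signed_powr (2 * H - 1) (t - u)) (at (t - u))"
    by (rule has_real_derivative_abs_powr)
  have g: "((\<lambda>u. t - u) has_real_derivative -1) (at u)" by (auto intro!: derivative_eq_intros)
  have 2: "((\<lambda>u. \<bar>t - u\<bar> powr (2 * H)) has_real_derivative 2 * H * signed_powr (2 * H - 1) (t - u) * -1) (at u)"
    by (rule DERIV_chain2[where f="\<lambda>x. \<bar>x\<bar> powr (2 * H)", OF d g])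
  have "((\<lambda>u. (\<bar>t\<bar> powr (2 * H) + \<bar>u\<bar> powr (2 * H) - \<bar>t - u\<bar> powr (2 * H)) / 2) has_real_derivative
      (0 + 2 * H * signed_powr (2 * H - 1) u - 2 * H * signed_powr (2 * H - 1) (t - u) * -1) / 2) (at u)"
    by (intro DERIV_cdivide DERIV_diff DERIV_add 1 2 DERIV_const)
  then show ?thesis by (simp add: cov_def[abs_def] step_slice_def algebra_simps add_divide_distrib)
qed

lemma continuous_on_cov: "continuous_on S (cov t)"
  unfolding cov_def[abs_def] using H_gt by (intro continuous_intros continuous_on_abs_powr) auto

lemma integral_step_slice:
  assumes "a \<le> b" shows "(LINT u:{a..b}|lborel. step_slice t u) = cov t b - cov t a"
  by (rule set_lebesgue_integral_FTC_strong[where S="{0, t}", OF assms])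
     (auto intro: continuous_on_cov continuous_on_step_slice cov_derivative)

text \<open>The derivative \<open>step_slice t\<close> of \<open>cov t\<close> is integrated from 0
  to s, and \<open>cov t 0 = 0\<close>. For negative s the orientation of \<open>fbm_step\<close>
  supplies the sign of the reversed integral.\<close>

lemma fbm_inner_step_step: "fbm_inner H (fbm_step t) (fbm_step s) = cov t s"
proof -
  have c0: "cov t 0 = 0" by (simp add: cov_def)
  have AE0: "AE r in lborel. r \<noteq> 0 \<and> r \<noteq> s" by (intro AE_conjI AE_lborel_singleton)
  have "(\<integral>u. step_slice t u * fbm_step s u \<partial>lborel) = cov t s"
  proof (cases "s \<ge> 0")
    case True
    have "(\<integral>u. step_slice t u * fbm_step s u \<partial>lborel) = (\<integral>u. indicator {0..s} u * step_slice t u \<partial>lborel)"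
    proof (rule integral_cong_AE)
      show "AE r in lborel. step_slice t r * fbm_step s r = indicator {0..s} r * step_slice t r"
        using AE0 by eventually_elim (use True in \<open>auto simp: fbm_step_def indicator_def\<close>)
    qed (unfold fbm_step_def, measurable)
    then show ?thesis using integral_step_slice[OF True, of t] c0 by (simp add: set_lebesgue_integral_def)
  next
    case False
    then have s: "s \<le> 0" by simp
    have "(\<integral>u. step_slice t u * fbm_step s u \<partial>lborel) = (\<integral>u. - (indicator {s..0} u * step_slice t u) \<partial>lborel)"
    proof (rule integral_cong_AE)
      show "AE r in lborel. step_slice t r * fbm_step s r = - (indicator {s..0} r * step_slice t r)"
        using AE0 by eventually_elim (use False in \<open>auto simp: fbm_step_def indicator_def\<close>)
    qed (unfold fbm_step_def, measurable)
    also have "... = - (\<integral>u. indicator {s..0} u * step_slice t u \<partial>lborel)" by simp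
    finally show ?thesis using integral_step_slice[OF s, of t] c0 by (simp add: set_lebesgue_integral_def)
  qed
  then show ?thesis using fbm_inner_step[OF adm_intros(4)] by simp
qed

end

section \<open>Approximation by step functions\<close>

definition step_comb :: "(real => real) => real set => real => real" where
  "step_comb c T r = (\<Sum>t\<in>T. c t * fbm_step t r)"

lemma fbm_step_diff: "a \<le> b ==> fbm_step b r - fbm_step a r = indicator {a<..b} r"
  by (auto simp: fbm_step_def indicator_def)

text \<open>The coefficients must not depend on \<open>h\<close>, which is later
  \<open>fbm_step\<close> at an arbitrary point. Collecting them by the value of \<open>x\<close>
  permits coinciding partition points.\<close>

lemma step_comb_sum:
  fixes a x :: "nat => real"
  shows "\<exists>c T. finite T \<and> (\<forall>h :: real => real. (\<Sum>t\<in>T. c t * h t) = (\<Sum>j<m. a j * (h (x (Suc j)) - h (x j))))"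
proof -
  define T where "T = x ` {..m}"
  define c where "c = (\<lambda>t. (\<Sum>j<m. a j * ((if x (Suc j) = t then 1 else 0) - (if x j = t then 1 else 0))))"
  have T: "finite T" by (simp add: T_def)
  have "(\<Sum>t\<in>T. c t * h t) = (\<Sum>j<m. a j * (h (x (Suc j)) - h (x j)))" for h :: "real => real"
  proof -
    have "(\<Sum>t\<in>T. c t * h t) = (\<Sum>j<m. \<Sum>t\<in>T. a j * ((if x (Suc j) = t then h t else 0) - (if x j = t then h t else 0)))"
      unfolding c_def sum_distrib_right by (subst sum.swap) (intro sum.cong refl, simp add: algebra_simps)
    also have "... = (\<Sum>j<m. a j * (h (x (Suc j)) - h (x j)))"
    proof (rule sum.cong[OF refl])
      fix j assume "j \<in> {..<m}"
      then have "x (Suc j) \<in> T" "x j \<in> T" by (auto simp: T_def)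
      then show "(\<Sum>t\<in>T. a j * ((if x (Suc j) = t then h t else 0) - (if x j = t then h t else 0))) = a j * (h (x (Suc j)) - h (x j))"
        using T by (simp add: sum_distrib_left[symmetric] sum_subtractf)
    qed
    finally show ?thesis .
  qed
  then show ?thesis using T by blast
qed

lemma continuous_approx_step:
  fixes h :: "real => real"
  assumes T: "T > 0" and h: "continuous_on {-T..T} h" and C: "\<And>x. \<bar>h x\<bar> \<le> C" and e: "e > 0"
  obtains c S where "finite S" "admissible T C (step_comb c S)"
    "\<And>r. \<bar>step_comb c S r - indicator {-T<..T} r * h r\<bar> \<le> e * indicator {-T..T} r"
proof -
  have "uniformly_continuous_on {-T..T} h" by (rule compact_uniformly_continuous[OF h]) simp
  then obtain d where d: "d > 0" "\<And>x y. x \<in> {-T..T} ==> y \<in> {-T..T} ==> dist y x < d ==> dist (h y) (h x) < e"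
    using e unfolding uniformly_continuous_on_def by metis
  obtain m :: nat where m: "2 * T / d < real m" using reals_Archimedean2 by blast
  have m0: "real m > 0" using T d m by (smt (verit) divide_pos_pos)
  define x where "x = (\<lambda>j. - T + 2 * T * real j / real m)"
  have x0: "x 0 = - T" "x m = T" using m0 by (auto simp: x_def)
  have xle: "x j \<le> x (Suc j)" for j using T m0 by (simp add: x_def divide_right_mono)
  have xd: "x (Suc j) - x j < d" for j
  proof -
    have "x (Suc j) - x j = 2 * T / real m" by (simp add: x_def algebra_simps add_divide_distrib)
    also have "... < d" using m m0 d by (simp add: field_simps)
    finally show ?thesis .
  qed
  have xin: "x j \<in> {-T..T}" if "j \<le> m" for j
    using that m0 T by (auto simp: x_def field_simps mult_left_mono)
  obtain c S where cS: "finite S" "\<And>g :: real => real. (\<Sum>t\<in>S. c t * g t) = (\<Sum>j<m. h (x j) * (g (x (Suc j)) - g (x j)))"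
    using step_comb_sum[where a="\<lambda>j. h (x j)" and x=x and m=m] by (elim exE conjE) (rule that, auto)
  have comb: "step_comb c S r = (\<Sum>j<m. h (x j) * indicator {x j<..x (Suc j)} r)" for r
    unfolding step_comb_def cS(2) by (simp add: fbm_step_diff[OF xle])
  \<comment> \<open>The half-open cells partition the interval, as the telescoping sum of oriented
    steps shows; hence errors on single cells do not add up.\<close>
  have one: "(\<Sum>j<m. indicator {x j<..x (Suc j)} r) = (indicator {-T<..T} r :: real)" for r
  proof -
    have "(\<Sum>j<m. indicator {x j<..x (Suc j)} r) = (\<Sum>j<m. fbm_step (x (Suc j)) r - fbm_step (x j) r)"
      by (simp add: fbm_step_diff[OF xle])
    also have "... = fbm_step (x m) r - fbm_step (x 0) r" by (rule sum_lessThan_telescope)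
    also have "... = indicator {-T<..T} r" unfolding x0 using T by (intro fbm_step_diff) simp
    finally show ?thesis .
  qed
  have wsum: "\<bar>\<Sum>j<m. w j * indicator {x j<..x (Suc j)} r\<bar> \<le> K * indicator {-T..T} r"
    if "\<And>j. j < m ==> r \<in> {x j<..x (Suc j)} ==> \<bar>w j\<bar> \<le> K" "K \<ge> 0" for w :: "nat => real" and r K :: real
  proof -
    have "\<bar>\<Sum>j<m. w j * indicator {x j<..x (Suc j)} r\<bar> \<le> (\<Sum>j<m. K * indicator {x j<..x (Suc j)} r)"
      by (rule order_trans[OF sum_abs]) (rule sum_mono, use that in \<open>auto simp: indicator_def abs_mult\<close>)
    also have "... = K * indicator {-T<..T} r" by (simp add: sum_distrib_left[symmetric] one)
    also have "... \<le> K * indicator {-T..T} r" using that(2) by (auto simp: indicator_def)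
    finally show ?thesis .
  qed
  have C0: "C \<ge> 0" using C[of 0] by simp
  show ?thesis
  proof (rule that[OF cS(1)])
    have "(\<lambda>r. step_comb c S r) \<in> borel_measurable borel"
      unfolding step_comb_def fbm_step_def by measurable
    then show "admissible T C (step_comb c S)"
      unfolding admissible_def
    proof (intro conjI allI)
      show "\<bar>step_comb c S x'\<bar> \<le> C * indicator {-T..T} x'" for x'
        unfolding comb by (rule wsum) (use C C0 in auto)
    qed (use T C0 in auto)
    fix r
    have "step_comb c S r - indicator {-T<..T} r * h r = (\<Sum>j<m. (h (x j) - h r) * indicator {x j<..x (Suc j)} r)"
      unfolding comb one[symmetric] left_diff_distrib sum_subtractf sum_distrib_right
      by (simp only: mult.commute)
    also have "\<bar>...\<bar> \<le> e * indicator {-T..T} r"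
    proof (rule wsum)
      fix j assume j: "j < m" "r \<in> {x j<..x (Suc j)}"
      then have "r \<in> {-T..T}" using xin[of j] xin[of "Suc j"] by auto
      moreover have "dist (x j) r < d" using j xd[of j] by (auto simp: dist_real_def)
      ultimately have "dist (h (x j)) (h r) < e" using xin[of j] j by (intro d) auto
      then show "\<bar>h (x j) - h r\<bar> \<le> e" by (simp add: dist_real_def)
    qed (use e in simp)
    finally show "\<bar>step_comb c S r - indicator {-T<..T} r * h r\<bar> \<le> e * indicator {-T..T} r" .
  qed
qed

text \<open>A measurable function is almost everywhere a limit of continuous ones. Clipping makes
  them uniformly bounded, and dominated convergence gives closeness in L^1.\<close>

lemma admissible_approx_continuous:
  assumes f: "admissible T C f" and e: "e > 0"
  obtains h where "continuous_on UNIV h" "\<And>x. \<bar>h x\<bar> \<le> C"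
    "(\<integral>x. \<bar>indicator {-T<..T} x * (f x - h x)\<bar> \<partial>lborel) < e"
proof -
  have [measurable]: "f \<in> borel_measurable borel" using f by (simp add: admissible_def)
  have C: "C \<ge> 0" using f by (simp add: admissible_def)
  have "f measurable_on UNIV"
    by (rule lebesgue_measurable_imp_measurable_on) (auto simp: measurable_completion)
  then obtain N g where N: "negligible N" and g: "\<And>n. continuous_on UNIV (g n)"
    and lim: "\<And>x. x \<notin> N ==> (\<lambda>n. g n x) \<longlonglongrightarrow> f x"
    unfolding measurable_on_def by auto
  \<comment> \<open>Clipping to [-C, C] leaves the limit unchanged, since \<open>f\<close> itself
    takes values there.\<close>
  define h where "h = (\<lambda>n x. max (- C) (min C (g n x)))"
  have h: "continuous_on UNIV (h n)" for n unfolding h_def by (intro continuous_intros g)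
  have hC: "\<bar>h n x\<bar> \<le> C" for n x using C by (auto simp: h_def)
  have [measurable]: "h n \<in> borel_measurable borel" for n by (rule borel_measurable_continuous_onI[OF h])
  have "AE x in lebesgue. x \<notin> N"
    using N by (intro AE_not_in) (simp add: negligible_iff_null_sets)
  then have AE: "AE x in lebesgue. (\<lambda>n. \<bar>indicator {-T<..T} x * (f x - h n x)\<bar>) \<longlonglongrightarrow> 0"
  proof eventually_elim
    case (elim x)
    have "(\<lambda>n. h n x) \<longlonglongrightarrow> max (- C) (min C (f x))"
      unfolding h_def by (intro tendsto_intros lim elim)
    also have "max (- C) (min C (f x)) = f x" using admissible_bound(1)[OF f, of x] by auto
    finally have "(\<lambda>n. \<bar>indicator {-T<..T} x * (f x - h n x)\<bar>) \<longlonglongrightarrow> \<bar>indicator {-T<..T} x * (f x - f x)\<bar>"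
      by (intro tendsto_intros)
    then show ?case by simp
  qed
  have "(\<lambda>n. \<integral>x. \<bar>indicator {-T<..T} x * (f x - h n x)\<bar> \<partial>lborel) \<longlonglongrightarrow> integral\<^sup>L lborel (\<lambda>x::real. 0)"
  proof (rule integral_dominated_convergence[where w="\<lambda>x::real. 2 * C * indicator {-T..T} x"])
    show "AE x in lborel. (\<lambda>n. \<bar>indicator {-T<..T} x * (f x - h n x)\<bar>) \<longlonglongrightarrow> 0"
      using AE by (simp add: AE_completion_iff)
    show "AE x in lborel. norm \<bar>indicator {-T<..T} x * (f x - h n x)\<bar> \<le> 2 * C * indicator {-T..T} x" for n
    proof (rule AE_I2)
      fix x
      have "\<bar>f x - h n x\<bar> \<le> 2 * C"
        using admissible_bound(1)[OF f, of x] hC[of n x] by linarith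
      then show "norm \<bar>indicator {-T<..T} x * (f x - h n x)\<bar> \<le> 2 * C * indicator {-T..T} x"
        by (auto simp: indicator_def)
    qed
  qed auto
  then have "\<forall>\<^sub>F n in sequentially. (\<integral>x. \<bar>indicator {-T<..T} x * (f x - h n x)\<bar> \<partial>lborel) < e"
    using e by (intro order_tendstoD) auto
  then obtain n where "(\<integral>x. \<bar>indicator {-T<..T} x * (f x - h n x)\<bar> \<partial>lborel) < e"
    using eventually_happens by fastforce
  then show ?thesis using that h hC by blast
qed

lemma admissible_approx_step:
  assumes f: "admissible T C f" and T: "T > 0" and e: "e > 0"
  obtains c S where "finite S" "admissible T C (step_comb c S)"
    "(\<integral>x. \<bar>f x - step_comb c S x\<bar> \<partial>lborel) < e"
proof -
  have [measurable]: "f \<in> borel_measurable borel" using f by (simp add: admissible_def)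
  obtain h where h: "continuous_on UNIV h" "\<And>x. \<bar>h x\<bar> \<le> C"
    "(\<integral>x. \<bar>indicator {-T<..T} x * (f x - h x)\<bar> \<partial>lborel) < e / 2"
    using admissible_approx_continuous[OF f, of "e / 2"] e by auto
  have [measurable]: "h \<in> borel_measurable borel" by (rule borel_measurable_continuous_onI[OF h(1)])
  \<comment> \<open>A uniform error \<open>e'\<close> on [-T, T] contributes 2T times
    \<open>e'\<close>, that is a quarter of e, to the L^1 distance.\<close>
  define e' where "e' = e / (8 * T)"
  have e': "e' > 0" "e' * (2 * T) < e / 2" using e T by (auto simp: e'_def field_simps)
  obtain c S where cS: "finite S" "admissible T C (step_comb c S)"
    "\<And>r. \<bar>step_comb c S r - indicator {-T<..T} r * h r\<bar> \<le> e' * indicator {-T..T} r"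
    by (rule continuous_approx_step[OF T continuous_on_subset[OF h(1) subset_UNIV] h(2) e'(1)]) (rule that)
  have C: "C \<ge> 0" using f by (simp add: admissible_def)
  have i1: "integrable lborel (\<lambda>x. \<bar>indicator {-T<..T} x * (f x - h x)\<bar>)"
  proof (rule Bochner_Integration.integrable_bound)
    show "integrable lborel (\<lambda>x. 2 * C * indicator {-T..T} x)" by simp
    have "\<bar>f x - h x\<bar> \<le> 2 * C" for x using admissible_bound(1)[OF f, of x] h(2)[of x] by linarith
    then show "AE x in lborel. norm \<bar>indicator {-T<..T} x * (f x - h x)\<bar> \<le> norm (2 * C * indicator {-T..T} x)"
      using C by (intro AE_I2) (auto simp: indicator_def)
  qed simp
  \<comment> \<open>The left endpoint lies outside all half-open cells.\<close>
  have AE0: "AE x in lborel. x \<noteq> - T" by (rule AE_lborel_singleton)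
  have "(\<integral>x. \<bar>f x - step_comb c S x\<bar> \<partial>lborel) \<le>
      (\<integral>x. \<bar>indicator {-T<..T} x * (f x - h x)\<bar> + e' * indicator {-T..T} x \<partial>lborel)"
  proof (rule integral_mono_AE)
    show "integrable lborel (\<lambda>x. \<bar>f x - step_comb c S x\<bar>)"
      by (intro integrable_abs Bochner_Integration.integrable_diff admissible_integrable[OF f] admissible_integrable[OF cS(2)])
    show "integrable lborel (\<lambda>x. \<bar>indicator {-T<..T} x * (f x - h x)\<bar> + e' * indicator {-T..T} x)"
      using i1 by simp
    show "AE x in lborel. \<bar>f x - step_comb c S x\<bar> \<le> \<bar>indicator {-T<..T} x * (f x - h x)\<bar> + e' * indicator {-T..T} x"
      using AE0
    proof eventually_elim
      case (elim x)
      have "f x = indicator {-T<..T} x * f x"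
        using admissible_bound(2)[OF f, of x] elim by (cases "x \<in> {-T..T}") auto
      then have "f x - step_comb c S x = indicator {-T<..T} x * (f x - h x) - (step_comb c S x - indicator {-T<..T} x * h x)"
        by (simp add: right_diff_distrib)
      then show ?case using cS(3)[of x] by linarith
    qed
  qed
  also have "... = (\<integral>x. \<bar>indicator {-T<..T} x * (f x - h x)\<bar> \<partial>lborel) + e' * (2 * T)"
    using i1 T by simp
  also have "... < e" using h(3) e'(2) by simp
  finally show ?thesis using that cS by blast
qed

section \<open>Wiener integrals\<close>

context prob_space begin

lemma L2_tendsto:
  fixes V :: "nat => 'a => real"
  assumes [measurable]: "\<And>n. V n \<in> borel_measurable M" "Y \<in> borel_measurable M" "W \<in> borel_measurable M"
    and V: "\<And>n. integrable M (\<lambda>w. (V n w)\<^sup>2)" and Y: "integrable M (\<lambda>w. (Y w)\<^sup>2)"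
    and W: "integrable M (\<lambda>w. (W w)\<^sup>2)"
    and lim: "(\<lambda>n. expectation (\<lambda>w. (V n w - Y w)\<^sup>2)) \<longlonglongrightarrow> 0"
  shows "(\<lambda>n. expectation (\<lambda>w. V n w * W w)) \<longlonglongrightarrow> expectation (\<lambda>w. Y w * W w)"
    and "(\<lambda>n. expectation (\<lambda>w. (V n w)\<^sup>2)) \<longlonglongrightarrow> expectation (\<lambda>w. (Y w)\<^sup>2)"
proof -
  define e where "e = (\<lambda>n. expectation (\<lambda>w. (V n w - Y w)\<^sup>2))"
  have e0: "(\<lambda>n. sqrt (e n)) \<longlonglongrightarrow> 0" using tendsto_real_sqrt[OF lim] by (simp add: e_def)
  have D: "integrable M (\<lambda>w. (V n w - Y w)\<^sup>2)" for n by (intro integrable_square_add V Y) auto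
  have *: "(\<lambda>n. expectation (\<lambda>w. (V n w - Y w) * Z w)) \<longlonglongrightarrow> 0"
    if [measurable]: "Z \<in> borel_measurable M" and Z: "integrable M (\<lambda>w. (Z w)\<^sup>2)" for Z
  proof (rule Lim_null_comparison)
    have "\<bar>expectation (\<lambda>w. (V n w - Y w) * Z w)\<bar> \<le> sqrt (e n) * sqrt (expectation (\<lambda>w. (Z w)\<^sup>2))" for n
      unfolding e_def by (intro abs_integral_mult_le D Z) auto
    then show "\<forall>\<^sub>F n in sequentially. norm (expectation (\<lambda>w. (V n w - Y w) * Z w)) \<le> sqrt (e n) * sqrt (expectation (\<lambda>w. (Z w)\<^sup>2))"
      by simp
    show "(\<lambda>n. sqrt (e n) * sqrt (expectation (\<lambda>w. (Z w)\<^sup>2))) \<longlonglongrightarrow> 0"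
      using tendsto_mult_right[OF e0] by simp
  qed
  have i: "integrable M (\<lambda>w. V n w * W w)" "integrable M (\<lambda>w. Y w * W w)" for n
    by (intro integrable_mult_of_square V Y W; simp)+
  have "expectation (\<lambda>w. (V n w - Y w) * W w) = expectation (\<lambda>w. V n w * W w) - expectation (\<lambda>w. Y w * W w)" for n
    unfolding left_diff_distrib using i by simp
  then show "(\<lambda>n. expectation (\<lambda>w. V n w * W w)) \<longlonglongrightarrow> expectation (\<lambda>w. Y w * W w)"
    using *[OF _ W] by (simp add: Lim_null[of "\<lambda>n. expectation (\<lambda>w. V n w * W w)"])
  have j: "integrable M (\<lambda>w. (V n w - Y w) * Y w)" for n by (intro integrable_mult_of_square D Y; simp)
  have "expectation (\<lambda>w. (V n w)\<^sup>2) - expectation (\<lambda>w. (Y w)\<^sup>2) = e n + 2 * expectation (\<lambda>w. (V n w - Y w) * Y w)" for n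
  proof -
    have "expectation (\<lambda>w. (V n w)\<^sup>2) = expectation (\<lambda>w. (Y w)\<^sup>2 + ((V n w - Y w)\<^sup>2 + 2 * ((V n w - Y w) * Y w)))"
      by (intro Bochner_Integration.integral_cong) (auto simp: power2_eq_square algebra_simps)
    then show ?thesis using D Y j by (simp add: e_def)
  qed
  moreover have "(\<lambda>n. e n + 2 * expectation (\<lambda>w. (V n w - Y w) * Y w)) \<longlonglongrightarrow> 0 + 2 * 0"
    unfolding e_def by (intro tendsto_intros lim * Y) auto
  ultimately show "(\<lambda>n. expectation (\<lambda>w. (V n w)\<^sup>2)) \<longlonglongrightarrow> expectation (\<lambda>w. (Y w)\<^sup>2)"
    by (simp add: Lim_null[of "\<lambda>n. expectation (\<lambda>w. (V n w)\<^sup>2)"])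
qed

text \<open>The limit is taken pointwise so that it is measurable for the smaller algebra itself and
  not only almost surely equal to such a function. The rate makes the L^1 norms of the increments
  summable, which gives almost sure convergence of the whole sequence; Fatou's lemma then yields the
  rate for the limit.\<close>

lemma L2_Cauchy_limit:
  fixes V :: "nat => 'a => real"
  assumes sub: "subalgebra M N" and VN: "\<And>n. V n \<in> borel_measurable N"
    and V: "\<And>n. integrable M (\<lambda>w. (V n w)\<^sup>2)"
    and C: "\<And>n m. n \<le> m ==> expectation (\<lambda>w. (V n w - V m w)\<^sup>2) \<le> (1/4) ^ n"
  obtains Y where "Y \<in> borel_measurable N" "integrable M (\<lambda>w. (Y w)\<^sup>2)"
    "\<And>n. expectation (\<lambda>w. (V n w - Y w)\<^sup>2) \<le> (1/4) ^ n"
proof -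
  have [measurable]: "V n \<in> borel_measurable M" for n
    by (rule measurable_from_subalg[OF sub VN])
  define Y where "Y = (\<lambda>w. lim (\<lambda>n. V n w))"
  have YN: "Y \<in> borel_measurable N" unfolding Y_def by (rule borel_measurable_lim_metric[OF VN])
  have [measurable]: "Y \<in> borel_measurable M" by (rule measurable_from_subalg[OF sub YN])
  have D: "integrable M (\<lambda>w. (V n w - V m w)\<^sup>2)" for n m by (intro integrable_square_add V) auto
  have E: "expectation (\<lambda>w. \<bar>V (Suc n) w - V n w\<bar>) \<le> (1/2) ^ n" for n
  proof -
    have "expectation (\<lambda>w. \<bar>V (Suc n) w - V n w\<bar>) \<le> sqrt (expectation (\<lambda>w. (V (Suc n) w - V n w)\<^sup>2))"
      by (rule integral_abs_le_sqrt[OF _ D]) auto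
    also have "... \<le> sqrt ((1/4) ^ n)" using C[of n "Suc n"] by (simp add: power2_commute)
    also have "... = (1/2) ^ n"
      by (rule real_sqrt_unique) (simp_all add: power2_eq_square power_mult_distrib[symmetric])
    finally show ?thesis .
  qed
  have i1: "integrable M (\<lambda>w. \<bar>V (Suc n) w - V n w\<bar>)" for n
    by (intro integrable_abs integrable_of_square[OF _ D]) auto
  have "(\<integral>\<^sup>+w. (\<Sum>n. ennreal \<bar>V (Suc n) w - V n w\<bar>) \<partial>M) = (\<Sum>n. \<integral>\<^sup>+w. ennreal \<bar>V (Suc n) w - V n w\<bar> \<partial>M)"
    by (rule nn_integral_suminf) auto
  also have "... \<le> (\<Sum>n. ennreal ((1/2) ^ n))"
    by (intro suminf_le) (auto simp: nn_integral_eq_integral[OF i1] intro!: ennreal_leI E)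
  also have "... = ennreal (\<Sum>n. (1/2) ^ n)"
    by (rule suminf_ennreal2) (auto intro: summable_geometric)
  also have "... < top" by simp
  finally have "AE w in M. (\<Sum>n. ennreal \<bar>V (Suc n) w - V n w\<bar>) \<noteq> \<infinity>"
    by (intro nn_integral_PInf_AE) auto
  then have lim: "AE w in M. (\<lambda>n. V n w) \<longlonglongrightarrow> Y w"
  proof eventually_elim
    case (elim w)
    then have "summable (\<lambda>n. \<bar>V (Suc n) w - V n w\<bar>)"
      by (intro summable_suminf_not_top) auto
    then have "summable (\<lambda>n. V (Suc n) w - V n w)" by (rule summable_rabs_cancel)
    then obtain l where "(\<lambda>n. \<Sum>i<n. V (Suc i) w - V i w) \<longlonglongrightarrow> l" by (auto simp: summable_def sums_def)
    then have "(\<lambda>n. V n w - V 0 w) \<longlonglongrightarrow> l"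
      unfolding sum_lessThan_telescope[of "\<lambda>n. V n w"] .
    from tendsto_add[OF this tendsto_const[of "V 0 w"]] have "convergent (\<lambda>n. V n w)"
      by (auto simp: convergent_def)
    then show ?case unfolding Y_def by (simp add: convergent_LIMSEQ_iff)
  qed
  have nn: "(\<integral>\<^sup>+w. ennreal ((V n w - Y w)\<^sup>2) \<partial>M) \<le> ennreal ((1/4) ^ n)" for n
  proof -
    have "(\<integral>\<^sup>+w. ennreal ((V n w - Y w)\<^sup>2) \<partial>M) = (\<integral>\<^sup>+w. liminf (\<lambda>m. ennreal ((V n w - V m w)\<^sup>2)) \<partial>M)"
    proof (rule nn_integral_cong_AE)
      show "AE w in M. ennreal ((V n w - Y w)\<^sup>2) = liminf (\<lambda>m. ennreal ((V n w - V m w)\<^sup>2))"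
        using lim
      proof eventually_elim
        case (elim w)
        have "(\<lambda>m. ennreal ((V n w - V m w)\<^sup>2)) \<longlonglongrightarrow> ennreal ((V n w - Y w)\<^sup>2)"
          by (intro tendsto_ennrealI tendsto_intros elim)
        from lim_imp_Liminf[OF _ this] show ?case by simp
      qed
    qed
    also have "... \<le> liminf (\<lambda>m. \<integral>\<^sup>+w. ennreal ((V n w - V m w)\<^sup>2) \<partial>M)"
      by (rule nn_integral_liminf) auto
    also have "... \<le> liminf (\<lambda>m. ennreal ((1/4) ^ n))"
    proof (rule Liminf_mono)
      show "\<forall>\<^sub>F m in sequentially. (\<integral>\<^sup>+w. ennreal ((V n w - V m w)\<^sup>2) \<partial>M) \<le> ennreal ((1/4) ^ n)"
        using eventually_ge_at_top[of n]
        by eventually_elim (simp add: nn_integral_eq_integral[OF D] C ennreal_leI)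
    qed
    also have "... = ennreal ((1/4) ^ n)" by (simp add: Liminf_const)
    finally show ?thesis .
  qed
  have DY: "integrable M (\<lambda>w. (V n w - Y w)\<^sup>2)" for n
    using order.strict_trans1[OF nn[of n] ennreal_less_top] by (intro integrableI_nonneg) auto
  have "integrable M (\<lambda>w. (V 0 w - (V 0 w - Y w))\<^sup>2)"
    by (intro integrable_square_add V DY) auto
  then have Y2: "integrable M (\<lambda>w. (Y w)\<^sup>2)" by simp
  have "expectation (\<lambda>w. (V n w - Y w)\<^sup>2) \<le> (1/4) ^ n" for n
    using nn[of n] unfolding nn_integral_eq_integral[OF DY[of n], OF AE_I2[OF zero_le_power2]]
    by (subst (asm) ennreal_le_iff) auto
  with YN Y2 show ?thesis by (rule that)
qed

end

section \<open>Linear combinations of the values of B\<close>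

locale fbm_space = prob_space M + hurst H for M :: "'a measure" and H :: real +
  fixes B :: "real => 'a => real"
  assumes fbm: "fractional_brownian_motion M H B"
begin

lemma B_measurable [measurable]: "B t \<in> borel_measurable M"
proof -
  have "\<forall>T c. finite T --> gaussian_rv M (\<lambda>w. \<Sum>s\<in>T. c s * B s w)"
    using fbm unfolding fractional_brownian_motion_def gaussian_process_def by blast
  from this[THEN spec[of _ "{t}"], THEN spec[of _ "\<lambda>_. 1"]] show ?thesis by (simp add: gaussian_rv_def)
qed

definition comb :: "(real => real) => real set => 'a => real" where
  "comb c T w = (\<Sum>t\<in>T. c t * B t w)"

lemma comb_measurable [measurable]: "comb c T \<in> borel_measurable M"
  unfolding comb_def by measurable

lemma B_normal_aux: "gaussian_rv M (comb c T)" if "finite T"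
  using fbm that unfolding fractional_brownian_motion_def gaussian_process_def comb_def[abs_def] by blast

lemma B_mean: "expectation (B t) = 0"
  using fbm unfolding fractional_brownian_motion_def by blast

lemma B_centered: "centered_normal M (expectation (\<lambda>w. (B t w)\<^sup>2)) (B t)"
proof (rule centered_normal_of_gaussian_rv)
  show "gaussian_rv M (B t)" using B_normal_aux[of "{t}" "\<lambda>_. 1"] by (simp add: comb_def[abs_def])
qed (rule B_mean)

lemma B_square_integrable: "integrable M (\<lambda>w. (B t w)\<^sup>2)"
  by (rule centered_normal_moments[OF B_centered])

lemma B_integrable: "integrable M (B t)"
  by (rule integrable_of_square[OF _ B_square_integrable]) simp

lemma B_cov: "expectation (\<lambda>w. B t w * B s w) = cov t s"
  using fbm unfolding fractional_brownian_motion_def cov_def by blast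

lemma B_prod_integrable: "integrable M (\<lambda>w. B t w * B s w)"
  by (intro integrable_mult_of_square B_square_integrable) auto

lemma comb_normal:
  assumes "finite T" shows "centered_normal M (expectation (\<lambda>w. (comb c T w)\<^sup>2)) (comb c T)"
proof (rule centered_normal_of_gaussian_rv[OF B_normal_aux[OF assms]])
  show "expectation (comb c T) = 0"
    unfolding comb_def by (subst Bochner_Integration.integral_sum) (auto simp: B_mean B_integrable)
qed

lemma comb_square_integrable: "finite T ==> integrable M (\<lambda>w. (comb c T w)\<^sup>2)"
  by (rule centered_normal_moments[OF comb_normal])

lemma adm_step_comb: "finite T ==> adm (step_comb c T)"
  unfolding step_comb_def[abs_def] by (intro adm_sum adm_intros)

lemma comb_B: "finite T ==> expectation (\<lambda>w. comb c T w * B s w) = fbm_inner H (fbm_step s) (step_comb c T)"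
proof -
  assume T: "finite T"
  have "expectation (\<lambda>w. comb c T w * B s w) = expectation (\<lambda>w. \<Sum>t\<in>T. c t * (B s w * B t w))"
    unfolding comb_def sum_distrib_right
    by (intro Bochner_Integration.integral_cong sum.cong refl) (simp only: mult_ac)
  also have "... = (\<Sum>t\<in>T. c t * cov s t)"
    by (subst Bochner_Integration.integral_sum) (auto simp: B_cov B_prod_integrable)
  also have "... = fbm_inner H (fbm_step s) (step_comb c T)"
    unfolding step_comb_def[abs_def] using T
    by (subst fbm_inner_sum_right) (auto intro!: adm_intros simp: fbm_inner_scale_right fbm_inner_step_step)
  finally show ?thesis .
qed

lemma comb_comb:
  assumes "finite S" "finite T"
  shows "expectation (\<lambda>w. comb c S w * comb d T w) = fbm_inner H (step_comb c S) (step_comb d T)"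
proof -
  have i: "integrable M (\<lambda>w. comb c S w * B t w)" for t
    by (intro integrable_mult_of_square comb_square_integrable assms B_square_integrable) auto
  have "expectation (\<lambda>w. comb c S w * comb d T w) = expectation (\<lambda>w. \<Sum>t\<in>T. d t * (comb c S w * B t w))"
    by (simp add: comb_def[of d] sum_distrib_left mult_ac)
  also have "... = (\<Sum>t\<in>T. d t * fbm_inner H (fbm_step t) (step_comb c S))"
    by (subst Bochner_Integration.integral_sum) (auto simp: i comb_B[OF assms(1)])
  also have "... = (\<Sum>t\<in>T. d t * fbm_inner H (step_comb c S) (fbm_step t))"
    by (intro sum.cong refl) (simp add: fbm_inner_sym[OF adm_intros(4) adm_step_comb[OF assms(1)]])
  also have "... = fbm_inner H (step_comb c S) (step_comb d T)"
  proof -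
    have "step_comb d T = (\<lambda>r. \<Sum>t\<in>T. d t * fbm_step t r)" by (simp add: step_comb_def fun_eq_iff)
    then show ?thesis using assms
      by (simp only:) (subst fbm_inner_sum_right, auto intro!: adm_intros adm_step_comb simp: fbm_inner_scale_right)
  qed
  finally show ?thesis .
qed

lemma fbm_inner_diff_diff:
  assumes "adm f" "adm g"
  shows "fbm_inner H (\<lambda>x. f x - g x) (\<lambda>x. f x - g x) = fbm_inner H f f - 2 * fbm_inner H f g + fbm_inner H g g"
proof -
  have d: "adm (\<lambda>x. f x - g x)" by (intro adm_intros assms)
  have "fbm_inner H (\<lambda>x. f x - g x) (\<lambda>x. f x - g x) = fbm_inner H (\<lambda>x. f x - g x) f - fbm_inner H (\<lambda>x. f x - g x) g"
    by (rule fbm_inner_diff_right[OF d assms])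
  also have "... = fbm_inner H f (\<lambda>x. f x - g x) - fbm_inner H g (\<lambda>x. f x - g x)"
    by (simp only: fbm_inner_sym[OF d assms(1)] fbm_inner_sym[OF d assms(2)])
  also have "... = (fbm_inner H f f - fbm_inner H f g) - (fbm_inner H g f - fbm_inner H g g)"
    by (simp only: fbm_inner_diff_right[OF assms(1) assms] fbm_inner_diff_right[OF assms(2) assms])
  finally show ?thesis by (simp add: fbm_inner_sym[OF assms(2,1)])
qed

lemma comb_dist:
  assumes "finite S" "finite T"
  shows "expectation (\<lambda>w. (comb c S w - comb d T w)\<^sup>2) =
    fbm_inner H (\<lambda>x. step_comb c S x - step_comb d T x) (\<lambda>x. step_comb c S x - step_comb d T x)"
proof -
  have i: "integrable M (\<lambda>w. comb c S w * comb d T w)"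
    by (intro integrable_mult_of_square comb_square_integrable assms) auto
  have "expectation (\<lambda>w. (comb c S w - comb d T w)\<^sup>2) =
     expectation (\<lambda>w. ((comb c S w)\<^sup>2 + (comb d T w)\<^sup>2) - 2 * (comb c S w * comb d T w))"
    by (intro Bochner_Integration.integral_cong) (auto simp: power2_diff)
  also have "... = expectation (\<lambda>w. (comb c S w)\<^sup>2) + expectation (\<lambda>w. (comb d T w)\<^sup>2) - 2 * expectation (\<lambda>w. comb c S w * comb d T w)"
    using comb_square_integrable[OF assms(1)] comb_square_integrable[OF assms(2)] i by simp
  finally show ?thesis
    using comb_comb[OF assms(1,1), of c c] comb_comb[OF assms(2,2), of d d] comb_comb[OF assms, of c d]
    by (simp add: fbm_inner_diff_diff[OF adm_step_comb[OF assms(1)] adm_step_comb[OF assms(2)]] power2_eq_square)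
qed

section \<open>The first chaos\<close>

text \<open>The closure in L^2 of the linear span of the variables \<open>B t\<close>, known as the
  first Wiener chaos. Its members are normal as limits of normal variables.\<close>

definition gauss_hilbert :: "('a => real) set" where
  "gauss_hilbert = {W \<in> borel_measurable M. integrable M (\<lambda>w. (W w)\<^sup>2) \<and>
     (\<forall>e>0. \<exists>c T. finite T \<and> expectation (\<lambda>w. (comb c T w - W w)\<^sup>2) < e)}"

lemma gauss_hilbert_normal:
  assumes "W \<in> gauss_hilbert" shows "centered_normal M (expectation (\<lambda>w. (W w)\<^sup>2)) W"
proof -
  have W: "W \<in> borel_measurable M" "integrable M (\<lambda>w. (W w)\<^sup>2)" using assms by (auto simp: gauss_hilbert_def)
  have "\<forall>n. \<exists>c T. finite T \<and> expectation (\<lambda>w. (comb c T w - W w)\<^sup>2) < inverse (real (Suc n))"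
    using assms unfolding gauss_hilbert_def by (auto simp del: of_nat_Suc)
  then obtain c T where cT: "\<And>n. finite (T n)" "\<And>n. expectation (\<lambda>w. (comb (c n) (T n) w - W w)\<^sup>2) < inverse (real (Suc n))"
    by metis
  show ?thesis
  proof (rule centered_normal_L2_limit[OF comb_normal[OF cT(1)] W])
    show "(\<lambda>n. expectation (\<lambda>w. (comb (c n) (T n) w - W w)\<^sup>2)) \<longlonglongrightarrow> 0"
      by (rule tendsto_sandwich[OF _ _ tendsto_const LIMSEQ_inverse_real_of_nat])
         (use cT(2) less_imp_le in \<open>auto intro!: always_eventually\<close>)
  qed
qed

lemma comb_scale: "a * comb c T w = comb (\<lambda>t. a * c t) T w"
  by (simp add: comb_def sum_distrib_left mult_ac)

lemma comb_add:
  assumes "finite S" "finite T"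
  shows "comb c S w + comb d T w = comb (\<lambda>t. (if t \<in> S then c t else 0) + (if t \<in> T then d t else 0)) (S \<union> T) w"
proof -
  have "comb c S w = (\<Sum>t\<in>S \<union> T. (if t \<in> S then c t else 0) * B t w)"
    unfolding comb_def by (rule sum.mono_neutral_cong_left) (use assms in auto)
  moreover have "comb d T w = (\<Sum>t\<in>S \<union> T. (if t \<in> T then d t else 0) * B t w)"
    unfolding comb_def by (rule sum.mono_neutral_cong_left) (use assms in auto)
  ultimately show ?thesis unfolding comb_def[of _ "S \<union> T"] by (simp add: distrib_right sum.distrib)
qed

lemma square_sum_le: "(a + b)\<^sup>2 \<le> 2 * a\<^sup>2 + 2 * (b::real)\<^sup>2"
  using zero_le_power2[of "a - b"] by (simp add: power2_sum power2_diff)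

lemma comb_in_gauss_hilbert: "finite T ==> comb c T \<in> gauss_hilbert"
  unfolding gauss_hilbert_def using comb_square_integrable
  by (auto intro!: exI[of _ c] exI[of _ T])

lemma gauss_hilbert_closed:
  assumes [measurable]: "W \<in> borel_measurable M" and W: "integrable M (\<lambda>w. (W w)\<^sup>2)"
    and ap: "\<And>e. e > 0 ==> \<exists>V\<in>gauss_hilbert. expectation (\<lambda>w. (V w - W w)\<^sup>2) < e"
  shows "W \<in> gauss_hilbert"
proof -
  have "\<exists>c T. finite T \<and> expectation (\<lambda>w. (comb c T w - W w)\<^sup>2) < e" if "e > 0" for e
  proof -
    have e4: "e / 4 > 0" using that by simp
    obtain V where V: "V \<in> gauss_hilbert" "expectation (\<lambda>w. (V w - W w)\<^sup>2) < e / 4" using ap[OF e4] by blast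
    have [measurable]: "V \<in> borel_measurable M" and V2: "integrable M (\<lambda>w. (V w)\<^sup>2)" using V by (auto simp: gauss_hilbert_def)
    obtain c T where cT: "finite T" "expectation (\<lambda>w. (comb c T w - V w)\<^sup>2) < e / 4"
      using V(1) e4 unfolding gauss_hilbert_def by blast
    have i: "integrable M (\<lambda>w. (comb c T w - V w)\<^sup>2)" "integrable M (\<lambda>w. (V w - W w)\<^sup>2)" "integrable M (\<lambda>w. (comb c T w - W w)\<^sup>2)"
      by (intro integrable_square_add comb_square_integrable cT(1) V2 W; simp)+
    have "expectation (\<lambda>w. (comb c T w - W w)\<^sup>2) \<le> expectation (\<lambda>w. 2 * (comb c T w - V w)\<^sup>2 + 2 * (V w - W w)\<^sup>2)"
    proof (rule integral_mono)
      show "(comb c T w - W w)\<^sup>2 \<le> 2 * (comb c T w - V w)\<^sup>2 + 2 * (V w - W w)\<^sup>2" for w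
        using square_sum_le[of "comb c T w - V w" "V w - W w"] by simp
    qed (use i in auto)
    also have "... < e" using i V(2) cT(2) by simp
    finally show ?thesis using cT(1) by blast
  qed
  then show ?thesis using W by (simp add: gauss_hilbert_def)
qed

sublocale G: gaussian_space M gauss_hilbert
proof
  show "\<exists>v. centered_normal M v W" if "W \<in> gauss_hilbert" for W using gauss_hilbert_normal[OF that] by blast
next
  fix W a assume W: "W \<in> gauss_hilbert"
  have [measurable]: "W \<in> borel_measurable M" and W2: "integrable M (\<lambda>w. (W w)\<^sup>2)" using W by (auto simp: gauss_hilbert_def)
  show "(\<lambda>w. a * W w) \<in> gauss_hilbert"
  proof (rule gauss_hilbert_closed)
    show "integrable M (\<lambda>w. (a * W w)\<^sup>2)" using W2 by (simp add: power_mult_distrib)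
    fix e :: real assume e: "e > 0"
    have e': "e / (a\<^sup>2 + 1) > 0" using e by (simp add: add_nonneg_pos)
    then obtain c T where cT: "finite T" "expectation (\<lambda>w. (comb c T w - W w)\<^sup>2) < e / (a\<^sup>2 + 1)"
      using W unfolding gauss_hilbert_def by blast
    have "expectation (\<lambda>w. (comb (\<lambda>t. a * c t) T w - a * W w)\<^sup>2) = a\<^sup>2 * expectation (\<lambda>w. (comb c T w - W w)\<^sup>2)"
      unfolding comb_scale[symmetric] right_diff_distrib[symmetric] power_mult_distrib by simp
    also have "... \<le> a\<^sup>2 * (e / (a\<^sup>2 + 1))" by (intro mult_left_mono less_imp_le[OF cT(2)]) simp
    also have "... = e - e / (a\<^sup>2 + 1)"
    proof -
      have "a\<^sup>2 + 1 \<noteq> 0" using zero_le_power2[of a] by linarith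
      then show ?thesis by (simp add: field_simps)
    qed
    also have "... < e" using e' by simp
    finally show "\<exists>V\<in>gauss_hilbert. expectation (\<lambda>w. (V w - a * W w)\<^sup>2) < e"
      using comb_in_gauss_hilbert[OF cT(1)] by blast
  qed simp
next
  fix V W assume V: "V \<in> gauss_hilbert" and W: "W \<in> gauss_hilbert"
  have [measurable]: "W \<in> borel_measurable M" "V \<in> borel_measurable M"
    and W2: "integrable M (\<lambda>w. (W w)\<^sup>2)" and V2: "integrable M (\<lambda>w. (V w)\<^sup>2)"
    using V W by (auto simp: gauss_hilbert_def)
  show "(\<lambda>w. V w + W w) \<in> gauss_hilbert"
  proof (rule gauss_hilbert_closed)
    show "integrable M (\<lambda>w. (V w + W w)\<^sup>2)" by (intro integrable_square_add V2 W2) auto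
    fix e :: real assume e: "e > 0"
    then have e': "e / 4 > 0" by simp
    obtain c T where cT: "finite T" "expectation (\<lambda>w. (comb c T w - V w)\<^sup>2) < e / 4"
      using V e' unfolding gauss_hilbert_def by blast
    obtain d S where dS: "finite S" "expectation (\<lambda>w. (comb d S w - W w)\<^sup>2) < e / 4"
      using W e' unfolding gauss_hilbert_def by blast
    define U where "U = comb (\<lambda>t. (if t \<in> T then c t else 0) + (if t \<in> S then d t else 0)) (T \<union> S)"
    have U: "U \<in> gauss_hilbert" unfolding U_def using cT dS by (intro comb_in_gauss_hilbert) auto
    have Ueq: "U w = comb c T w + comb d S w" for w unfolding U_def comb_add[OF cT(1) dS(1)] ..
    have i: "integrable M (\<lambda>w. (comb c T w - V w)\<^sup>2)" "integrable M (\<lambda>w. (comb d S w - W w)\<^sup>2)"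
      by (intro integrable_square_add comb_square_integrable cT(1) dS(1) V2 W2; simp)+
    have "integrable M (\<lambda>w. (U w)\<^sup>2)" using U by (simp add: gauss_hilbert_def)
    then have j: "integrable M (\<lambda>w. (U w - (V w + W w))\<^sup>2)"
      using V2 W2 by (intro integrable_square_add) (auto simp: U_def)
    have "expectation (\<lambda>w. (U w - (V w + W w))\<^sup>2) \<le> expectation (\<lambda>w. 2 * (comb c T w - V w)\<^sup>2 + 2 * (comb d S w - W w)\<^sup>2)"
    proof (rule integral_mono)
      show "(U w - (V w + W w))\<^sup>2 \<le> 2 * (comb c T w - V w)\<^sup>2 + 2 * (comb d S w - W w)\<^sup>2" for w
        using square_sum_le[of "comb c T w - V w" "comb d S w - W w"] unfolding Ueq by (simp add: algebra_simps)
    qed (use i j in auto)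
    also have "... < e" using i cT(2) dS(2) by simp
    finally show "\<exists>U\<in>gauss_hilbert. expectation (\<lambda>w. (U w - (V w + W w))\<^sup>2) < e" using U by blast
  qed simp
qed

lemma B_in: "B t \<in> gauss_hilbert"
  using comb_in_gauss_hilbert[of "{t}" "\<lambda>_. 1"] by (simp add: comb_def[abs_def])

lemma gauss_hilbert_AE_cong:
  assumes W: "W \<in> gauss_hilbert" and [measurable]: "V \<in> borel_measurable M" and eq: "AE w in M. V w = W w"
  shows "V \<in> gauss_hilbert"
proof (rule gauss_hilbert_closed)
  have [measurable]: "W \<in> borel_measurable M" using W by (rule G.meas)
  have "integrable M (\<lambda>w. (W w)\<^sup>2) \<longleftrightarrow> integrable M (\<lambda>w. (V w)\<^sup>2)"
    by (rule integrable_cong_AE) (use eq in auto)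
  then show "integrable M (\<lambda>w. (V w)\<^sup>2)" using G.sq[OF W] by simp
  have "expectation (\<lambda>w. (W w - V w)\<^sup>2) = 0"
    using eq by (intro integral_eq_zero_AE) auto
  then show "\<exists>U\<in>gauss_hilbert. expectation (\<lambda>w. (U w - V w)\<^sup>2) < e" if "e > 0" for e
    using W that by (intro bexI[of _ W]) simp_all
qed simp

text \<open>W is approximated by combinations of the \<open>B t\<close>, to which it is orthogonal;
  its own second moment is therefore as small as the approximation error permits.\<close>

lemma gauss_hilbert_eq_zero:
  assumes W: "W \<in> gauss_hilbert" and orth: "\<And>s. expectation (\<lambda>w. W w * B s w) = 0"
  shows "AE w in M. W w = 0"
proof -
  note [measurable] = G.meas[OF W]
  define a where "a = expectation (\<lambda>w. (W w)\<^sup>2)"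
  have a0: "a \<ge> 0" by (simp add: a_def)
  have "a \<le> e" if e: "e > 0" for e
  proof -
    obtain c T where cT: "finite T" "expectation (\<lambda>w. (comb c T w - W w)\<^sup>2) < e"
      using W e unfolding gauss_hilbert_def by blast
    have i: "integrable M (\<lambda>w. W w * comb c T w)" "integrable M (\<lambda>w. W w * B t w)" for t
      by (intro G.prod_int W comb_in_gauss_hilbert cT(1) B_in)+
    have "expectation (\<lambda>w. W w * comb c T w) = expectation (\<lambda>w. \<Sum>t\<in>T. c t * (W w * B t w))"
      by (simp add: comb_def sum_distrib_left mult_ac)
    also have "... = 0"
      by (subst Bochner_Integration.integral_sum) (auto simp: i orth)
    finally have z: "expectation (\<lambda>w. W w * comb c T w) = 0" .
    have "a = \<bar>expectation (\<lambda>w. W w * comb c T w - (W w)\<^sup>2)\<bar>"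
      using i G.sq[OF W] z by (simp add: a_def)
    also have "... = \<bar>expectation (\<lambda>w. W w * (comb c T w - W w))\<bar>"
      by (simp add: right_diff_distrib power2_eq_square)
    also have "... \<le> sqrt a * sqrt (expectation (\<lambda>w. (comb c T w - W w)\<^sup>2))"
      unfolding a_def by (intro abs_integral_mult_le G.sq[OF W] integrable_square_add comb_square_integrable cT(1)) auto
    also have "... \<le> sqrt a * sqrt e" using cT(2) by (intro mult_left_mono real_sqrt_le_mono) (auto simp: a0)
    finally have "sqrt a * sqrt a \<le> sqrt a * sqrt e" using a0 by simp
    then have "sqrt a \<le> sqrt e" if "a > 0"
      using that by (subst (asm) mult_le_cancel_left_pos) simp_all
    then show ?thesis using a0 e by (cases "a = 0") auto
  qed
  then have "a \<le> 0" by (meson dense_ge)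
  then have "a = 0" using a0 by simp
  then have "AE w in M. (W w)\<^sup>2 = 0"
    using G.sq[OF W] unfolding a_def by (subst (asm) integral_nonneg_eq_0_iff_AE) auto
  then show ?thesis by simp
qed

text \<open>The algebra generated by B, in the form in which it appears in the independence
  hypothesis on \<xi>. Everything that is to be independent of \<xi> must be measurable for
  it.\<close>

definition path_algebra :: "'a measure" where
  "path_algebra = vimage_algebra (space M) (\<lambda>w t. B t w) (Pi\<^sub>M UNIV (\<lambda>_. borel))"

lemma B_path_algebra [measurable]: "B t \<in> borel_measurable path_algebra"
proof -
  have "(\<lambda>w t. B t w) \<in> path_algebra \<rightarrow>\<^sub>M Pi\<^sub>M UNIV (\<lambda>_. borel)"
    unfolding path_algebra_def by (rule measurable_vimage_algebra1) (auto simp: space_PiM)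
  from measurable_compose[OF this measurable_component_singleton[of t UNIV]] show ?thesis by simp
qed

lemma subalgebra_path_algebra: "subalgebra M path_algebra"
proof -
  have f: "(\<lambda>w t. B t w) \<in> M \<rightarrow>\<^sub>M Pi\<^sub>M UNIV (\<lambda>_. borel)" by (rule measurable_PiM_single') auto
  show ?thesis unfolding subalgebra_def path_algebra_def
    using measurable_sets[OF f] by (subst sets_vimage_algebra2) (auto simp: space_PiM)
qed

section \<open>Existence, uniqueness and isometry of Wiener integrals\<close>

text \<open>The integral of a deterministic function is characterised by its covariances with B
  instead of being built as a limit. Within the first chaos they determine it almost surely, and a
  concrete process can be recognised as such an integral by computing them.\<close>

definition wiener :: "(real => real) => ('a => real) => bool" where
  "wiener f Y \<longleftrightarrow> Y \<in> gauss_hilbert \<and> Y \<in> borel_measurable path_algebra \<and>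
     (\<forall>s. expectation (\<lambda>w. Y w * B s w) = fbm_inner H (fbm_step s) f)"

lemma wiener_exists:
  assumes "adm f" obtains Y where "wiener f Y" "expectation (\<lambda>w. (Y w)\<^sup>2) = fbm_inner H f f"
proof -
  obtain T0 C where "admissible T0 C f" using assms by (auto simp: adm_def)
  define T where "T = max T0 1"
  have f: "admissible T C f" and T: "T > 0" using \<open>admissible T0 C f\<close> by (auto simp: T_def intro: admissible_mono)
  have C: "C \<ge> 0" using f by (simp add: admissible_def)
  \<comment> \<open>Differences of functions bounded by C are bounded by 2C; K is the factor by
    which their squared norm is controlled by their L^1 norm.\<close>
  define K where "K = H * (2 * H - 1) * (2 * C * kernel_bound T)"
  have K: "K \<ge> 0" using H_gt C kernel_bound_nonneg by (simp add: K_def)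
  \<comment> \<open>Chosen so that two approximations with these errors satisfy the rate required by
    \<open>L2_Cauchy_limit\<close>; the summand 1 keeps the denominator positive when K = 0.\<close>
  define \<delta> where "\<delta> = (\<lambda>n::nat. (1/4) ^ n / (2 * K + 1))"
  have \<delta>: "\<delta> n > 0" for n using K by (simp add: \<delta>_def add_nonneg_pos)
  have \<delta>m: "\<delta> m \<le> \<delta> n" if "n \<le> m" for n m
    using that K by (simp add: \<delta>_def divide_right_mono power_decreasing)
  have \<delta>K: "K * (2 * \<delta> n) \<le> (1/4) ^ n" for n 
  proof -
    have "K * (2 * \<delta> n) = (1/4) ^ n * (2 * K / (2 * K + 1))" by (simp add: \<delta>_def)
    also have "... \<le> (1/4) ^ n * 1" using K by (intro mult_left_mono) auto
    finally show ?thesis by simp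
  qed
  have \<delta>0: "\<delta> \<longlonglongrightarrow> 0"
    unfolding \<delta>_def using tendsto_divide[OF LIMSEQ_realpow_zero[of "1/4"] tendsto_const[of "2 * K + 1"]] K by simp
  have "\<forall>n. \<exists>c S. finite S \<and> admissible T C (step_comb c S) \<and> (\<integral>x. \<bar>f x - step_comb c S x\<bar> \<partial>lborel) < \<delta> n"
    using admissible_approx_step[OF f T \<delta>] by metis
  then obtain c S where S: "\<And>n. finite (S n)" and gS: "\<And>n. admissible T C (step_comb (c n) (S n))"
    and \<delta>g: "\<And>n. (\<integral>x. \<bar>f x - step_comb (c n) (S n) x\<bar> \<partial>lborel) < \<delta> n" by metis
  define g where "g n = step_comb (c n) (S n)" for n
  define V where "V n = comb (c n) (S n)" for n
  note g' = gS[folded g_def] and \<delta>g' = \<delta>g[folded g_def]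
  have dd: "admissible T (2 * C) (\<lambda>x. u x - w x)" if "admissible T C u" "admissible T C w" for u w
    using admissible_diff[OF that] by simp
  have V2: "integrable M (\<lambda>w. (V n w)\<^sup>2)" for n unfolding V_def by (rule comb_square_integrable[OF S])
  have [measurable]: "V n \<in> borel_measurable M" for n unfolding V_def by measurable
  have cauchy: "expectation (\<lambda>w. (V n w - V m w)\<^sup>2) \<le> (1/4) ^ n" if nm: "n \<le> m" for n m
  proof -
    have "(\<integral>x. \<bar>g n x - g m x\<bar> \<partial>lborel) \<le> (\<integral>x. \<bar>f x - g n x\<bar> + \<bar>f x - g m x\<bar> \<partial>lborel)"
      by (intro integral_mono Bochner_Integration.integrable_add integrable_abs admissible_integrable[OF dd] f g') linarith
    also have "... = (\<integral>x. \<bar>f x - g n x\<bar> \<partial>lborel) + (\<integral>x. \<bar>f x - g m x\<bar> \<partial>lborel)"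
      by (intro Bochner_Integration.integral_add integrable_abs admissible_integrable[OF dd] f g')
    also have "... \<le> 2 * \<delta> n" using \<delta>g'[of n] \<delta>g'[of m] \<delta>m[OF nm] by linarith
    finally have l: "(\<integral>x. \<bar>g n x - g m x\<bar> \<partial>lborel) \<le> 2 * \<delta> n" .
    have "expectation (\<lambda>w. (V n w - V m w)\<^sup>2) = fbm_inner H (\<lambda>x. g n x - g m x) (\<lambda>x. g n x - g m x)"
      unfolding V_def g_def by (rule comb_dist[OF S S])
    also have "... \<le> H * (2 * H - 1) * (2 * C * kernel_bound T * (\<integral>x. \<bar>g n x - g m x\<bar> \<partial>lborel))"
      using fbm_inner_bound[OF dd[OF g' g'] dd[OF g' g']] by (rule order_trans[OF abs_ge_self])
    also have "... = K * (\<integral>x. \<bar>g n x - g m x\<bar> \<partial>lborel)" by (simp add: K_def mult_ac)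
    also have "... \<le> K * (2 * \<delta> n)" by (rule mult_left_mono[OF l K])
    also have "... \<le> (1/4) ^ n" by (rule \<delta>K)
    finally show ?thesis .
  qed
  have VP: "V n \<in> borel_measurable path_algebra" for n unfolding V_def comb_def by measurable
  obtain Y :: "'a => real" where Y: "Y \<in> borel_measurable path_algebra" "integrable M (\<lambda>w. (Y w)\<^sup>2)"
    "\<And>n. expectation (\<lambda>w. (V n w - Y w)\<^sup>2) \<le> (1/4) ^ n"
    by (rule L2_Cauchy_limit[OF subalgebra_path_algebra VP V2 cauchy]) (assumption, rule that)
  have [measurable]: "Y \<in> borel_measurable M" by (rule measurable_from_subalg[OF subalgebra_path_algebra Y(1)])
  have lim: "(\<lambda>n. expectation (\<lambda>w. (V n w - Y w)\<^sup>2)) \<longlonglongrightarrow> 0"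
    by (rule tendsto_sandwich[OF _ _ tendsto_const LIMSEQ_realpow_zero[of "1/4"]])
       (use Y(3) in \<open>auto intro!: always_eventually\<close>)
  have inner_lim: "(\<lambda>n. fbm_inner H u (g n)) \<longlonglongrightarrow> fbm_inner H u f" if u: "adm u" for u
  proof -
    obtain T' D where "admissible T' D u" using u by (auto simp: adm_def)
    define T2 where "T2 = max T T'"
    have u': "admissible T2 D u" using \<open>admissible T' D u\<close> by (rule admissible_mono) (auto simp: T2_def)
    have d': "admissible T2 (2 * C) (\<lambda>x. g n x - f x)" for n
      using dd[OF g' f] by (rule admissible_mono) (auto simp: T2_def)
    have "norm (fbm_inner H u (g n) - fbm_inner H u f) \<le> H * (2 * H - 1) * (D * kernel_bound T2 * \<delta> n)" for n
    proof -
      have "fbm_inner H u (g n) - fbm_inner H u f = fbm_inner H u (\<lambda>x. g n x - f x)"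
        using u g'[of n] f by (subst fbm_inner_diff_right) (auto simp: adm_def)
      also have "norm ... \<le> H * (2 * H - 1) * (D * kernel_bound T2 * (\<integral>x. \<bar>g n x - f x\<bar> \<partial>lborel))"
        unfolding real_norm_def by (rule fbm_inner_bound[OF u' d'])
      also have "... \<le> H * (2 * H - 1) * (D * kernel_bound T2 * \<delta> n)"
        using \<delta>g'[of n] H_gt kernel_bound_nonneg[of T2] u'
        by (intro mult_left_mono) (auto simp: admissible_def abs_minus_commute)
      finally show ?thesis .
    qed
    moreover have "(\<lambda>n. H * (2 * H - 1) * (D * kernel_bound T2 * \<delta> n)) \<longlonglongrightarrow> 0"
      using tendsto_mult_left[OF tendsto_mult_left[OF \<delta>0, of "D * kernel_bound T2"], of "H * (2 * H - 1)"] by simp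
    ultimately show ?thesis
      by (rule_tac Lim_null[THEN iffD2], rule_tac Lim_null_comparison[OF always_eventually[OF allI]])
  qed
  have "Y \<in> gauss_hilbert"
  proof (rule gauss_hilbert_closed[OF _ Y(2)])
    fix e :: real assume "e > 0"
    then have "\<forall>\<^sub>F n in sequentially. expectation (\<lambda>w. (V n w - Y w)\<^sup>2) < e"
      using lim by (intro order_tendstoD)
    then obtain n where "expectation (\<lambda>w. (V n w - Y w)\<^sup>2) < e" using eventually_happens by fastforce
    then show "\<exists>V\<in>gauss_hilbert. expectation (\<lambda>w. (V w - Y w)\<^sup>2) < e"
      using comb_in_gauss_hilbert[OF S, of "c n" n] by (auto simp: V_def)
  qed simp
  moreover have "expectation (\<lambda>w. Y w * B s w) = fbm_inner H (fbm_step s) f" for s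
  proof (rule LIMSEQ_unique)
    show "(\<lambda>n. expectation (\<lambda>w. V n w * B s w)) \<longlonglongrightarrow> expectation (\<lambda>w. Y w * B s w)"
      by (rule L2_tendsto(1)[OF _ _ _ V2 Y(2) B_square_integrable lim]) auto
    show "(\<lambda>n. expectation (\<lambda>w. V n w * B s w)) \<longlonglongrightarrow> fbm_inner H (fbm_step s) f"
      unfolding V_def comb_B[OF S] using inner_lim[OF adm_intros(4)] by (simp add: g_def)
  qed
  ultimately have w: "wiener f Y" using Y(1) by (simp add: wiener_def)
  have "expectation (\<lambda>w. (Y w)\<^sup>2) = fbm_inner H f f"
  proof (rule LIMSEQ_unique)
    show "(\<lambda>n. expectation (\<lambda>w. (V n w)\<^sup>2)) \<longlonglongrightarrow> expectation (\<lambda>w. (Y w)\<^sup>2)"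
      by (rule L2_tendsto(2)[OF _ _ _ V2 Y(2) B_square_integrable lim]) auto
    have af: "adm f" "adm (g n)" for n using f g' by (auto simp: adm_def)
    have "(\<lambda>n. fbm_inner H (g n) (g n) - fbm_inner H f (g n)) \<longlonglongrightarrow> 0"
    proof (rule Lim_null_comparison[OF always_eventually[OF allI]])
      fix n
      have "fbm_inner H (g n) (g n) - fbm_inner H f (g n) = fbm_inner H (g n) (\<lambda>x. g n x - f x)"
        using af by (simp add: fbm_inner_diff_right fbm_inner_sym[of f "g n"])
      also have "norm ... \<le> H * (2 * H - 1) * (C * kernel_bound T * (\<integral>x. \<bar>g n x - f x\<bar> \<partial>lborel))"
        unfolding real_norm_def by (rule fbm_inner_bound[OF g' dd[OF g' f]])
      also have "... \<le> H * (2 * H - 1) * (C * kernel_bound T * \<delta> n)"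
        using \<delta>g'[of n] H_gt kernel_bound_nonneg[of T] C
        by (intro mult_left_mono) (auto simp: abs_minus_commute)
      finally show "norm (fbm_inner H (g n) (g n) - fbm_inner H f (g n)) \<le> H * (2 * H - 1) * (C * kernel_bound T * \<delta> n)" .
      show "(\<lambda>n. H * (2 * H - 1) * (C * kernel_bound T * \<delta> n)) \<longlonglongrightarrow> 0"
        using tendsto_mult_left[OF tendsto_mult_left[OF \<delta>0, of "C * kernel_bound T"], of "H * (2 * H - 1)"] by simp
    qed
    from tendsto_add[OF this inner_lim[OF af(1)]]
    show "(\<lambda>n. expectation (\<lambda>w. (V n w)\<^sup>2)) \<longlonglongrightarrow> fbm_inner H f f"
      unfolding V_def power2_eq_square comb_comb[OF S S] by (simp add: g_def)
  qed
  with w show ?thesis by (rule that)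
qed

lemma wiener_meas:
  assumes "wiener f Y"
  shows "Y \<in> gauss_hilbert" "Y \<in> borel_measurable M" "Y \<in> borel_measurable path_algebra"
    "integrable M (\<lambda>w. (Y w)\<^sup>2)" "expectation (\<lambda>w. Y w * B s w) = fbm_inner H (fbm_step s) f"
  using assms G.meas G.sq by (auto simp: wiener_def)

lemma wiener_unique:
  assumes "wiener f Y" "wiener f Y'" shows "AE w in M. Y w = Y' w"
proof -
  have "AE w in M. Y w - Y' w = 0"
  proof (rule gauss_hilbert_eq_zero)
    show "(\<lambda>w. Y w - Y' w) \<in> gauss_hilbert" using assms by (intro G.diff) (auto simp: wiener_def)
    fix s
    have "integrable M (\<lambda>w. Y w * B s w)" "integrable M (\<lambda>w. Y' w * B s w)"
      using assms by (auto intro!: G.prod_int B_in simp: wiener_def)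
    then show "expectation (\<lambda>w. (Y w - Y' w) * B s w) = 0"
      using assms by (simp add: left_diff_distrib wiener_def)
  qed
  then show ?thesis by simp
qed

lemma wiener_add:
  assumes "adm f" "adm g" "wiener f Y" "wiener g Y'"
  shows "wiener (\<lambda>x. f x + g x) (\<lambda>w. Y w + Y' w)"
proof -
  have "expectation (\<lambda>w. (Y w + Y' w) * B s w) = fbm_inner H (fbm_step s) (\<lambda>x. f x + g x)" for s
  proof -
    have "integrable M (\<lambda>w. Y w * B s w)" "integrable M (\<lambda>w. Y' w * B s w)"
      using assms by (auto intro!: G.prod_int B_in simp: wiener_def)
    then show ?thesis
      using assms by (simp add: distrib_right wiener_def fbm_inner_add_right[OF adm_intros(4) assms(1,2)])
  qed
  then show ?thesis using assms by (auto simp: wiener_def intro!: G.add)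
qed

lemma wiener_norm:
  assumes "adm f" "wiener f Y" shows "expectation (\<lambda>w. (Y w)\<^sup>2) = fbm_inner H f f"
proof -
  obtain Y' where Y': "wiener f Y'" "expectation (\<lambda>w. (Y' w)\<^sup>2) = fbm_inner H f f"
    using wiener_exists[OF assms(1)] by blast
  have "expectation (\<lambda>w. (Y w)\<^sup>2) = expectation (\<lambda>w. (Y' w)\<^sup>2)"
    using wiener_meas(2)[OF assms(2)] wiener_meas(2)[OF Y'(1)] wiener_unique[OF assms(2) Y'(1)]
    by (intro integral_cong_AE) auto
  then show ?thesis using Y' by simp
qed

text \<open>Polarisation: the norm identity is applied to f, to g and to their sum.\<close>

lemma wiener_isometry:
  assumes f: "adm f" "wiener f Y" and g: "adm g" "wiener g Y'"
  shows "expectation (\<lambda>w. Y w * Y' w) = fbm_inner H f g"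
proof -
  have i: "integrable M (\<lambda>w. Y w * Y' w)" "integrable M (\<lambda>w. (Y w)\<^sup>2)" "integrable M (\<lambda>w. (Y' w)\<^sup>2)"
    using f g by (auto intro!: G.prod_int G.sq simp: wiener_def)
  have fg: "adm (\<lambda>x. f x + g x)" by (intro adm_intros f g)
  have "expectation (\<lambda>w. (Y w + Y' w)\<^sup>2) = expectation (\<lambda>w. ((Y w)\<^sup>2 + (Y' w)\<^sup>2) + 2 * (Y w * Y' w))"
    by (intro Bochner_Integration.integral_cong) (auto simp: power2_sum)
  also have "... = fbm_inner H f f + fbm_inner H g g + 2 * expectation (\<lambda>w. Y w * Y' w)"
    using i wiener_norm[OF f] wiener_norm[OF g] by simp
  finally have 1: "expectation (\<lambda>w. (Y w + Y' w)\<^sup>2) = fbm_inner H f f + fbm_inner H g g + 2 * expectation (\<lambda>w. Y w * Y' w)" .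
  have "expectation (\<lambda>w. (Y w + Y' w)\<^sup>2) = fbm_inner H (\<lambda>x. f x + g x) (\<lambda>x. f x + g x)"
    by (rule wiener_norm[OF fg wiener_add[OF f(1) g(1) f(2) g(2)]])
  also have "... = fbm_inner H (\<lambda>x. f x + g x) f + fbm_inner H (\<lambda>x. f x + g x) g"
    by (rule fbm_inner_add_right[OF fg f(1) g(1)])
  also have "... = fbm_inner H f (\<lambda>x. f x + g x) + fbm_inner H g (\<lambda>x. f x + g x)"
    by (simp only: fbm_inner_sym[OF fg f(1)] fbm_inner_sym[OF fg g(1)])
  also have "... = (fbm_inner H f f + fbm_inner H f g) + (fbm_inner H g f + fbm_inner H g g)"
    by (simp only: fbm_inner_add_right[OF f(1) f(1) g(1)] fbm_inner_add_right[OF g(1) f(1) g(1)])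
  finally show ?thesis using 1 fbm_inner_sym[OF g(1) f(1)] by simp
qed

text \<open>The bound is of order T^(2H): \<open>kernel_bound\<close> contributes the exponent 2H -
  1 and the L^1 norm one more factor T.\<close>

lemma wiener_norm_bound:
  assumes f: "admissible T C f" and Y: "wiener f Y"
  shows "expectation (\<lambda>w. (Y w)\<^sup>2) \<le> H * (2 * H - 1) * (C * kernel_bound T * (2 * T * C))"
proof -
  have "expectation (\<lambda>w. (Y w)\<^sup>2) = fbm_inner H f f" using f Y by (intro wiener_norm) (auto simp: adm_def)
  also have "... \<le> H * (2 * H - 1) * (C * kernel_bound T * (\<integral>s. \<bar>f s\<bar> \<partial>lborel))"
    by (rule order_trans[OF abs_ge_self fbm_inner_bound[OF f f]])
  also have "... \<le> H * (2 * H - 1) * (C * kernel_bound T * (2 * T * C))"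
    using admissible_integral_bound[OF f] H_gt kernel_bound_nonneg[of T] f
    by (intro mult_left_mono) (auto simp: admissible_def)
  finally show ?thesis .
qed

end

section \<open>Time integrals of processes\<close>

lemma measurable_pair_subalgebra:
  assumes "subalgebra M N" and f: "f \<in> borel_measurable (N \<Otimes>\<^sub>M borel)"
  shows "f \<in> borel_measurable (M \<Otimes>\<^sub>M borel)"
proof -
  have "(\<lambda>x. x) \<in> M \<rightarrow>\<^sub>M N"
    using assms(1) by (auto simp: measurable_def subalgebra_def)
  then have "(\<lambda>x. (fst x, snd x)) \<in> M \<Otimes>\<^sub>M borel \<rightarrow>\<^sub>M N \<Otimes>\<^sub>M borel"
    by (intro measurable_Pair measurable_compose[OF measurable_fst] measurable_snd) simp
  from measurable_compose[OF this f] show ?thesis by simp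
qed

lemma set_integral_square_le:
  fixes f :: "real => real"
  assumes [measurable]: "f \<in> borel_measurable borel" and T: "T \<ge> 0" and f: "set_integrable lborel {0..T} (\<lambda>s. (f s)\<^sup>2)"
  shows "(LINT s:{0..T}|lborel. f s)\<^sup>2 \<le> T * (LINT s:{0..T}|lborel. (f s)\<^sup>2)"
proof -
  let ?i = "indicator {0..T} :: real => real"
  have e: "(?i s * f s)\<^sup>2 = ?i s * (f s)\<^sup>2" "(?i s)\<^sup>2 = ?i s" "(?i s * f s) * ?i s = ?i s * f s" for s
    by (auto simp: indicator_def)
  have "(\<integral>s. (?i s * f s) * ?i s \<partial>lborel)\<^sup>2 \<le> (\<integral>s. (?i s * f s)\<^sup>2 \<partial>lborel) * (\<integral>s. (?i s)\<^sup>2 \<partial>lborel)"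
    by (rule integral_mult_square_le) (use f in \<open>auto simp: e set_integrable_def\<close>)
  then show ?thesis using T unfolding e by (simp add: set_lebesgue_integral_def mult.commute)
qed

context prob_space begin

lemma process_Fubini:
  fixes U :: "'a => real => real"
  assumes U: "(\<lambda>(w, s). U w s) \<in> borel_measurable (M \<Otimes>\<^sub>M borel)"
    and i: "\<And>s. s \<in> {0..T} ==> integrable M (\<lambda>w. U w s)"
    and b: "\<And>s. s \<in> {0..T} ==> expectation (\<lambda>w. \<bar>U w s\<bar>) \<le> K"
  shows "AE w in M. set_integrable lborel {0..T} (U w)"
    and "integrable M (\<lambda>w. LINT s:{0..T}|lborel. U w s)"
    and "expectation (\<lambda>w. LINT s:{0..T}|lborel. U w s) = (LINT s:{0..T}|lborel. expectation (\<lambda>w. U w s))"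
    and "set_integrable lborel {0..T} (\<lambda>s. expectation (\<lambda>w. U w s))"
    and "integrable (M \<Otimes>\<^sub>M lborel) (\<lambda>(w, s). indicator {0..T} s * U w s)"
proof -
  interpret P: pair_sigma_finite lborel M ..
  interpret Q: pair_sigma_finite M lborel ..
  have Um [measurable]: "case_prod U \<in> borel_measurable (M \<Otimes>\<^sub>M borel)" using U by simp
  have m: "(\<lambda>(s, w). indicator {0..T} s * U w s) \<in> borel_measurable (lborel \<Otimes>\<^sub>M M)"
    by measurable
  have n: "(\<integral>w. norm (case (s, w) of (s, w) => indicator {0..T} s * U w s) \<partial>M) =
      indicator {0..T} s * expectation (\<lambda>w. \<bar>U w s\<bar>)" for s
    by (simp add: abs_mult)
  have 1: "integrable (lborel \<Otimes>\<^sub>M M) (\<lambda>(s, w). indicator {0..T} s * U w s)"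
  proof (rule P.Fubini_integrable[OF m])
    show "integrable lborel (\<lambda>s. \<integral>w. norm (case (s, w) of (s, w) => indicator {0..T} s * U w s) \<partial>M)"
      unfolding n
    proof (rule Bochner_Integration.integrable_bound)
      show "integrable lborel (\<lambda>s. K * indicator {0..T} s)" by simp
      show "(\<lambda>s. indicator {0..T} s * expectation (\<lambda>w. \<bar>U w s\<bar>)) \<in> borel_measurable lborel"
        by measurable
      have nn: "0 \<le> expectation (\<lambda>w. \<bar>U w s\<bar>)" for s by simp
      show "AE s in lborel. norm (indicator {0..T} s * expectation (\<lambda>w. \<bar>U w s\<bar>)) \<le> norm (K * indicator {0..T} s)"
      proof (rule AE_I2)
        fix s
        show "norm (indicator {0..T} s * expectation (\<lambda>w. \<bar>U w s\<bar>)) \<le> norm (K * indicator {0..T} s)"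
          using b[of s] nn[of s] by (cases "s \<in> {0..T}") auto
      qed
    qed
    show "AE s in lborel. integrable M (\<lambda>w. case (s, w) of (s, w) => indicator {0..T} s * U w s)"
    proof (rule AE_I2)
      fix s show "integrable M (\<lambda>w. case (s, w) of (s, w) => indicator {0..T} s * U w s)"
        using i[of s] by (cases "s \<in> {0..T}") auto
    qed
  qed
  show 2: "integrable (M \<Otimes>\<^sub>M lborel) (\<lambda>(w, s). indicator {0..T} s * U w s)"
    using P.integrable_product_swap[OF 1] by (simp add: case_prod_beta')
  show "AE w in M. set_integrable lborel {0..T} (U w)"
    using Q.AE_integrable_fst'[OF 2] by (simp add: set_integrable_def)
  show "integrable M (\<lambda>w. LINT s:{0..T}|lborel. U w s)"
    using Q.integrable_fst'[OF 2] by (simp add: set_lebesgue_integral_def)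
  have s: "(\<integral>w. indicator {0..T} s * U w s \<partial>M) = indicator {0..T} s * expectation (\<lambda>w. U w s)" for s by simp
  have "expectation (\<lambda>w. LINT s:{0..T}|lborel. U w s) = (\<integral>x. (case x of (w, s) => indicator {0..T} s * U w s) \<partial>(M \<Otimes>\<^sub>M lborel))"
    using Q.integral_fst'[OF 2] by (simp add: set_lebesgue_integral_def)
  also have "... = (\<integral>s. indicator {0..T} s * expectation (\<lambda>w. U w s) \<partial>lborel)"
    using Q.integral_snd[OF 2] unfolding s by simp
  finally show "expectation (\<lambda>w. LINT s:{0..T}|lborel. U w s) = (LINT s:{0..T}|lborel. expectation (\<lambda>w. U w s))"
    by (simp add: set_lebesgue_integral_def)
  show "set_integrable lborel {0..T} (\<lambda>s. expectation (\<lambda>w. U w s))"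
    using Q.integrable_snd[OF 2] unfolding s by (simp add: set_integrable_def)
qed

text \<open>Cauchy-Schwarz turns the uniform second moment bound into the uniform L^1 bound on
  \<open>Y w * U w s\<close> that Fubini's theorem asks for.\<close>

lemma process_inner:
  fixes U :: "'a => real => real"
  assumes U: "(\<lambda>(w, s). U w s) \<in> borel_measurable (M \<Otimes>\<^sub>M borel)"
    and i: "\<And>s. s \<in> {0..T} ==> integrable M (\<lambda>w. (U w s)\<^sup>2)"
    and b: "\<And>s. s \<in> {0..T} ==> expectation (\<lambda>w. (U w s)\<^sup>2) \<le> K"
    and Y [measurable]: "Y \<in> borel_measurable M" and Y2: "integrable M (\<lambda>w. (Y w)\<^sup>2)"
  shows "integrable M (\<lambda>w. Y w * (LINT s:{0..T}|lborel. U w s))"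
    and "expectation (\<lambda>w. Y w * (LINT s:{0..T}|lborel. U w s)) = (LINT s:{0..T}|lborel. expectation (\<lambda>w. Y w * U w s))"
    and "set_integrable lborel {0..T} (\<lambda>s. expectation (\<lambda>w. Y w * U w s))"
proof -
  have Um [measurable]: "case_prod U \<in> borel_measurable (M \<Otimes>\<^sub>M borel)" using U by simp
  have Us [measurable]: "(\<lambda>w. U w s) \<in> borel_measurable M" for s
    using measurable_compose[OF measurable_Pair2' Um] by simp
  have m: "(\<lambda>(w, s). Y w * U w s) \<in> borel_measurable (M \<Otimes>\<^sub>M borel)" by measurable
  have int: "integrable M (\<lambda>w. Y w * U w s)" if "s \<in> {0..T}" for s
    by (intro integrable_mult_of_square Y2 i that) auto
  have bd: "expectation (\<lambda>w. \<bar>Y w * U w s\<bar>) \<le> sqrt (expectation (\<lambda>w. (Y w)\<^sup>2)) * sqrt K" if "s \<in> {0..T}" for s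
  proof -
    have "expectation (\<lambda>w. \<bar>Y w\<bar> * \<bar>U w s\<bar>) \<le> sqrt (expectation (\<lambda>w. \<bar>Y w\<bar>\<^sup>2)) * sqrt (expectation (\<lambda>w. \<bar>U w s\<bar>\<^sup>2))"
      by (rule order_trans[OF abs_ge_self abs_integral_mult_le]) (use Y2 i[OF that] in auto)
    also have "... \<le> sqrt (expectation (\<lambda>w. (Y w)\<^sup>2)) * sqrt K"
      using b[OF that] by (intro mult_mono real_sqrt_le_mono) auto
    finally show ?thesis by (simp add: abs_mult)
  qed
  note F = process_Fubini[where T=T, OF m int bd]
  have e: "(LINT s:{0..T}|lborel. Y w * U w s) = Y w * (LINT s:{0..T}|lborel. U w s)" for w
    by (rule set_integral_mult_right)
  show "integrable M (\<lambda>w. Y w * (LINT s:{0..T}|lborel. U w s))" using F(2) unfolding e .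
  show "expectation (\<lambda>w. Y w * (LINT s:{0..T}|lborel. U w s)) = (LINT s:{0..T}|lborel. expectation (\<lambda>w. Y w * U w s))"
    using F(3) unfolding e .
  show "set_integrable lborel {0..T} (\<lambda>s. expectation (\<lambda>w. Y w * U w s))" by (rule F(4))
qed

lemma process_integral_measurable:
  fixes U :: "'a => real => real"
  assumes U: "(\<lambda>(w, s). U w s) \<in> borel_measurable (N \<Otimes>\<^sub>M borel)"
  shows "(\<lambda>w. LINT s:{0..T}|lborel. U w s) \<in> borel_measurable N"
proof -
  have [measurable]: "case_prod U \<in> borel_measurable (N \<Otimes>\<^sub>M borel)" using U by simp
  show ?thesis unfolding set_lebesgue_integral_def by measurable
qed

text \<open>The double integral arises from two uses of \<open>process_inner\<close>: first with the
  time integral itself as the fixed factor, then with \<open>U w s\<close>. The first use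
  presupposes that the time integral is square integrable, which follows from Cauchy-Schwarz along
  each path.\<close>

lemma process_square:
  fixes U :: "'a => real => real"
  assumes U: "(\<lambda>(w, s). U w s) \<in> borel_measurable (M \<Otimes>\<^sub>M borel)" and T: "T \<ge> 0"
    and i: "\<And>s. s \<in> {0..T} ==> integrable M (\<lambda>w. (U w s)\<^sup>2)"
    and b: "\<And>s. s \<in> {0..T} ==> expectation (\<lambda>w. (U w s)\<^sup>2) \<le> K"
  shows "integrable M (\<lambda>w. (LINT s:{0..T}|lborel. U w s)\<^sup>2)"
    and "expectation (\<lambda>w. (LINT s:{0..T}|lborel. U w s)\<^sup>2) =
      (LINT s:{0..T}|lborel. LINT t:{0..T}|lborel. expectation (\<lambda>w. U w s * U w t))"
    and "set_integrable lborel {0..T} (\<lambda>s. LINT t:{0..T}|lborel. expectation (\<lambda>w. U w s * U w t))"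
    and "AE w in M. set_integrable lborel {0..T} (U w)"
proof -
  have Um [measurable]: "case_prod U \<in> borel_measurable (M \<Otimes>\<^sub>M borel)" using U by simp
  have Us [measurable]: "(\<lambda>w. U w s) \<in> borel_measurable M" for s
    using measurable_compose[OF measurable_Pair2' Um] by simp
  have V [measurable]: "(\<lambda>w. LINT s:{0..T}|lborel. U w s) \<in> borel_measurable M"
    by (rule process_integral_measurable[OF U])
  have m2: "(\<lambda>(w, s). (U w s)\<^sup>2) \<in> borel_measurable (M \<Otimes>\<^sub>M borel)" by measurable
  have b2: "expectation (\<lambda>w. \<bar>(U w s)\<^sup>2\<bar>) \<le> K" if "s \<in> {0..T}" for s using b[OF that] by simp
  have F1: "AE w in M. set_integrable lborel {0..T} (\<lambda>s. (U w s)\<^sup>2)"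
    and F2: "integrable M (\<lambda>w. LINT s:{0..T}|lborel. (U w s)\<^sup>2)"
    by (rule process_Fubini[OF m2 i b2]; assumption)+
  show sq: "integrable M (\<lambda>w. (LINT s:{0..T}|lborel. U w s)\<^sup>2)"
  proof (rule Bochner_Integration.integrable_bound)
    show "integrable M (\<lambda>w. T * (LINT s:{0..T}|lborel. (U w s)\<^sup>2))" using F2 by simp
    show "AE w in M. norm ((LINT s:{0..T}|lborel. U w s)\<^sup>2) \<le> norm (T * (LINT s:{0..T}|lborel. (U w s)\<^sup>2))"
      using F1 AE_space
    proof eventually_elim
      case (elim w)
      have "U w \<in> borel_measurable borel"
        using measurable_compose[OF measurable_Pair1'[OF elim(2)] Um] by simp
      from set_integral_square_le[OF this T elim(1)] show ?case
        by (simp only: real_norm_def abs_power2)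
    qed
  qed measurable
  have e1: "expectation (\<lambda>w. (LINT s:{0..T}|lborel. U w s) * U w s) = (LINT t:{0..T}|lborel. expectation (\<lambda>w. U w s * U w t))"
    if "s \<in> {0..T}" for s
    using process_inner(2)[where T=T, OF U i b Us i[OF that]] by (simp only: mult.commute)
  have "expectation (\<lambda>w. (LINT s:{0..T}|lborel. U w s)\<^sup>2) =
      (LINT s:{0..T}|lborel. expectation (\<lambda>w. (LINT s:{0..T}|lborel. U w s) * U w s))"
    using process_inner(2)[where T=T, OF U i b V sq] by (simp only: power2_eq_square)
  also have "... = (LINT s:{0..T}|lborel. LINT t:{0..T}|lborel. expectation (\<lambda>w. U w s * U w t))"
    by (rule set_lebesgue_integral_cong) (simp_all add: e1)
  finally show "expectation (\<lambda>w. (LINT s:{0..T}|lborel. U w s)\<^sup>2) =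
      (LINT s:{0..T}|lborel. LINT t:{0..T}|lborel. expectation (\<lambda>w. U w s * U w t))" .
  show "set_integrable lborel {0..T} (\<lambda>s. LINT t:{0..T}|lborel. expectation (\<lambda>w. U w s * U w t))"
    using process_inner(3)[where T=T, OF U i b V sq] by (rule set_integrable_cong[THEN iffD1, rotated -1]) (simp_all add: e1)
  have "expectation (\<lambda>w. \<bar>U w s\<bar>) \<le> sqrt K" if "s \<in> {0..T}" for s
    using integral_abs_le_sqrt[OF Us i[OF that]] real_sqrt_le_mono[OF b[OF that]] by linarith
  from process_Fubini(1)[where T=T, OF U integrable_of_square[OF Us i] this]
  show "AE w in M. set_integrable lborel {0..T} (U w)" by simp
qed

end

section \<open>Linear filters\<close>

definition ou_integral :: "real => (real => real) => real => real" where
  "ou_integral a k t = exp (- a * t) * (LINT s:{0..t}|lborel. exp (a * s) * k s)"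

text \<open>Variation of constants: this is the solution x of x(t) = k(t) - a * int_0^t x(s) ds. In
  this form k need only be continuous, as is the case for a path of B.\<close>

definition ou_filter :: "real => (real => real) => real => real" where
  "ou_filter a k t = k t - a * ou_integral a k t"

lemma set_integral_eq_integral:
  fixes g :: "real => real"
  assumes "continuous_on {0..T} g" "x \<in> {0..T}"
  shows "(LINT s:{0..x}|lborel. g s) = integral {0..x} g"
  by (rule set_borel_integral_eq_integral(2)[OF borel_integrable_atLeastAtMost'])
     (rule continuous_on_subset[OF assms(1)], use assms in auto)

lemma set_integral_has_derivative:
  fixes g :: "real => real"
  assumes g: "continuous_on {0..T} g" and t: "0 < t" "t < T"
  shows "((\<lambda>x. LINT s:{0..x}|lborel. g s) has_real_derivative g t) (at t)"
proof -
  have "((\<lambda>x. integral {0..x} g) has_real_derivative g t) (at t within {0..T})"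
    by (rule integral_has_real_derivative[OF g]) (use t in auto)
  then have "((\<lambda>x. integral {0..x} g) has_real_derivative g t) (at t)"
    using t by (simp add: at_within_Icc_at)
  then show ?thesis
  proof (rule DERIV_cong_ev[THEN iffD1, rotated -1, OF _ refl _ refl])
    have "\<forall>\<^sub>F x in nhds t. x \<in> {0<..<T}" using t by (intro eventually_nhds_in_open) auto
    then show "\<forall>\<^sub>F x in nhds t. integral {0..x} g = (LINT s:{0..x}|lborel. g s)"
      by eventually_elim (rule set_integral_eq_integral[OF g, symmetric], auto)
  qed
qed

lemma continuous_on_set_integral:
  fixes g :: "real => real"
  assumes g: "continuous_on {0..T} g"
  shows "continuous_on {0..T} (\<lambda>x. LINT s:{0..x}|lborel. g s)"
proof -
  have "continuous_on {0..T} (\<lambda>x. integral {0..x} g)"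
    by (rule indefinite_integral_continuous_1[OF integrable_continuous_real[OF g]])
  then show ?thesis
    by (rule continuous_on_cong[OF refl, THEN iffD1, rotated]) (rule set_integral_eq_integral[OF g, symmetric])
qed

lemma continuous_on_ou_integral:
  assumes k: "continuous_on {0..T} k" shows "continuous_on {0..T} (ou_integral a k)"
  unfolding ou_integral_def[abs_def]
  by (intro continuous_intros continuous_on_set_integral k)

lemma continuous_on_ou_filter:
  assumes k: "continuous_on {0..T} k" shows "continuous_on {0..T} (ou_filter a k)"
  unfolding ou_filter_def[abs_def]
  by (intro continuous_intros continuous_on_ou_integral k)

text \<open>By the product rule \<open>ou_filter a k\<close> is the derivative of
  \<open>ou_integral a k\<close>, which vanishes at 0. Thus the filter does solve its integral
  equation.\<close>

lemma set_integral_ou_filter: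
  assumes k: "continuous_on {0..T} k" and T: "T \<ge> 0"
  shows "(LINT s:{0..T}|lborel. ou_filter a k s) = ou_integral a k T"
proof -
  have "(LINT s:{0..T}|lborel. ou_filter a k s) = ou_integral a k T - ou_integral a k 0"
  proof (rule set_lebesgue_integral_FTC_strong[OF T finite.emptyI continuous_on_ou_integral[OF k] continuous_on_ou_filter[OF k]])
    fix t assume t: "0 < t" "t < T"
    have c: "continuous_on {0..T} (\<lambda>s. exp (a * s) * k s)" by (intro continuous_intros k)
    have e: "((\<lambda>t. exp (- a * t)) has_real_derivative - a * exp (- a * t)) (at t)"
      by (auto intro!: derivative_eq_intros)
    have "(ou_integral a k has_real_derivative
        (- a * exp (- a * t)) * (LINT s:{0..t}|lborel. exp (a * s) * k s) + (exp (a * t) * k t) * exp (- a * t)) (at t)"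
      unfolding ou_integral_def[abs_def] by (rule DERIV_mult[OF e set_integral_has_derivative[OF c t]])
    moreover have "(- a * exp (- a * t)) * (LINT s:{0..t}|lborel. exp (a * s) * k s) + (exp (a * t) * k t) * exp (- a * t) = ou_filter a k t"
    proof -
      have "(exp (a * t) * k t) * exp (- a * t) = k t * (exp (a * t) * exp (- (a * t)))" by simp
      also have "... = k t" by (simp add: exp_minus)
      finally show ?thesis by (simp add: ou_filter_def ou_integral_def)
    qed
    ultimately show "(ou_integral a k has_real_derivative ou_filter a k t) (at t)" by (simp only:)
  qed
  moreover have "ou_integral a k 0 = 0"
    by (simp add: ou_integral_def set_lebesgue_integral_def integral_eq_zero_AE[OF AE_mp[OF AE_lborel_singleton[of 0]]])
  ultimately show ?thesis by simp
qed

lemma ou_integral_0: "ou_integral a k 0 = 0"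
proof -
  have "(LINT s:{0..0}|lborel. exp (a * s) * k s) = 0"
    unfolding set_lebesgue_integral_def
    by (rule integral_eq_zero_AE) (use AE_lborel_singleton[of "0::real"] in \<open>auto elim!: eventually_mono\<close>)
  then show ?thesis by (simp add: ou_integral_def)
qed

text \<open>The integrating factor \<open>exp (a * t)\<close> is applied to the integral y of x, not
  to x itself, because only y is differentiable: the derivative of exp(a t) y(t) is exp(a t)
  k(t).\<close>

lemma ou_filter_unique:
  assumes x: "continuous_on {0..T} x" and k: "continuous_on {0..T} k" and T: "T \<ge> 0"
    and eq: "\<And>t. t \<in> {0..T} ==> x t = k t - a * (LINT s:{0..t}|lborel. x s)"
  shows "x T = ou_filter a k T"
proof -
  define y where "y = (\<lambda>t. LINT s:{0..t}|lborel. x s)"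
  have cy: "continuous_on {0..T} y" unfolding y_def by (rule continuous_on_set_integral[OF x])
  have y0: "y 0 = 0" unfolding y_def set_lebesgue_integral_def
    by (rule integral_eq_zero_AE) (use AE_lborel_singleton[of "0::real"] in \<open>auto elim!: eventually_mono\<close>)
  have "(LINT s:{0..T}|lborel. exp (a * s) * k s) = exp (a * T) * y T - exp (a * 0) * y 0"
  proof (rule set_lebesgue_integral_FTC_strong[OF T finite.emptyI])
    show "continuous_on {0..T} (\<lambda>t. exp (a * t) * y t)" by (intro continuous_intros cy)
    show "continuous_on {0..T} (\<lambda>s. exp (a * s) * k s)" by (intro continuous_intros k)
    fix t assume t: "0 < t" "t < T"
    have e: "((\<lambda>t. exp (a * t)) has_real_derivative a * exp (a * t)) (at t)"
      by (auto intro!: derivative_eq_intros)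
    have "((\<lambda>t. exp (a * t) * y t) has_real_derivative (a * exp (a * t)) * y t + x t * exp (a * t)) (at t)"
      unfolding y_def by (rule DERIV_mult[OF e set_integral_has_derivative[OF x t]])
    moreover have "(a * exp (a * t)) * y t + x t * exp (a * t) = exp (a * t) * k t"
    proof -
      have "k t = x t + a * y t" using eq[of t] t by (simp add: y_def)
      then show ?thesis by (simp only:) (simp add: algebra_simps)
    qed
    ultimately show "((\<lambda>t. exp (a * t) * y t) has_real_derivative exp (a * t) * k t) (at t)" by simp
  qed
  then have "ou_integral a k T = y T" by (simp add: ou_integral_def y0 mult.assoc[symmetric] mult_exp_exp)
  then show ?thesis using eq[of T] T by (simp add: ou_filter_def y_def)
qed

lemma ou_filter_affine:
  assumes b: "continuous_on {0..t} b" and d: "continuous_on {0..t} d"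
  shows "ou_filter a (\<lambda>s. b s + c * d s) t = ou_filter a b t + c * ou_filter a d t"
proof -
  have i: "set_integrable lborel {0..t} (\<lambda>s. exp (a * s) * b s)" "set_integrable lborel {0..t} (\<lambda>s. c * (exp (a * s) * d s))"
    by (intro borel_integrable_atLeastAtMost' continuous_intros b d)+
  have "(LINT s:{0..t}|lborel. exp (a * s) * (b s + c * d s)) =
      (LINT s:{0..t}|lborel. exp (a * s) * b s + c * (exp (a * s) * d s))"
    by (simp add: algebra_simps)
  also have "... = (LINT s:{0..t}|lborel. exp (a * s) * b s) + c * (LINT s:{0..t}|lborel. exp (a * s) * d s)"
    using i by (simp add: set_integral_add)
  finally show ?thesis by (simp add: ou_filter_def ou_integral_def algebra_simps)
qed

lemma set_integral_exp:
  fixes a t :: real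
  assumes "a \<noteq> 0" "t \<ge> 0" shows "(LINT s:{0..t}|lborel. exp (a * s)) = (exp (a * t) - 1) / a"
proof -
  have "(LINT s:{0..t}|lborel. exp (a * s)) = exp (a * t) / a - exp (a * 0) / a"
    by (rule set_lebesgue_integral_FTC_strong[OF assms(2) finite.emptyI])
       (use assms(1) in \<open>auto intro!: continuous_intros derivative_eq_intros\<close>)
  then show ?thesis by (simp add: diff_divide_distrib)
qed

lemma ou_filter_const:
  assumes "a \<noteq> 0" "t \<ge> 0" shows "ou_filter a (\<lambda>_. c) t = c * exp (- a * t)"
proof -
  have "(LINT s:{0..t}|lborel. exp (a * s) * c) = (exp (a * t) - 1) / a * c"
    using set_integral_exp[OF assms] by simp
  then show ?thesis using assms(1)
    by (simp add: ou_filter_def ou_integral_def exp_minus field_simps)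
qed

text \<open>The input may grow linearly while the output stays bounded, since exponential weights
  discount the past. The estimates of the two parts add up to (L / a) * (1 - exp(-a t)).\<close>

lemma ou_filter_bounded:
  assumes a: "a > 0" and t: "t \<ge> 0" and k: "continuous_on {0..t} k" and k0: "k 0 = 0"
    and L0: "L \<ge> 0" and L: "\<And>s. s \<in> {0..t} ==> \<bar>k t - k s\<bar> \<le> L * (t - s)"
  shows "\<bar>ou_filter a k t\<bar> \<le> L / a"
proof -
  have i1: "set_integrable lborel {0..t} (\<lambda>s. exp (a * s) * (k t - k s))"
    "set_integrable lborel {0..t} (\<lambda>s. exp (a * s) * k s)" "set_integrable lborel {0..t} (\<lambda>s. exp (a * s) * k t)"
    "set_integrable lborel {0..t} (\<lambda>s. L * (exp (a * s) * (t - s)))"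
    by (intro borel_integrable_atLeastAtMost' continuous_intros k)+
  have e1: "(LINT s:{0..t}|lborel. exp (a * s) * (k t - k s)) =
      (exp (a * t) - 1) / a * k t - (LINT s:{0..t}|lborel. exp (a * s) * k s)"
    unfolding right_diff_distrib using i1 set_integral_exp[of a t] a t by (simp add: set_integral_diff)
  \<comment> \<open>The weights a * exp(-a (t - s)) have total mass 1 - exp(-a t), so the filter can
    be rewritten in terms of increments of k, which are controlled.\<close>
  have "ou_filter a k t = exp (- a * t) * k t + a * exp (- a * t) * (LINT s:{0..t}|lborel. exp (a * s) * (k t - k s))"
  proof -
    have "exp (- a * t) * exp (a * t) = 1" by (simp add: mult_exp_exp)
    then have "exp (- a * t) * (exp (a * t) * x) = x" for x by (simp add: mult.assoc[symmetric])
    then show ?thesis unfolding e1 using a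
      by (simp add: ou_filter_def ou_integral_def right_diff_distrib left_diff_distrib diff_divide_distrib mult.assoc)
  qed
  moreover have "\<bar>exp (- a * t) * k t\<bar> \<le> exp (- a * t) * (L * t)"
    using L[of 0] t k0 by (simp add: abs_mult)
  moreover have "\<bar>a * exp (- a * t) * (LINT s:{0..t}|lborel. exp (a * s) * (k t - k s))\<bar> \<le>
      a * exp (- a * t) * (L * ((exp (a * t) - 1 - a * t) / a\<^sup>2))"
  proof -
    have "\<bar>LINT s:{0..t}|lborel. exp (a * s) * (k t - k s)\<bar> \<le> (LINT s:{0..t}|lborel. \<bar>exp (a * s) * (k t - k s)\<bar>)"
      using set_integral_norm_bound[OF i1(1)] by simp
    also have "... \<le> (LINT s:{0..t}|lborel. L * (exp (a * s) * (t - s)))"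
    proof (rule set_integral_mono)
      show "set_integrable lborel {0..t} (\<lambda>s. \<bar>exp (a * s) * (k t - k s)\<bar>)" using i1(1) by (rule set_integrable_abs)
      show "\<bar>exp (a * s) * (k t - k s)\<bar> \<le> L * (exp (a * s) * (t - s))" if "s \<in> {0..t}" for s
        using mult_left_mono[OF L[OF that], of "exp (a * s)"] by (simp add: abs_mult mult_ac)
    qed (rule i1)
    also have "... = L * ((exp (a * t) - 1 - a * t) / a\<^sup>2)"
    proof -
      have "(LINT s:{0..t}|lborel. exp (a * s) * (t - s)) =
          exp (a * t) * ((t - t) / a + 1 / a\<^sup>2) - exp (a * 0) * ((t - 0) / a + 1 / a\<^sup>2)"
      proof (rule set_lebesgue_integral_FTC_strong[OF t finite.emptyI])
        fix s
        have "((\<lambda>s. exp (a * s) * ((t - s) / a + 1 / a\<^sup>2)) has_real_derivative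
            (a * exp (a * s)) * ((t - s) / a + 1 / a\<^sup>2) + (- 1 / a) * exp (a * s)) (at s)"
          using a by (auto intro!: derivative_eq_intros)
        moreover have "(a * exp (a * s)) * ((t - s) / a + 1 / a\<^sup>2) + (- 1 / a) * exp (a * s) = exp (a * s) * (t - s)"
          using a by (simp add: field_simps power2_eq_square)
        ultimately show "((\<lambda>s. exp (a * s) * ((t - s) / a + 1 / a\<^sup>2)) has_real_derivative exp (a * s) * (t - s)) (at s)"
          by simp
      qed (use a in \<open>auto intro!: continuous_intros\<close>)
      also have "... = (exp (a * t) - 1 - a * t) / a\<^sup>2" using a by (simp add: field_simps power2_eq_square)
      finally show ?thesis by simp
    qed
    finally have "\<bar>a * exp (- a * t)\<bar> * \<bar>LINT s:{0..t}|lborel. exp (a * s) * (k t - k s)\<bar> \<le>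
        \<bar>a * exp (- a * t)\<bar> * (L * ((exp (a * t) - 1 - a * t) / a\<^sup>2))"
      by (rule mult_left_mono) simp
    then show ?thesis unfolding abs_mult[of "a * exp (- a * t)" "LINT s:{0..t}|lborel. exp (a * s) * (k t - k s)"] using a by simp
  qed
  ultimately have "\<bar>ou_filter a k t\<bar> \<le> exp (- a * t) * (L * t) + a * exp (- a * t) * (L * ((exp (a * t) - 1 - a * t) / a\<^sup>2))"
    by linarith
  also have "... = (L / a) * (exp (- a * t) * exp (a * t)) - (L / a) * exp (- a * t)"
    using a by (simp add: field_simps power2_eq_square)
  also have "... = L / a - (L / a) * exp (- a * t)" by (simp add: mult_exp_exp)
  also have "... \<le> L / a" using L0 a by simp
  finally show ?thesis .
qed

section \<open>The Ornstein-Uhlenbeck process driven by fractional Brownian motion\<close>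

locale fbm_ou = fbm_space M H B for M :: "'a measure" and H :: real and B :: "real => 'a => real" +
  fixes \<alpha> :: real
  assumes \<alpha>_pos: "\<alpha> > 0"
begin

text \<open>A jointly measurable version of the path. Almost all paths are continuous, but the
  exceptional set need not belong to the \<open>\<sigma>\<close>-algebra of the path.\<close>

definition B_version :: "'a => real => real" where
  "B_version w t = lim (\<lambda>k. B (of_int \<lfloor>real (Suc k) * t\<rfloor> / real (Suc k)) w)"

lemma B_version_measurable: "case_prod B_version \<in> borel_measurable (path_algebra \<Otimes>\<^sub>M borel)"
proof -
  \<comment> \<open>The rounded time takes countably many values, at each of which B is measurable;
    this gives joint measurability.\<close>
  have "(\<lambda>x. B (of_int \<lfloor>real (Suc k) * snd x\<rfloor> / real (Suc k)) (fst x)) \<in> borel_measurable (path_algebra \<Otimes>\<^sub>M borel)" for k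
    by (rule measurable_compose_countable[where f="\<lambda>i x. B (of_int i / real (Suc k)) (fst x)" and g="\<lambda>x. \<lfloor>real (Suc k) * snd x\<rfloor>"])
       measurable
  then have "(\<lambda>x. lim (\<lambda>k. B (of_int \<lfloor>real (Suc k) * snd x\<rfloor> / real (Suc k)) (fst x))) \<in> borel_measurable (path_algebra \<Otimes>\<^sub>M borel)"
    by (rule borel_measurable_lim_metric)
  then show ?thesis by (simp add: B_version_def[abs_def] case_prod_beta')
qed

definition good :: "'a => bool" where "good w \<longleftrightarrow> continuous_on UNIV (\<lambda>t. B t w)"

lemma AE_good: "AE w in M. good w"
  using fbm unfolding fractional_brownian_motion_def good_def by blast

lemma B_version_good:
  assumes "good w" shows "B_version w t = B t w"
proof -
  define x where "x = (\<lambda>k. of_int \<lfloor>real (Suc k) * t\<rfloor> / real (Suc k) :: real)"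
  have "x \<longlonglongrightarrow> t"
  proof (rule Lim_null[THEN iffD2], rule Lim_null_comparison[OF _ LIMSEQ_inverse_real_of_nat])
    have "\<bar>x k - t\<bar> \<le> inverse (real (Suc k))" for k
    proof -
      have "\<bar>of_int \<lfloor>real (Suc k) * t\<rfloor> - real (Suc k) * t\<bar> \<le> 1" by linarith
      moreover have "x k - t = (of_int \<lfloor>real (Suc k) * t\<rfloor> - real (Suc k) * t) / real (Suc k)"
        by (simp add: x_def diff_divide_distrib)
      ultimately show ?thesis
        by (simp add: abs_divide divide_right_mono inverse_eq_divide del: of_nat_Suc)
    qed
    then show "\<forall>\<^sub>F k in sequentially. norm (x k - t) \<le> inverse (real (Suc k))" by simp
  qed
  moreover have "isCont (\<lambda>t. B t w) t" using assms by (simp add: good_def continuous_on_eq_continuous_at)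
  ultimately have "(\<lambda>k. B (x k) w) \<longlonglongrightarrow> B t w" by (rule isCont_tendsto_compose[rotated])
  then show ?thesis unfolding B_version_def x_def by (rule limI)
qed

lemma B_version_eq: "good w ==> B_version w = (\<lambda>t. B t w)"
  by (simp add: fun_eq_iff B_version_good)

lemma good_cont: "good w ==> continuous_on S (\<lambda>t. B t w)"
  unfolding good_def by (rule continuous_on_subset) auto

definition Z :: "'a => real => real" where "Z w t = ou_filter \<alpha> (B_version w) t"

lemma Z_measurable_path: "case_prod Z \<in> borel_measurable (path_algebra \<Otimes>\<^sub>M borel)"
proof -
  note [measurable] = B_version_measurable
  \<comment> \<open>The moving endpoint of integration is written as a condition in the integrand,
    so that measurability in the path and in t follows from the theorem on parameter
    integrals.\<close>
  have 1: "(\<lambda>(x, s). (if 0 \<le> s \<and> s \<le> snd x then exp (\<alpha> * s) * B_version (fst x) s else 0)) \<in> borel_measurable ((path_algebra \<Otimes>\<^sub>M borel) \<Otimes>\<^sub>M lborel)"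
    by measurable
  have "(\<lambda>x. \<integral>s. (if 0 \<le> s \<and> s \<le> snd x then exp (\<alpha> * s) * B_version (fst x) s else 0) \<partial>lborel) \<in> borel_measurable (path_algebra \<Otimes>\<^sub>M borel)"
    using lborel.borel_measurable_lebesgue_integral[OF 1] by simp
  moreover have "(LINT s:{0..snd x}|lborel. exp (\<alpha> * s) * B_version (fst x) s) =
      (\<integral>s. (if 0 \<le> s \<and> s \<le> snd x then exp (\<alpha> * s) * B_version (fst x) s else 0) \<partial>lborel)" for x :: "'a \<times> real"
    unfolding set_lebesgue_integral_def by (intro Bochner_Integration.integral_cong) auto
  ultimately have [measurable]: "(\<lambda>x. LINT s:{0..snd x}|lborel. exp (\<alpha> * s) * B_version (fst x) s) \<in> borel_measurable (path_algebra \<Otimes>\<^sub>M borel)"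
    by simp
  have "(\<lambda>x. B_version (fst x) (snd x) - \<alpha> * (exp (- \<alpha> * snd x) * (LINT s:{0..snd x}|lborel. exp (\<alpha> * s) * B_version (fst x) s)))
      \<in> borel_measurable (path_algebra \<Otimes>\<^sub>M borel)"
    by measurable
  then show ?thesis by (simp add: Z_def[abs_def] ou_filter_def ou_integral_def case_prod_beta')
qed

lemma Z_measurable [measurable]: "case_prod Z \<in> borel_measurable (M \<Otimes>\<^sub>M borel)"
  and B_version_measurable' [measurable]: "case_prod B_version \<in> borel_measurable (M \<Otimes>\<^sub>M borel)"
  by (rule measurable_pair_subalgebra[OF subalgebra_path_algebra Z_measurable_path]
           measurable_pair_subalgebra[OF subalgebra_path_algebra B_version_measurable])+

lemma Zt_path_measurable: "(\<lambda>w. Z w t) \<in> borel_measurable path_algebra"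
  using measurable_compose[OF measurable_Pair2' Z_measurable_path] by simp

lemma Zt_measurable [measurable]: "(\<lambda>w. Z w t) \<in> borel_measurable M"
  by (rule measurable_from_subalg[OF subalgebra_path_algebra Zt_path_measurable])

lemma Bv_measurable [measurable]: "(\<lambda>w. B_version w t) \<in> borel_measurable M"
  using measurable_compose[OF measurable_Pair2' B_version_measurable'] by simp

lemma AE_B_version: "AE w in M. B_version w t = B t w"
  using AE_good by eventually_elim (rule B_version_good)

lemma good_Z_cont: "good w ==> continuous_on {0..T} (Z w)"
  unfolding Z_def[abs_def] using B_version_eq good_cont by (intro continuous_on_ou_filter) simp

lemma good_Z_integral:
  assumes "good w" "T \<ge> 0" shows "\<alpha> * (LINT s:{0..T}|lborel. Z w s) = B T w - Z w T"
proof -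
  have "continuous_on {0..T} (B_version w)" using assms good_cont by (simp add: B_version_eq)
  from set_integral_ou_filter[OF this assms(2), of \<alpha>]
  show ?thesis unfolding Z_def by (simp add: ou_filter_def[of \<alpha> _ T] B_version_good[OF assms(1)])
qed

lemma cov_diag: "cov t t = \<bar>t\<bar> powr (2 * H)"
  by (simp add: cov_def)

definition Y_int :: "real => 'a => real" where
  "Y_int t w = (LINT s:{0..t}|lborel. exp (\<alpha> * s) * B_version w s)"

lemma expB_meas: "(\<lambda>(w, s). exp (\<alpha> * s) * B_version w s) \<in> borel_measurable (M \<Otimes>\<^sub>M borel)"
  by measurable

lemma expB_sq:
  "integrable M (\<lambda>w. (exp (\<alpha> * s) * B_version w s)\<^sup>2)"
  "expectation (\<lambda>w. (exp (\<alpha> * s) * B_version w s)\<^sup>2) = (exp (\<alpha> * s))\<^sup>2 * cov s s"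
proof -
  have ae: "AE w in M. (exp (\<alpha> * s) * B s w)\<^sup>2 = (exp (\<alpha> * s) * B_version w s)\<^sup>2"
    using AE_B_version[of s] by eventually_elim simp
  have "integrable M (\<lambda>w. (exp (\<alpha> * s) * B s w)\<^sup>2)"
    using B_square_integrable by (simp add: power_mult_distrib)
  then show "integrable M (\<lambda>w. (exp (\<alpha> * s) * B_version w s)\<^sup>2)"
    by (rule integrable_cong_AE_imp) (use ae in auto)
  have "expectation (\<lambda>w. (exp (\<alpha> * s) * B_version w s)\<^sup>2) = expectation (\<lambda>w. (exp (\<alpha> * s) * B s w)\<^sup>2)"
    by (rule integral_cong_AE) (use ae in auto)
  also have "... = (exp (\<alpha> * s))\<^sup>2 * expectation (\<lambda>w. (B s w)\<^sup>2)" by (simp add: power_mult_distrib)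
  also have "expectation (\<lambda>w. (B s w)\<^sup>2) = cov s s" using B_cov[of s s] by (simp add: power2_eq_square)
  finally show "expectation (\<lambda>w. (exp (\<alpha> * s) * B_version w s)\<^sup>2) = (exp (\<alpha> * s))\<^sup>2 * cov s s" .
qed

lemma expB_bound:
  assumes "s \<in> {0..t}"
  shows "expectation (\<lambda>w. (exp (\<alpha> * s) * B_version w s)\<^sup>2) \<le> (exp (\<alpha> * t))\<^sup>2 * \<bar>t\<bar> powr (2 * H)"
  unfolding expB_sq(2) cov_diag using assms \<alpha>_pos H_gt
  by (intro mult_mono power_mono powr_mono2) auto

lemma Y_int_square: "t \<ge> 0 ==> integrable M (\<lambda>w. (Y_int t w)\<^sup>2)"
  unfolding Y_int_def by (rule process_square(1)[OF expB_meas _ expB_sq(1) expB_bound])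

lemma Y_int_measurable [measurable]: "Y_int t \<in> borel_measurable M"
  unfolding Y_int_def[abs_def] by (rule process_integral_measurable[OF expB_meas])

lemma Z_eq: "Z w t = B_version w t - \<alpha> * (exp (- \<alpha> * t) * Y_int t w)"
  by (simp add: Z_def ou_filter_def ou_integral_def Y_int_def)

lemma Bv_square: "integrable M (\<lambda>w. (B_version w t)\<^sup>2)"
  by (rule integrable_cong_AE_imp[OF B_square_integrable[of t]]) (use AE_B_version[of t] in auto)

lemma Z_square: "t \<ge> 0 ==> integrable M (\<lambda>w. (Z w t)\<^sup>2)"
  unfolding Z_eq using Y_int_square[of t]
  by (intro integrable_square_add(2) Bv_square) (auto simp: power_mult_distrib)

text \<open>Fubini's theorem turns the filter on paths into the filter on covariances.\<close>

lemma Z_inner: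
  assumes t: "t \<ge> 0" and [measurable]: "Y \<in> borel_measurable M" and Y: "integrable M (\<lambda>w. (Y w)\<^sup>2)"
  shows "expectation (\<lambda>w. Y w * Z w t) = ou_filter \<alpha> (\<lambda>s. expectation (\<lambda>w. Y w * B s w)) t"
proof -
  have e: "expectation (\<lambda>w. Y w * (exp (\<alpha> * s) * B_version w s)) = exp (\<alpha> * s) * expectation (\<lambda>w. Y w * B s w)" for s
  proof -
    have "expectation (\<lambda>w. Y w * (exp (\<alpha> * s) * B_version w s)) = expectation (\<lambda>w. exp (\<alpha> * s) * (Y w * B s w))"
      by (rule integral_cong_AE) (use AE_B_version[of s] in auto)
    then show ?thesis by simp
  qed
  have "expectation (\<lambda>w. Y w * B_version w t) = expectation (\<lambda>w. Y w * B t w)"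
    by (rule integral_cong_AE) (use AE_B_version[of t] in auto)
  moreover have "expectation (\<lambda>w. Y w * Y_int t w) = (LINT s:{0..t}|lborel. exp (\<alpha> * s) * expectation (\<lambda>w. Y w * B s w))"
  proof -
    have "expectation (\<lambda>w. Y w * Y_int t w) = (LINT s:{0..t}|lborel. expectation (\<lambda>w. Y w * (exp (\<alpha> * s) * B_version w s)))"
      unfolding Y_int_def by (rule process_inner(2)[OF expB_meas expB_sq(1) expB_bound assms(2) Y])
    then show ?thesis by (simp only: e)
  qed
  moreover have "expectation (\<lambda>w. Y w * Z w t) =
      expectation (\<lambda>w. Y w * B_version w t - (\<alpha> * exp (- \<alpha> * t)) * (Y w * Y_int t w))"
    unfolding Z_eq by (simp add: algebra_simps)
  moreover have "integrable M (\<lambda>w. Y w * B_version w t)" "integrable M (\<lambda>w. Y w * Y_int t w)"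
    by (intro integrable_mult_of_square Y Bv_square Y_int_square t; simp)+
  ultimately show ?thesis by (simp add: ou_filter_def ou_integral_def)
qed

section \<open>The process Z as a Wiener integral\<close>

text \<open>The function whose Wiener integral is \<open>Z w t\<close>: the response at time t to a
  unit impulse at time r.\<close>

definition ou_kernel :: "real => real => real" where
  "ou_kernel t r = indicator {0<..t} r * exp (- \<alpha> * (t - r))"

lemma ou_kernel_admissible: "t \<ge> 0 ==> admissible t 1 (ou_kernel t)"
proof -
  assume t: "t \<ge> 0"
  have "\<bar>ou_kernel t x\<bar> \<le> 1 * indicator {-t..t} x" for x
    using t \<alpha>_pos by (auto simp: ou_kernel_def indicator_def)
  moreover have "ou_kernel t \<in> borel_measurable borel" unfolding ou_kernel_def[abs_def] by measurable
  ultimately show ?thesis using t unfolding admissible_def by auto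
qed

lemma ou_kernel_adm: "t \<ge> 0 ==> adm (ou_kernel t)"
  using ou_kernel_admissible unfolding adm_def by blast

lemma cov_0 [simp]: "cov q 0 = 0" by (simp add: cov_def)

text \<open>Integration by parts: \<open>step_slice q\<close> is the derivative of
  \<open>cov q\<close>, and the derivative of the exponential produces the integral term of the
  filter. The boundary term at 0 vanishes with \<open>cov q 0\<close>.\<close>

lemma fbm_inner_ou_kernel:
  assumes t: "t \<ge> 0" shows "fbm_inner H (fbm_step q) (ou_kernel t) = ou_filter \<alpha> (cov q) t"
proof -
  have i: "set_integrable lborel {0..t} (\<lambda>s. exp (\<alpha> * s) * step_slice q s)"
     "set_integrable lborel {0..t} (\<lambda>s. \<alpha> * (exp (\<alpha> * s) * cov q s))"
    by (intro borel_integrable_atLeastAtMost' continuous_intros continuous_on_step_slice continuous_on_cov)+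
  have "(LINT s:{0..t}|lborel. \<alpha> * (exp (\<alpha> * s) * cov q s) + exp (\<alpha> * s) * step_slice q s) =
      exp (\<alpha> * t) * cov q t - exp (\<alpha> * 0) * cov q 0"
  proof (rule set_lebesgue_integral_FTC_strong[where S="{0, q}", OF t])
    fix s assume "s \<notin> {0, q}"
    then have "(cov q has_real_derivative step_slice q s) (at s)" by (intro cov_derivative) auto
    moreover have "((\<lambda>s. exp (\<alpha> * s)) has_real_derivative \<alpha> * exp (\<alpha> * s)) (at s)"
      by (auto intro!: derivative_eq_intros)
    ultimately have "((\<lambda>s. exp (\<alpha> * s) * cov q s) has_real_derivative (\<alpha> * exp (\<alpha> * s)) * cov q s + step_slice q s * exp (\<alpha> * s)) (at s)"
      by (rule DERIV_mult[rotated])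
    then show "((\<lambda>s. exp (\<alpha> * s) * cov q s) has_real_derivative \<alpha> * (exp (\<alpha> * s) * cov q s) + exp (\<alpha> * s) * step_slice q s) (at s)"
      by (simp add: mult_ac)
  qed (auto intro!: continuous_intros continuous_on_step_slice continuous_on_cov)
  then have eq: "(LINT s:{0..t}|lborel. exp (\<alpha> * s) * step_slice q s) =
      exp (\<alpha> * t) * cov q t - \<alpha> * (LINT s:{0..t}|lborel. exp (\<alpha> * s) * cov q s)"
    using i by (simp add: set_integral_add)
  have "fbm_inner H (fbm_step q) (ou_kernel t) = (\<integral>s. step_slice q s * ou_kernel t s \<partial>lborel)"
    by (rule fbm_inner_step[OF ou_kernel_adm[OF t]])
  also have "... = (\<integral>s. exp (- \<alpha> * t) * (indicator {0..t} s * (exp (\<alpha> * s) * step_slice q s)) \<partial>lborel)"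
  proof (rule integral_cong_AE)
    show "AE s in lborel. step_slice q s * ou_kernel t s = exp (- \<alpha> * t) * (indicator {0..t} s * (exp (\<alpha> * s) * step_slice q s))"
      using AE_lborel_singleton[of "0::real"]
      by eventually_elim (auto simp: ou_kernel_def indicator_def mult_exp_exp algebra_simps)
  qed (unfold ou_kernel_def, measurable)
  also have "... = exp (- \<alpha> * t) * (LINT s:{0..t}|lborel. exp (\<alpha> * s) * step_slice q s)"
    by (simp add: set_lebesgue_integral_def)
  also have "... = (exp (- \<alpha> * t) * exp (\<alpha> * t)) * cov q t - \<alpha> * (exp (- \<alpha> * t) * (LINT s:{0..t}|lborel. exp (\<alpha> * s) * cov q s))"
    unfolding eq by (simp add: algebra_simps)
  also have "exp (- \<alpha> * t) * exp (\<alpha> * t) = 1" by (simp add: exp_minus)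
  finally show ?thesis by (simp add: ou_filter_def ou_integral_def)
qed

text \<open>Here Y is any square integrable variable. It need not belong to the first chaos, so
  \<open>gauss_hilbert_eq_zero\<close> cannot replace this.\<close>

lemma gauss_hilbert_orthogonal:
  assumes W: "W \<in> gauss_hilbert" and [measurable]: "Y \<in> borel_measurable M" and Y: "integrable M (\<lambda>w. (Y w)\<^sup>2)"
    and orth: "\<And>s. expectation (\<lambda>w. Y w * B s w) = 0"
  shows "expectation (\<lambda>w. Y w * W w) = 0"
proof -
  note [measurable] = G.meas[OF W]
  define y where "y = expectation (\<lambda>w. (Y w)\<^sup>2)"
  have y0: "0 \<le> y" by (simp add: y_def)
  have "\<bar>expectation (\<lambda>w. Y w * W w)\<bar> \<le> e" if e: "e > 0" for e
  proof -
    \<comment> \<open>With this squared distance the Cauchy-Schwarz bound is e * sqrt y / (sqrt y +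
      1), which is at most e also when y = 0.\<close>
    define d where "d = (e / (sqrt y + 1))\<^sup>2"
    have s1: "sqrt y + 1 > 0" using real_sqrt_ge_zero[OF y0] by linarith
    then have d: "d > 0" using e by (simp add: d_def)
    then obtain c T where cT: "finite T" "expectation (\<lambda>w. (comb c T w - W w)\<^sup>2) < d"
      using W unfolding gauss_hilbert_def by blast
    have i: "integrable M (\<lambda>w. Y w * comb c T w)" "integrable M (\<lambda>w. Y w * B t w)" "integrable M (\<lambda>w. Y w * W w)" for t
      by (intro integrable_mult_of_square Y comb_square_integrable cT(1) B_square_integrable G.sq[OF W]; simp)+
    have "expectation (\<lambda>w. Y w * comb c T w) = expectation (\<lambda>w. \<Sum>t\<in>T. c t * (Y w * B t w))"
      by (simp add: comb_def sum_distrib_left mult_ac)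
    also have "... = 0"
      by (subst Bochner_Integration.integral_sum) (auto simp: i orth)
    finally have z: "expectation (\<lambda>w. Y w * comb c T w) = 0" .
    have "\<bar>expectation (\<lambda>w. Y w * W w)\<bar> = \<bar>expectation (\<lambda>w. Y w * comb c T w - Y w * W w)\<bar>"
      using i z by simp
    also have "... = \<bar>expectation (\<lambda>w. Y w * (comb c T w - W w))\<bar>"
      by (simp add: right_diff_distrib)
    also have "... \<le> sqrt y * sqrt (expectation (\<lambda>w. (comb c T w - W w)\<^sup>2))"
      unfolding y_def by (intro abs_integral_mult_le Y G.sq[OF W] integrable_square_add comb_square_integrable cT(1)) auto
    also have "... \<le> sqrt y * sqrt d" using cT(2) by (intro mult_left_mono real_sqrt_le_mono) (auto simp: y0)
    also have "sqrt d = e / (sqrt y + 1)" using e s1 by (simp add: d_def)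
    also have "sqrt y * (e / (sqrt y + 1)) = e * (sqrt y / (sqrt y + 1))" by simp
    also have "... \<le> e * 1" using e s1 by (intro mult_left_mono) auto
    finally show ?thesis by simp
  qed
  then have "\<bar>expectation (\<lambda>w. Y w * W w)\<bar> \<le> 0" by (meson dense_ge)
  then show ?thesis by simp
qed

text \<open>It is not known beforehand that \<open>Z w t\<close> belongs to the first chaos. Let W
  be an abstract Wiener integral of the same kernel. The difference Z - W is orthogonal to all
  \<open>B s\<close>, hence to W by density and to Z by \<open>Z_inner\<close>, as the filter of the
  zero function is zero. So it is orthogonal to itself.\<close>

lemma wiener_Z:
  assumes t: "t \<ge> 0" shows "wiener (ou_kernel t) (\<lambda>w. Z w t)"
proof -
  obtain W where W: "wiener (ou_kernel t) W" using wiener_exists[OF ou_kernel_adm[OF t]] by blast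
  note [measurable] = wiener_meas(2)[OF W]
  have ZB: "expectation (\<lambda>w. Z w t * B s w) = fbm_inner H (fbm_step s) (ou_kernel t)" for s
  proof -
    have "expectation (\<lambda>w. Z w t * B s w) = ou_filter \<alpha> (\<lambda>r. expectation (\<lambda>w. B s w * B r w)) t"
      using Z_inner[OF t _ B_square_integrable, of s] by (simp add: mult.commute)
    then show ?thesis by (simp add: B_cov fbm_inner_ou_kernel[OF t])
  qed
  define Y where "Y = (\<lambda>w. Z w t - W w)"
  have [measurable]: "Y \<in> borel_measurable M" unfolding Y_def by measurable
  have Y2: "integrable M (\<lambda>w. (Y w)\<^sup>2)"
    unfolding Y_def by (intro integrable_square_add Z_square t wiener_meas(4)[OF W]) auto
  have i: "integrable M (\<lambda>w. Z w t * B s w)" "integrable M (\<lambda>w. W w * B s w)"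
      "integrable M (\<lambda>w. Y w * Z w t)" "integrable M (\<lambda>w. Y w * W w)" for s
    by (intro integrable_mult_of_square Z_square t wiener_meas(4)[OF W] B_square_integrable Y2; simp)+
  have YB: "expectation (\<lambda>w. Y w * B s w) = 0" for s
    unfolding Y_def left_diff_distrib using i ZB wiener_meas(5)[OF W] by simp
  have "expectation (\<lambda>w. Y w * Z w t) = 0"
    unfolding Z_inner[OF t \<open>Y \<in> borel_measurable M\<close> Y2] YB
    by (simp add: ou_filter_def ou_integral_def set_lebesgue_integral_def)
  moreover have "expectation (\<lambda>w. Y w * W w) = 0"
    by (rule gauss_hilbert_orthogonal[OF wiener_meas(1)[OF W] _ Y2 YB]) simp
  moreover have "expectation (\<lambda>w. (Y w)\<^sup>2) = expectation (\<lambda>w. Y w * Z w t) - expectation (\<lambda>w. Y w * W w)"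
    using i by (simp add: Bochner_Integration.integral_diff[symmetric] Y_def power2_eq_square right_diff_distrib del: Bochner_Integration.integral_diff)
  ultimately have "expectation (\<lambda>w. (Y w)\<^sup>2) = 0" by simp
  then have "AE w in M. (Y w)\<^sup>2 = 0" using Y2 by (subst (asm) integral_nonneg_eq_0_iff_AE) auto
  then have "AE w in M. Z w t = W w" by (simp add: Y_def)
  from gauss_hilbert_AE_cong[OF wiener_meas(1)[OF W] Zt_measurable this]
  show ?thesis using ZB Zt_path_measurable by (simp add: wiener_def)
qed

section \<open>The covariance of Z\<close>

definition Zcov :: "real => real => real" where "Zcov s t = expectation (\<lambda>w. Z w s * Z w t)"

lemma Zcov_eq: "s \<ge> 0 ==> t \<ge> 0 ==> Zcov s t = fbm_inner H (ou_kernel s) (ou_kernel t)"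
  unfolding Zcov_def by (intro wiener_isometry ou_kernel_adm wiener_Z)

lemma ou_kernel_nonneg [simp]: "0 \<le> ou_kernel t r" by (simp add: ou_kernel_def)

lemma fbm_inner_mono:
  assumes "adm f" "adm g" and f: "\<And>x. 0 \<le> f x" "\<And>x. f x \<le> g x"
  shows "fbm_inner H f f \<le> fbm_inner H g g"
  unfolding fbm_inner_altdef
proof (rule mult_left_mono)
  show "(\<integral>(r, s). f r * f s * kernel r s \<partial>(lborel \<Otimes>\<^sub>M lborel)) \<le> (\<integral>(r, s). g r * g s * kernel r s \<partial>(lborel \<Otimes>\<^sub>M lborel))"
  proof (intro integral_mono fbm_inner_integrable assms)
    fix x :: "real \<times> real"
    have "f (fst x) * f (snd x) * kernel (fst x) (snd x) \<le> g (fst x) * g (snd x) * kernel (fst x) (snd x)"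
      using f order_trans[OF f] by (intro mult_right_mono mult_mono) auto
    then show "(case x of (r, s) => f r * f s * kernel r s) \<le> (case x of (r, s) => g r * g s * kernel r s)"
      by (simp add: case_prod_beta)
  qed
qed (use H_gt in simp)

lemma Zcov_nonneg: "s \<ge> 0 ==> t \<ge> 0 ==> 0 \<le> Zcov s t"
  unfolding Zcov_eq fbm_inner_altdef using H_gt
  by (intro mult_nonneg_nonneg Bochner_Integration.integral_nonneg) auto

text \<open>The inner integral of the kernel against \<open>ou_kernel t\<close> is split at distance
  1 from the diagonal: the near part gives 2 / (2H - 1), and the far part, where the kernel is at
  most 1, gives 1 / \<alpha>. The outer integral contributes another 1 / \<alpha>.\<close>

definition Zbound :: real where "Zbound = H * (2 * H - 1) * ((2 / (2 * H - 1) + 1 / \<alpha>) / \<alpha>)"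

lemma Zbound_nonneg: "0 \<le> Zbound"
  using H_gt \<alpha>_pos by (simp add: Zbound_def)

lemma ou_kernel_integral_le: "t \<ge> 0 ==> (\<integral>r. ou_kernel t r \<partial>lborel) \<le> 1 / \<alpha>"
proof -
  assume t: "t \<ge> 0"
  have "(\<integral>r. ou_kernel t r \<partial>lborel) = (\<integral>r. exp (- \<alpha> * t) * (indicator {0..t} r * exp (\<alpha> * r)) \<partial>lborel)"
  proof (rule integral_cong_AE)
    show "AE s in lborel. ou_kernel t s = exp (- \<alpha> * t) * (indicator {0..t} s * exp (\<alpha> * s))"
      using AE_lborel_singleton[of "0::real"]
      by eventually_elim (auto simp: ou_kernel_def indicator_def mult_exp_exp algebra_simps)
  qed (unfold ou_kernel_def, measurable)
  also have "... = exp (- \<alpha> * t) * (LINT r:{0..t}|lborel. exp (\<alpha> * r))" by (simp add: set_lebesgue_integral_def)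
  also have "... = (1 - exp (- \<alpha> * t)) / \<alpha>"
    using \<alpha>_pos t by (subst set_integral_exp) (auto simp: exp_minus field_simps)
  also have "... \<le> 1 / \<alpha>" using \<alpha>_pos by (intro divide_right_mono) auto
  finally show ?thesis .
qed

lemma Zcov_diag_le: assumes t: "t \<ge> 0" shows "Zcov t t \<le> Zbound"
proof -
  have p: "2 * H - 1 > 0" using H_gt by simp
  note adm = ou_kernel_admissible[OF t]
  have inner: "(\<integral>r. ou_kernel t r * kernel r s \<partial>lborel) \<le> 2 / (2 * H - 1) + 1 / \<alpha>" for s
  proof -
    have "(\<integral>r. ou_kernel t r * kernel r s \<partial>lborel) \<le> (\<integral>r. indicator {s-1..s+1} r * kernel r s + ou_kernel t r \<partial>lborel)"
    proof (rule integral_mono)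
      show "integrable lborel (\<lambda>r. ou_kernel t r * kernel r s)" by (rule admissible_kernel_integrable[OF adm])
      show "integrable lborel (\<lambda>r. indicator {s-1..s+1} r * kernel r s + ou_kernel t r)"
        by (intro Bochner_Integration.integrable_add kernel_integrable admissible_integrable[OF adm]) simp
      fix r
      have k1: "ou_kernel t r \<le> 1" using admissible_bound(1)[OF adm, of r] by simp
      show "ou_kernel t r * kernel r s \<le> indicator {s-1..s+1} r * kernel r s + ou_kernel t r"
      proof (cases "r \<in> {s-1..s+1}")
        case True
        then show ?thesis using mult_right_mono[OF k1, of "kernel r s"] ou_kernel_nonneg[of t r] by (simp add: add_increasing2)
      next
        case False
        then have "\<bar>r - s\<bar> \<ge> 1" by auto
        then have "kernel r s \<le> 1" unfolding kernel_def using H_lt powr_mono[of "2 * H - 2" 0 "\<bar>r - s\<bar>"] by (simp split: if_splits)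
        then show ?thesis using False mult_left_mono[of "kernel r s" 1 "ou_kernel t r"] by simp
      qed
    qed
    also have "... = (\<integral>r. indicator {s-1..s+1} r * kernel r s \<partial>lborel) + (\<integral>r. ou_kernel t r \<partial>lborel)"
      by (intro Bochner_Integration.integral_add kernel_integrable admissible_integrable[OF adm]) simp
    also have "(\<integral>r. indicator {s-1..s+1} r * kernel r s \<partial>lborel) = 2 / (2 * H - 1)"
      by (subst kernel_integral) (auto simp: signed_powr_def)
    finally show ?thesis using ou_kernel_integral_le[OF t] by simp
  qed
  have C: "2 / (2 * H - 1) + 1 / \<alpha> \<ge> 0" using p \<alpha>_pos by simp
  have "(\<integral>s. ou_kernel t s * (\<integral>r. ou_kernel t r * kernel r s \<partial>lborel) \<partial>lborel) \<le>
      (\<integral>s. ou_kernel t s * (2 / (2 * H - 1) + 1 / \<alpha>) \<partial>lborel)"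
  proof (rule integral_mono_AE')
    show "integrable lborel (\<lambda>s. ou_kernel t s * (2 / (2 * H - 1) + 1 / \<alpha>))"
      by (intro integrable_mult_left admissible_integrable[OF adm])
    show "AE s in lborel. ou_kernel t s * (\<integral>r. ou_kernel t r * kernel r s \<partial>lborel) \<le> ou_kernel t s * (2 / (2 * H - 1) + 1 / \<alpha>)"
      by (intro AE_I2 mult_left_mono inner) simp
    show "AE s in lborel. 0 \<le> ou_kernel t s * (2 / (2 * H - 1) + 1 / \<alpha>)"
      using C by (intro AE_I2 mult_nonneg_nonneg) auto
  qed
  also have "... = (\<integral>s. ou_kernel t s \<partial>lborel) * (2 / (2 * H - 1) + 1 / \<alpha>)" by simp
  also have "... \<le> (1 / \<alpha>) * (2 / (2 * H - 1) + 1 / \<alpha>)"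
    by (rule mult_right_mono[OF ou_kernel_integral_le[OF t] C])
  finally have "(\<integral>s. ou_kernel t s * (\<integral>r. ou_kernel t r * kernel r s \<partial>lborel) \<partial>lborel) \<le> (2 / (2 * H - 1) + 1 / \<alpha>) / \<alpha>"
    by simp
  then show ?thesis
    unfolding Zcov_eq[OF t t] fbm_inner_altdef admissible_kernel_pair(2)[OF adm adm] Zbound_def
    using H_gt p by (intro mult_left_mono) auto
qed

text \<open>The kernel is nonnegative, so the norm is monotone on nonnegative functions. On (t - 1,
  t] the function \<open>ou_kernel t\<close> is at least exp(-\<alpha>), and the indicator of this
  interval has norm 1, being the variance of an increment over unit time. The interval must lie in
  the positive half-line, whence t \<ge> 1.\<close>

lemma Zcov_diag_ge: assumes t: "t \<ge> 1" shows "exp (- 2 * \<alpha>) \<le> Zcov t t"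
proof -
  define f where "f = (\<lambda>x. fbm_step t x - fbm_step (t - 1) x)"
  have f: "adm f" unfolding f_def by (intro adm_intros)
  have fi: "f x = indicator {t-1<..t} x" for x unfolding f_def by (rule fbm_step_diff) simp
  have "fbm_inner H f f = cov t t - 2 * cov t (t - 1) + cov (t - 1) (t - 1)"
    unfolding f_def by (subst fbm_inner_diff_diff) (auto intro: adm_intros simp: fbm_inner_step_step)
  also have "... = 1" by (simp add: cov_def field_simps)
  finally have f1: "fbm_inner H f f = 1" .
  have ef: "adm (\<lambda>x. exp (- \<alpha>) * f x)" by (intro adm_intros f)
  have "fbm_inner H (\<lambda>x. exp (- \<alpha>) * f x) (\<lambda>x. exp (- \<alpha>) * f x) = exp (- \<alpha>) * exp (- \<alpha>) * fbm_inner H f f"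
    by (simp only: fbm_inner_scale_right fbm_inner_sym[OF ef f] mult.assoc)
  also have "... = exp (- 2 * \<alpha>)" by (simp add: f1 mult_exp_exp)
  finally have "exp (- 2 * \<alpha>) = fbm_inner H (\<lambda>x. exp (- \<alpha>) * f x) (\<lambda>x. exp (- \<alpha>) * f x)" ..
  also have "... \<le> fbm_inner H (ou_kernel t) (ou_kernel t)"
  proof (rule fbm_inner_mono[OF ef ou_kernel_adm])
    show "exp (- \<alpha>) * f x \<le> ou_kernel t x" for x
    proof (cases "x \<in> {t-1<..t}")
      case True
      then have "- \<alpha> * 1 \<le> - \<alpha> * (t - x)" using \<alpha>_pos by (intro mult_left_mono_neg) auto
      then show ?thesis using True t by (simp add: fi ou_kernel_def)
    qed (simp add: fi)
  qed (use t in \<open>auto simp: fi\<close>)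
  finally show ?thesis using t by (simp add: Zcov_eq)
qed

lemma Z_in: "t \<ge> 0 ==> (\<lambda>w. Z w t) \<in> gauss_hilbert"
  using wiener_Z wiener_meas(1) by blast

lemma Z_var_le: "t \<ge> 0 ==> expectation (\<lambda>w. (Z w t)\<^sup>2) \<le> Zbound"
  using Zcov_diag_le[of t] by (simp add: Zcov_def power2_eq_square)

lemma Zcov_abs_le:
  assumes "s \<ge> 0" "t \<ge> 0" shows "\<bar>Zcov s t\<bar> \<le> Zbound"
proof -
  have "\<bar>Zcov s t\<bar> \<le> sqrt (expectation (\<lambda>w. (Z w s)\<^sup>2)) * sqrt (expectation (\<lambda>w. (Z w t)\<^sup>2))"
    unfolding Zcov_def by (intro abs_integral_mult_le Z_square assms) auto
  also have "... \<le> sqrt Zbound * sqrt Zbound"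
    using Z_var_le assms Zbound_nonneg by (intro mult_mono real_sqrt_le_mono) auto
  also have "... = Zbound"
    using Zbound_nonneg by simp
  finally show ?thesis .
qed

lemma Zcov_measurable [measurable]: "case_prod Zcov \<in> borel_measurable (borel \<Otimes>\<^sub>M borel)"
proof -
  have "(\<lambda>(x, w). Z w (fst x) * Z w (snd x)) \<in> borel_measurable ((borel \<Otimes>\<^sub>M borel) \<Otimes>\<^sub>M M)" by measurable
  from borel_measurable_lebesgue_integral[OF this] show ?thesis
    by (simp add: Zcov_def case_prod_beta')
qed

section \<open>Second moments of time integrals of Z\<close>

definition Zcov_mass :: "real => real" where
  "Zcov_mass T = (LINT s:{0..T}|lborel. LINT t:{0..T}|lborel. Zcov s t)"

text \<open>Since \<open>\<alpha> * \<integral> Z = B - Z\<close>, the integrated covariance grows like the variance of \<open>B\<close>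
  only, whence all time averages below converge.\<close>

lemma Zcov_mass_le:
  assumes T: "T \<ge> 0" shows "Zcov_mass T \<le> (2 * T powr (2 * H) + 2 * Zbound) / \<alpha>\<^sup>2"
proof -
  let ?I = "\<lambda>w. LINT s:{0..T}|lborel. Z w s"
  have Zm: "(\<lambda>(w, s). Z w s) \<in> borel_measurable (M \<Otimes>\<^sub>M borel)" by measurable
  have sq: "integrable M (\<lambda>w. (?I w)\<^sup>2)" and e: "expectation (\<lambda>w. (?I w)\<^sup>2) = Zcov_mass T"
    unfolding Zcov_mass_def Zcov_def
    by (rule process_square[OF Zm T]; use Z_square Z_var_le in auto)+
  have "\<alpha>\<^sup>2 * Zcov_mass T = expectation (\<lambda>w. (\<alpha> * ?I w)\<^sup>2)" by (simp add: e[symmetric] power_mult_distrib)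
  also have "... \<le> expectation (\<lambda>w. 2 * (B T w)\<^sup>2 + 2 * (Z w T)\<^sup>2)"
  proof (rule integral_mono_AE)
    show "integrable M (\<lambda>w. (\<alpha> * ?I w)\<^sup>2)" using sq by (simp add: power_mult_distrib)
    show "integrable M (\<lambda>w. 2 * (B T w)\<^sup>2 + 2 * (Z w T)\<^sup>2)" using B_square_integrable Z_square[OF T] by simp
    show "AE w in M. (\<alpha> * ?I w)\<^sup>2 \<le> 2 * (B T w)\<^sup>2 + 2 * (Z w T)\<^sup>2"
      using AE_good
    proof eventually_elim
      case (elim w)
      show ?case unfolding good_Z_integral[OF elim T] using square_sum_le[of "B T w" "- Z w T"] by simp
    qed
  qed
  also have "... = 2 * cov T T + 2 * expectation (\<lambda>w. (Z w T)\<^sup>2)"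
    using B_square_integrable Z_square[OF T] B_cov[of T T] by (simp add: power2_eq_square)
  also have "... \<le> 2 * T powr (2 * H) + 2 * Zbound" using Z_var_le[OF T] T by (simp add: cov_diag)
  finally show ?thesis using \<alpha>_pos by (simp add: field_simps)
qed

text \<open>The second moment of every time integral of Z or \<open>Z2\<close> below is a double
  integral of some \<open>h\<close>. Since the covariance of Z is nonnegative, bounded weights can
  be pulled out and only \<open>Zcov_mass\<close> has to be estimated.\<close>

lemma Zcov_double_integral_le:
  assumes T: "T \<ge> 0" and m: "(\<lambda>(s, t). h s t) \<in> borel_measurable (borel \<Otimes>\<^sub>M borel)"
    and C: "C \<ge> 0" and h: "\<And>s t. s \<in> {0..T} ==> t \<in> {0..T} ==> \<bar>h s t\<bar> \<le> C * Zcov s t"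
  shows "(LINT s:{0..T}|lborel. LINT t:{0..T}|lborel. h s t) \<le> C * Zcov_mass T"
proof -
  have hm [measurable]: "case_prod h \<in> borel_measurable (borel \<Otimes>\<^sub>M borel)" using m by simp
  define K where "K = Zbound"
  have K: "\<bar>Zcov s t\<bar> \<le> K" if "s \<in> {0..T}" "t \<in> {0..T}" for s t using Zcov_abs_le that by (auto simp: K_def)
  have K0: "K \<ge> 0" using K[of 0 0] T by auto
  have si: "set_integrable lborel {0..T} g" if [measurable]: "g \<in> borel_measurable borel" and g: "\<And>s. s \<in> {0..T} ==> \<bar>g s\<bar> \<le> D"
    for g :: "real => real" and D
    unfolding set_integrable_def
  proof (rule Bochner_Integration.integrable_bound)
    show "integrable lborel (\<lambda>s. D * indicator {0..T} s)" by simp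
    show "AE s in lborel. norm (indicator {0..T} s *\<^sub>R g s) \<le> norm (D * indicator {0..T} s)"
      using g by (intro AE_I2) (auto simp: indicator_def intro: order_trans[OF _ abs_ge_self])
  qed measurable
  have sm: "(\<lambda>t. f s t) \<in> borel_measurable borel" if "case_prod f \<in> borel_measurable (borel \<Otimes>\<^sub>M borel)" for f :: "real => real => real" and s
    using measurable_compose[OF measurable_Pair1' that, of s] by simp
  have hb: "\<bar>h s t\<bar> \<le> C * K" if "s \<in> {0..T}" "t \<in> {0..T}" for s t
    using h[OF that] mult_left_mono[OF order_trans[OF abs_ge_self K[OF that]] C] by linarith
  have i1: "set_integrable lborel {0..T} (h s)" "set_integrable lborel {0..T} (Zcov s)" if "s \<in> {0..T}" for s
    using si[OF sm[OF hm] hb[OF that]] si[OF sm[OF Zcov_measurable] K[OF that]] by simp_all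
  have le1: "(LINT t:{0..T}|lborel. h s t) \<le> C * (LINT t:{0..T}|lborel. Zcov s t)" if s: "s \<in> {0..T}" for s
  proof -
    have "(LINT t:{0..T}|lborel. h s t) \<le> (LINT t:{0..T}|lborel. C * Zcov s t)"
      using h[OF s] i1[OF s] by (intro set_integral_mono) (auto intro: order_trans[OF abs_ge_self])
    then show ?thesis by simp
  qed
  have bd: "\<bar>LINT t:{0..T}|lborel. g t\<bar> \<le> D * T" if g: "set_integrable lborel {0..T} g" "\<And>s. s \<in> {0..T} ==> \<bar>g s\<bar> \<le> D" for g :: "real => real" and D
  proof -
    have "\<bar>LINT t:{0..T}|lborel. g t\<bar> \<le> (LINT t:{0..T}|lborel. \<bar>g t\<bar>)" using set_integral_norm_bound[OF g(1)] by simp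
    also have "... \<le> (LINT t:{0..T}|lborel. D)"
      using g by (intro set_integral_mono set_integrable_abs) (auto simp: set_integrable_def)
    also have "... = D * T" using T by (simp add: set_lebesgue_integral_def)
    finally show ?thesis .
  qed
  have o1: "(\<lambda>s. LINT t:{0..T}|lborel. h s t) \<in> borel_measurable borel" "(\<lambda>s. LINT t:{0..T}|lborel. Zcov s t) \<in> borel_measurable borel"
    unfolding set_lebesgue_integral_def by measurable
  have "(LINT s:{0..T}|lborel. LINT t:{0..T}|lborel. h s t) \<le> (LINT s:{0..T}|lborel. C * (LINT t:{0..T}|lborel. Zcov s t))"
  proof (rule set_integral_mono[OF _ _ le1])
    show "set_integrable lborel {0..T} (\<lambda>s. LINT t:{0..T}|lborel. h s t)"
      by (rule si[OF o1(1)]) (rule bd[OF i1(1) hb])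
    show "set_integrable lborel {0..T} (\<lambda>s. C * (LINT t:{0..T}|lborel. Zcov s t))"
      by (rule set_integrable_mult_right[OF si[OF o1(2)]]) (rule bd[OF i1(2) K])
  qed
  then show ?thesis by (simp add: Zcov_mass_def)
qed

lemma weighted_average_square:
  assumes T: "T \<ge> 0" and [measurable]: "g \<in> borel_measurable borel" and g: "\<And>s. s \<in> {0..T} ==> \<bar>g s\<bar> \<le> C"
  shows "integrable M (\<lambda>w. (LINT s:{0..T}|lborel. g s * Z w s)\<^sup>2)"
    and "expectation (\<lambda>w. (LINT s:{0..T}|lborel. g s * Z w s)\<^sup>2) \<le> C\<^sup>2 * Zcov_mass T"
proof -
  have m: "(\<lambda>(w, s). g s * Z w s) \<in> borel_measurable (M \<Otimes>\<^sub>M borel)" by measurable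
  have C: "C \<ge> 0" using g[of 0] T by auto
  have i: "integrable M (\<lambda>w. (g s * Z w s)\<^sup>2)" if "s \<in> {0..T}" for s
    using Z_square that by (simp add: power_mult_distrib)
  have b: "expectation (\<lambda>w. (g s * Z w s)\<^sup>2) \<le> C\<^sup>2 * Zbound" if "s \<in> {0..T}" for s
  proof -
    have "(g s)\<^sup>2 \<le> C\<^sup>2" using g[OF that] by (rule power2_le_iff_abs_le[OF C, THEN iffD2])
    then have "(g s)\<^sup>2 * expectation (\<lambda>w. (Z w s)\<^sup>2) \<le> C\<^sup>2 * Zbound"
      using Z_var_le[of s] that by (intro mult_mono) auto
    then show ?thesis by (simp add: power_mult_distrib)
  qed
  show "integrable M (\<lambda>w. (LINT s:{0..T}|lborel. g s * Z w s)\<^sup>2)" by (rule process_square(1)[OF m T i b])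
  have "expectation (\<lambda>w. (LINT s:{0..T}|lborel. g s * Z w s)\<^sup>2) =
      (LINT s:{0..T}|lborel. LINT t:{0..T}|lborel. expectation (\<lambda>w. g s * Z w s * (g t * Z w t)))"
    by (rule process_square(2)[OF m T i b])
  also have "... = (LINT s:{0..T}|lborel. LINT t:{0..T}|lborel. g s * g t * Zcov s t)"
  proof -
    have "expectation (\<lambda>w. g s * Z w s * (g t * Z w t)) = g s * g t * Zcov s t" for s t
    proof -
      have "(\<lambda>w. g s * Z w s * (g t * Z w t)) = (\<lambda>w. (g s * g t) * (Z w s * Z w t))" by (simp add: fun_eq_iff)
      then show ?thesis by (simp add: Zcov_def)
    qed
    then show ?thesis by simp
  qed
  also have "... \<le> C\<^sup>2 * Zcov_mass T"
  proof (rule Zcov_double_integral_le[OF T])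
    show "(\<lambda>(s, t). g s * g t * Zcov s t) \<in> borel_measurable (borel \<Otimes>\<^sub>M borel)" by measurable
    fix s t assume st: "s \<in> {0..T}" "t \<in> {0..T}"
    have "\<bar>g s * g t * Zcov s t\<bar> = \<bar>g s\<bar> * \<bar>g t\<bar> * Zcov s t" using Zcov_nonneg st by (simp add: abs_mult)
    also have "... \<le> C * C * Zcov s t" using g st Zcov_nonneg C by (intro mult_right_mono mult_mono) auto
    finally show "\<bar>g s * g t * Zcov s t\<bar> \<le> C\<^sup>2 * Zcov s t" by (simp add: power2_eq_square)
  qed simp
  finally show "expectation (\<lambda>w. (LINT s:{0..T}|lborel. g s * Z w s)\<^sup>2) \<le> C\<^sup>2 * Zcov_mass T" .
qed

text \<open>The Wick square of Z, an element of the second chaos.\<close>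

definition Z2 :: "'a => real => real" where "Z2 w s = (Z w s)\<^sup>2 - Zcov s s"

lemma Z2_measurable [measurable]: "case_prod Z2 \<in> borel_measurable (M \<Otimes>\<^sub>M borel)"
proof -
  have "(\<lambda>s. Zcov s s) \<in> borel_measurable borel"
    using measurable_compose[OF measurable_Pair[OF measurable_ident measurable_ident] Zcov_measurable] by simp
  note [measurable] = this
  show ?thesis unfolding Z2_def[abs_def] by measurable
qed

lemma Z2_cov:
  assumes "s \<ge> 0" "t \<ge> 0"
  shows "integrable M (\<lambda>w. Z2 w s * Z2 w t)" "expectation (\<lambda>w. Z2 w s * Z2 w t) = 2 * (Zcov s t)\<^sup>2"
proof -
  have i: "integrable M (\<lambda>w. (Z w s)\<^sup>2 * (Z w t)\<^sup>2)" "integrable M (\<lambda>w. (Z w s)\<^sup>2)" "integrable M (\<lambda>w. (Z w t)\<^sup>2)"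
    using G.wick(1)[OF Z_in[OF assms(1)] Z_in[OF assms(2)]] Z_square assms by auto
  have e: "Z2 w s * Z2 w t = (Z w s)\<^sup>2 * (Z w t)\<^sup>2 - Zcov s s * (Z w t)\<^sup>2 - Zcov t t * (Z w s)\<^sup>2 + Zcov s s * Zcov t t" for w
    by (simp add: Z2_def algebra_simps)
  show "integrable M (\<lambda>w. Z2 w s * Z2 w t)" unfolding e using i by simp
  have v: "expectation (\<lambda>w. (Z w r)\<^sup>2) = Zcov r r" for r by (simp add: Zcov_def power2_eq_square)
  have "expectation (\<lambda>w. Z2 w s * Z2 w t) = expectation (\<lambda>w. (Z w s)\<^sup>2 * (Z w t)\<^sup>2) - Zcov s s * Zcov t t"
    unfolding e using i by (simp add: v prob_space)
  also have "... = 2 * (Zcov s t)\<^sup>2"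
    unfolding G.wick(2)[OF Z_in[OF assms(1)] Z_in[OF assms(2)]] v by (simp add: Zcov_def)
  finally show "expectation (\<lambda>w. Z2 w s * Z2 w t) = 2 * (Zcov s t)\<^sup>2" .
qed

lemma Z2_square:
  assumes "s \<ge> 0"
  shows "integrable M (\<lambda>w. (Z2 w s)\<^sup>2)" "expectation (\<lambda>w. (Z2 w s)\<^sup>2) \<le> 2 * Zbound\<^sup>2"
proof -
  show "integrable M (\<lambda>w. (Z2 w s)\<^sup>2)" using Z2_cov(1)[OF assms assms] by (simp add: power2_eq_square)
  have "(Zcov s s)\<^sup>2 \<le> Zbound\<^sup>2" using Zcov_nonneg[OF assms assms] Zcov_diag_le[OF assms] by (intro power_mono)
  then show "expectation (\<lambda>w. (Z2 w s)\<^sup>2) \<le> 2 * Zbound\<^sup>2"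
    using Z2_cov(2)[OF assms assms] by (simp add: power2_eq_square)
qed

text \<open>By Wick's formula the covariance of \<open>Z2\<close> is twice the square of
  \<open>Zcov\<close>. Bounding one of the two factors by \<open>Zbound\<close> leaves
  \<open>Zcov_mass\<close>, whose growth is already known.\<close>

lemma Z2_average_square:
  assumes T: "T \<ge> 0"
  shows "integrable M (\<lambda>w. (LINT s:{0..T}|lborel. Z2 w s)\<^sup>2)"
    and "expectation (\<lambda>w. (LINT s:{0..T}|lborel. Z2 w s)\<^sup>2) \<le> 2 * Zbound * Zcov_mass T"
proof -
  have m: "(\<lambda>(w, s). Z2 w s) \<in> borel_measurable (M \<Otimes>\<^sub>M borel)" by measurable
  have i: "integrable M (\<lambda>w. (Z2 w s)\<^sup>2)" and b: "expectation (\<lambda>w. (Z2 w s)\<^sup>2) \<le> 2 * Zbound\<^sup>2" if "s \<in> {0..T}" for s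
    using Z2_square[of s] that by auto
  show "integrable M (\<lambda>w. (LINT s:{0..T}|lborel. Z2 w s)\<^sup>2)" by (rule process_square(1)[OF m T i b])
  have "expectation (\<lambda>w. (LINT s:{0..T}|lborel. Z2 w s)\<^sup>2) =
      (LINT s:{0..T}|lborel. LINT t:{0..T}|lborel. expectation (\<lambda>w. Z2 w s * Z2 w t))"
    by (rule process_square(2)[OF m T i b])
  also have "... = (LINT s:{0..T}|lborel. LINT t:{0..T}|lborel. 2 * (Zcov s t)\<^sup>2)"
    by (intro set_lebesgue_integral_cong ballI allI impI) (auto simp: Z2_cov(2))
  also have "... \<le> 2 * Zbound * Zcov_mass T"
  proof (rule Zcov_double_integral_le[OF T])
    show "(\<lambda>(s, t). 2 * (Zcov s t)\<^sup>2) \<in> borel_measurable (borel \<Otimes>\<^sub>M borel)" by measurable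
    show "0 \<le> 2 * Zbound" using Zcov_abs_le[of 0 0] by simp
    fix s t assume "s \<in> {0..T}" "t \<in> {0..T}"
    then have "Zcov s t * Zcov s t \<le> Zbound * Zcov s t"
      using Zcov_abs_le[of s t] Zcov_nonneg[of s t] by (intro mult_right_mono) auto
    then show "\<bar>2 * (Zcov s t)\<^sup>2\<bar> \<le> 2 * Zbound * Zcov s t" by (simp add: power2_eq_square)
  qed
  finally show "expectation (\<lambda>w. (LINT s:{0..T}|lborel. Z2 w s)\<^sup>2) \<le> 2 * Zbound * Zcov_mass T" .
qed

end

section \<open>Integration by parts for smooth functionals of the path\<close>

lemma bounded_smooth_dep: "bounded_smooth k f ==> (\<And>i. i < k ==> x i = y i) ==> f x = f y"
  unfolding bounded_smooth_def by blast

lemma bounded_smooth_iter: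
  assumes "bounded_smooth k f" "set is \<subseteq> {..<k}"
  shows "continuous_on UNIV (iter_partial is f)" "bounded (range (iter_partial is f))"
  using assms unfolding bounded_smooth_def by blast+

lemma bounded_smooth_cont: "bounded_smooth k f ==> continuous_on UNIV f"
  using bounded_smooth_iter(1)[of k f "[]"] by (simp add: iter_partial_def)

lemma bounded_smooth_bdd: "bounded_smooth k f ==> bounded (range f)"
  using bounded_smooth_iter(2)[of k f "[]"] by (simp add: iter_partial_def)

lemma bounded_smooth_deriv:
  assumes f: "bounded_smooth k f" and i: "i < k"
  shows "((\<lambda>y. f (x(i := y))) has_real_derivative partial_deriv i f x) (at (x i))"
proof -
  have "(\<lambda>y. iter_partial [] f (x(i := y))) differentiable (at (x i))"
    using f i unfolding bounded_smooth_def by (metis empty_iff empty_set subsetI)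
  then show ?thesis
    unfolding partial_deriv_def iter_partial_def by (simp add: DERIV_deriv_iff_real_differentiable)
qed

text \<open>As \<open>iter_partial\<close> applies the last index of its list first, a derivative
  taken beforehand appears at the end of the list.\<close>

lemma bounded_smooth_partial:
  assumes f: "bounded_smooth k f" and i: "i < k"
  shows "bounded_smooth k (partial_deriv i f)"
proof -
  have it: "iter_partial is (partial_deriv i f) = iter_partial (is @ [i]) f" for "is"
    by (simp add: iter_partial_def)
  have dep: "partial_deriv i f x = partial_deriv i f y" if "\<forall>j<k. x j = y j" for x y
  proof -
    have "(\<lambda>z. f (x(i := z))) = (\<lambda>z. f (y(i := z)))"
      using that by (intro ext bounded_smooth_dep[OF f]) auto
    then show ?thesis using that i by (simp add: partial_deriv_def)
  qed
  show ?thesis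
    unfolding bounded_smooth_def it
  proof (intro conjI allI impI)
    fix x y :: "nat => real" assume "\<forall>j<k. x j = y j" then show "partial_deriv i f x = partial_deriv i f y" by (rule dep)
  next
    fix "is" assume "set is \<subseteq> {..<k}"
    then have s: "set (is @ [i]) \<subseteq> {..<k}" using i by auto
    show "continuous_on UNIV (iter_partial (is @ [i]) f)" "bounded (range (iter_partial (is @ [i]) f))"
      by (rule bounded_smooth_iter[OF f s])+
    show "(\<lambda>y. iter_partial (is @ [i]) f (x(j := y))) differentiable (at (x j))" if "j < k" for j x
      using f s that unfolding bounded_smooth_def by blast
  qed
qed

lemma bounded_range_bound:
  assumes "bounded (range (f :: 'b => real))" obtains C where "C \<ge> 0" "\<And>x. \<bar>f x\<bar> \<le> C"
proof -
  obtain C where "\<And>x. \<bar>f x\<bar> \<le> C" using assms by (auto simp: bounded_iff)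
  then show ?thesis using that[of C] by (meson abs_ge_zero order_trans)
qed

lemma bounded_smooth_common_bound:
  assumes f: "bounded_smooth k f"
  obtains C where "C \<ge> 0" "\<And>x. \<bar>f x\<bar> \<le> C" "\<And>i x. i < k ==> \<bar>partial_deriv i f x\<bar> \<le> C"
proof -
  obtain C0 where C0: "C0 \<ge> 0" "\<And>x. \<bar>f x\<bar> \<le> C0" using bounded_range_bound[OF bounded_smooth_bdd[OF f]] by blast
  have "\<forall>i. \<exists>C. C \<ge> 0 \<and> (i < k --> (\<forall>x. \<bar>partial_deriv i f x\<bar> \<le> C))"
  proof
    fix i
    show "\<exists>C. C \<ge> 0 \<and> (i < k --> (\<forall>x. \<bar>partial_deriv i f x\<bar> \<le> C))"
    proof (cases "i < k")
      case True
      show ?thesis using bounded_range_bound[OF bounded_smooth_bdd[OF bounded_smooth_partial[OF f True]]] by metis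
    qed auto
  qed
  then obtain D where D: "\<And>i. D i \<ge> 0" "\<And>i x. i < k ==> \<bar>partial_deriv i f x\<bar> \<le> D i" by metis
  have s: "D i \<le> (\<Sum>i<k. D i)" if "i < k" for i using that D(1) by (intro member_le_sum) auto
  show ?thesis
  proof (rule that[of "C0 + (\<Sum>i<k. D i)"])
    show "0 \<le> C0 + (\<Sum>i<k. D i)" using C0 D by (simp add: sum_nonneg)
    show "\<bar>f x\<bar> \<le> C0 + (\<Sum>i<k. D i)" for x using C0(2)[of x] sum_nonneg[of "{..<k}" D] D by auto
    show "\<bar>partial_deriv i f x\<bar> \<le> C0 + (\<Sum>i<k. D i)" if "i < k" for i x
      using D(2)[OF that, of x] s[OF that] C0(1) by linarith
  qed
qed

lemma ou_integral_has_derivative: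
  assumes k: "continuous_on {0..T} k" and t: "0 < t" "t < T"
  shows "(ou_integral a k has_real_derivative ou_filter a k t) (at t)"
  using set_integral_has_derivative[OF continuous_on_ou_filter[OF k] t, of a]
proof (rule DERIV_cong_ev[THEN iffD1, rotated -1, OF _ refl _ refl])
  have "\<forall>\<^sub>F x in nhds t. x \<in> {0<..<T}" using t by (intro eventually_nhds_in_open) auto
  then show "\<forall>\<^sub>F x in nhds t. (LINT s:{0..x}|lborel. ou_filter a k s) = ou_integral a k x"
    by eventually_elim (rule set_integral_ou_filter[OF continuous_on_subset[OF k]], auto)
qed

context fbm_ou begin

definition functional :: "((nat => real) => real) => (nat => real) => 'a => real" where
  "functional f t w = f (\<lambda>i. B (t i) w)"

lemma functional_measurable_path:
  assumes "continuous_on UNIV f" shows "functional f t \<in> borel_measurable path_algebra"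
proof -
  have "(\<lambda>w i. B (t i) w) \<in> path_algebra \<rightarrow>\<^sub>M Pi\<^sub>M UNIV (\<lambda>_. borel)"
    by (rule measurable_PiM_single') auto
  then have "(\<lambda>w i. B (t i) w) \<in> path_algebra \<rightarrow>\<^sub>M (borel :: (nat => real) measure)"
    by (simp only: measurable_cong_sets[OF refl sets_PiM_equal_borel])
  from measurable_compose[OF this borel_measurable_continuous_onI[OF assms]] show ?thesis
    by (simp add: functional_def[abs_def])
qed

lemma functional_measurable: "continuous_on UNIV f ==> functional f t \<in> borel_measurable M"
  by (rule measurable_from_subalg[OF subalgebra_path_algebra functional_measurable_path])

lemma functional_square:
  assumes f: "bounded_smooth k f"
  shows "functional f t \<in> borel_measurable M" "integrable M (\<lambda>w. (functional f t w)\<^sup>2)" "integrable M (functional f t)"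
proof -
  obtain C where C: "C \<ge> 0" "\<And>x. \<bar>f x\<bar> \<le> C" using bounded_range_bound[OF bounded_smooth_bdd[OF f]] by blast
  show m [measurable]: "functional f t \<in> borel_measurable M" by (rule functional_measurable[OF bounded_smooth_cont[OF f]])
  show "integrable M (\<lambda>w. (functional f t w)\<^sup>2)"
  proof (rule integrable_const_bound[where B="C\<^sup>2"])
    show "AE w in M. norm ((functional f t w)\<^sup>2) \<le> C\<^sup>2"
      using C by (intro AE_I2) (simp add: functional_def power2_le_iff_abs_le)
  qed simp
  then show "integrable M (functional f t)" by (rule integrable_of_square[OF m])
qed

lemma ibp1:
  assumes f: "bounded_smooth k f" and W: "W \<in> gauss_hilbert"
  shows "expectation (\<lambda>w. functional f t w * W w) =
    (\<Sum>i<k. expectation (functional (partial_deriv i f) t) * expectation (\<lambda>w. B (t i) w * W w))"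
proof -
  obtain C where C: "C \<ge> 0" "\<And>x. \<bar>f x\<bar> \<le> C" "\<And>i x. i < k ==> \<bar>partial_deriv i f x\<bar> \<le> C"
    by (rule bounded_smooth_common_bound[OF f]) blast
  have le: "C \<le> C * (1 + (\<Sum>i<k. \<bar>x i\<bar>))" for x :: "nat => real"
    using C(1) mult_nonneg_nonneg[of C "\<Sum>i<k. \<bar>x i\<bar>"] by (simp add: distrib_left sum_nonneg)
  have "expectation (\<lambda>w. f (\<lambda>i. B (t i) w) * W w) =
    (\<Sum>i<k. expectation (\<lambda>w. partial_deriv i f (\<lambda>j. B (t j) w)) * expectation (\<lambda>w. B (t i) w * W w))"
  proof (rule G.stein[where U="\<lambda>i. B (t i)" and f=f and f'="\<lambda>i. partial_deriv i f" and C=C])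
    show "\<bar>f x\<bar> \<le> C * (1 + (\<Sum>i<k. \<bar>x i\<bar>))" for x by (rule order_trans[OF C(2) le])
    show "\<bar>partial_deriv i f x\<bar> \<le> C * (1 + (\<Sum>i<k. \<bar>x i\<bar>))" if "i < k" for i x by (rule order_trans[OF C(3)[OF that] le])
    show "f x = f y" if "\<And>i. i < k ==> x i = y i" for x y by (rule bounded_smooth_dep[OF f that])
    show "continuous_on UNIV f" by (rule bounded_smooth_cont[OF f])
    show "continuous_on UNIV (partial_deriv i f)" if "i < k" for i by (rule bounded_smooth_cont[OF bounded_smooth_partial[OF f that]])
    show "((\<lambda>y. f (x(i := y))) has_real_derivative partial_deriv i f x) (at (x i))" if "i < k" for i x
      by (rule bounded_smooth_deriv[OF f that])
  qed (auto intro: B_in W)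
  then show ?thesis by (simp add: functional_def[abs_def])
qed

text \<open>V is added as a further variable and \<open>G.stein\<close> is applied to f(x) times
  this variable. The product grows linearly, which is the growth that \<open>G.stein\<close> admits.
  The derivative in the new variable is f itself and produces the last summand.\<close>

lemma ibp2:
  assumes f: "bounded_smooth k f" and V: "V \<in> gauss_hilbert" and W: "W \<in> gauss_hilbert"
  shows "expectation (\<lambda>w. functional f t w * V w * W w) =
    (\<Sum>i<k. expectation (\<lambda>w. functional (partial_deriv i f) t w * V w) * expectation (\<lambda>w. B (t i) w * W w)) +
    expectation (functional f t) * expectation (\<lambda>w. V w * W w)"
proof -
  obtain C where C: "C \<ge> 0" "\<And>x. \<bar>f x\<bar> \<le> C" "\<And>i x. i < k ==> \<bar>partial_deriv i f x\<bar> \<le> C"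
    by (rule bounded_smooth_common_bound[OF f]) blast
  define U where "U = (\<lambda>i. if i < k then B (t i) else V)"
  define g where "g = (\<lambda>x. f x * x k)"
  \<comment> \<open>The last index k stands for the derivative in the variable that carries
    V.\<close>
  define g' where "g' = (\<lambda>i x. if i < k then partial_deriv i f x * x k else f x)"
  have le: "C * (1 + \<bar>x k\<bar>) \<le> C * (1 + (\<Sum>i<Suc k. \<bar>x i\<bar>))" for x :: "nat => real"
    using C(1) by (intro mult_left_mono) (auto simp: sum_nonneg)
  have fB: "f (\<lambda>i. U i w) = functional f t w" for w
    unfolding functional_def by (rule bounded_smooth_dep[OF f]) (simp add: U_def)
  have dB: "partial_deriv i f (\<lambda>i. U i w) = functional (partial_deriv i f) t w" if "i < k" for i w
    unfolding functional_def by (rule bounded_smooth_dep[OF bounded_smooth_partial[OF f that]]) (simp add: U_def)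
  have "expectation (\<lambda>w. g (\<lambda>i. U i w) * W w) =
    (\<Sum>i<Suc k. expectation (\<lambda>w. g' i (\<lambda>j. U j w)) * expectation (\<lambda>w. U i w * W w))"
  proof (rule G.stein[where C=C])
    show "U i \<in> gauss_hilbert" for i using V B_in by (simp add: U_def)
    show "g x = g y" if "\<And>i. i < Suc k ==> x i = y i" for x y
      using bounded_smooth_dep[OF f, of x y] that by (simp add: g_def)
    show "((\<lambda>y. g (x(i := y))) has_real_derivative g' i x) (at (x i))" if "i < Suc k" for i x
    proof (cases "i < k")
      case True
      have "((\<lambda>y. f (x(i := y)) * x k) has_real_derivative partial_deriv i f x * x k) (at (x i))"
        by (rule DERIV_cmult_right[OF bounded_smooth_deriv[OF f True]])
      then show ?thesis using True by (simp add: g_def g'_def)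
    next
      case False
      then have [simp]: "i = k" using that by simp
      have "f (x(k := y)) = f x" for y by (rule bounded_smooth_dep[OF f]) simp
      then have "(\<lambda>y. g (x(i := y))) = (\<lambda>y. f x * y)" by (simp add: g_def)
      moreover have "((\<lambda>y. f x * y) has_real_derivative f x) (at (x i))" by (auto intro!: derivative_eq_intros)
      ultimately show ?thesis by (simp add: g'_def)
    qed
    show "continuous_on UNIV g"
      unfolding g_def by (intro continuous_intros bounded_smooth_cont[OF f]) simp
    show "continuous_on UNIV (g' i)" if "i < Suc k" for i
    proof (cases "i < k")
      case True
      have "continuous_on UNIV (\<lambda>x. partial_deriv i f x * x k)"
        by (intro continuous_on_mult bounded_smooth_cont[OF bounded_smooth_partial[OF f True]]) simp
      then show ?thesis using True by (simp add: g'_def)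
    next
      case False
      then show ?thesis using bounded_smooth_cont[OF f] by (simp add: g'_def)
    qed
    show "\<bar>g x\<bar> \<le> C * (1 + (\<Sum>i<Suc k. \<bar>x i\<bar>))" for x
    proof -
      have "\<bar>g x\<bar> \<le> C * \<bar>x k\<bar>" unfolding g_def abs_mult by (intro mult_right_mono C) auto
      also have "... \<le> C * (1 + \<bar>x k\<bar>)" using C(1) by (intro mult_left_mono) auto
      finally show ?thesis using le[of x] by linarith
    qed
    show "\<bar>g' i x\<bar> \<le> C * (1 + (\<Sum>i<Suc k. \<bar>x i\<bar>))" if "i < Suc k" for i x
    proof (cases "i < k")
      case True
      then have "\<bar>g' i x\<bar> \<le> C * \<bar>x k\<bar>" unfolding g'_def using C(3)[OF True] by (simp add: abs_mult mult_right_mono)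
      also have "... \<le> C * (1 + \<bar>x k\<bar>)" using C(1) by (intro mult_left_mono) auto
      finally show ?thesis using le[of x] by linarith
    next
      case False
      then have "\<bar>g' i x\<bar> \<le> C * 1" using C(2) by (simp add: g'_def)
      also have "... \<le> C * (1 + \<bar>x k\<bar>)" using C(1) by (intro mult_left_mono) auto
      finally show ?thesis using le[of x] by linarith
    qed
  qed (rule W)
  moreover have "expectation (\<lambda>w. g (\<lambda>i. U i w) * W w) = expectation (\<lambda>w. functional f t w * V w * W w)"
    by (simp add: g_def fB) (simp add: U_def)
  moreover have "expectation (\<lambda>w. g' i (\<lambda>j. U j w)) * expectation (\<lambda>w. U i w * W w) =
      expectation (\<lambda>w. functional (partial_deriv i f) t w * V w) * expectation (\<lambda>w. B (t i) w * W w)" if "i < k" for i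
    using that by (simp add: g'_def dB) (simp add: U_def)
  moreover have "expectation (\<lambda>w. g' k (\<lambda>j. U j w)) * expectation (\<lambda>w. U k w * W w) =
      expectation (functional f t) * expectation (\<lambda>w. V w * W w)"
    by (simp add: g'_def fB) (simp add: U_def)
  ultimately show ?thesis by simp
qed

text \<open>Along a path dZ = - \<alpha> Z dt + dB, so the chain rule suggests Z(T)^2 / 2 + \<alpha>
  * int_0^T Z^2 as the integral of Z against B. A divergence has mean zero, hence every square is
  replaced by its centred version.\<close>

definition Z_div :: "real => 'a => real" where
  "Z_div T w = Z2 w T / 2 + \<alpha> * (LINT s:{0..T}|lborel. Z2 w s)"

lemma Z_div_measurable [measurable]: "Z_div T \<in> borel_measurable M"
proof -
  have "(\<lambda>(w, s). Z2 w s) \<in> borel_measurable (M \<Otimes>\<^sub>M borel)" by measurable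
  note [measurable] = process_integral_measurable[OF this] 
  have [measurable]: "(\<lambda>w. Z2 w T) \<in> borel_measurable M" unfolding Z2_def by measurable
  show ?thesis unfolding Z_div_def[abs_def] by measurable
qed

lemma Z_div_square: "T \<ge> 0 ==> integrable M (\<lambda>w. (Z_div T w)\<^sup>2)"
proof -
  assume T: "T \<ge> 0"
  have "(\<lambda>(w, s). Z2 w s) \<in> borel_measurable (M \<Otimes>\<^sub>M borel)" by measurable
  note [measurable] = process_integral_measurable[OF this] 
  have [measurable]: "(\<lambda>w. Z2 w T) \<in> borel_measurable M" unfolding Z2_def by measurable
  show ?thesis unfolding Z_div_def[abs_def]
  proof (rule integrable_square_add(1))
    show "integrable M (\<lambda>w. (Z2 w T / 2)\<^sup>2)" using Z2_square(1)[OF T] by (simp add: power_divide)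
    show "integrable M (\<lambda>w. (\<alpha> * (LINT s:{0..T}|lborel. Z2 w s))\<^sup>2)"
      using Z2_average_square(1)[OF T] by (simp add: power_mult_distrib)
  qed measurable
qed

lemma Z_B_cov: "s \<ge> 0 ==> expectation (\<lambda>w. B q w * Z w s) = ou_filter \<alpha> (cov q) s"
  using Z_inner[OF _ B_measurable B_square_integrable, of s q] by (simp add: B_cov)

text \<open>The derivative of \<open>E[F Z\<^sub>s\<^sup>2]\<close> is computed through the symmetry of \<open>E[F Z\<^sub>s Z\<^sub>r]\<close> in \<open>s\<close> and \<open>r\<close>,
  which makes the symmetry of second partial derivatives unnecessary.\<close>

lemma Z_div_duality:
  assumes f: "bounded_smooth k f" and T: "T \<ge> 0"
  shows "expectation (\<lambda>w. functional f t w * Z_div T w) =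
    (LINT s:{0..T}|lborel. \<Sum>i<k. expectation (\<lambda>w. functional (partial_deriv i f) t w * Z w s) * step_slice (t i) s)"
proof -
  let ?F = "functional f t" and ?D = "\<lambda>i. functional (partial_deriv i f) t"
  define \<rho> where "\<rho> = (\<lambda>i. ou_filter \<alpha> (cov (t i)))"
  define \<rho>' where "\<rho>' = (\<lambda>i s. step_slice (t i) s - \<alpha> * \<rho> i s)"
  define m where "m = (\<lambda>i j. expectation (functional (partial_deriv j (partial_deriv i f)) t))"
  define p where "p = (\<lambda>i s. \<Sum>j<k. m i j * \<rho> j s)"
  define p' where "p' = (\<lambda>i s. \<Sum>j<k. m i j * \<rho>' j s)"
  have cov_c: "continuous_on {0..T'} (cov q)" for T' q by (rule continuous_on_cov)
  have \<rho>c: "continuous_on {0..T'} (\<rho> i)" for i T' unfolding \<rho>_def by (rule continuous_on_ou_filter[OF cov_c])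
  have pc: "continuous_on {0..T'} (p i)" for i T' unfolding p_def by (intro continuous_intros \<rho>c)
  have \<rho>E: "expectation (\<lambda>w. B (t i) w * Z w s) = \<rho> i s" if "s \<ge> 0" for i s
    unfolding \<rho>_def by (rule Z_B_cov[OF that])
  have pE: "expectation (\<lambda>w. ?D i w * Z w s) = p i s" if "i < k" "s \<ge> 0" for i s
    unfolding p_def m_def ibp1[OF bounded_smooth_partial[OF f that(1)] Z_in[OF that(2)]] using \<rho>E[OF that(2)] by simp
  have \<Psi>: "expectation (\<lambda>w. ?F w * Z w s * Z w r) = (\<Sum>i<k. p i s * \<rho> i r) + expectation ?F * Zcov s r"
    if "s \<ge> 0" "r \<ge> 0" for s r
    unfolding ibp2[OF f Z_in[OF that(1)] Z_in[OF that(2)]] Zcov_def using pE that \<rho>E by simp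
  \<comment> \<open>Both sides arise from the same expectation by integrating by parts with respect
    to one or the other of the two factors Z.\<close>
  have sym: "(\<Sum>i<k. p i s * \<rho> i r) = (\<Sum>i<k. p i r * \<rho> i s)" if "s \<ge> 0" "r \<ge> 0" for s r
  proof -
    have "expectation (\<lambda>w. ?F w * Z w s * Z w r) = expectation (\<lambda>w. ?F w * Z w r * Z w s)" by (simp add: mult_ac)
    moreover have "Zcov s r = Zcov r s" by (simp add: Zcov_def mult.commute)
    ultimately show ?thesis using \<Psi>[OF that] \<Psi>[OF that(2,1)] by simp
  qed
  have \<rho>d: "(\<rho> i has_real_derivative \<rho>' i s) (at s)" if "s > 0" "s \<noteq> t i" for i s
  proof -
    have "(ou_integral \<alpha> (cov (t i)) has_real_derivative \<rho> i s) (at s)"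
      unfolding \<rho>_def by (rule ou_integral_has_derivative[OF cov_c[of "s + 1"]]) (use that in auto)
    moreover have "(cov (t i) has_real_derivative step_slice (t i) s) (at s)" using that by (intro cov_derivative) auto
    ultimately have "((\<lambda>s. cov (t i) s - \<alpha> * ou_integral \<alpha> (cov (t i)) s) has_real_derivative step_slice (t i) s - \<alpha> * \<rho> i s) (at s)"
      by (intro DERIV_diff DERIV_cmult)
    then show ?thesis by (simp add: \<rho>_def \<rho>'_def ou_filter_def[abs_def])
  qed
  have pd: "(p i has_real_derivative p' i s) (at s)" if "s > 0" "s \<notin> t ` {..<k}" for i s
    unfolding p_def p'_def by (intro DERIV_sum DERIV_cmult \<rho>d) (use that in auto)
  \<comment> \<open>The symmetric relation is differentiated in r and then evaluated at r =
    s.\<close>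
  have symd: "(\<Sum>i<k. p i s * \<rho>' i s) = (\<Sum>i<k. p' i s * \<rho> i s)" if s: "s > 0" "s \<notin> t ` {..<k}" for s
  proof (rule DERIV_unique)
    show "((\<lambda>r. \<Sum>i<k. p i s * \<rho> i r) has_real_derivative (\<Sum>i<k. p i s * \<rho>' i s)) (at s)"
      by (intro DERIV_sum DERIV_cmult \<rho>d) (use s in auto)
    have "((\<lambda>r. \<Sum>i<k. p i r * \<rho> i s) has_real_derivative (\<Sum>i<k. p' i s * \<rho> i s)) (at s)"
      by (intro DERIV_sum DERIV_cmult_right pd s)
    then show "((\<lambda>r. \<Sum>i<k. p i s * \<rho> i r) has_real_derivative (\<Sum>i<k. p' i s * \<rho> i s)) (at s)"
    proof (rule DERIV_cong_ev[THEN iffD1, rotated -1, OF _ refl _ refl])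
      have "\<forall>\<^sub>F x in nhds s. x \<in> {0<..}" using s by (intro eventually_nhds_in_open) auto
      then show "\<forall>\<^sub>F r in nhds s. (\<Sum>i<k. p i r * \<rho> i s) = (\<Sum>i<k. p i s * \<rho> i r)"
        by eventually_elim (use s in \<open>auto intro: sym\<close>)
    qed
  qed
  define h where "h = (\<lambda>s. \<Sum>i<k. p i s * \<rho> i s)"
  have h0: "h 0 = 0"
    by (simp add: h_def \<rho>_def ou_filter_def ou_integral_0)
  \<comment> \<open>By \<open>symd\<close> the derivative of \<open>h\<close> is twice the sum of
    the products of \<open>p\<close> and \<rho>'. Inserting the definition of \<rho>' splits off
    \<alpha> times \<open>h\<close>, which becomes the integral term of
    \<open>Z_div\<close>.\<close>
  have "(LINT s:{0..T}|lborel. 2 * (\<Sum>i<k. p i s * \<rho>' i s)) = h T - h 0"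
  proof (rule set_lebesgue_integral_FTC_strong[where S="t ` {..<k}", OF T])
    show "continuous_on {0..T} h" unfolding h_def by (intro continuous_intros pc \<rho>c)
    show "continuous_on {0..T} (\<lambda>s. 2 * (\<Sum>i<k. p i s * \<rho>' i s))"
      unfolding \<rho>'_def by (intro continuous_intros pc \<rho>c continuous_on_step_slice)
    fix s assume s: "s \<notin> t ` {..<k}" "0 < s"
    have "(h has_real_derivative (\<Sum>i<k. p' i s * \<rho> i s + \<rho>' i s * p i s)) (at s)"
      unfolding h_def by (intro DERIV_sum DERIV_mult pd \<rho>d) (use s in auto)
    moreover have "(\<Sum>i<k. p' i s * \<rho> i s + \<rho>' i s * p i s) = 2 * (\<Sum>i<k. p i s * \<rho>' i s)"
      using symd[OF s(2,1)] by (simp add: sum.distrib mult.commute)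
    ultimately show "(h has_real_derivative 2 * (\<Sum>i<k. p i s * \<rho>' i s)) (at s)" by simp
  qed simp
  moreover have "(LINT s:{0..T}|lborel. 2 * (\<Sum>i<k. p i s * \<rho>' i s)) =
      2 * (LINT s:{0..T}|lborel. \<Sum>i<k. p i s * step_slice (t i) s) - 2 * (\<alpha> * (LINT s:{0..T}|lborel. h s))"
  proof -
    have i: "set_integrable lborel {0..T} (\<lambda>s. 2 * (\<Sum>i<k. p i s * step_slice (t i) s))" "set_integrable lborel {0..T} (\<lambda>s. 2 * (\<alpha> * h s))"
      unfolding h_def by (intro borel_integrable_atLeastAtMost' continuous_intros pc \<rho>c continuous_on_step_slice)+
    have "2 * (\<Sum>i<k. p i s * \<rho>' i s) = 2 * (\<Sum>i<k. p i s * step_slice (t i) s) - 2 * (\<alpha> * h s)" for s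
      unfolding \<rho>'_def h_def by (simp add: right_diff_distrib sum_subtractf sum_distrib_left mult_ac)
    then show ?thesis using set_integral_diff(2)[OF i] by simp
  qed
  ultimately have key: "h T / 2 + \<alpha> * (LINT s:{0..T}|lborel. h s) = (LINT s:{0..T}|lborel. \<Sum>i<k. p i s * step_slice (t i) s)"
    using h0 by linarith
  note Fm [measurable] = functional_square(1)[OF f, of t] and F2 = functional_square(2)[OF f, of t] and F1 = functional_square(3)[OF f, of t]
  have FZ2: "expectation (\<lambda>w. ?F w * Z2 w s) = h s" if s: "s \<ge> 0" for s
  proof -
    obtain C where C: "C \<ge> 0" "\<And>x. \<bar>f x\<bar> \<le> C" using bounded_range_bound[OF bounded_smooth_bdd[OF f]] by blast
    have i: "integrable M (\<lambda>w. ?F w * (Z w s)\<^sup>2)"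
    proof (rule Bochner_Integration.integrable_bound)
      show "integrable M (\<lambda>w. C * (Z w s)\<^sup>2)" using Z_square[OF s] by simp
      show "AE w in M. norm (?F w * (Z w s)\<^sup>2) \<le> norm (C * (Z w s)\<^sup>2)"
        using C by (intro AE_I2) (simp add: functional_def abs_mult mult_right_mono)
    qed measurable
    have "expectation (\<lambda>w. ?F w * Z2 w s) = expectation (\<lambda>w. ?F w * (Z w s)\<^sup>2 - Zcov s s * ?F w)"
      by (simp add: Z2_def right_diff_distrib mult.commute)
    also have "... = expectation (\<lambda>w. ?F w * (Z w s)\<^sup>2) - Zcov s s * expectation ?F" using i F1 by simp
    also have "expectation (\<lambda>w. ?F w * (Z w s)\<^sup>2) = expectation (\<lambda>w. ?F w * Z w s * Z w s)"
      by (simp add: power2_eq_square mult.assoc)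
    finally show ?thesis unfolding \<Psi>[OF s s] h_def by simp
  qed
  have Z2m: "(\<lambda>(w, s). Z2 w s) \<in> borel_measurable (M \<Otimes>\<^sub>M borel)" by measurable
  have i: "integrable M (\<lambda>w. (Z2 w s)\<^sup>2)" and b: "expectation (\<lambda>w. (Z2 w s)\<^sup>2) \<le> 2 * Zbound\<^sup>2" if "s \<in> {0..T}" for s
    using Z2_square[of s] that by auto
  have [measurable]: "(\<lambda>w. Z2 w T) \<in> borel_measurable M" unfolding Z2_def by measurable
  have i1: "integrable M (\<lambda>w. ?F w * Z2 w T)" by (intro integrable_mult_of_square F2 Z2_square(1) T) auto
  have i2: "integrable M (\<lambda>w. ?F w * (LINT s:{0..T}|lborel. Z2 w s))" by (rule process_inner(1)[OF Z2m i b Fm F2])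
  have "expectation (\<lambda>w. ?F w * Z_div T w) = expectation (\<lambda>w. ?F w * Z2 w T / 2 + \<alpha> * (?F w * (LINT s:{0..T}|lborel. Z2 w s)))"
    by (simp add: Z_div_def distrib_left mult_ac)
  also have "... = expectation (\<lambda>w. ?F w * Z2 w T) / 2 + \<alpha> * expectation (\<lambda>w. ?F w * (LINT s:{0..T}|lborel. Z2 w s))"
    using i1 i2 by simp
  also have "expectation (\<lambda>w. ?F w * (LINT s:{0..T}|lborel. Z2 w s)) = (LINT s:{0..T}|lborel. expectation (\<lambda>w. ?F w * Z2 w s))"
    by (rule process_inner(2)[OF Z2m i b Fm F2])
  also have "... = (LINT s:{0..T}|lborel. h s)"
    by (rule set_lebesgue_integral_cong) (auto simp: FZ2)
  also have "expectation (\<lambda>w. ?F w * Z2 w T) = h T" by (rule FZ2[OF T])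
  also have "h T / 2 + \<alpha> * (LINT s:{0..T}|lborel. h s) = (LINT s:{0..T}|lborel. \<Sum>i<k. p i s * step_slice (t i) s)" by (rule key)
  also have "... = (LINT s:{0..T}|lborel. \<Sum>i<k. expectation (\<lambda>w. ?D i w * Z w s) * step_slice (t i) s)"
    by (rule set_lebesgue_integral_cong) (auto simp: pE)
  finally show ?thesis .
qed

end

section \<open>Divergences involving the initial value\<close>

locale fou_space = fbm_ou M H B \<alpha> for M :: "'a measure" and H :: real and B :: "real => 'a => real" and \<alpha> :: real +
  fixes \<xi> :: "'a => real"
  assumes \<xi>_measurable [measurable]: "\<xi> \<in> borel_measurable M"
    and \<xi>_indep: "indep_set (sets (vimage_algebra (space M) \<xi> borel))
       (sets (vimage_algebra (space M) (\<lambda>w t. B t w) (Pi\<^sub>M UNIV (\<lambda>_. borel))))"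
begin

abbreviation "\<I> \<equiv> initial_algebra M \<xi>"
abbreviation "\<F> \<equiv> full_algebra M B \<xi>"

lemma space_full [simp]: "space \<F> = space M" and sets_full: "sets \<F> = sigma_sets (space M)
     ({\<xi> -` A \<inter> space M | A. A \<in> sets borel} \<union> {B t -` A \<inter> space M | t A. A \<in> sets borel})"
  unfolding full_algebra_def by (auto intro!: space_measure_of sets_measure_of)

lemma space_initial [simp]: "space \<I> = space M" by (simp add: initial_algebra_def)

lemma sets_initial: "sets \<I> = {\<xi> -` A \<inter> space M | A. A \<in> sets borel}"
  unfolding initial_algebra_def by (rule sets_vimage_algebra2) auto

lemma \<xi>_initial [measurable]: "\<xi> \<in> borel_measurable \<I>"
  unfolding initial_algebra_def by (rule measurable_vimage_algebra1) auto

lemma \<xi>_full [measurable]: "\<xi> \<in> borel_measurable \<F>"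
  by (rule measurableI) (auto simp: sets_full intro!: sigma_sets.Basic)

lemma B_full [measurable]: "B t \<in> borel_measurable \<F>"
  by (rule measurableI) (auto simp: sets_full intro!: sigma_sets.Basic)

lemma full_subalgebra: "subalgebra M \<F>"
proof -
  have "sigma_sets (space M) ({\<xi> -` A \<inter> space M | A. A \<in> sets borel} \<union> {B t -` A \<inter> space M | t A. A \<in> sets borel}) \<subseteq> sets M"
    by (rule sets.sigma_sets_subset) (auto intro: measurable_sets[OF \<xi>_measurable] measurable_sets[OF B_measurable])
  then show ?thesis unfolding subalgebra_def by (simp add: sets_full)
qed

lemma initial_full: "subalgebra \<F> \<I>"
  unfolding subalgebra_def sets_initial using measurable_sets[OF \<xi>_full] by auto

lemma initial_subalgebra: "subalgebra M \<I>"
  unfolding subalgebra_def sets_initial using measurable_sets[OF \<xi>_measurable] by auto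

lemma path_full: "subalgebra \<F> path_algebra"
proof -
  have f: "(\<lambda>w t. B t w) \<in> \<F> \<rightarrow>\<^sub>M Pi\<^sub>M UNIV (\<lambda>_. borel)" by (rule measurable_PiM_single') auto
  show ?thesis unfolding subalgebra_def path_algebra_def
    using measurable_sets[OF f] by (subst sets_vimage_algebra2) (auto simp: space_PiM)
qed

lemma initial_path_indep:
  fixes W V :: "'a => real"
  assumes W: "W \<in> borel_measurable \<I>" "integrable M W" and V: "V \<in> borel_measurable path_algebra" "integrable M V"
  shows "integrable M (\<lambda>w. W w * V w)" "expectation (\<lambda>w. W w * V w) = expectation W * expectation V"
proof -
  have "indep_var borel W borel V"
    unfolding indep_var_def indep_vars_def2
  proof (intro conjI ballI)
    show "random_variable (case_bool borel borel i) (case_bool W V i)" for i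
      using W(2) V(2) by (cases i) auto
    show "indep_sets (\<lambda>i. {case_bool W V i -` A \<inter> space M | A. A \<in> sets (case_bool borel borel i)}) UNIV"
    proof (rule indep_sets_mono_sets)
      show "indep_sets (case_bool (sets \<I>) (sets path_algebra)) UNIV"
        using \<xi>_indep unfolding indep_set_def initial_algebra_def path_algebra_def .
      fix i :: bool
      have "space path_algebra = space M" by (simp add: path_algebra_def)
      then show "{case_bool W V i -` A \<inter> space M | A. A \<in> sets (case_bool borel borel i)} \<subseteq> case_bool (sets \<I>) (sets path_algebra) i"
        using measurable_sets[OF W(1)] measurable_sets[OF V(1)] by (cases i) auto
    qed
  qed
  from indep_var_integrable[OF this W(2) V(2)] indep_var_lebesgue_integral[OF this W(2) V(2)]
  show "integrable M (\<lambda>w. W w * V w)" "expectation (\<lambda>w. W w * V w) = expectation W * expectation V" by auto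
qed

definition cutoff :: "nat => 'a set" where "cutoff m = {w \<in> space M. \<bar>\<xi> w\<bar> \<le> real m}"

lemma cutoff_sets: "cutoff m \<in> sets \<I>"
proof -
  have "{w \<in> space \<I>. \<bar>\<xi> w\<bar> \<le> real m} \<in> sets \<I>" by measurable
  then show ?thesis by (simp add: cutoff_def)
qed

lemma cutoff_incseq: "incseq cutoff"
  by (auto simp: incseq_def cutoff_def intro: order_trans)

lemma cutoff_UN: "w \<in> space M ==> w \<in> (\<Union>m. cutoff m)"
  using real_arch_simple[of "\<bar>\<xi> w\<bar>"] by (auto simp: cutoff_def)

lemma cutoff_bound: "\<bar>indicator (cutoff m) w * \<xi> w\<bar> \<le> real m"
  by (auto simp: cutoff_def indicator_def)

lemma Z_measurable_full: "case_prod Z \<in> borel_measurable (\<F> \<Otimes>\<^sub>M borel)"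
  by (rule measurable_pair_subalgebra[OF path_full Z_measurable_path])

text \<open>Measurability with respect to B alone is what makes this part of the divergence
  independent of \<xi>.\<close>

lemma Z_div_path: "Z_div T \<in> borel_measurable path_algebra"
proof -
  have "(\<lambda>s. Zcov s s) \<in> borel_measurable borel"
    using measurable_compose[OF measurable_Pair[OF measurable_ident measurable_ident] Zcov_measurable] by simp
  note [measurable] = this Z_measurable_path Zt_path_measurable
  have "(\<lambda>(w, s). Z2 w s) \<in> borel_measurable (path_algebra \<Otimes>\<^sub>M borel)" unfolding Z2_def by measurable
  note [measurable] = process_integral_measurable[OF this]
  have [measurable]: "(\<lambda>w. Z2 w T) \<in> borel_measurable path_algebra" unfolding Z2_def by measurable
  show ?thesis unfolding Z_div_def[abs_def] by measurable
qed

lemma functional_path: "bounded_smooth k f ==> functional f t \<in> borel_measurable path_algebra"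
  by (rule functional_measurable_path[OF bounded_smooth_cont])

text \<open>The derivative of a smooth variable is a combination of oriented steps, so the double
  integral reduces to single integrals against \<open>step_slice\<close>.\<close>

lemma fbm_inner_malliavin:
  assumes v: "adm v"
  shows "fbm_inner H (malliavin_deriv B G k t f w) v =
    (\<Sum>i<k. G w * functional (partial_deriv i f) t w * (\<integral>s. step_slice (t i) s * v s \<partial>lborel))"
proof -
  have m: "malliavin_deriv B G k t f w = (\<lambda>r. \<Sum>i<k. (G w * functional (partial_deriv i f) t w) * fbm_step (t i) r)"
    by (simp add: fun_eq_iff malliavin_deriv_def functional_def)
  have a: "adm (\<lambda>r. \<Sum>i<k. (G w * functional (partial_deriv i f) t w) * fbm_step (t i) r)"
    by (intro adm_sum adm_intros) auto
  have "fbm_inner H (malliavin_deriv B G k t f w) v = fbm_inner H v (\<lambda>r. \<Sum>i<k. (G w * functional (partial_deriv i f) t w) * fbm_step (t i) r)"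
    unfolding m by (rule fbm_inner_sym[OF a v])
  also have "... = (\<Sum>i<k. (G w * functional (partial_deriv i f) t w) * fbm_inner H v (fbm_step (t i)))"
    by (subst fbm_inner_sum_right) (auto intro!: v adm_intros simp: fbm_inner_scale_right)
  also have "... = (\<Sum>i<k. (G w * functional (partial_deriv i f) t w) * (\<integral>s. step_slice (t i) s * v s \<partial>lborel))"
    by (simp only: fbm_inner_sym[OF v adm_intros(4)] fbm_inner_step[OF v])
  finally show ?thesis .
qed

lemma malliavin_measurable:
  assumes sd: "smooth_data M \<xi> G k f"
  shows "(\<lambda>(w, r). malliavin_deriv B G k t f w r) \<in> borel_measurable (M \<Otimes>\<^sub>M borel)"
proof -
  have G: "G \<in> borel_measurable \<I>" and f: "bounded_smooth k f" using sd by (auto simp: smooth_data_def)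
  have mG: "G \<in> borel_measurable M" by (rule measurable_from_subalg[OF initial_subalgebra G])
  have "(\<lambda>x. \<Sum>i<k. G (fst x) * functional (partial_deriv i f) t (fst x) * fbm_step (t i) (snd x)) \<in> borel_measurable (M \<Otimes>\<^sub>M borel)"
  proof (rule borel_measurable_sum)
    fix i assume "i \<in> {..<k}"
    then have mD: "functional (partial_deriv i f) t \<in> borel_measurable M" using functional_square(1)[OF bounded_smooth_partial[OF f]] by auto
    have "fbm_step (t i) \<in> borel_measurable borel" unfolding fbm_step_def by measurable
    then show "(\<lambda>x. G (fst x) * functional (partial_deriv i f) t (fst x) * fbm_step (t i) (snd x)) \<in> borel_measurable (M \<Otimes>\<^sub>M borel)"
      by (intro borel_measurable_times measurable_compose[OF measurable_fst mG] measurable_compose[OF measurable_fst mD]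
          measurable_compose[OF measurable_snd])
  qed
  then show ?thesis by (simp add: malliavin_deriv_def functional_def case_prod_beta')
qed

lemma fbm_inner_malliavin_measurable:
  assumes sd: "smooth_data M \<xi> G k f" and v: "(\<lambda>(w, r). v w r) \<in> borel_measurable (\<F> \<Otimes>\<^sub>M borel)"
  shows "(\<lambda>w. fbm_inner H (malliavin_deriv B G k t f w) (v w)) \<in> borel_measurable M"
proof -
  have mI: "(\<lambda>(w, r). v w r) \<in> borel_measurable (M \<Otimes>\<^sub>M borel)"
    by (rule measurable_pair_subalgebra[OF full_subalgebra v])
  have "(\<lambda>(w, x). malliavin_deriv B G k t f w (fst x) * v w (snd x) * \<bar>fst x - snd x\<bar> powr (2 * H - 2))
      \<in> borel_measurable (M \<Otimes>\<^sub>M (borel \<Otimes>\<^sub>M borel))"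
    using measurable_compose[OF _ malliavin_measurable[OF sd], of "\<lambda>(w, x). (w, fst x)" "M \<Otimes>\<^sub>M (borel \<Otimes>\<^sub>M borel)"]
      measurable_compose[OF _ mI, of "\<lambda>(w, x). (w, snd x)" "M \<Otimes>\<^sub>M (borel \<Otimes>\<^sub>M borel)"]
    unfolding case_prod_beta' by (intro borel_measurable_times) auto
  then have "(\<lambda>(w, x). malliavin_deriv B G k t f w (fst x) * v w (snd x) * \<bar>fst x - snd x\<bar> powr (2 * H - 2))
      \<in> borel_measurable (M \<Otimes>\<^sub>M (lborel \<Otimes>\<^sub>M lborel))"
    by (subst measurable_cong_sets[OF sets_pair_measure_cong[OF refl sets_pair_measure_cong[OF sets_lborel sets_lborel]] refl])
  from sigma_finite_measure.borel_measurable_lebesgue_integral[OF lborel_pair.sigma_finite_measure_axioms this]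
  show ?thesis unfolding fbm_inner_def case_prod_beta' by (intro borel_measurable_times) auto
qed

lemma divergence_duality_term:
  assumes W: "W \<in> borel_measurable \<I>" "\<forall>w\<in>space M. \<bar>W w\<bar> \<le> c"
    and V: "V \<in> borel_measurable path_algebra" "integrable M (\<lambda>w. (V w)\<^sup>2)" and f: "bounded_smooth k f"
  shows "integrable M (\<lambda>w. W w * (functional f t w * V w))"
    "expectation (\<lambda>w. W w * (functional f t w * V w)) = expectation W * expectation (\<lambda>w. functional f t w * V w)"
proof -
  have [measurable]: "W \<in> borel_measurable M" "V \<in> borel_measurable M"
    using measurable_from_subalg[OF initial_subalgebra W(1)] measurable_from_subalg[OF subalgebra_path_algebra V(1)] by auto
  note F = functional_square[OF f, of t]
  have iW: "integrable M W" using W(2) by (intro integrable_const_bound[where B=c]) auto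
  have iV: "integrable M (\<lambda>w. functional f t w * V w)" by (intro integrable_mult_of_square F V(2)) auto
  have m: "(\<lambda>w. functional f t w * V w) \<in> borel_measurable path_algebra"
    using functional_path[OF f, of t] V(1) by measurable
  show "integrable M (\<lambda>w. W w * (functional f t w * V w))"
    "expectation (\<lambda>w. W w * (functional f t w * V w)) = expectation W * expectation (\<lambda>w. functional f t w * V w)"
    by (rule initial_path_indep[OF W(1) iW m iV])+
qed

definition trunc :: "real => (real => real) => real => real" where
  "trunc T f s = indicator {0..T} s * f s"

lemma trunc_admissible:
  assumes "T \<ge> 0" "C \<ge> 0" and f: "f \<in> borel_measurable borel" "\<And>s. s \<in> {0..T} ==> \<bar>f s\<bar> \<le> C"
  shows "admissible T C (trunc T f)"
proof -
  note [measurable] = f(1)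
  have "trunc T f \<in> borel_measurable borel" unfolding trunc_def[abs_def] by measurable
  moreover have "\<bar>trunc T f x\<bar> \<le> C * indicator {-T..T} x" for x
    using f(2)[of x] assms(1,2) by (auto simp: trunc_def indicator_def)
  ultimately show ?thesis using assms by (simp add: admissible_def)
qed

text \<open>One form for all integrands of the estimator: \<open>f1 = 0\<close> and
  \<open>c = 0\<close> give the functions \<phi>, while an exponential for \<open>f1\<close> and
  \<open>c = \<sigma>\<close> give X. The cutoff makes the coefficient \<xi> bounded.\<close>

definition integrand :: "nat => real => (real => real) => (real => real) => real => 'a => real => real" where
  "integrand m T f1 f2 c w s =
     indicator (cutoff m) w * (\<xi> w * trunc T f1 s + trunc T f2 s + c * trunc T (Z w) s)"

context
  fixes T C c :: real and f1 f2 :: "real => real" and J K :: "'a => real"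
  assumes T: "T \<ge> 0" and C: "C \<ge> 0"
    and f1 [measurable]: "f1 \<in> borel_measurable borel" and f1_bound: "\<And>s. s \<in> {0..T} ==> \<bar>f1 s\<bar> \<le> C"
    and f2 [measurable]: "f2 \<in> borel_measurable borel" and f2_bound: "\<And>s. s \<in> {0..T} ==> \<bar>f2 s\<bar> \<le> C"
    and J: "wiener (trunc T f1) J" and K: "wiener (trunc T f2) K"
begin

lemma adm1: "adm (trunc T f1)" and adm2: "adm (trunc T f2)"
  using trunc_admissible[OF T C f1 f1_bound] trunc_admissible[OF T C f2 f2_bound] by (auto simp: adm_def)

lemma JK_measurable [measurable]: "J \<in> borel_measurable M" "K \<in> borel_measurable M"
  using wiener_meas(2) J K by auto

lemma integrand_measurable: "(\<lambda>(w, s). integrand m T f1 f2 c w s) \<in> borel_measurable (\<F> \<Otimes>\<^sub>M borel)"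
proof -
  have [measurable]: "cutoff m \<in> sets \<F>" using cutoff_sets initial_full by (auto simp: subalgebra_def)
  note [measurable] = Z_measurable_full
  show ?thesis unfolding integrand_def trunc_def by measurable
qed

lemma integrand_square:
  "integrable M (\<lambda>w. (integrand m T f1 f2 c w s)\<^sup>2)"
  "expectation (\<lambda>w. (integrand m T f1 f2 c w s)\<^sup>2) \<le> 2 * (real m * C + C)\<^sup>2 + 2 * (c\<^sup>2 * Zbound)"
proof -
  define D where "D = real m * C + C"
  have D0: "D \<ge> 0" using C by (simp add: D_def)
  have mm: "(\<lambda>(w, s). integrand m T f1 f2 c w s) \<in> borel_measurable (M \<Otimes>\<^sub>M borel)"
    by (rule measurable_pair_subalgebra[OF full_subalgebra integrand_measurable])
  have [measurable]: "(\<lambda>w. integrand m T f1 f2 c w s) \<in> borel_measurable M"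
    using measurable_compose[OF measurable_Pair2' mm, of s] by simp
  define q where "q = (\<lambda>w. 2 * D\<^sup>2 + 2 * (c\<^sup>2 * (indicator {0..T} s * (Z w s)\<^sup>2)))"
  have q: "integrable M q" and Eq: "expectation q \<le> 2 * D\<^sup>2 + 2 * (c\<^sup>2 * Zbound)"
  proof -
    have i: "integrable M (\<lambda>w. indicator {0..T} s * (Z w s)\<^sup>2)"
      using Z_square[of s] by (cases "s \<in> {0..T}") auto
    then show "integrable M q" unfolding q_def by simp
    have "expectation (\<lambda>w. indicator {0..T} s * (Z w s)\<^sup>2) \<le> Zbound"
      using Z_var_le[of s] Zbound_nonneg by (cases "s \<in> {0..T}") auto
    then show "expectation q \<le> 2 * D\<^sup>2 + 2 * (c\<^sup>2 * Zbound)"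
      unfolding q_def using i by (simp add: prob_space mult_left_mono)
  qed
  have le: "(integrand m T f1 f2 c w s)\<^sup>2 \<le> q w" for w
  proof (cases "s \<in> {0..T} \<and> w \<in> cutoff m")
    case False
    then have "integrand m T f1 f2 c w s = 0" by (auto simp: integrand_def trunc_def)
    then show ?thesis by (simp add: q_def)
  next
    case True
    then have e: "integrand m T f1 f2 c w s = (\<xi> w * f1 s + f2 s) + c * Z w s" by (simp add: integrand_def trunc_def)
    have "\<bar>\<xi> w * f1 s + f2 s\<bar> \<le> \<bar>\<xi> w\<bar> * \<bar>f1 s\<bar> + \<bar>f2 s\<bar>" by (metis abs_mult abs_triangle_ineq)
    also have "... \<le> real m * C + C"
      using True f1_bound[of s] f2_bound[of s] C by (intro add_mono mult_mono) (auto simp: cutoff_def)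
    finally have "(\<xi> w * f1 s + f2 s)\<^sup>2 \<le> D\<^sup>2" using D0 by (simp add: power2_le_iff_abs_le D_def)
    then show ?thesis unfolding e q_def
      using square_sum_le[of "\<xi> w * f1 s + f2 s" "c * Z w s"] True by (simp add: power_mult_distrib)
  qed
  show i: "integrable M (\<lambda>w. (integrand m T f1 f2 c w s)\<^sup>2)"
    by (rule Bochner_Integration.integrable_bound[OF q]) (use le in \<open>auto intro: order_trans[OF _ abs_ge_self]\<close>)
  show "expectation (\<lambda>w. (integrand m T f1 f2 c w s)\<^sup>2) \<le> 2 * (real m * C + C)\<^sup>2 + 2 * (c\<^sup>2 * Zbound)"
    unfolding D_def[symmetric] by (rule order_trans[OF integral_mono[OF i q le] Eq])
qed

text \<open>By Cauchy-Schwarz the mean of the absolute product of the integrand at r and s is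
  bounded by a constant on the square and vanishes outside it. Fubini's theorem then reduces the
  claim to integrability of the kernel on the square.\<close>

lemma integrand_kernel_integrable:
  "integrable (M \<Otimes>\<^sub>M (lborel \<Otimes>\<^sub>M lborel))
     (\<lambda>(w, r, s). integrand m T f1 f2 c w r * integrand m T f1 f2 c w s * \<bar>r - s\<bar> powr (2 * H - 2))"
proof -
  let ?v = "integrand m T f1 f2 c"
  interpret LL: pair_sigma_finite lborel "lborel :: real measure" ..
  interpret P: pair_sigma_finite "lborel \<Otimes>\<^sub>M lborel :: (real \<times> real) measure" M ..
  interpret Q: pair_sigma_finite M "lborel \<Otimes>\<^sub>M lborel :: (real \<times> real) measure" ..
  have mm [measurable]: "case_prod ?v \<in> borel_measurable (M \<Otimes>\<^sub>M borel)"
    using measurable_pair_subalgebra[OF full_subalgebra integrand_measurable] by simp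
  define D where "D = 2 * (real m * C + C)\<^sup>2 + 2 * (c\<^sup>2 * Zbound)"
  have D0: "D \<ge> 0" using Zbound_nonneg by (simp add: D_def)
  have vm [measurable]: "(\<lambda>w. ?v w s) \<in> borel_measurable M" for s
    using measurable_compose[OF measurable_Pair2' mm, of s] by simp
  have m1: "(\<lambda>(x, w). ?v w (fst x) * ?v w (snd x) * kernel (fst x) (snd x)) \<in> borel_measurable ((lborel \<Otimes>\<^sub>M lborel) \<Otimes>\<^sub>M M)"
    unfolding kernel_def by measurable
  have ab: "expectation (\<lambda>w. \<bar>?v w r * ?v w s\<bar>) \<le> D * (indicator {0..T} r * indicator {0..T} s)" for r s
  proof (cases "r \<in> {0..T} \<and> s \<in> {0..T}")
    case True
    have "expectation (\<lambda>w. \<bar>?v w r\<bar> * \<bar>?v w s\<bar>) \<le> sqrt (expectation (\<lambda>w. \<bar>?v w r\<bar>\<^sup>2)) * sqrt (expectation (\<lambda>w. \<bar>?v w s\<bar>\<^sup>2))"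
      by (rule order_trans[OF abs_ge_self abs_integral_mult_le]) (use integrand_square(1) in auto)
    also have "... \<le> sqrt D * sqrt D"
      using integrand_square(2) D0 unfolding D_def by (intro mult_mono real_sqrt_le_mono) auto
    finally show ?thesis using True D0 by (simp add: abs_mult)
  next
    case False
    then have "?v w r * ?v w s = 0" for w by (auto simp: integrand_def trunc_def)
    then show ?thesis using D0 by (simp only: abs_zero integral_zero) simp
  qed
  have n: "(\<integral>w. norm (case (x, w) of (x, w) => ?v w (fst x) * ?v w (snd x) * kernel (fst x) (snd x)) \<partial>M) =
      expectation (\<lambda>w. \<bar>?v w (fst x) * ?v w (snd x)\<bar>) * kernel (fst x) (snd x)" for x
    by (simp add: abs_mult)
  have ad: "admissible T 1 (trunc T (\<lambda>_. 1))" by (rule trunc_admissible[OF T]) auto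
  have dom: "integrable (lborel \<Otimes>\<^sub>M lborel) (\<lambda>x. D * (case x of (r, s) => trunc T (\<lambda>_. 1) r * trunc T (\<lambda>_. 1) s * kernel r s))"
    by (rule integrable_mult_right[OF admissible_kernel_pair(1)[OF ad ad]])
  have "integrable ((lborel \<Otimes>\<^sub>M lborel) \<Otimes>\<^sub>M M) (\<lambda>(x, w). ?v w (fst x) * ?v w (snd x) * kernel (fst x) (snd x))"
  proof (rule P.Fubini_integrable[OF m1])
    show "integrable (lborel \<Otimes>\<^sub>M lborel) (\<lambda>x. \<integral>w. norm (case (x, w) of (x, w) => ?v w (fst x) * ?v w (snd x) * kernel (fst x) (snd x)) \<partial>M)"
      unfolding n
    proof (rule Bochner_Integration.integrable_bound[OF dom])
      show "(\<lambda>x. expectation (\<lambda>w. \<bar>?v w (fst x) * ?v w (snd x)\<bar>) * kernel (fst x) (snd x)) \<in> borel_measurable (lborel \<Otimes>\<^sub>M lborel)"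
        unfolding kernel_def by measurable
      show "AE x in lborel \<Otimes>\<^sub>M lborel. norm (expectation (\<lambda>w. \<bar>?v w (fst x) * ?v w (snd x)\<bar>) * kernel (fst x) (snd x)) \<le>
          norm (D * (case x of (r, s) => trunc T (\<lambda>_. 1) r * trunc T (\<lambda>_. 1) s * kernel r s))"
      proof (rule AE_I2)
        fix x :: "real \<times> real"
        have "expectation (\<lambda>w. \<bar>?v w (fst x) * ?v w (snd x)\<bar>) * kernel (fst x) (snd x) \<le>
            D * (indicator {0..T} (fst x) * indicator {0..T} (snd x)) * kernel (fst x) (snd x)"
          by (rule mult_right_mono[OF ab]) simp
        then show "norm (expectation (\<lambda>w. \<bar>?v w (fst x) * ?v w (snd x)\<bar>) * kernel (fst x) (snd x)) \<le>
            norm (D * (case x of (r, s) => trunc T (\<lambda>_. 1) r * trunc T (\<lambda>_. 1) s * kernel r s))"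
          using D0 by (simp add: trunc_def case_prod_beta abs_mult mult.assoc)
      qed
    qed
    have "integrable M (\<lambda>w. ?v w r * ?v w s)" for r s
      by (intro integrable_mult_of_square integrand_square(1)) auto
    then show "AE x in lborel \<Otimes>\<^sub>M lborel. integrable M (\<lambda>w. case (x, w) of (x, w) => ?v w (fst x) * ?v w (snd x) * kernel (fst x) (snd x))"
      by (intro AE_I2) simp
  qed
  from P.integrable_product_swap[OF this] show ?thesis by (simp add: case_prod_beta' kernel_def)
qed

text \<open>The divergence is linear and treats \<xi> as a constant; deterministic integrands give
  Wiener integrals.\<close>

definition div_value :: "'a => real" where
  "div_value w = \<xi> w * J w + K w + c * Z_div T w"

lemma div_value_measurable: "div_value \<in> borel_measurable \<F>"
proof -
  have [measurable]: "J \<in> borel_measurable \<F>" "K \<in> borel_measurable \<F>" "Z_div T \<in> borel_measurable \<F>"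
    using measurable_from_subalg[OF path_full] wiener_meas(3) J K Z_div_path by blast+
  show ?thesis unfolding div_value_def[abs_def] by measurable
qed

lemma div_value_square: "integrable M (\<lambda>w. (indicator (cutoff m) w * div_value w)\<^sup>2)"
proof -
  have [measurable]: "cutoff m \<in> sets M" using cutoff_sets initial_subalgebra by (auto simp: subalgebra_def)
  have [measurable]: "div_value \<in> borel_measurable M" by (rule measurable_from_subalg[OF full_subalgebra div_value_measurable])
  have i: "integrable M (\<lambda>w. 2 * (2 * ((real m)\<^sup>2 * (J w)\<^sup>2) + 2 * (K w)\<^sup>2) + 2 * (c\<^sup>2 * (Z_div T w)\<^sup>2))"
    using wiener_meas(4)[OF J] wiener_meas(4)[OF K] Z_div_square[OF T] by simp
  have le: "(indicator (cutoff m) w * div_value w)\<^sup>2 \<le> 2 * (2 * ((real m)\<^sup>2 * (J w)\<^sup>2) + 2 * (K w)\<^sup>2) + 2 * (c\<^sup>2 * (Z_div T w)\<^sup>2)" for w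
  proof (cases "w \<in> cutoff m")
    case True
    have "(\<xi> w)\<^sup>2 \<le> (real m)\<^sup>2" using True by (simp add: cutoff_def power2_le_iff_abs_le)
    then have "(\<xi> w * J w)\<^sup>2 \<le> (real m)\<^sup>2 * (J w)\<^sup>2" by (simp add: power_mult_distrib mult_right_mono)
    moreover have "(\<xi> w * J w + K w)\<^sup>2 \<le> 2 * (\<xi> w * J w)\<^sup>2 + 2 * (K w)\<^sup>2" by (rule square_sum_le)
    moreover have "(div_value w)\<^sup>2 \<le> 2 * (\<xi> w * J w + K w)\<^sup>2 + 2 * (c * Z_div T w)\<^sup>2"
      unfolding div_value_def by (rule square_sum_le)
    ultimately show ?thesis using True by (simp add: power_mult_distrib)
  qed simp
  show ?thesis
    by (rule Bochner_Integration.integrable_bound[OF i]) (use le in \<open>auto intro: order_trans[OF _ abs_ge_self]\<close>)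
qed

lemma good_integrand_adm:
  assumes w: "good w" "w \<in> space M" shows "adm (trunc T (Z w))"
proof -
  have "bounded (Z w ` {0..T})"
    by (intro compact_imp_bounded compact_continuous_image good_Z_cont[OF w(1)]) simp
  then obtain D where D: "\<And>s. s \<in> {0..T} ==> \<bar>Z w s\<bar> \<le> D"
    unfolding bounded_iff by (simp del: atLeastAtMost_iff) blast
  have "D \<ge> 0" using D[of 0] T by auto
  moreover have "Z w \<in> borel_measurable borel"
    using measurable_compose[OF measurable_Pair1'[OF w(2)] Z_measurable] by simp
  ultimately have "admissible T D (trunc T (Z w))" by (intro trunc_admissible[OF T] D)
  then show ?thesis by (auto simp: adm_def)
qed

lemma slice_integrable: "adm v ==> integrable lborel (\<lambda>s. step_slice q s * v s)"
proof -
  assume "adm v"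
  then obtain S D where v: "admissible S D v" by (auto simp: adm_def)
  note [measurable] = admissible_measurable[OF v]
  have "bounded (step_slice q ` {-S..S})"
    by (intro compact_imp_bounded compact_continuous_image continuous_on_step_slice) simp
  then obtain L where L: "\<And>s. s \<in> {-S..S} ==> \<bar>step_slice q s\<bar> \<le> L"
    unfolding bounded_iff by (simp del: atLeastAtMost_iff) blast
  show ?thesis
  proof (rule Bochner_Integration.integrable_bound)
    show "integrable lborel (\<lambda>s. L * \<bar>v s\<bar>)" by (intro integrable_mult_right integrable_abs admissible_integrable[OF v])
    show "AE s in lborel. norm (step_slice q s * v s) \<le> norm (L * \<bar>v s\<bar>)"
    proof (rule AE_I2)
      fix s
      show "norm (step_slice q s * v s) \<le> norm (L * \<bar>v s\<bar>)"
      proof (cases "s \<in> {-S..S}")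
        case True
        have "\<bar>step_slice q s\<bar> * \<bar>v s\<bar> \<le> \<bar>L\<bar> * \<bar>v s\<bar>"
          using L[OF True] by (intro mult_right_mono) auto
        then show ?thesis by (simp add: abs_mult)
      next
        case False
        then have "v s = 0" using admissible_bound(2)[OF v, of s] by simp
        then show ?thesis by simp
      qed
    qed
  qed measurable
qed

text \<open>Independence splits every term on both sides into a mean over \<xi> times a mean over
  the path. For the path factors, \<open>ibp1\<close> handles the two Wiener integrals and
  \<open>Z_div_duality\<close> handles Z; both sides then become the same sum.\<close>

lemma is_divergence_integrand:
  "is_divergence M H B \<xi> (integrand m T f1 f2 c) (\<lambda>w. indicator (cutoff m) w * div_value w)"
  unfolding is_divergence_def
proof (intro conjI allI impI)
  show "(\<lambda>(w, r). integrand m T f1 f2 c w r) \<in> borel_measurable (\<F> \<Otimes>\<^sub>M borel)" by (rule integrand_measurable)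
  show "integrable (M \<Otimes>\<^sub>M (lborel \<Otimes>\<^sub>M lborel))
     (\<lambda>(w, r, s). integrand m T f1 f2 c w r * integrand m T f1 f2 c w s * \<bar>r - s\<bar> powr (2 * H - 2))"
    by (rule integrand_kernel_integrable)
  have cF: "cutoff m \<in> sets \<F>" using cutoff_sets initial_full by (auto simp: subalgebra_def)
  show "(\<lambda>w. indicator (cutoff m) w * div_value w) \<in> borel_measurable \<F>"
    using cF div_value_measurable by measurable
  show "integrable M (\<lambda>w. (indicator (cutoff m) w * div_value w)\<^sup>2)" by (rule div_value_square)
  fix G k t f assume sd: "smooth_data M \<xi> G k f"
  then have G: "G \<in> borel_measurable \<I>" "bounded (G ` space M)" and f: "bounded_smooth k f"
    by (auto simp: smooth_data_def)
  obtain g where g: "\<And>w. w \<in> space M ==> \<bar>G w\<bar> \<le> g" using G(2) by (auto simp: bounded_iff)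
  \<comment> \<open>\<open>G1\<close> and \<open>G2\<close> collect the factors that are functions
    of \<xi>: \<open>G1\<close> accompanies the terms without \<xi>, \<open>G2\<close> those with
    it. The cutoff keeps \<open>G2\<close> bounded although \<xi> is not.\<close>
  define G1 where "G1 = (\<lambda>w. G w * indicator (cutoff m) w)"
  define G2 where "G2 = (\<lambda>w. G1 w * \<xi> w)"
  note [measurable] = G(1) cutoff_sets
  have G1: "G1 \<in> borel_measurable \<I>" "\<forall>w\<in>space M. \<bar>G1 w\<bar> \<le> g"
    and G2: "G2 \<in> borel_measurable \<I>" "\<forall>w\<in>space M. \<bar>G2 w\<bar> \<le> g * real m"
  proof (safe)
    show m1: "G1 \<in> borel_measurable \<I>" unfolding G1_def by measurable
    show "\<bar>G1 w\<bar> \<le> g" if "w \<in> space M" for w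
      using g[OF that] by (auto simp: G1_def indicator_def intro: order_trans[OF abs_ge_zero])
    show "G2 \<in> borel_measurable \<I>" unfolding G2_def using m1 by measurable
    show "\<bar>G2 w\<bar> \<le> g * real m" if "w \<in> space M" for w
    proof -
      have "\<bar>G2 w\<bar> = \<bar>G w\<bar> * \<bar>indicator (cutoff m) w * \<xi> w\<bar>" by (simp add: G1_def G2_def abs_mult)
      also have "... \<le> g * real m"
        using g[OF that] cutoff_bound by (intro mult_mono) (auto intro: order_trans[OF abs_ge_zero])
      finally show ?thesis .
    qed
  qed
  let ?F = "functional f t" and ?D = "\<lambda>i. functional (partial_deriv i f) t"
  define a where "a = (\<lambda>i v. \<integral>s. step_slice (t i) s * v s \<partial>lborel)"
  have Dsm: "bounded_smooth k (partial_deriv i f)" if "i < k" for i by (rule bounded_smooth_partial[OF f that])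
  note tJ = divergence_duality_term[OF G2 wiener_meas(3)[OF J] wiener_meas(4)[OF J]]
  note tK = divergence_duality_term[OF G1 wiener_meas(3)[OF K] wiener_meas(4)[OF K]]
  note tZ = divergence_duality_term[OF G1 Z_div_path Z_div_square[OF T]]
  define S where "S = (\<lambda>i w. LINT s:{0..T}|lborel. step_slice (t i) s * Z w s)"
  have bs: "\<exists>L. \<forall>s\<in>{0..T}. \<bar>step_slice q s\<bar> \<le> L" for q
  proof -
    have "bounded (step_slice q ` {0..T})"
      by (intro compact_imp_bounded compact_continuous_image continuous_on_step_slice) simp
    then show ?thesis by (auto simp: bounded_iff)
  qed
  have S2: "integrable M (\<lambda>w. (S i w)\<^sup>2)" for i
  proof -
    obtain L where "\<And>s. s \<in> {0..T} ==> \<bar>step_slice (t i) s\<bar> \<le> L" using bs by blast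
    then show ?thesis unfolding S_def by (rule weighted_average_square(1)[OF T step_slice_measurable])
  qed
  have SP: "S i \<in> borel_measurable path_algebra" for i
    unfolding S_def
  proof (rule process_integral_measurable)
    note [measurable] = Z_measurable_path
    show "(\<lambda>(w, s). step_slice (t i) s * Z w s) \<in> borel_measurable (path_algebra \<Otimes>\<^sub>M borel)" by measurable
  qed
  note tS = divergence_duality_term[OF G1 SP S2 Dsm]
  \<comment> \<open>The constant 1 as path factor yields the terms in which only the derivative of
    the functional occurs.\<close>
  have one: "(\<lambda>_. 1) \<in> borel_measurable path_algebra" "integrable M (\<lambda>_. 1\<^sup>2 :: real)" by auto
  note t1 = divergence_duality_term[OF G2 one Dsm, unfolded mult_1_right]
  note t2 = divergence_duality_term[OF G1 one Dsm, unfolded mult_1_right]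
  have DS: "expectation (\<lambda>w. ?D i w * S i w) = (LINT s:{0..T}|lborel. expectation (\<lambda>w. ?D i w * Z w s) * step_slice (t i) s)"
    and DSi: "set_integrable lborel {0..T} (\<lambda>s. expectation (\<lambda>w. ?D i w * Z w s) * step_slice (t i) s)" if i: "i < k" for i
  proof -
    obtain L where L: "\<And>s. s \<in> {0..T} ==> \<bar>step_slice (t i) s\<bar> \<le> L" using bs by blast
    have L0: "L \<ge> 0" using L[of 0] T by auto
    have m: "(\<lambda>(w, s). step_slice (t i) s * Z w s) \<in> borel_measurable (M \<Otimes>\<^sub>M borel)" by measurable
    have i2: "integrable M (\<lambda>w. (step_slice (t i) s * Z w s)\<^sup>2)" if "s \<in> {0..T}" for s
      using Z_square[of s] that by (simp add: power_mult_distrib)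
    have b2: "expectation (\<lambda>w. (step_slice (t i) s * Z w s)\<^sup>2) \<le> L\<^sup>2 * Zbound" if "s \<in> {0..T}" for s
    proof -
      have "(step_slice (t i) s)\<^sup>2 \<le> L\<^sup>2" using L[OF that] L0 by (simp add: power2_le_iff_abs_le)
      then have "(step_slice (t i) s)\<^sup>2 * expectation (\<lambda>w. (Z w s)\<^sup>2) \<le> L\<^sup>2 * Zbound"
        using Z_var_le[of s] that by (intro mult_mono) auto
      then show ?thesis by (simp add: power_mult_distrib)
    qed
    have e: "expectation (\<lambda>w. ?D i w * (step_slice (t i) s * Z w s)) = expectation (\<lambda>w. ?D i w * Z w s) * step_slice (t i) s" for s
    proof -
      have "(\<lambda>w. ?D i w * (step_slice (t i) s * Z w s)) = (\<lambda>w. (?D i w * Z w s) * step_slice (t i) s)"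
        by (simp add: fun_eq_iff)
      then show ?thesis by simp
    qed
    show "expectation (\<lambda>w. ?D i w * S i w) = (LINT s:{0..T}|lborel. expectation (\<lambda>w. ?D i w * Z w s) * step_slice (t i) s)"
      unfolding S_def e[symmetric] by (rule process_inner(2)[OF m i2 b2 functional_square(1,2)[OF Dsm[OF i]]])
    show "set_integrable lborel {0..T} (\<lambda>s. expectation (\<lambda>w. ?D i w * Z w s) * step_slice (t i) s)"
      unfolding e[symmetric] by (rule process_inner(3)[OF m i2 b2 functional_square(1,2)[OF Dsm[OF i]]])
  qed
  have EJ: "expectation (\<lambda>w. ?F w * J w) = (\<Sum>i<k. expectation (?D i) * a i (trunc T f1))"
    unfolding ibp1[OF f wiener_meas(1)[OF J]] a_def fbm_inner_step[OF adm1, symmetric] wiener_meas(5)[OF J, symmetric]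
    by (simp add: mult.commute)
  have EK: "expectation (\<lambda>w. ?F w * K w) = (\<Sum>i<k. expectation (?D i) * a i (trunc T f2))"
    unfolding ibp1[OF f wiener_meas(1)[OF K]] a_def fbm_inner_step[OF adm2, symmetric] wiener_meas(5)[OF K, symmetric]
    by (simp add: mult.commute)
  have EZ: "expectation (\<lambda>w. ?F w * Z_div T w) = (\<Sum>i<k. expectation (\<lambda>w. ?D i w * S i w))"
  proof -
    have "(LINT s:{0..T}|lborel. \<Sum>i<k. expectation (\<lambda>w. ?D i w * Z w s) * step_slice (t i) s) =
        (\<Sum>i<k. LINT s:{0..T}|lborel. expectation (\<lambda>w. ?D i w * Z w s) * step_slice (t i) s)"
      using DSi unfolding set_lebesgue_integral_def set_integrable_def scaleR_sum_right
      by (subst Bochner_Integration.integral_sum) auto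
    also have "... = (\<Sum>i<k. expectation (\<lambda>w. ?D i w * S i w))" by (intro sum.cong refl) (simp add: DS)
    finally show ?thesis unfolding Z_div_duality[OF f T] .
  qed
  have "(\<integral>w. smooth_variable B G t f w * (indicator (cutoff m) w * div_value w) \<partial>M) =
      (\<integral>w. (G2 w * (?F w * J w) + G1 w * (?F w * K w)) + c * (G1 w * (?F w * Z_div T w)) \<partial>M)"
    by (intro Bochner_Integration.integral_cong refl)
       (simp add: smooth_variable_def functional_def div_value_def G1_def G2_def algebra_simps)
  also have "... = expectation G2 * expectation (\<lambda>w. ?F w * J w) + expectation G1 * expectation (\<lambda>w. ?F w * K w) +
      c * (expectation G1 * expectation (\<lambda>w. ?F w * Z_div T w))"
    using tJ(1)[OF f, of t] tK(1)[OF f, of t] tZ(1)[OF f, of t]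
    by (simp add: tJ(2)[OF f, of t] tK(2)[OF f, of t] tZ(2)[OF f, of t])
  finally have L: "(\<integral>w. smooth_variable B G t f w * (indicator (cutoff m) w * div_value w) \<partial>M) =
      (\<Sum>i<k. expectation G2 * expectation (?D i) * a i (trunc T f1) + expectation G1 * expectation (?D i) * a i (trunc T f2) +
        c * (expectation G1 * expectation (\<lambda>w. ?D i w * S i w)))"
    unfolding EJ EK EZ by (simp add: sum.distrib sum_distrib_left mult.assoc)
  \<comment> \<open>Almost every path of Z is continuous, hence bounded on [0, T], and only then may
    the inner product be expanded linearly.\<close>
  have ae: "AE w in M. fbm_inner H (malliavin_deriv B G k t f w) (integrand m T f1 f2 c w) =
      (\<Sum>i<k. (G2 w * ?D i w) * a i (trunc T f1) + (G1 w * ?D i w) * a i (trunc T f2) + c * (G1 w * (?D i w * S i w)))"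
    using AE_good AE_space
  proof eventually_elim
    case (elim w)
    note aZ = good_integrand_adm[OF elim]
    let ?i = "indicator (cutoff m) w :: real"
    have v: "integrand m T f1 f2 c w = (\<lambda>s. ?i * (\<xi> w * trunc T f1 s + trunc T f2 s + c * trunc T (Z w) s))"
      by (simp add: fun_eq_iff integrand_def)
    have adv: "adm (integrand m T f1 f2 c w)" unfolding v by (intro adm_intros adm1 adm2 aZ)
    have "(\<integral>s. step_slice (t i) s * integrand m T f1 f2 c w s \<partial>lborel) =
        ?i * (\<xi> w * a i (trunc T f1) + a i (trunc T f2) + c * S i w)" for i
    proof -
      have "(\<integral>s. step_slice (t i) s * integrand m T f1 f2 c w s \<partial>lborel) =
          (\<integral>s. ?i * (\<xi> w * (step_slice (t i) s * trunc T f1 s) + step_slice (t i) s * trunc T f2 s + c * (step_slice (t i) s * trunc T (Z w) s)) \<partial>lborel)"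
        unfolding v by (intro Bochner_Integration.integral_cong refl) (simp add: algebra_simps)
      also have "... = ?i * (\<xi> w * a i (trunc T f1) + a i (trunc T f2) + c * (\<integral>s. step_slice (t i) s * trunc T (Z w) s \<partial>lborel))"
        using slice_integrable[OF adm1, of "t i"] slice_integrable[OF adm2, of "t i"] slice_integrable[OF aZ, of "t i"]
        by (simp add: a_def)
      also have "(\<integral>s. step_slice (t i) s * trunc T (Z w) s \<partial>lborel) = S i w"
        unfolding S_def set_lebesgue_integral_def trunc_def by (simp add: mult_ac)
      finally show ?thesis .
    qed
    then show ?case
      unfolding fbm_inner_malliavin[OF adv]
      by (intro sum.cong refl) (simp add: G1_def G2_def algebra_simps)
  qed
  have "(\<integral>w. fbm_inner H (malliavin_deriv B G k t f w) (integrand m T f1 f2 c w) \<partial>M) =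
     (\<integral>w. (\<Sum>i<k. (G2 w * ?D i w) * a i (trunc T f1) + (G1 w * ?D i w) * a i (trunc T f2) + c * (G1 w * (?D i w * S i w))) \<partial>M)"
  proof (rule integral_cong_AE[OF _ _ ae])
    show "(\<lambda>w. fbm_inner H (malliavin_deriv B G k t f w) (integrand m T f1 f2 c w)) \<in> borel_measurable M"
      by (rule fbm_inner_malliavin_measurable[OF sd integrand_measurable])
    have sm: "(\<lambda>w. ?D i w) \<in> borel_measurable M" "S i \<in> borel_measurable M" if "i < k" for i
      using functional_square(1)[OF Dsm[OF that]] measurable_from_subalg[OF subalgebra_path_algebra SP] by auto
    have "G1 \<in> borel_measurable M" "G2 \<in> borel_measurable M"
      using measurable_from_subalg[OF initial_subalgebra] G1(1) G2(1) by auto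
    then show "(\<lambda>w. \<Sum>i<k. (G2 w * ?D i w) * a i (trunc T f1) + (G1 w * ?D i w) * a i (trunc T f2) + c * (G1 w * (?D i w * S i w)))
        \<in> borel_measurable M"
      using sm by (intro borel_measurable_sum borel_measurable_add borel_measurable_times borel_measurable_const) auto
  qed
  also have "... = (\<Sum>i<k. expectation G2 * expectation (?D i) * a i (trunc T f1) + expectation G1 * expectation (?D i) * a i (trunc T f2) +
        c * (expectation G1 * expectation (\<lambda>w. ?D i w * S i w)))"
  proof (subst Bochner_Integration.integral_sum)
    show "integrable M (\<lambda>w. (G2 w * ?D i w) * a i (trunc T f1) + (G1 w * ?D i w) * a i (trunc T f2) + c * (G1 w * (?D i w * S i w)))"
      if "i \<in> {..<k}" for i
      using t1(1)[of i t] t2(1)[of i t] tS(1)[of i t i] that by simp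
    show "(\<Sum>i<k. expectation (\<lambda>w. (G2 w * ?D i w) * a i (trunc T f1) + (G1 w * ?D i w) * a i (trunc T f2) + c * (G1 w * (?D i w * S i w)))) =
      (\<Sum>i<k. expectation G2 * expectation (?D i) * a i (trunc T f1) + expectation G1 * expectation (?D i) * a i (trunc T f2) +
        c * (expectation G1 * expectation (\<lambda>w. ?D i w * S i w)))"
    proof (rule sum.cong[OF refl])
      fix i assume "i \<in> {..<k}"
      then have i: "i < k" by simp
      show "expectation (\<lambda>w. (G2 w * ?D i w) * a i (trunc T f1) + (G1 w * ?D i w) * a i (trunc T f2) + c * (G1 w * (?D i w * S i w))) =
        expectation G2 * expectation (?D i) * a i (trunc T f1) + expectation G1 * expectation (?D i) * a i (trunc T f2) +
        c * (expectation G1 * expectation (\<lambda>w. ?D i w * S i w))"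
        using t1[OF i, of t] t2[OF i, of t] tS[OF i, of t i] by simp
    qed
  qed
  finally show "(\<integral>w. smooth_variable B G t f w * (indicator (cutoff m) w * div_value w) \<partial>M) =
      (\<integral>w. fbm_inner H (malliavin_deriv B G k t f w) (integrand m T f1 f2 c w) \<partial>M)"
    unfolding L ..
qed

lemma has_skorohod_integral_affine:
  assumes u: "AE w in M. \<forall>s\<in>{0..T}. u s w = \<xi> w * f1 s + f2 s + c * Z w s"
  shows "has_skorohod_integral M H B \<xi> (\<lambda>w s. indicator {0..T} s * u s w) div_value"
  unfolding has_skorohod_integral_def
proof (intro conjI div_value_measurable exI[of _ cutoff] exI[of _ "\<lambda>m. integrand m T f1 f2 c"] allI)
  show "incseq cutoff" by (rule cutoff_incseq)
  show "cutoff m \<in> sets \<I>" for m by (rule cutoff_sets)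
  show "AE w in M. w \<in> (\<Union>m. cutoff m)" by (rule AE_I2[OF cutoff_UN])
  show "AE w in M. AE r in lborel. integrand m T f1 f2 c w r = indicator (cutoff m) w * (indicator {0..T} r * u r w)" for m
    using u
  proof eventually_elim
    case (elim w)
    show ?case
    proof (rule AE_I2)
      fix r
      show "integrand m T f1 f2 c w r = indicator (cutoff m) w * (indicator {0..T} r * u r w)"
        using elim by (cases "r \<in> {0..T}") (auto simp: integrand_def trunc_def)
    qed
  qed
  show "is_divergence M H B \<xi> (integrand m T f1 f2 c) (\<lambda>w. indicator (cutoff m) w * div_value w)" for m
    by (rule is_divergence_integrand)
qed

end

end

section \<open>Uniqueness of the divergence\<close>

text \<open>The derivative is written as a cosine with its phase shifted by pi/2, so that multiples
  of cosines of affine functions are closed under partial differentiation and iterated derivatives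
  have the same shape.\<close>

lemma partial_deriv_cos_linear:
  assumes "i < k"
  shows "((\<lambda>y. a * cos ((\<Sum>j<k. l j * (x(i := y)) j) + c)) has_real_derivative a * l i * cos ((\<Sum>j<k. l j * x j) + (c + pi / 2))) (at (x i))"
    and "partial_deriv i (\<lambda>x. a * cos ((\<Sum>j<k. l j * x j) + c)) = (\<lambda>x. a * l i * cos ((\<Sum>j<k. l j * x j) + (c + pi / 2)))"
proof -
  have s: "(\<Sum>j<k. l j * (x(i := y)) j) = (\<Sum>j\<in>{..<k} - {i}. l j * x j) + l i * y" for x y
  proof -
    have "(\<Sum>j<k. l j * (x(i := y)) j) = l i * (x(i := y)) i + (\<Sum>j\<in>{..<k} - {i}. l j * (x(i := y)) j)"
      using assms by (intro sum.remove) auto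
    then show ?thesis by simp
  qed
  have d: "((\<lambda>y. a * cos ((\<Sum>j<k. l j * (x(i := y)) j) + c)) has_real_derivative a * l i * cos ((\<Sum>j<k. l j * x j) + (c + pi / 2))) (at (x i))" for x
  proof -
    let ?r = "\<Sum>j\<in>{..<k} - {i}. l j * x j"
    have "(\<Sum>j<k. l j * x j) = ?r + l i * x i" using s[of x "x i"] by simp
    then have e: "cos ((\<Sum>j<k. l j * x j) + (c + pi / 2)) = - sin (?r + l i * x i + c)"
      using minus_sin_cos_eq[of "?r + l i * x i + c"] by (simp add: add.assoc)
    have "((\<lambda>y. a * cos (?r + l i * y + c)) has_real_derivative a * (- sin (?r + l i * x i + c) * l i)) (at (x i))"
      by (auto intro!: derivative_eq_intros)
    then show ?thesis unfolding s e by (simp add: mult_ac)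
  qed
  then show "((\<lambda>y. a * cos ((\<Sum>j<k. l j * (x(i := y)) j) + c)) has_real_derivative a * l i * cos ((\<Sum>j<k. l j * x j) + (c + pi / 2))) (at (x i))" .
  show "partial_deriv i (\<lambda>x. a * cos ((\<Sum>j<k. l j * x j) + c)) = (\<lambda>x. a * l i * cos ((\<Sum>j<k. l j * x j) + (c + pi / 2)))"
    unfolding partial_deriv_def by (intro ext DERIV_imp_deriv d)
qed

lemma bounded_smooth_cos_linear: "bounded_smooth k (\<lambda>x. cos ((\<Sum>j<k. l j * x j) + c))"
proof -
  let ?g = "\<lambda>a c x. a * cos ((\<Sum>j<k. l j * x j) + c)"
  have it: "\<exists>a c'. iter_partial is (\<lambda>x. cos ((\<Sum>j<k. l j * x j) + c)) = ?g a c'" if "set is \<subseteq> {..<k}" for "is"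
    using that
  proof (induction "is")
    case Nil
    have "iter_partial [] (\<lambda>x. cos ((\<Sum>j<k. l j * x j) + c)) = ?g 1 c" by (simp add: iter_partial_def)
    then show ?case by blast
  next
    case (Cons i "is")
    then obtain a c' where "iter_partial is (\<lambda>x. cos ((\<Sum>j<k. l j * x j) + c)) = ?g a c'" by auto
    then have "iter_partial (i # is) (\<lambda>x. cos ((\<Sum>j<k. l j * x j) + c)) = ?g (a * l i) (c' + pi / 2)"
      using partial_deriv_cos_linear(2)[of i k a l c'] Cons.prems by (simp add: iter_partial_def)
    then show ?case by blast
  qed
  show ?thesis
    unfolding bounded_smooth_def
  proof (intro conjI allI impI)
    show "cos ((\<Sum>j<k. l j * x j) + c) = cos ((\<Sum>j<k. l j * y j) + c)" if "\<forall>i<k. x i = y i" for x y :: "nat => real"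
    proof -
      have "(\<Sum>j<k. l j * x j) = (\<Sum>j<k. l j * y j)" using that by (intro sum.cong) auto
      then show ?thesis by simp
    qed
    fix "is" :: "nat list" assume "set is \<subseteq> {..<k}"
    from it[OF this] obtain a c' where e: "iter_partial is (\<lambda>x. cos ((\<Sum>j<k. l j * x j) + c)) = ?g a c'" by auto
    have "continuous_on UNIV (\<lambda>x::nat => real. x j)" for j by (rule continuous_on_product_coordinates)
    then show "continuous_on UNIV (iter_partial is (\<lambda>x. cos ((\<Sum>j<k. l j * x j) + c)))"
      unfolding e by (intro continuous_intros)
    show "bounded (range (iter_partial is (\<lambda>x. cos ((\<Sum>j<k. l j * x j) + c))))"
      unfolding e by (intro boundedI[of _ "\<bar>a\<bar>"]) (auto simp: abs_mult intro!: mult_left_le)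
    show "(\<lambda>y. iter_partial is (\<lambda>x. cos ((\<Sum>j<k. l j * x j) + c)) (x(i := y))) differentiable at (x i)" if "i < k" for i x
      unfolding e using partial_deriv_cos_linear(1)[OF that, of a l x c'] real_differentiable_def by blast
  qed
qed

lemma is_divergenceD:
  assumes "is_divergence M H B \<xi> u Y" "smooth_data M \<xi> G k f"
  shows "(\<integral>w. smooth_variable B G t f w * Y w \<partial>M) = (\<integral>w. fbm_inner H (malliavin_deriv B G k t f w) (u w) \<partial>M)"
  using assms unfolding is_divergence_def by blast

context fou_space
begin

text \<open>Dynkin's argument: the cylinder sets generate the full algebra and are stable under
  intersection, and the sets over which D integrates to 0 form a Dynkin system.\<close>

lemma full_zeroI_cylinder:
  fixes D :: "'a => real"
  assumes D: "integrable M D"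
    and cyl: "\<And>A (t :: nat => real) C (k :: nat). A \<in> sets borel ==> (\<And>j. C j \<in> sets borel) ==>
      expectation (\<lambda>w. indicator A (\<xi> w) * (\<Prod>j<k. indicator (C j) (B (t j) w)) * D w) = 0"
    and E: "E \<in> sets \<F>"
  shows "expectation (\<lambda>w. indicator E w * D w) = 0"
proof -
  define cy where "cy A k t C = {w \<in> space M. \<xi> w \<in> A \<and> (\<forall>j<k. B (t j) w \<in> C j)}"
    for A :: "real set" and k and t :: "nat => real" and C :: "nat => real set"
  define \<G> where "\<G> = {cy A k t C | A k t C. A \<in> sets borel \<and> (\<forall>j. C j \<in> sets borel)}"
  have GI: "cy A k t C \<in> \<G>" if "A \<in> sets borel" "\<And>j. C j \<in> sets borel" for A k t C
    using that unfolding \<G>_def by blast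
  have Gsub: "\<G> \<subseteq> sets \<F>"
  proof
    fix E assume "E \<in> \<G>"
    then obtain A k t C where E: "E = cy A k t C" and [measurable]: "A \<in> sets borel" "\<And>j. C j \<in> sets borel" by (auto simp: \<G>_def)
    have "{w \<in> space \<F>. \<xi> w \<in> A \<and> (\<forall>j<k. B (t j) w \<in> C j)} \<in> sets \<F>" by measurable
    then show "E \<in> sets \<F>" by (simp only: E cy_def space_full)
  qed
  have int: "Int_stable \<G>"
  proof (rule Int_stableI)
    fix a b assume "a \<in> \<G>" "b \<in> \<G>"
    then obtain A k t C A' k' t' C' where a: "a = cy A k t C" "A \<in> sets borel" "\<And>j. C j \<in> sets borel"
      and b: "b = cy A' k' t' C'" "A' \<in> sets borel" "\<And>j. C' j \<in> sets borel" by (auto simp: \<G>_def)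
    \<comment> \<open>The intersection of two cylinders is the cylinder over the concatenated lists
      of times.\<close>
    let ?t = "\<lambda>j. if j < k then t j else t' (j - k)" and ?C = "\<lambda>j. if j < k then C j else C' (j - k)"
    have "(\<forall>j<k + k'. B (?t j) w \<in> ?C j) \<longleftrightarrow> (\<forall>j<k. B (t j) w \<in> C j) \<and> (\<forall>j<k'. B (t' j) w \<in> C' j)" for w
    proof (intro iffI conjI allI impI)
      fix j assume l: "\<forall>j<k + k'. B (?t j) w \<in> ?C j"
      show "B (t j) w \<in> C j" if "j < k" using l[rule_format, of j] that by simp
      show "B (t' j) w \<in> C' j" if "j < k'" using l[rule_format, of "k + j"] that by simp
    qed auto
    then have "a \<inter> b = cy (A \<inter> A') (k + k') ?t ?C" unfolding a(1) b(1) cy_def by blast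
    then show "a \<inter> b \<in> \<G>" using a(2,3) b(2,3) by (auto intro!: GI)
  qed
  have gen: "sets \<F> = sigma_sets (space M) \<G>"
  proof
    show "sigma_sets (space M) \<G> \<subseteq> sets \<F>" using sets.sigma_sets_subset[OF Gsub] by simp
    have "\<xi> -` A \<inter> space M \<in> \<G>" if "A \<in> sets borel" for A
    proof -
      have "\<xi> -` A \<inter> space M = cy A 0 (\<lambda>_. 0) (\<lambda>_. UNIV)" by (auto simp: cy_def)
      then show ?thesis using GI[of A "\<lambda>_. UNIV"] that by simp
    qed
    moreover have "B s -` A \<inter> space M \<in> \<G>" if "A \<in> sets borel" for A s
    proof -
      have "B s -` A \<inter> space M = cy UNIV 1 (\<lambda>_. s) (\<lambda>_. A)" by (auto simp: cy_def)
      then show ?thesis using GI[of UNIV "\<lambda>_. A"] that by simp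
    qed
    ultimately have "{\<xi> -` A \<inter> space M | A. A \<in> sets borel} \<union> {B t -` A \<inter> space M | t A. A \<in> sets borel} \<subseteq> \<G>" by auto
    then show "sets \<F> \<subseteq> sigma_sets (space M) \<G>" unfolding sets_full by (rule sigma_sets_subseteq)
  qed
  have mF: "A \<in> sets M" if "A \<in> sets \<F>" for A using full_subalgebra that by (auto simp: subalgebra_def)
  have Gpow: "\<G> \<subseteq> Pow (space M)" by (auto simp: \<G>_def cy_def)
  have basic0: "expectation (\<lambda>w. indicator A w * D w) = 0" if AG: "A \<in> \<G>" for A
  proof -
    obtain A' k t C where A: "A = cy A' k t C" and A': "A' \<in> sets borel" and C: "\<forall>j. C j \<in> sets borel" using AG unfolding \<G>_def by blast
    have "indicator A w * D w = indicator A' (\<xi> w) * (\<Prod>j<k. indicator (C j) (B (t j) w)) * D w" if "w \<in> space M" for w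
    proof (cases "\<forall>j<k. B (t j) w \<in> C j")
      case True then show ?thesis using that by (auto simp: A cy_def indicator_def)
    next
      case False
      then obtain j where "j < k" "B (t j) w \<notin> C j" by auto
      then have "(\<Prod>j<k. indicator (C j) (B (t j) w) :: real) = 0" by (intro prod_zero) (auto intro!: bexI[of _ j])
      then show ?thesis using False by (simp add: A cy_def)
    qed
    then have "expectation (\<lambda>w. indicator A w * D w) =
        expectation (\<lambda>w. indicator A' (\<xi> w) * (\<Prod>j<k. indicator (C j) (B (t j) w)) * D w)"
      by (intro Bochner_Integration.integral_cong refl)
    then show ?thesis using cyl[OF A', of C t k] C by simp
  qed
  have sp: "expectation D = 0"
    using cyl[of UNIV "\<lambda>_. UNIV" "\<lambda>_. 0" 0] by simp
  have si: "integrable M (\<lambda>w. indicator A w * D w)" if "A \<in> sets \<F>" for A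
    using integrable_mult_indicator[OF mF[OF that] D] by simp
  show ?thesis
  proof (rule sigma_sets_induct_disjoint[OF int Gpow])
    show "expectation (\<lambda>w. indicator {} w * D w) = 0" by simp
  next
    fix A assume "A \<in> \<G>" then show "expectation (\<lambda>w. indicator A w * D w) = 0" by (rule basic0)
  next
    fix A assume A: "A \<in> sigma_sets (space M) \<G>" "expectation (\<lambda>w. indicator A w * D w) = 0"
    have "expectation (\<lambda>w. indicator (space M - A) w * D w) = expectation (\<lambda>w. D w - indicator A w * D w)"
      by (intro Bochner_Integration.integral_cong refl) (auto simp: indicator_def)
    also have "... = expectation D - expectation (\<lambda>w. indicator A w * D w)"
      by (rule Bochner_Integration.integral_diff[OF D si]) (use A gen in auto)
    finally show "expectation (\<lambda>w. indicator (space M - A) w * D w) = 0" using A sp by simp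
  next
    fix A :: "nat => 'a set"
    assume d: "disjoint_family A" and r: "range A \<subseteq> sigma_sets (space M) \<G>" and z: "\<And>i. expectation (\<lambda>w. indicator (A i) w * D w) = 0"
    have mA: "A i \<in> sets M" for i using r mF gen by auto
    have "set_integrable M (\<Union>i. A i) D" unfolding set_integrable_def by (rule integrable_mult_indicator[OF _ D]) (use mA in auto)
    from lebesgue_integral_countable_add[OF mA _ this] d
    have "(LINT x:(\<Union>i. A i)|M. D x) = (\<Sum>i. (LINT x:A i|M. D x))" by (auto simp: disjoint_family_on_def)
    then show "expectation (\<lambda>w. indicator (\<Union>i. A i) w * D w) = 0" using z unfolding set_lebesgue_integral_def by simp
  qed (use E gen in simp)
qed

text \<open>For a fixed event of \<xi>, the positive and the negative part of D are taken as
  densities of two finite measures. The hypothesis says that both give the same cosine integrals of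
  the values of B, so they agree on boxes, and cylinder sets determine D.\<close>

lemma full_zeroI_cos:
  fixes D :: "'a => real"
  assumes D: "D \<in> borel_measurable \<F>" "integrable M D"
    and cos: "\<And>A l t c (k :: nat). A \<in> sets borel ==>
      expectation (\<lambda>w. indicator A (\<xi> w) * cos ((\<Sum>j<k. l j * B (t j) w) + c) * D w) = 0"
  shows "AE w in M. D w = 0"
proof -
  have [measurable]: "D \<in> borel_measurable M" using D(2) by auto
  have cyl: "expectation (\<lambda>w. indicator A (\<xi> w) * (\<Prod>j<k. indicator (C j) (B (t j) w)) * D w) = 0"
    if [measurable]: "A \<in> sets borel" "\<And>j. C j \<in> sets borel" for A and t C :: "nat => _" and k :: nat
  proof -
    define p where "p s w = indicator A (\<xi> w) * max 0 (s * D w)" for s :: real and w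
    have [measurable]: "p s \<in> borel_measurable M" for s unfolding p_def[abs_def] by measurable
    have p0: "p s w \<ge> 0" for s w by (simp add: p_def)
    have pi: "integrable M (p s)" for s
      by (rule Bochner_Integration.integrable_bound[OF integrable_mult_right[OF D(2), of s]]) (auto simp: p_def indicator_def)
    let ?\<mu> = "\<lambda>s. density M (\<lambda>w. ennreal (p s w))"
    have fin: "finite_measure (?\<mu> s)" for s
    proof (rule finite_measureI)
      have "emeasure (?\<mu> s) (space (?\<mu> s)) = (\<integral>\<^sup>+w. ennreal (p s w) * indicator (space M) w \<partial>M)"
        by (subst emeasure_density) auto
      also have "... = (\<integral>\<^sup>+w. ennreal (p s w) \<partial>M)" by (intro nn_integral_cong) simp
      also have "... = ennreal (expectation (p s))" by (rule nn_integral_eq_integral[OF pi]) (simp add: p0)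
      finally show "emeasure (?\<mu> s) (space (?\<mu> s)) \<noteq> \<infinity>" by simp
    qed
    have ip: "integral\<^sup>L (?\<mu> s) g = expectation (\<lambda>w. p s w * g w)" if "g \<in> borel_measurable M" for g s
    proof -
      have "AE w in M. 0 \<le> p s w" using p0 by simp
      from integral_density[OF that _ this] show ?thesis by simp
    qed
    have pd: "p 1 w - p (- 1) w = indicator A (\<xi> w) * D w" for w by (auto simp: p_def indicator_def)
    have bi: "integrable M (\<lambda>w. p s w * g w)" if [measurable]: "g \<in> borel_measurable M" and "\<And>w. \<bar>g w\<bar> \<le> 1" for g s
    proof (rule Bochner_Integration.integrable_bound[OF pi[of s]])
      show "AE w in M. norm (p s w * g w) \<le> norm (p s w)"
        by (rule AE_I2) (simp add: abs_mult mult_left_le that(2))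
    qed measurable
    have df: "expectation (\<lambda>w. p 1 w * g w) - expectation (\<lambda>w. p (- 1) w * g w) = expectation (\<lambda>w. indicator A (\<xi> w) * g w * D w)"
      if "g \<in> borel_measurable M" "\<And>w. \<bar>g w\<bar> \<le> 1" for g
    proof -
      have "expectation (\<lambda>w. p 1 w * g w) - expectation (\<lambda>w. p (- 1) w * g w) = expectation (\<lambda>w. p 1 w * g w - p (- 1) w * g w)"
        using bi[OF that] by simp
      also have "(\<lambda>w. p 1 w * g w - p (- 1) w * g w) = (\<lambda>w. indicator A (\<xi> w) * g w * D w)"
        unfolding left_diff_distrib[symmetric] pd by (simp add: mult_ac)
      finally show ?thesis .
    qed
    have eq: "distr (?\<mu> 1) (Pi\<^sub>M {..<k} (\<lambda>_. borel)) (\<lambda>w. \<lambda>i\<in>{..<k}. B (t i) w) =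
        distr (?\<mu> (- 1)) (Pi\<^sub>M {..<k} (\<lambda>_. borel)) (\<lambda>w. \<lambda>i\<in>{..<k}. B (t i) w)"
    proof (rule distr_PiM_eqI_cos[OF fin fin, where Y="\<lambda>i. B (t i)" and Y'="\<lambda>i. B (t i)"])
      fix l c
      have [measurable]: "(\<lambda>w. cos ((\<Sum>j<k. l j * B (t j) w) + c)) \<in> borel_measurable M" by measurable
      have "expectation (\<lambda>w. p 1 w * cos ((\<Sum>j<k. l j * B (t j) w) + c)) - expectation (\<lambda>w. p (- 1) w * cos ((\<Sum>j<k. l j * B (t j) w) + c)) = 0"
        by (subst df) (auto intro: cos)
      then show "(\<integral>w. cos ((\<Sum>i<k. l i * B (t i) w) + c) \<partial>?\<mu> 1) = (\<integral>w. cos ((\<Sum>i<k. l i * B (t i) w) + c) \<partial>?\<mu> (- 1))"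
        by (subst (1 2) ip) auto
    qed auto
    let ?g = "\<lambda>w. \<Prod>j<k. indicator (C j) (B (t j) w) :: real"
    have gm [measurable]: "?g \<in> borel_measurable M" by measurable
    have g1: "0 \<le> ?g w" "?g w \<le> 1" for w
    proof -
      show "0 \<le> ?g w" by (intro prod_nonneg) auto
      show "?g w \<le> 1" by (intro prod_le_1) (auto simp: indicator_def)
    qed
    have bx: "emeasure (distr (?\<mu> s) (Pi\<^sub>M {..<k} (\<lambda>_. borel)) (\<lambda>w. \<lambda>i\<in>{..<k}. B (t i) w)) (Pi\<^sub>E {..<k} C) = ennreal (\<integral>w. ?g w \<partial>?\<mu> s)" for s
      by (rule emeasure_distr_PiM_box[OF fin, where Y="\<lambda>i. B (t i)"]) auto
    have "ennreal (expectation (\<lambda>w. p 1 w * ?g w)) = ennreal (expectation (\<lambda>w. p (- 1) w * ?g w))"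
      using bx[of 1] bx[of "- 1"] eq by (simp add: ip)
    moreover have "expectation (\<lambda>w. p s w * ?g w) \<ge> 0" for s
      using p0 g1 by (intro Bochner_Integration.integral_nonneg mult_nonneg_nonneg) auto
    ultimately have "expectation (\<lambda>w. p 1 w * ?g w) = expectation (\<lambda>w. p (- 1) w * ?g w)" by simp
    then show ?thesis using df[OF gm] g1 by (simp add: abs_le_iff order_trans[OF _ g1(1)])
  qed
  have z: "expectation (\<lambda>w. indicator E w * D w) = 0" if "E \<in> sets \<F>" for E
    by (rule full_zeroI_cylinder[OF D(2) cyl that]) auto
  let ?P = "{w \<in> space M. D w > 0}"
  have P: "?P \<in> sets \<F>"
  proof -
    have "{w \<in> space \<F>. D w > 0} \<in> sets \<F>" using D(1) by measurable
    then show ?thesis by simp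
  qed
  have PM: "?P \<in> sets M" by measurable
  \<comment> \<open>Pointwise, the absolute value is twice the positive part minus D. Both terms
    integrate to 0, as they are integrals of D over sets of the full algebra.\<close>
  have "expectation (\<lambda>w. \<bar>D w\<bar>) = expectation (\<lambda>w. 2 * (indicator ?P w * D w) - D w)"
    by (intro Bochner_Integration.integral_cong refl) (auto simp: indicator_def)
  also have "... = 2 * expectation (\<lambda>w. indicator ?P w * D w) - expectation D"
    using integrable_mult_indicator[OF PM D(2)] D(2) by simp
  also have "expectation D = expectation (\<lambda>w. indicator (space M) w * D w)"
    by (intro Bochner_Integration.integral_cong refl) auto
  also have "... = 0" using z[of "space M"] sets.top[of \<F>] by simp
  also have "expectation (\<lambda>w. indicator ?P w * D w) = 0" by (rule z[OF P])
  finally have "expectation (\<lambda>w. \<bar>D w\<bar>) = 0" by simp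
  then show ?thesis using integral_nonneg_eq_0_iff_AE[of M "\<lambda>w. \<bar>D w\<bar>"] D(2) by auto
qed

text \<open>The hypothesis concerns the products and not the factors, since it is applied where the
  same indicators are distributed differently over the two arguments.\<close>

lemma fbm_inner_cong_AE:
  assumes m: "u \<in> borel_measurable borel" "u' \<in> borel_measurable borel" "v \<in> borel_measurable borel" "v' \<in> borel_measurable borel"
    and ae: "AE s in lborel. \<forall>r. u r * v s = u' r * v' s"
  shows "fbm_inner H u v = fbm_inner H u' v'"
proof -
  note [measurable] = m
  have pm: "(\<lambda>x. f (fst x) * g (snd x) * \<bar>fst x - snd x\<bar> powr (2 * H - 2)) \<in> borel_measurable (lborel \<Otimes>\<^sub>M lborel)"
    if [measurable]: "f \<in> borel_measurable borel" "g \<in> borel_measurable borel" for f g :: "real => real"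
  proof -
    have "(\<lambda>x. f (fst x) * g (snd x) * \<bar>fst x - snd x\<bar> powr (2 * H - 2)) \<in> borel_measurable (borel \<Otimes>\<^sub>M borel)" by measurable
    then show ?thesis by (subst measurable_cong_sets[OF sets_pair_measure_cong[OF sets_lborel sets_lborel] refl])
  qed
  have "{x \<in> space (borel \<Otimes>\<^sub>M borel). u (fst x) * v (snd x) = u' (fst x) * v' (snd x)} \<in> sets (borel \<Otimes>\<^sub>M borel)" by measurable
  then have mp: "{x \<in> space (lborel \<Otimes>\<^sub>M lborel). u (fst x) * v (snd x) = u' (fst x) * v' (snd x)} \<in> sets (lborel \<Otimes>\<^sub>M lborel)"
    by (simp add: space_pair_measure sets_pair_measure_cong[OF sets_lborel sets_lborel])
  have "AE s in lborel. AE r in lborel. u r * v s = u' r * v' s" using ae by eventually_elim auto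
  then have "AE r in lborel. AE s in lborel. u r * v s = u' r * v' s"
    by (subst lborel_pair.AE_commute[OF mp])
  then have "AE x in lborel \<Otimes>\<^sub>M lborel. u (fst x) * v (snd x) = u' (fst x) * v' (snd x)"
    by (intro lborel_pair.AE_pair_measure mp) simp
  then have "AE x in lborel \<Otimes>\<^sub>M lborel. u (fst x) * v (snd x) * \<bar>fst x - snd x\<bar> powr (2 * H - 2) = u' (fst x) * v' (snd x) * \<bar>fst x - snd x\<bar> powr (2 * H - 2)"
    by eventually_elim simp
  then have "(\<integral>x. u (fst x) * v (snd x) * \<bar>fst x - snd x\<bar> powr (2 * H - 2) \<partial>(lborel \<Otimes>\<^sub>M lborel)) =
      (\<integral>x. u' (fst x) * v' (snd x) * \<bar>fst x - snd x\<bar> powr (2 * H - 2) \<partial>(lborel \<Otimes>\<^sub>M lborel))"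
    using pm[OF m(1,3)] pm[OF m(2,4)] by (intro integral_cong_AE)
  then show ?thesis unfolding fbm_inner_def case_prod_beta' by simp
qed

text \<open>The two divergences come with unrelated localising events. Each is tested against
  variables that contain the indicator of the other's event; on the intersection both are then
  tested against the same integrand. The intersections increase to a set of full measure.\<close>

lemma has_skorohod_integral_unique:
  assumes "has_skorohod_integral M H B \<xi> u Y" "has_skorohod_integral M H B \<xi> u Y'"
  shows "AE w in M. Y w = Y' w"
proof -
  have data: "\<exists>A v. Y \<in> borel_measurable \<F> \<and> incseq A \<and> (\<forall>k. A k \<in> sets \<I>) \<and> (AE w in M. w \<in> (\<Union>k. A k)) \<and>
      (\<forall>k. AE w in M. AE r in lborel. v k w r = indicator (A k) w * u w r) \<and>
      (\<forall>k. is_divergence M H B \<xi> (v k) (\<lambda>w. indicator (A k) w * Y w))"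
    if "has_skorohod_integral M H B \<xi> u Y" for Y
    using that unfolding has_skorohod_integral_def by blast
  obtain A v where Y: "Y \<in> borel_measurable \<F>" and A: "incseq A" "\<And>k. A k \<in> sets \<I>" "AE w in M. w \<in> (\<Union>k. A k)"
    and v: "\<And>k. AE w in M. AE r in lborel. v k w r = indicator (A k) w * u w r"
    and dv: "\<And>k. is_divergence M H B \<xi> (v k) (\<lambda>w. indicator (A k) w * Y w)"
    using data[OF assms(1)] by blast
  obtain A' v' where Y': "Y' \<in> borel_measurable \<F>" and A': "incseq A'" "\<And>k. A' k \<in> sets \<I>" "AE w in M. w \<in> (\<Union>k. A' k)"
    and v': "\<And>k. AE w in M. AE r in lborel. v' k w r = indicator (A' k) w * u w r"
    and dv': "\<And>k. is_divergence M H B \<xi> (v' k) (\<lambda>w. indicator (A' k) w * Y' w)"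
    using data[OF assms(2)] by blast
  have "AE w in M. indicator (A m \<inter> A' m) w * (Y w - Y' w) = 0" for m
  proof (rule full_zeroI_cos)
    have F: "A m \<in> sets \<F>" "A' m \<in> sets \<F>" using A(2) A'(2) initial_full by (auto simp: subalgebra_def)
    then have AM [measurable]: "A m \<in> sets M" "A' m \<in> sets M" using full_subalgebra by (auto simp: subalgebra_def)
    note [measurable] = A(2) A'(2)
    show "(\<lambda>w. indicator (A m \<inter> A' m) w * (Y w - Y' w)) \<in> borel_measurable \<F>"
      using F Y Y' by measurable
    have i1: "integrable M (\<lambda>w. indicator (A m) w * Y w)" and i2: "integrable M (\<lambda>w. indicator (A' m) w * Y' w)"
      using dv[of m] dv'[of m] unfolding is_divergence_def
      by (auto intro!: integrable_of_square measurable_from_subalg[OF full_subalgebra])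
    have d: "indicator (A m \<inter> A' m) w * (Y w - Y' w) =
        indicator (A' m) w * (indicator (A m) w * Y w) - indicator (A m) w * (indicator (A' m) w * Y' w)" for w
      by (auto simp: indicator_def)
    have j1: "integrable M (\<lambda>w. indicator (A' m) w * (indicator (A m) w * Y w))"
      and j2: "integrable M (\<lambda>w. indicator (A m) w * (indicator (A' m) w * Y' w))"
      using integrable_mult_indicator[OF AM(2) i1] integrable_mult_indicator[OF AM(1) i2] by simp_all
    then show "integrable M (\<lambda>w. indicator (A m \<inter> A' m) w * (Y w - Y' w))" unfolding d by simp
    fix S :: "real set" and l t :: "nat => real" and c :: real and k :: nat assume [measurable]: "S \<in> sets borel"
    let ?f = "\<lambda>x. cos ((\<Sum>j<k. l j * x j) + c)"
    \<comment> \<open>The indicators are crossed: \<open>A' m\<close> goes to the test variable for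
      Y, \<open>A m\<close> to the one for \<open>Y'\<close>. This is legitimate because both events
      are functions of \<xi>, like the factor G of a smooth variable.\<close>
    let ?G = "\<lambda>w. indicator (A' m) w * indicator S (\<xi> w) :: real" and ?G' = "\<lambda>w. indicator (A m) w * indicator S (\<xi> w) :: real"
    have sd: "smooth_data M \<xi> ?G k ?f" "smooth_data M \<xi> ?G' k ?f"
      unfolding smooth_data_def
      by (auto intro!: bounded_smooth_cos_linear boundedI[of _ 1] simp: indicator_def) (measurable)
    have vm: "case_prod (v m) \<in> borel_measurable (\<F> \<Otimes>\<^sub>M borel)" "case_prod (v' m) \<in> borel_measurable (\<F> \<Otimes>\<^sub>M borel)"
      using dv[of m] dv'[of m] by (auto simp: is_divergence_def)
    have e2: "expectation (\<lambda>w. fbm_inner H (malliavin_deriv B ?G k t ?f w) (v m w)) =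
        expectation (\<lambda>w. fbm_inner H (malliavin_deriv B ?G' k t ?f w) (v' m w))"
    proof (rule integral_cong_AE)
      show "(\<lambda>w. fbm_inner H (malliavin_deriv B ?G k t ?f w) (v m w)) \<in> borel_measurable M"
        by (rule fbm_inner_malliavin_measurable[OF sd(1)]) (rule vm)
      show "(\<lambda>w. fbm_inner H (malliavin_deriv B ?G' k t ?f w) (v' m w)) \<in> borel_measurable M"
        by (rule fbm_inner_malliavin_measurable[OF sd(2)]) (rule vm)
      show "AE w in M. fbm_inner H (malliavin_deriv B ?G k t ?f w) (v m w) = fbm_inner H (malliavin_deriv B ?G' k t ?f w) (v' m w)"
        using v[of m] v'[of m] AE_space
      proof eventually_elim
        case (elim w)
        have sl: "U w \<in> borel_measurable borel" if "case_prod U \<in> borel_measurable (\<F> \<Otimes>\<^sub>M borel)" for U :: "'a => real => real"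
          using measurable_compose[OF measurable_Pair1'[of w \<F>] that] elim(3) by simp
        have sl': "malliavin_deriv B g k t ?f w \<in> borel_measurable borel" for g
          unfolding malliavin_deriv_def[abs_def] fbm_step_def by measurable
        have mm: "malliavin_deriv B ?G k t ?f w r = indicator (A' m) w * malliavin_deriv B (\<lambda>w. indicator S (\<xi> w)) k t ?f w r"
          "malliavin_deriv B ?G' k t ?f w r = indicator (A m) w * malliavin_deriv B (\<lambda>w. indicator S (\<xi> w)) k t ?f w r" for r
          by (simp_all add: malliavin_deriv_def sum_distrib_left mult_ac)
        show ?case
        proof (rule fbm_inner_cong_AE[OF sl' sl' sl[OF vm(1)] sl[OF vm(2)]])
          show "AE s in lborel. \<forall>r. malliavin_deriv B ?G k t ?f w r * v m w s = malliavin_deriv B ?G' k t ?f w r * v' m w s"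
            using elim(1,2) by eventually_elim (simp add: mm)
        qed
      qed
    qed
    have e: "expectation (\<lambda>w. smooth_variable B ?G t ?f w * (indicator (A m) w * Y w)) =
       expectation (\<lambda>w. smooth_variable B ?G' t ?f w * (indicator (A' m) w * Y' w))"
      by (rule trans[OF is_divergenceD[OF dv sd(1)] trans[OF e2 is_divergenceD[OF dv' sd(2), symmetric]]])
    have b: "integrable M (\<lambda>w. q w * (indicator S (\<xi> w) * cos ((\<Sum>j<k. l j * B (t j) w) + c)))" if q: "integrable M q" for q
    proof (rule Bochner_Integration.integrable_bound[OF q])
      show "(\<lambda>w. q w * (indicator S (\<xi> w) * cos ((\<Sum>j<k. l j * B (t j) w) + c))) \<in> borel_measurable M"
        using q by measurable
      show "AE w in M. norm (q w * (indicator S (\<xi> w) * cos ((\<Sum>j<k. l j * B (t j) w) + c))) \<le> norm (q w)"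
        by (intro AE_I2) (auto simp: abs_mult indicator_def intro!: mult_left_le)
    qed
    define p where "p w = indicator S (\<xi> w) * cos ((\<Sum>j<k. l j * B (t j) w) + c)" for w
    define q where "q w = indicator (A' m) w * (indicator (A m) w * Y w)" for w
    define q' where "q' w = indicator (A m) w * (indicator (A' m) w * Y' w)" for w
    have "smooth_variable B ?G t ?f w * (indicator (A m) w * Y w) = q w * p w"
      "smooth_variable B ?G' t ?f w * (indicator (A' m) w * Y' w) = q' w * p w" for w
      by (simp_all add: smooth_variable_def p_def q_def q'_def mult_ac)
    with e have e': "expectation (\<lambda>w. q w * p w) = expectation (\<lambda>w. q' w * p w)" by simp
    have "p w * (indicator (A m \<inter> A' m) w * (Y w - Y' w)) = q w * p w - q' w * p w" for w
      unfolding d q_def q'_def by (simp add: algebra_simps)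
    moreover have "expectation (\<lambda>w. q w * p w - q' w * p w) = 0"
    proof -
      have "integrable M (\<lambda>w. q w * p w)" unfolding p_def q_def by (rule b[OF j1])
      moreover have "integrable M (\<lambda>w. q' w * p w)" unfolding p_def q'_def by (rule b[OF j2])
      ultimately show ?thesis using e' by simp
    qed
    ultimately show "expectation (\<lambda>w. indicator S (\<xi> w) * cos ((\<Sum>j<k. l j * B (t j) w) + c) * (indicator (A m \<inter> A' m) w * (Y w - Y' w))) = 0"
      unfolding p_def by simp
  qed
  then have ae: "AE w in M. \<forall>m. indicator (A m \<inter> A' m) w * (Y w - Y' w) = 0" unfolding AE_all_countable by blast
  have key: "Y w = Y' w" if i: "w \<in> A i" and j: "w \<in> A' j"
    and z: "\<forall>m. indicator (A m \<inter> A' m) w * (Y w - Y' w) = 0" for w i j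
  proof -
    have "w \<in> A (max i j)" using incseqD[OF A(1) max.cobounded1[of i j]] i by blast
    moreover have "w \<in> A' (max i j)" using incseqD[OF A'(1) max.cobounded2[of j i]] j by blast
    ultimately have "indicator (A (max i j) \<inter> A' (max i j)) w = (1 :: real)" by simp
    then have "1 * (Y w - Y' w) = 0" using z[THEN spec, of "max i j"] by (simp only:)
    then show ?thesis by simp
  qed
  show ?thesis
    using A(3) A'(3) ae by eventually_elim (blast intro: key)
qed

lemma skorohod_integral_AE_eq:
  assumes "has_skorohod_integral M H B \<xi> (\<lambda>w t. indicator {0..T} t * u t w) Y"
  shows "AE w in M. skorohod_integral M H B \<xi> T u w = Y w"
proof -
  define P where "P = has_skorohod_integral M H B \<xi> (\<lambda>w t. indicator {0..T} t * u t w)"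
  have "P Y" using assms by (simp only: P_def)
  then have "P (SOME Y. P Y)" by (rule someI[of P])
  then have h: "has_skorohod_integral M H B \<xi> (\<lambda>w t. indicator {0..T} t * u t w) (skorohod_integral M H B \<xi> T u)"
    by (simp only: P_def skorohod_integral_def)
  show ?thesis by (rule has_skorohod_integral_unique[OF h assms])
qed

end

section \<open>Convergence in probability and matrix inversion\<close>

text \<open>If the probabilities stayed above some \<eta> along a subsequence, a further subsequence
  would make S, and hence e, tend to 0 almost surely, against dominated convergence. The quantifier
  over r stands inside the almost sure statement because the further subsequence is found only
  during the proof.\<close>

lemma (in prob_space) tendsto_prob_of_subsequences:
  fixes S e :: "nat => 'a => real"
  assumes S: "\<And>n. integrable M (S n)" "(\<lambda>n. expectation (\<lambda>w. \<bar>S n w\<bar>)) \<longlonglongrightarrow> 0"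
    and e [measurable]: "\<And>n. e n \<in> borel_measurable M"
    and imp: "AE w in M. \<forall>r. strict_mono r --> (\<lambda>n. S (r n) w) \<longlonglongrightarrow> 0 --> (\<lambda>n. e (r n) w) \<longlonglongrightarrow> 0"
    and \<epsilon>: "\<epsilon> > 0"
  shows "(\<lambda>n. prob {w \<in> space M. e n w > \<epsilon>}) \<longlonglongrightarrow> 0"
proof (rule ccontr)
  let ?p = "\<lambda>n. prob {w \<in> space M. e n w > \<epsilon>}"
  assume "\<not> ?p \<longlonglongrightarrow> 0"
  then obtain \<eta> where \<eta>: "\<eta> > 0" and ev: "\<And>N. \<exists>n\<ge>N. \<not> dist (?p n) 0 < \<eta>" unfolding LIMSEQ_def by blast
  have "\<exists>n\<ge>N. n \<in> {n. \<eta> \<le> ?p n}" for N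
    using ev[of N] by (auto simp: dist_real_def not_less)
  then have "infinite {n. \<eta> \<le> ?p n}" unfolding infinite_nat_iff_unbounded_le by blast
  then obtain r :: "nat => nat" where r: "strict_mono r" "\<And>n. r n \<in> {n. \<eta> \<le> ?p n}"
    using infinite_enumerate by blast
  have "(\<lambda>n. expectation (\<lambda>w. norm (S (r n) w))) \<longlonglongrightarrow> 0"
    using LIMSEQ_subseq_LIMSEQ[OF S(2) r(1)] by (simp add: o_def)
  from tendsto_L1_AE_subseq[OF _ this] S(1) obtain s :: "nat => nat"
    where s: "strict_mono s" "AE w in M. (\<lambda>n. S (r (s n)) w) \<longlonglongrightarrow> 0" by blast
  have rs: "strict_mono (\<lambda>n. r (s n))" using strict_mono_o[OF r(1) s(1)] by (simp add: o_def)
  have lim: "AE w in M. (\<lambda>n. e (r (s n)) w) \<longlonglongrightarrow> 0"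
    using s(2) imp by eventually_elim (use rs in blast)
  have "(\<lambda>n. expectation (indicator {w \<in> space M. e (r (s n)) w > \<epsilon>} :: 'a => real)) \<longlonglongrightarrow> expectation (\<lambda>_. 0)"
  proof (rule integral_dominated_convergence[where w="\<lambda>_. 1"])
    show "AE w in M. (\<lambda>n. indicator {w \<in> space M. e (r (s n)) w > \<epsilon>} w :: real) \<longlonglongrightarrow> 0"
      using lim
    proof eventually_elim
      case (elim w)
      have "eventually (\<lambda>n. e (r (s n)) w < \<epsilon>) sequentially" by (rule order_tendstoD(2)[OF elim \<epsilon>])
      then have "eventually (\<lambda>n. indicator {w \<in> space M. e (r (s n)) w > \<epsilon>} w = (0 :: real)) sequentially"
        by eventually_elim (auto simp: indicator_def)
      then show ?case by (rule tendsto_eventually)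
    qed
  qed (auto simp: indicator_def)
  moreover have "expectation (indicator {w \<in> space M. e (r (s n)) w > \<epsilon>} :: 'a => real) = ?p (r (s n))" for n
  proof -
    have "{w \<in> space M. e (r (s n)) w > \<epsilon>} \<inter> space M = {w \<in> space M. e (r (s n)) w > \<epsilon>}" by auto
    then show ?thesis by simp
  qed
  ultimately have "(\<lambda>n. ?p (r (s n))) \<longlonglongrightarrow> 0" by simp
  then have "\<eta> \<le> 0" by (rule LIMSEQ_le_const) (use r(2) in auto)
  then show False using \<eta> by simp
qed

lemma borel_measurable_completion_AE:
  assumes g: "g \<in> borel_measurable M" and ae: "AE w in M. f w = g w"
  shows "f \<in> borel_measurable (completion M)"
proof (rule measurableI)
  fix A :: "'b set" assume A: "A \<in> sets borel"
  have "g -` A \<inter> space M \<in> sets (completion M)" using measurable_sets[OF g A] by auto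
  moreover have "AE w in completion M. w \<in> g -` A \<inter> space M \<longleftrightarrow> w \<in> f -` A \<inter> space M"
    using AE_completion[OF ae] by eventually_elim auto
  moreover have "f -` A \<inter> space M \<subseteq> space (completion M)" by simp
  ultimately have "f -` A \<inter> space M \<in> sets (completion M)" by (metis completion.in_sets_AE)
  then show "f -` A \<inter> space (completion M) \<in> sets (completion M)" by simp
qed auto

text \<open>The estimator itself is measurable only for the completion. The estimates are carried
  out for a version that is measurable for M, and probabilities do not change.\<close>

lemma (in prob_space) tendsto_in_probability_AE_version:
  fixes f :: "nat => 'a => 'b :: {metric_space, second_countable_topology}"
  assumes g [measurable]: "\<And>n. g n \<in> borel_measurable M" and ae: "\<And>n. AE w in M. f n w = g n w"
    and lim: "\<And>\<epsilon>. \<epsilon> > 0 ==> (\<lambda>n. prob {w \<in> space M. dist (g n w) l > \<epsilon>}) \<longlonglongrightarrow> 0"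
  shows "tendsto_in_probability M f l"
  unfolding tendsto_in_probability_def
proof (intro conjI allI impI)
  show f: "f n \<in> borel_measurable (completion M)" for n by (rule borel_measurable_completion_AE[OF g ae])
  fix \<epsilon> :: real assume \<epsilon>: "\<epsilon> > 0"
  have "measure (completion M) {w \<in> space M. dist (f n w) l > \<epsilon>} = prob {w \<in> space M. dist (g n w) l > \<epsilon>}" for n
  proof -
    have s: "{w \<in> space M. dist (g n w) l > \<epsilon>} \<in> sets M" by measurable
    have "{w \<in> space (completion M). dist (f n w) l > \<epsilon>} \<in> sets (completion M)" using f[of n] by measurable
    then have sf: "{w \<in> space M. dist (f n w) l > \<epsilon>} \<in> sets (completion M)" by simp
    have "AE w in completion M. w \<in> {w \<in> space M. dist (f n w) l > \<epsilon>} \<longleftrightarrow> w \<in> {w \<in> space M. dist (g n w) l > \<epsilon>}"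
      using AE_completion[OF ae[of n]] by eventually_elim simp
    then have "measure (completion M) {w \<in> space M. dist (f n w) l > \<epsilon>} = measure (completion M) {w \<in> space M. dist (g n w) l > \<epsilon>}"
      by (rule measure_eq_AE[OF _ sf sets_completionI_sets[OF s]])
    also have "... = prob {w \<in> space M. dist (g n w) l > \<epsilon>}" by (rule measure_completion[OF s])
    finally show ?thesis .
  qed
  then show "(\<lambda>n. measure (completion M) {w \<in> space M. dist (f n w) l > \<epsilon>}) \<longlonglongrightarrow> 0" using lim[OF \<epsilon>] by simp
qed

section \<open>The matrix inverse and the linear system of the estimator\<close>

lemma borel_measurable_vecI:
  fixes f :: "'a => real^'n"
  assumes "\<And>i. (\<lambda>x. f x $ i) \<in> borel_measurable M" shows "f \<in> borel_measurable M"
  using assms by (subst borel_measurable_euclidean_space) (auto simp: Basis_vec_def inner_axis)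

lemma matrix_inv_right: "A ** matrix_inv A = mat 1" and matrix_inv_left: "matrix_inv A ** A = mat 1"
  if "invertible A" for A :: "real^'n^'n"
  using someI_ex[OF that[unfolded invertible_def]] unfolding matrix_inv_def by blast+

text \<open>A singular matrix has the junk inverse \<open>SOME B. False\<close>, which does not depend on the matrix.\<close>

lemma borel_measurable_matrix_inv_mult:
  fixes A :: "'a => real^'n^'n" and b :: "'a => real^'n"
  assumes A: "\<And>i j. (\<lambda>x. A x $ i $ j) \<in> borel_measurable M" and b: "\<And>i. (\<lambda>x. b x $ i) \<in> borel_measurable M"
  shows "(\<lambda>x. matrix_inv (A x) *v b x) \<in> borel_measurable M"
proof (rule borel_measurable_vecI)
  fix k
  define C :: "real^'n^'n" where "C = (SOME B. False)"
  have m: "(\<lambda>x. det (F x)) \<in> borel_measurable M" if "\<And>i j. (\<lambda>x. F x $ i $ j) \<in> borel_measurable M" for F :: "'a => real^'n^'n"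
    unfolding det_def by (intro borel_measurable_sum borel_measurable_times borel_measurable_prod borel_measurable_const that)
  have "(matrix_inv (A x) *v b x) $ k =
      (if det (A x) = 0 then (C *v b x) $ k else det (\<chi> i j. if j = k then b x $ i else A x $ i $ j) / det (A x))" for x
  proof (cases "det (A x) = 0")
    case True
    then have "\<not> invertible (A x)" by (simp add: invertible_det_nz)
    then have "(\<lambda>B. A x ** B = mat 1 \<and> B ** A x = mat 1) = (\<lambda>B. False)" by (auto simp: invertible_def)
    then have "matrix_inv (A x) = C" by (simp add: matrix_inv_def C_def)
    then show ?thesis using True by simp
  next
    case False
    then have "A x ** matrix_inv (A x) = mat 1" by (simp add: invertible_det_nz matrix_inv_right)
    then have "A x *v (matrix_inv (A x) *v b x) = b x" by (simp add: matrix_vector_mul_assoc)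
    then show ?thesis using cramer[OF False, of "matrix_inv (A x) *v b x" "b x"] False by (simp add: vec_eq_iff)
  qed
  moreover have "(\<lambda>x. (C *v b x) $ k) \<in> borel_measurable M"
    unfolding matrix_vector_mult_def using b by simp
  moreover have "(\<lambda>x. det (\<chi> i j. if j = k then b x $ i else A x $ i $ j)) \<in> borel_measurable M"
    by (rule m) (use A b in simp)
  moreover have "{x \<in> space M. det (A x) = 0} \<in> sets M" using m[OF A] by measurable
  ultimately show "(\<lambda>x. (matrix_inv (A x) *v b x) $ k) \<in> borel_measurable M"
    using m[OF A] by (simp add: measurable_If borel_measurable_divide)
qed

lemma sum_UNIV_option: "(\<Sum>j\<in>UNIV. f j) = f None + (\<Sum>i\<in>UNIV. f (Some i))" for f :: "'p::finite option => real"
  unfolding UNIV_option_conv by (subst sum.insert) (auto simp: sum.reindex)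

lemma lse_Q_mult:
  "(lse_Q \<phi> X n w *v v) $ Some i = real n * v $ Some i - lse_a \<phi> X n w $ i * v $ None"
  "(lse_Q \<phi> X n w *v v) $ None = lse_b X n w * v $ None - (\<Sum>i\<in>UNIV. lse_a \<phi> X n w $ i * v $ Some i)"
  by (simp_all add: matrix_vector_mult_def sum_UNIV_option lse_Q_def sum_negf if_distrib[of "\<lambda>x. x * _"] cong: if_cong)

text \<open>Block elimination: the upper rows are solved for the first p components and inserted
  into the last row, whose coefficient becomes n times the Schur complement \<open>s\<close>. The
  resulting identities hold for every vector, so a positive \<open>s\<close> leaves only the zero
  vector in the kernel.\<close>

lemma lse_Q_solve:
  fixes \<phi> :: "'p::finite => real => real" and X :: "real => 'a => real" and n :: nat and w :: 'a
  defines "s \<equiv> lse_b X n w / real n - (\<Sum>i\<in>UNIV. (lse_a \<phi> X n w $ i / real n)\<^sup>2)"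
  assumes n: "n > 0" and s: "s > 0" and v: "v = matrix_inv (lse_Q \<phi> X n w) *v d"
  shows "v $ None = (d $ None / real n + (\<Sum>i\<in>UNIV. lse_a \<phi> X n w $ i / real n * (d $ Some i / real n))) / s"
    and "v $ Some i = d $ Some i / real n + lse_a \<phi> X n w $ i / real n * v $ None"
    and "invertible (lse_Q \<phi> X n w)"
proof -
  let ?a = "\<lambda>i. lse_a \<phi> X n w $ i" and ?Q = "lse_Q \<phi> X n w"
  have Some: "y $ Some i = (?Q *v y) $ Some i / real n + ?a i / real n * y $ None" for y i
    using n unfolding lse_Q_mult by (simp add: field_simps)
  have None: "s * y $ None = (?Q *v y) $ None / real n + (\<Sum>i\<in>UNIV. ?a i / real n * ((?Q *v y) $ Some i / real n))" for y
  proof -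
    have "(\<Sum>i\<in>UNIV. ?a i / real n * y $ Some i) =
        (\<Sum>i\<in>UNIV. ?a i / real n * ((?Q *v y) $ Some i / real n) + (?a i / real n)\<^sup>2 * y $ None)"
      by (intro sum.cong refl, subst Some) (simp add: power2_eq_square algebra_simps)
    then have "(\<Sum>i\<in>UNIV. ?a i / real n * y $ Some i) =
        (\<Sum>i\<in>UNIV. ?a i / real n * ((?Q *v y) $ Some i / real n)) + (\<Sum>i\<in>UNIV. (?a i / real n)\<^sup>2) * y $ None"
      by (simp only: sum.distrib sum_distrib_right)
    moreover have "(?Q *v y) $ None / real n = lse_b X n w / real n * y $ None - (\<Sum>i\<in>UNIV. ?a i / real n * y $ Some i)"
      unfolding lse_Q_mult(2) by (simp add: diff_divide_distrib sum_divide_distrib)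
    ultimately show ?thesis unfolding s_def by (simp only: left_diff_distrib)
  qed
  have "y = 0" if "?Q *v y = 0" for y
  proof -
    have "y $ None = 0" using None[of y] s that by simp
    then have "y $ j = 0" for j using Some[of y] that by (cases j) auto
    then show ?thesis by (simp add: vec_eq_iff)
  qed
  then show inv: "invertible ?Q" unfolding invertible_left_inverse matrix_left_invertible_ker by blast
  have "?Q *v v = d" unfolding v by (simp add: matrix_vector_mul_assoc matrix_inv_right[OF inv])
  then show "v $ None = (d $ None / real n + (\<Sum>i\<in>UNIV. ?a i / real n * (d $ Some i / real n))) / s"
    and "v $ Some i = d $ Some i / real n + ?a i / real n * v $ None"
    using None[of v] Some[of v i] s by (simp_all add: field_simps)
qed

section \<open>Averages over a bounded time interval\<close>

definition bdd_on :: "real => (real => real) => bool" where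
  "bdd_on T f \<longleftrightarrow> f \<in> borel_measurable borel \<and> (\<exists>C. \<forall>s\<in>{0..T}. \<bar>f s\<bar> \<le> C)"

lemma bdd_onI: "f \<in> borel_measurable borel ==> (\<And>s. s \<in> {0..T} ==> \<bar>f s\<bar> \<le> C) ==> bdd_on T f"
  unfolding bdd_on_def by blast

lemma bdd_on_integrable: assumes "bdd_on T f" shows "set_integrable lborel {0..T} f"
proof -
  obtain C where f [measurable]: "f \<in> borel_measurable borel" and C: "\<forall>s\<in>{0..T}. \<bar>f s\<bar> \<le> C" using assms by (auto simp: bdd_on_def)
  have i: "integrable lborel (\<lambda>s. C * indicator {0..T} s :: real)" by (intro integrable_mult_right integrable_real_indicator) (auto simp: emeasure_lborel_Icc_eq)
  show ?thesis unfolding set_integrable_def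
    by (rule Bochner_Integration.integrable_bound[OF i]) (use C in \<open>auto simp: indicator_def intro!: AE_I2 intro: order_trans[OF _ abs_ge_self]\<close>)
qed

lemma bdd_on_const: "bdd_on T (\<lambda>_. c)" by (rule bdd_onI[of _ _ "\<bar>c\<bar>"]) auto

lemma bdd_on_add: assumes "bdd_on T f" "bdd_on T g" shows "bdd_on T (\<lambda>s. f s + g s)"
proof -
  obtain C D where [measurable]: "f \<in> borel_measurable borel" "g \<in> borel_measurable borel"
    and "\<forall>s\<in>{0..T}. \<bar>f s\<bar> \<le> C" "\<forall>s\<in>{0..T}. \<bar>g s\<bar> \<le> D" using assms by (auto simp: bdd_on_def)
  then show ?thesis by (intro bdd_onI[of _ _ "C + D"]) (auto intro: order_trans[OF abs_triangle_ineq add_mono])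
qed

lemma bdd_on_mult: assumes "bdd_on T f" "bdd_on T g" shows "bdd_on T (\<lambda>s. f s * g s)"
proof -
  obtain C D where [measurable]: "f \<in> borel_measurable borel" "g \<in> borel_measurable borel"
    and C: "\<forall>s\<in>{0..T}. \<bar>f s\<bar> \<le> C" and D: "\<forall>s\<in>{0..T}. \<bar>g s\<bar> \<le> D" using assms by (auto simp: bdd_on_def)
  have "\<bar>f s * g s\<bar> \<le> C * D" if "s \<in> {0..T}" for s
    using C[rule_format, OF that] D[rule_format, OF that] unfolding abs_mult by (intro mult_mono) auto
  then show ?thesis by (intro bdd_onI) auto
qed

lemma bdd_on_diff: "bdd_on T f ==> bdd_on T g ==> bdd_on T (\<lambda>s. f s - g s)"
  using bdd_on_add[OF _ bdd_on_mult[OF bdd_on_const[of T "- 1"]], of f g] by simp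

lemma bdd_on_sum: "(\<And>i. i \<in> I ==> bdd_on T (f i)) ==> bdd_on T (\<lambda>s. \<Sum>i\<in>I. f i s)"
  by (induction I rule: infinite_finite_induct) (auto intro: bdd_on_const bdd_on_add)

lemmas bdd_on_intros = bdd_on_const bdd_on_add bdd_on_mult bdd_on_diff bdd_on_sum

text \<open>Normalised by the length of the interval, so that the functions \<phi> are orthonormal
  on [0, n] for every positive integer n and the entries of Q divided by n are such means.\<close>

definition mean_prod :: "real => (real => real) => (real => real) => real" where
  "mean_prod T f g = (LINT s:{0..T}|lborel. f s * g s) / T"

lemma mean_prod_sym: "mean_prod T f g = mean_prod T g f" by (simp add: mean_prod_def mult.commute)

lemma mean_prod_add:
  assumes "bdd_on T f" "bdd_on T f'" "bdd_on T g"
  shows "mean_prod T (\<lambda>s. f s + f' s) g = mean_prod T f g + mean_prod T f' g"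
  using set_integral_add(2)[OF bdd_on_integrable[OF bdd_on_mult[OF assms(1,3)]] bdd_on_integrable[OF bdd_on_mult[OF assms(2,3)]]]
  by (simp add: mean_prod_def distrib_right add_divide_distrib)

lemma mean_prod_scale: "mean_prod T (\<lambda>s. c * f s) g = c * mean_prod T f g"
  unfolding mean_prod_def mult.assoc by simp

lemma mean_prod_diff:
  assumes "bdd_on T f" "bdd_on T f'" "bdd_on T g"
  shows "mean_prod T (\<lambda>s. f s - f' s) g = mean_prod T f g - mean_prod T f' g"
  using mean_prod_add[OF assms(1) bdd_on_mult[OF bdd_on_const assms(2)] assms(3), of "- 1"] mean_prod_scale[of T "- 1" f' g] by simp

lemma mean_prod_sum:
  assumes "\<And>i. i \<in> I ==> bdd_on T (f i)" "bdd_on T g"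
  shows "mean_prod T (\<lambda>s. \<Sum>i\<in>I. f i s) g = (\<Sum>i\<in>I. mean_prod T (f i) g)"
  using assms(1)
proof (induction I rule: infinite_finite_induct)
  case (insert i I)
  then show ?case
    using mean_prod_add[of T "f i" "\<lambda>s. \<Sum>i\<in>I. f i s" g] assms(2) bdd_on_sum[of I T f] by simp
qed (simp_all add: mean_prod_def)

lemma mean_prod_nonneg: "T > 0 ==> mean_prod T f f \<ge> 0"
  unfolding mean_prod_def set_lebesgue_integral_def by (intro divide_nonneg_pos Bochner_Integration.integral_nonneg) auto

lemma mean_prod_abs_le:
  assumes T: "T > 0" and f: "bdd_on T f" "\<And>s. s \<in> {0..T} ==> \<bar>f s\<bar> \<le> C"
    and g: "bdd_on T g" "\<And>s. s \<in> {0..T} ==> \<bar>g s\<bar> \<le> D"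
  shows "\<bar>mean_prod T f g\<bar> \<le> C * D"
proof -
  have i: "set_integrable lborel {0..T} (\<lambda>s. f s * g s)" by (intro bdd_on_integrable bdd_on_mult f g)
  have "\<bar>LINT s:{0..T}|lborel. f s * g s\<bar> \<le> (LINT s:{0..T}|lborel. \<bar>f s * g s\<bar>)"
    using set_integral_norm_bound[OF i] by simp
  also have "... \<le> (LINT s:{0..T}|lborel. C * D)"
  proof (rule set_integral_mono)
    show "set_integrable lborel {0..T} (\<lambda>s. \<bar>f s * g s\<bar>)" using set_integrable_abs[OF i] .
    show "set_integrable lborel {0..T} (\<lambda>s. C * D)" by (intro bdd_on_integrable bdd_on_const)
    show "\<bar>f s * g s\<bar> \<le> C * D" if "s \<in> {0..T}" for s
      using f(2)[OF that] g(2)[OF that] unfolding abs_mult by (intro mult_mono) auto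
  qed
  also have "... = C * D * T" using T by (simp add: set_lebesgue_integral_def)
  finally show ?thesis using T by (simp add: mean_prod_def divide_le_eq)
qed

context
  fixes T :: real and \<phi> :: "'p::finite => real => real"
  assumes T: "T > 0" and \<phi>_bdd_on: "\<And>i. bdd_on T (\<phi> i)"
    and orth: "\<And>i j. mean_prod T (\<phi> i) (\<phi> j) = (if i = j then 1 else 0)"
begin

lemma bessel_mean_prod:
  assumes m: "bdd_on T m" shows "(\<Sum>i\<in>UNIV. (mean_prod T m (\<phi> i))\<^sup>2) \<le> mean_prod T m m"
proof -
  define c where "c i = mean_prod T m (\<phi> i)" for i
  let ?p = "\<lambda>s. \<Sum>i\<in>UNIV. c i * \<phi> i s"
  have b: "bdd_on T (\<lambda>s. c i * \<phi> i s)" for i by (intro bdd_on_intros \<phi>_bdd_on)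
  have p: "bdd_on T ?p" by (intro bdd_on_sum b)
  have mp: "mean_prod T ?p m = (\<Sum>i\<in>UNIV. (c i)\<^sup>2)"
    unfolding mean_prod_sum[OF b m] by (simp add: mean_prod_scale mean_prod_sym[of T "\<phi> _"] c_def power2_eq_square)
  have "mean_prod T ?p (\<phi> j) = c j" for j
    unfolding mean_prod_sum[OF b \<phi>_bdd_on] by (simp add: mean_prod_scale orth if_distrib cong: if_cong)
  then have "mean_prod T ?p ?p = (\<Sum>i\<in>UNIV. (c i)\<^sup>2)"
    unfolding mean_prod_sum[OF b p] by (simp add: mean_prod_scale mean_prod_sym[of T "\<phi> _" ?p] power2_eq_square)
  moreover have "0 \<le> mean_prod T (\<lambda>s. m s - ?p s) (\<lambda>s. m s - ?p s)" by (rule mean_prod_nonneg[OF T])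
  moreover have "mean_prod T (\<lambda>s. m s - ?p s) (\<lambda>s. m s - ?p s) = mean_prod T m m - mean_prod T ?p m - (mean_prod T ?p m - mean_prod T ?p ?p)"
  proof -
    have "mean_prod T (\<lambda>s. m s - ?p s) g = mean_prod T m g - mean_prod T ?p g" if "bdd_on T g" for g
      by (rule mean_prod_diff[OF m p that])
    note e = this[OF m] this[OF p] this[OF bdd_on_diff[OF m p]]
    show ?thesis unfolding e(3) using e(1,2) mean_prod_sym[of T m ?p] mean_prod_sym[of T m "\<lambda>s. m s - ?p s"]
        mean_prod_sym[of T ?p "\<lambda>s. m s - ?p s"] by linarith
  qed
  ultimately have "(\<Sum>i\<in>UNIV. (c i)\<^sup>2) \<le> mean_prod T m m" using mp by linarith
  then show ?thesis by (simp add: c_def)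
qed

text \<open>The right-hand side is the squared distance of \<open>x\<close> from the span of the
  \<phi>. Expanding it along x = m + c z gives the left-hand side plus the squared distance of
  \<open>m\<close>, which is nonnegative by Bessel's inequality. Thus a lower bound is obtained
  without knowing the mean square of \<open>m\<close>.\<close>

lemma residual_mean_prod_ge:
  fixes c :: real and m z :: "real => real"
  assumes m: "bdd_on T m" and z: "bdd_on T z"
  defines "x \<equiv> \<lambda>s. m s + c * z s"
  shows "2 * c * (mean_prod T m z - (\<Sum>i\<in>UNIV. mean_prod T m (\<phi> i) * mean_prod T z (\<phi> i))) +
      c\<^sup>2 * (mean_prod T z z - (\<Sum>i\<in>UNIV. (mean_prod T z (\<phi> i))\<^sup>2)) \<le>
    mean_prod T x x - (\<Sum>i\<in>UNIV. (mean_prod T x (\<phi> i))\<^sup>2)"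
proof -
  have cz: "bdd_on T (\<lambda>s. c * z s)" by (intro bdd_on_intros z)
  have x: "bdd_on T x" unfolding x_def by (intro bdd_on_intros m z)
  have xg: "mean_prod T x g = mean_prod T m g + c * mean_prod T z g" if "bdd_on T g" for g
    unfolding x_def mean_prod_add[OF m cz that] mean_prod_scale ..
  have xx: "mean_prod T x x = mean_prod T m m + 2 * c * mean_prod T m z + c\<^sup>2 * mean_prod T z z"
  proof -
    have "mean_prod T m x = mean_prod T m m + c * mean_prod T m z" "mean_prod T z x = mean_prod T m z + c * mean_prod T z z"
      using xg[OF m] xg[OF z] mean_prod_sym[of T x] mean_prod_sym[of T z m] by simp_all
    then show ?thesis using xg[OF x] by (simp add: power2_eq_square algebra_simps)
  qed
  have "(\<Sum>i\<in>UNIV. (mean_prod T x (\<phi> i))\<^sup>2) = (\<Sum>i\<in>UNIV. (mean_prod T m (\<phi> i))\<^sup>2 +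
      2 * c * (mean_prod T m (\<phi> i) * mean_prod T z (\<phi> i)) + c\<^sup>2 * (mean_prod T z (\<phi> i))\<^sup>2)"
    by (intro sum.cong refl) (simp add: xg[OF \<phi>_bdd_on] power2_eq_square algebra_simps)
  also have "... = (\<Sum>i\<in>UNIV. (mean_prod T m (\<phi> i))\<^sup>2) + 2 * c * (\<Sum>i\<in>UNIV. mean_prod T m (\<phi> i) * mean_prod T z (\<phi> i)) +
      c\<^sup>2 * (\<Sum>i\<in>UNIV. (mean_prod T z (\<phi> i))\<^sup>2)"
    by (simp only: sum.distrib sum_distrib_left)
  finally show ?thesis using bessel_mean_prod[OF m] unfolding xx by (simp add: right_diff_distrib)
qed

end

lemma set_integral_periodic:
  fixes f :: "real => real"
  assumes b: "\<And>T. bdd_on T f" and per: "\<And>t. f (t + 1) = f t"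
  shows "(LINT s:{0..real n}|lborel. f s) = real n * (LINT s:{0..1}|lborel. f s)"
proof (induction n)
  case 0
  have "(LINT s:{0}|lborel. f s) = 0"
    unfolding set_lebesgue_integral_def
    by (rule integral_eq_zero_AE) (use AE_lborel_singleton[of 0] in \<open>auto elim!: eventually_mono\<close>)
  then show ?case by simp
next
  case (Suc n)
  have f [measurable]: "f \<in> borel_measurable borel" using b by (auto simp: bdd_on_def)
  have p: "f (real n + s) = f s" for s
  proof (induction n)
    case (Suc n) then show ?case using per[of "real n + s"] by (simp add: add_ac)
  qed simp
  have i: "set_integrable lborel {0..real (Suc n)} f" by (rule bdd_on_integrable[OF b])
  have u: "{0..real (Suc n)} = {0..real n} \<union> {real n..real (Suc n)}" by auto
  have "(LINT s:{0..real (Suc n)}|lborel. f s) = (LINT s:{0..real n}|lborel. f s) + (LINT s:{real n..real (Suc n)}|lborel. f s)"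
    unfolding u
  proof (rule set_integral_Un_AE)
    show "AE s in lborel. \<not> (s \<in> {0..real n} \<and> s \<in> {real n..real (Suc n)})"
      using AE_lborel_singleton[of "real n"] by eventually_elim auto
    show "set_integrable lborel {0..real n} f" "set_integrable lborel {real n..real (Suc n)} f"
      by (rule set_integrable_subset[OF i]; auto)+
  qed auto
  also have "(LINT s:{real n..real (Suc n)}|lborel. f s) = (\<integral>s. indicator {real n..real (Suc n)} (real n + s) * f (real n + s) \<partial>lborel)"
    unfolding set_lebesgue_integral_def
    using lborel_integral_real_affine[of 1 "\<lambda>s. indicator {real n..real (Suc n)} s * f s" "real n"] by simp
  also have "... = (LINT s:{0..1}|lborel. f s)"
    unfolding set_lebesgue_integral_def by (intro Bochner_Integration.integral_cong refl) (auto simp: p indicator_def)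
  finally show ?case using Suc by (simp add: algebra_simps)
qed

lemma borel_measurable_running_integral:
  fixes f :: "real => real"
  assumes [measurable]: "f \<in> borel_measurable borel"
  shows "(\<lambda>t. LINT s:{0..t}|lborel. f s) \<in> borel_measurable borel"
proof -
  have "(\<lambda>(t, s). (if 0 \<le> s \<and> s \<le> t then 1 else 0) * f s) \<in> borel_measurable (borel \<Otimes>\<^sub>M lborel)" by measurable
  from lborel.borel_measurable_lebesgue_integral[OF this]
  have "(\<lambda>t. \<integral>s. (if 0 \<le> s \<and> s \<le> t then 1 else 0) * f s \<partial>lborel) \<in> borel_measurable borel" by simp
  also have "(\<lambda>t. \<integral>s. (if 0 \<le> s \<and> s \<le> t then 1 else 0) * f s \<partial>lborel) = (\<lambda>t. LINT s:{0..t}|lborel. f s)"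
    unfolding set_lebesgue_integral_def by (intro ext Bochner_Integration.integral_cong refl) (auto simp: indicator_def)
  finally show ?thesis .
qed

section \<open>Consistency of the least squares estimator\<close>

context fou_space
begin

section \<open>Averages that are negligible against n\<close>

definition bdd_half_line :: "(real => real) => bool" where
  "bdd_half_line f \<longleftrightarrow> f \<in> borel_measurable borel \<and> (\<exists>C\<ge>0. \<forall>s\<ge>0. \<bar>f s\<bar> \<le> C)"

lemma bdd_half_line_bdd_on: "bdd_half_line f ==> bdd_on T f"
  unfolding bdd_half_line_def bdd_on_def by (metis atLeastAtMost_iff)

definition wiener_int :: "real => (real => real) => 'a => real" where
  "wiener_int T f = (SOME Y. wiener (trunc T f) Y)"

lemma wiener_int: assumes "bdd_half_line f" "T \<ge> 0" shows "wiener (trunc T f) (wiener_int T f)"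
proof -
  obtain C where f: "f \<in> borel_measurable borel" and C: "C \<ge> 0" "\<forall>s\<ge>0. \<bar>f s\<bar> \<le> C" using assms(1) by (auto simp: bdd_half_line_def)
  have "admissible T C (trunc T f)" by (rule trunc_admissible[OF assms(2) C(1) f]) (use C in auto)
  then have "adm (trunc T f)" by (auto simp: adm_def)
  then obtain Y where "wiener (trunc T f) Y" by (rule wiener_exists)
  then show ?thesis unfolding wiener_int_def by (rule someI[of "wiener (trunc T f)"])
qed

text \<open>The exponent 2H is below 2, so these second moments are o(n^2).\<close>

definition subquadratic :: "(nat => 'a => real) => bool" where
  "subquadratic V \<longleftrightarrow> (\<forall>n. V n \<in> borel_measurable M \<and> integrable M (\<lambda>w. (V n w)\<^sup>2)) \<and>
     (\<exists>C D. \<forall>n. expectation (\<lambda>w. (V n w)\<^sup>2) \<le> C * real n powr (2 * H) + D)"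

lemma subquadratic_limit:
  assumes "subquadratic V" shows "(\<lambda>n. expectation (\<lambda>w. (V n w / real n)\<^sup>2)) \<longlonglongrightarrow> 0"
proof -
  obtain C D where CD: "\<And>n. expectation (\<lambda>w. (V n w)\<^sup>2) \<le> C * real n powr (2 * H) + D" using assms by (auto simp: subquadratic_def)
  have p: "(\<lambda>n. real n powr q) \<longlonglongrightarrow> 0" if "q < 0" for q :: real
    by (rule tendsto_neg_powr[OF that filterlim_real_sequentially])
  have "(\<lambda>n. C * real n powr (2 * H - 2) + D * real n powr (- 2)) \<longlonglongrightarrow> C * 0 + D * 0"
    using H_lt by (intro tendsto_intros p) auto
  then have lim: "(\<lambda>n. C * real n powr (2 * H - 2) + D * real n powr (- 2)) \<longlonglongrightarrow> 0" by simp
  have "expectation (\<lambda>w. (V n w / real n)\<^sup>2) \<le> C * real n powr (2 * H - 2) + D * real n powr (- 2)" if "n \<ge> 1" for n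
  proof -
    have n: "real n > 0" using that by simp
    have e: "(C * real n powr (2 * H) + D) / (real n)\<^sup>2 = C * real n powr (2 * H - 2) + D * real n powr (- 2)"
      using n by (simp add: powr_diff powr_minus powr_numeral add_divide_distrib divide_inverse distrib_right mult.assoc)
    have "expectation (\<lambda>w. (V n w / real n)\<^sup>2) = expectation (\<lambda>w. (V n w)\<^sup>2) / (real n)\<^sup>2" by (simp add: power_divide)
    also have "... \<le> (C * real n powr (2 * H) + D) / (real n)\<^sup>2" by (intro divide_right_mono CD) simp
    finally show ?thesis unfolding e .
  qed
  then show ?thesis
    by (intro tendsto_sandwich[OF _ _ tendsto_const lim] eventually_sequentiallyI[of 1])
      (auto intro!: Bochner_Integration.integral_nonneg)
qed

text \<open>All error sequences are merged into the single sequence of the sum of their squares,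
  whose convergence to 0 along a subsequence entails that of every summand.\<close>

lemma tendsto_prob_of_subquadratic:
  fixes e :: "nat => 'a => real"
  assumes fin: "finite \<V>" and V: "\<And>V. V \<in> \<V> ==> subquadratic V"
    and e: "\<And>n. e n \<in> borel_measurable M"
    and imp: "AE w in M. \<forall>r. strict_mono r --> (\<forall>V\<in>\<V>. (\<lambda>n. V (r n) w / real (r n)) \<longlonglongrightarrow> 0) --> (\<lambda>n. e (r n) w) \<longlonglongrightarrow> 0"
    and \<epsilon>: "\<epsilon> > 0"
  shows "(\<lambda>n. prob {w \<in> space M. e n w > \<epsilon>}) \<longlonglongrightarrow> 0"
proof (rule tendsto_prob_of_subsequences[OF _ _ e _ \<epsilon>])
  let ?S = "\<lambda>n w. \<Sum>V\<in>\<V>. (V n w / real n)\<^sup>2"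
  have i: "integrable M (\<lambda>w. (V n w / real n)\<^sup>2)" if "V \<in> \<V>" for V n
    using V[OF that] by (simp add: subquadratic_def power_divide)
  show "integrable M (?S n)" for n by (intro Bochner_Integration.integrable_sum i)
  have "expectation (\<lambda>w. \<bar>?S n w\<bar>) = (\<Sum>V\<in>\<V>. expectation (\<lambda>w. (V n w / real n)\<^sup>2))" for n
    using i by (simp add: abs_of_nonneg sum_nonneg)
  moreover have "(\<lambda>n. \<Sum>V\<in>\<V>. expectation (\<lambda>w. (V n w / real n)\<^sup>2)) \<longlonglongrightarrow> (\<Sum>V\<in>\<V>. 0)"
    by (intro tendsto_sum subquadratic_limit V)
  ultimately show "(\<lambda>n. expectation (\<lambda>w. \<bar>?S n w\<bar>)) \<longlonglongrightarrow> 0" by simp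
  have sub: "(\<lambda>n. V (r n) w / real (r n)) \<longlonglongrightarrow> 0" if "(\<lambda>n. ?S (r n) w) \<longlonglongrightarrow> 0" "V \<in> \<V>" for r :: "nat => nat" and V w
  proof -
    have "(\<lambda>n. (V (r n) w / real (r n))\<^sup>2) \<longlonglongrightarrow> 0"
    proof (rule tendsto_sandwich[OF _ _ tendsto_const that(1)])
      show "\<forall>\<^sub>F n in sequentially. (V (r n) w / real (r n))\<^sup>2 \<le> ?S (r n) w"
        using that(2) fin by (intro always_eventually allI member_le_sum) auto
    qed simp
    then have "(\<lambda>n. sqrt ((V (r n) w / real (r n))\<^sup>2)) \<longlonglongrightarrow> 0" using tendsto_real_sqrt by fastforce
    then show ?thesis by (simp only: real_sqrt_abs tendsto_rabs_zero_iff)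
  qed
  show "AE w in M. \<forall>r. strict_mono r --> (\<lambda>n. ?S (r n) w) \<longlonglongrightarrow> 0 --> (\<lambda>n. e (r n) w) \<longlonglongrightarrow> 0"
    using imp by eventually_elim (use sub in blast)
qed

lemma subquadratic_wiener_int:
  assumes f: "bdd_half_line f" shows "subquadratic (\<lambda>n. wiener_int (real n) f)"
proof -
  obtain C where fm: "f \<in> borel_measurable borel" and C: "C \<ge> 0" "\<forall>s\<ge>0. \<bar>f s\<bar> \<le> C" using f by (auto simp: bdd_half_line_def)
  have w: "wiener (trunc (real n) f) (wiener_int (real n) f)" for n by (rule wiener_int[OF f]) simp
  have "expectation (\<lambda>w. (wiener_int (real n) f w)\<^sup>2) \<le> (2 * H * C\<^sup>2 * 2 powr (2 * H)) * real n powr (2 * H) + 0" for n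
  proof -
    have "admissible (real n) C (trunc (real n) f)" by (rule trunc_admissible[OF _ C(1) fm]) (use C in auto)
    from wiener_norm_bound[OF this w]
    have "expectation (\<lambda>w. (wiener_int (real n) f w)\<^sup>2) \<le> H * (2 * H - 1) * (C * kernel_bound (real n) * (2 * real n * C))" .
    also have "... = 2 * H * C\<^sup>2 * (2 * real n) powr (2 * H)"
    proof (cases "n = 0")
      case False
      have "(2 * real n) powr (2 * H) = (2 * real n) powr (1 + (2 * H - 1))" by simp
      also have "... = (2 * real n) * (2 * real n) powr (2 * H - 1)" using False by (subst powr_add) simp
      finally show ?thesis using H_gt unfolding kernel_bound_def by (simp add: power2_eq_square)
    qed simp
    also have "... = (2 * H * C\<^sup>2 * 2 powr (2 * H)) * real n powr (2 * H) + 0" by (simp add: powr_mult)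
    finally show ?thesis .
  qed
  then show ?thesis using wiener_meas(2,4)[OF w] unfolding subquadratic_def by blast
qed

lemma subquadratic_average:
  assumes f: "bdd_half_line f" shows "subquadratic (\<lambda>n w. LINT s:{0..real n}|lborel. f s * Z w s)"
proof -
  obtain C where fm [measurable]: "f \<in> borel_measurable borel" and C: "C \<ge> 0" "\<forall>s\<ge>0. \<bar>f s\<bar> \<le> C" using f by (auto simp: bdd_half_line_def)
  have m: "(\<lambda>w. LINT s:{0..real n}|lborel. f s * Z w s) \<in> borel_measurable M" for n
    by (rule process_integral_measurable) measurable
  have i: "integrable M (\<lambda>w. (LINT s:{0..real n}|lborel. f s * Z w s)\<^sup>2)" for n
    by (rule weighted_average_square(1)[of _ _ C]) (use C in auto)
  have "expectation (\<lambda>w. (LINT s:{0..real n}|lborel. f s * Z w s)\<^sup>2) \<le>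
      (C\<^sup>2 * 2 / \<alpha>\<^sup>2) * real n powr (2 * H) + C\<^sup>2 * 2 * Zbound / \<alpha>\<^sup>2" for n
  proof -
    have "expectation (\<lambda>w. (LINT s:{0..real n}|lborel. f s * Z w s)\<^sup>2) \<le> C\<^sup>2 * Zcov_mass (real n)"
      by (rule weighted_average_square(2)) (use C in auto)
    also have "... \<le> C\<^sup>2 * ((2 * real n powr (2 * H) + 2 * Zbound) / \<alpha>\<^sup>2)" by (intro mult_left_mono Zcov_mass_le) auto
    also have "... = (C\<^sup>2 * 2 / \<alpha>\<^sup>2) * real n powr (2 * H) + C\<^sup>2 * 2 * Zbound / \<alpha>\<^sup>2"
      by (simp add: algebra_simps add_divide_distrib)
    finally show ?thesis .
  qed
  then show ?thesis using m i unfolding subquadratic_def by blast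
qed

lemma Zcov_diag_measurable [measurable]: "(\<lambda>s. Zcov s s) \<in> borel_measurable borel"
  using measurable_compose[OF measurable_Pair[OF measurable_ident measurable_ident] Zcov_measurable] by simp

lemma Z2_measurable_pair: "(\<lambda>(w, s). Z2 w s) \<in> borel_measurable (M \<Otimes>\<^sub>M borel)"
  unfolding Z2_def by measurable

lemma subquadratic_Z2_average: "subquadratic (\<lambda>n w. LINT s:{0..real n}|lborel. Z2 w s)"
proof -
  have m: "(\<lambda>w. LINT s:{0..real n}|lborel. Z2 w s) \<in> borel_measurable M" for n
    by (rule process_integral_measurable[OF Z2_measurable_pair])
  have i: "integrable M (\<lambda>w. (LINT s:{0..real n}|lborel. Z2 w s)\<^sup>2)" for n by (rule Z2_average_square(1)) simp
  have "expectation (\<lambda>w. (LINT s:{0..real n}|lborel. Z2 w s)\<^sup>2) \<le>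
      (2 * Zbound * 2 / \<alpha>\<^sup>2) * real n powr (2 * H) + 2 * Zbound * 2 * Zbound / \<alpha>\<^sup>2" for n
  proof -
    have "expectation (\<lambda>w. (LINT s:{0..real n}|lborel. Z2 w s)\<^sup>2) \<le> 2 * Zbound * Zcov_mass (real n)"
      by (rule Z2_average_square(2)) simp
    also have "... \<le> 2 * Zbound * ((2 * real n powr (2 * H) + 2 * Zbound) / \<alpha>\<^sup>2)"
      using Zbound_nonneg by (intro mult_left_mono Zcov_mass_le) auto
    also have "... = (2 * Zbound * 2 / \<alpha>\<^sup>2) * real n powr (2 * H) + 2 * Zbound * 2 * Zbound / \<alpha>\<^sup>2"
      by (simp add: algebra_simps add_divide_distrib)
    finally show ?thesis .
  qed
  then show ?thesis using m i unfolding subquadratic_def by blast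
qed

lemma subquadratic_Z2: "subquadratic (\<lambda>n w. Z2 w (real n))"
proof -
  have "expectation (\<lambda>w. (Z2 w (real n))\<^sup>2) \<le> 0 * real n powr (2 * H) + 2 * Zbound\<^sup>2" for n
    using Z2_square(2)[of "real n"] by simp
  moreover have "(\<lambda>w. Z2 w (real n)) \<in> borel_measurable M" for n unfolding Z2_def by measurable
  ultimately show ?thesis using Z2_square(1) unfolding subquadratic_def by (metis of_nat_0_le_iff)
qed

lemma good_Z_bdd_on: assumes "good w" "w \<in> space M" shows "bdd_on T (Z w)"
proof -
  have "bounded (Z w ` {0..T})"
    by (intro compact_imp_bounded compact_continuous_image good_Z_cont[OF assms(1)]) simp
  then obtain C where "\<forall>s\<in>{0..T}. \<bar>Z w s\<bar> \<le> C" unfolding bounded_iff by (simp del: atLeastAtMost_iff) blast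
  moreover have "Z w \<in> borel_measurable borel"
    using measurable_compose[OF measurable_Pair1'[OF assms(2)] Z_measurable] by simp
  ultimately show ?thesis unfolding bdd_on_def by blast
qed

lemma Zcov_diag_bdd_on: "bdd_on T (\<lambda>s. Zcov s s)"
  using Zcov_abs_le by (intro bdd_onI[of _ _ Zbound]) auto

text \<open>The square of Z is split into \<open>Z2\<close> and its mean. The mean has a positive
  lower bound only after time 1, which costs the proportion 1 / n of the interval.\<close>

lemma mean_prod_Z_ge:
  assumes w: "good w" "w \<in> space M" and n: "n \<ge> 1"
  shows "(LINT s:{0..real n}|lborel. Z2 w s) / real n + exp (- 2 * \<alpha>) * (1 - 1 / real n) \<le> mean_prod (real n) (Z w) (Z w)"
proof -
  note z = good_Z_bdd_on[OF w, of "real n"]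
  have "(LINT s:{0..real n}|lborel. Z2 w s) = (LINT s:{0..real n}|lborel. Z w s * Z w s) - (LINT s:{0..real n}|lborel. Zcov s s)"
    unfolding Z2_def power2_eq_square
    by (rule set_integral_diff(2)) (intro bdd_on_integrable bdd_on_mult z Zcov_diag_bdd_on)+
  moreover have "exp (- 2 * \<alpha>) * (real n - 1) \<le> (LINT s:{0..real n}|lborel. Zcov s s)"
  proof -
    have "exp (- 2 * \<alpha>) * (real n - 1) = (LINT s:{0..real n}|lborel. exp (- 2 * \<alpha>) * indicator {1..real n} s)"
    proof -
      have "(LINT s:{0..real n}|lborel. exp (- 2 * \<alpha>) * indicator {1..real n} s) = (\<integral>s. exp (- 2 * \<alpha>) * indicator {1..real n} s \<partial>lborel)"
        unfolding set_lebesgue_integral_def by (intro Bochner_Integration.integral_cong refl) (auto simp: indicator_def)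
      then show ?thesis using n by simp
    qed
    also have "... \<le> (LINT s:{0..real n}|lborel. Zcov s s)"
    proof (rule set_integral_mono)
      show "set_integrable lborel {0..real n} (\<lambda>s. exp (- 2 * \<alpha>) * indicator {1..real n} s)"
        by (intro bdd_on_integrable bdd_onI[of _ _ "exp (- 2 * \<alpha>)"]) (auto simp: indicator_def)
      show "set_integrable lborel {0..real n} (\<lambda>s. Zcov s s)" by (rule bdd_on_integrable[OF Zcov_diag_bdd_on])
      show "exp (- 2 * \<alpha>) * indicator {1..real n} s \<le> Zcov s s" if "s \<in> {0..real n}" for s
        using Zcov_diag_ge[of s] Zcov_nonneg[of s s] that by (auto simp: indicator_def)
    qed
    finally show ?thesis .
  qed
  ultimately have "(LINT s:{0..real n}|lborel. Z2 w s) + exp (- 2 * \<alpha>) * (real n - 1) \<le> (LINT s:{0..real n}|lborel. Z w s * Z w s)" by simp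
  from divide_right_mono[OF this, of "real n"]
  show ?thesis using n by (simp add: mean_prod_def add_divide_distrib diff_divide_distrib right_diff_distrib)
qed

end

section \<open>The model and its explicit solution\<close>

locale fou_estimation = fou_space M H B \<alpha> \<xi>
  for M :: "'a measure" and H :: real and B :: "real => 'a => real" and \<alpha> :: real and \<xi> :: "'a => real" +
  fixes \<sigma> :: real and \<phi> :: "'p::finite => real => real" and \<mu> :: "real^'p" and X :: "real => 'a => real"
  assumes \<sigma>_pos: "\<sigma> > 0"
    and \<phi>_meas [measurable]: "\<And>i. \<phi> i \<in> borel_measurable borel"
    and \<phi>_bdd: "\<And>i. bounded (range (\<phi> i))"
    and \<phi>_per: "\<And>i t. \<phi> i (t + 1) = \<phi> i t"
    and \<phi>_orth: "\<And>i j. (LINT t:{0..1}|lborel. \<phi> i t * \<phi> j t) = (if i = j then 1 else 0)"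
    and X: "fou_process M B \<sigma> \<phi> \<mu> \<alpha> \<xi> X"
begin

abbreviation "L \<equiv> periodic_mean \<phi> \<mu>"

lemma \<phi>_bound: obtains C where "C \<ge> 0" "\<And>t. \<bar>\<phi> i t\<bar> \<le> C"
proof -
  obtain C where C: "\<And>t. \<bar>\<phi> i t\<bar> \<le> C" using \<phi>_bdd[of i] by (auto simp: bounded_iff)
  then show thesis using order_trans[OF abs_ge_zero C[of 0]] by (intro that[of C]) auto
qed

lemma \<phi>_half_line: "bdd_half_line (\<phi> i)"
  by (rule \<phi>_bound[of i]) (auto simp: bdd_half_line_def)

lemma \<phi>_bdd_on: "bdd_on T (\<phi> i)" by (rule bdd_half_line_bdd_on[OF \<phi>_half_line])

lemma \<phi>_mean_prod: assumes "n > 0" shows "mean_prod (real n) (\<phi> i) (\<phi> j) = (if i = j then 1 else 0)"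
  unfolding mean_prod_def using assms
  by (subst set_integral_periodic) (auto intro!: bdd_on_mult \<phi>_bdd_on simp: \<phi>_per \<phi>_orth)

lemma L_measurable [measurable]: "L \<in> borel_measurable borel" unfolding periodic_mean_def[abs_def] by measurable

lemma L_bound: obtains C where "C \<ge> 0" "\<And>t. \<bar>L t\<bar> \<le> C"
proof -
  define C where "C i = (SUP t. \<bar>\<phi> i t\<bar>)" for i
  have C: "\<bar>\<phi> i t\<bar> \<le> C i" for i t
    unfolding C_def by (rule \<phi>_bound[of i]) (auto intro!: cSUP_upper bdd_aboveI2)
  have b: "\<bar>L t\<bar> \<le> (\<Sum>i\<in>UNIV. \<bar>\<mu> $ i\<bar> * C i)" for t
    unfolding periodic_mean_def by (rule order_trans[OF sum_abs]) (auto simp: abs_mult intro!: sum_mono mult_left_mono C)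
  show thesis by (rule that[OF order_trans[OF abs_ge_zero b] b])
qed

lemma L_bdd_on: "bdd_on T L" by (rule L_bound, rule bdd_onI) auto

definition drift :: "real => real" where "drift t = (LINT s:{0..t}|lborel. L s)"

definition h :: "real => real" where "h = ou_filter \<alpha> drift"

lemma drift_measurable [measurable]: "drift \<in> borel_measurable borel"
  unfolding drift_def[abs_def] by (rule borel_measurable_running_integral) simp

lemma h_measurable [measurable]: "h \<in> borel_measurable borel"
proof -
  have [measurable]: "(\<lambda>t. LINT s:{0..t}|lborel. exp (\<alpha> * s) * drift s) \<in> borel_measurable borel"
    by (rule borel_measurable_running_integral) measurable
  show ?thesis unfolding h_def ou_filter_def[abs_def] ou_integral_def[abs_def] by measurable
qed

lemma drift_diff:
  assumes C: "\<And>t. \<bar>L t\<bar> \<le> C" and st: "0 \<le> s" "s \<le> t" shows "\<bar>drift t - drift s\<bar> \<le> C * (t - s)"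
proof -
  have i: "set_integrable lborel {0..t} L" by (rule bdd_on_integrable[OF L_bdd_on])
  have i2: "set_integrable lborel {s<..t} L" by (rule set_integrable_subset[OF i]) (use st in auto)
  have u: "{0..t} = {0..s} \<union> {s<..t}" using st by auto
  have "drift t = drift s + (LINT r:{s<..t}|lborel. L r)"
    unfolding drift_def u by (rule set_integral_Un[OF _ set_integrable_subset[OF i] i2]) (use st in auto)
  moreover have "\<bar>LINT r:{s<..t}|lborel. L r\<bar> \<le> C * (t - s)"
  proof -
    have "\<bar>LINT r:{s<..t}|lborel. L r\<bar> \<le> (LINT r:{s<..t}|lborel. \<bar>L r\<bar>)" using set_integral_norm_bound[OF i2] by simp
    also have "... \<le> (LINT r:{s<..t}|lborel. C)"
    proof (rule set_integral_mono[OF set_integrable_abs[OF i2]])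
      show "set_integrable lborel {s<..t} (\<lambda>r. C)"
        by (rule set_integrable_subset[OF bdd_on_integrable[OF bdd_on_const[of t C]]]) (use st in auto)
    qed (rule C)
    also have "... = C * (t - s)" using st by (simp add: set_lebesgue_integral_def)
    finally show ?thesis .
  qed
  ultimately show ?thesis by simp
qed

lemma drift_cont: "continuous_on {0..T} drift"
proof (rule L_bound)
  fix C assume C: "C \<ge> 0" "\<And>t. \<bar>L t\<bar> \<le> C"
  show ?thesis
  proof (rule lipschitz_on_continuous_on[of C], rule lipschitz_onI[OF _ C(1)])
    fix s t assume "s \<in> {0..T}" "t \<in> {0..T}"
    then show "dist (drift s) (drift t) \<le> C * dist s t"
      using drift_diff[OF C(2), of s t] drift_diff[OF C(2), of t s] by (cases "s \<le> t") (auto simp: dist_real_def abs_minus_commute)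
  qed
qed

text \<open>The integrated drift may grow linearly, but it is Lipschitz, as L is bounded;
  \<open>ou_filter_bounded\<close> applies.\<close>

lemma h_half_line: "bdd_half_line h"
proof (rule L_bound)
  fix C assume C: "C \<ge> 0" "\<And>t. \<bar>L t\<bar> \<le> C"
  have "drift 0 = 0"
    using drift_diff[OF C(2), of 0 0] set_integral_periodic[OF L_bdd_on, of 0] by (simp add: drift_def periodic_mean_def \<phi>_per)
  then have "\<bar>h t\<bar> \<le> C / \<alpha>" if "t \<ge> 0" for t
    unfolding h_def using that by (intro ou_filter_bounded[OF \<alpha>_pos that drift_cont _ C(1)] drift_diff[OF C(2)]) auto
  then show ?thesis unfolding bdd_half_line_def using C(1) \<alpha>_pos by (auto intro!: exI[of _ "C / \<alpha>"])
qed

lemma exp_half_line: "bdd_half_line (\<lambda>s. exp (- \<alpha> * s))"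
  unfolding bdd_half_line_def using \<alpha>_pos by (auto intro!: exI[of _ 1])

definition X_version :: "real => 'a => real" where
  "X_version t w = \<xi> w * exp (- \<alpha> * t) + h t + \<sigma> * Z w t"

lemma X_version_measurable: "(\<lambda>(w, t). X_version t w) \<in> borel_measurable (M \<Otimes>\<^sub>M borel)"
  unfolding X_version_def by measurable

lemma X_version_eq: "AE w in M. \<forall>t\<ge>0. X t w = X_version t w"
proof -
  have "AE w in M. continuous_on {0..} (\<lambda>t. X t w)"
    and "AE w in M. \<forall>t\<ge>0. X t w = \<xi> w + (LINT s:{0..t}|lborel. L s - \<alpha> * X s w) + \<sigma> * B t w"
    using X unfolding fou_process_def by blast+
  with AE_good show ?thesis
  proof eventually_elim
    case (elim w)
    have Bc: "continuous_on {0..T} (\<lambda>t. B t w)" for T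
      using elim(1) unfolding good_def by (rule continuous_on_subset) simp
    show ?case
    proof (intro allI impI)
      fix T :: real assume T: "T \<ge> 0"
      have Xc: "continuous_on {0..t} (\<lambda>t. X t w)" for t by (rule continuous_on_subset[OF elim(2)]) auto
      \<comment> \<open>The factor 1 brings the sum into the shape of
        \<open>ou_filter_affine\<close>, which is used twice.\<close>
      let ?k = "\<lambda>t. (\<xi> w + 1 * drift t) + \<sigma> * B t w"
      have "X t w = ?k t - \<alpha> * (LINT s:{0..t}|lborel. X s w)" if "t \<in> {0..T}" for t
      proof -
        have iX: "set_integrable lborel {0..t} (\<lambda>s. X s w)" by (rule borel_integrable_atLeastAtMost'[OF Xc])
        have "(LINT s:{0..t}|lborel. L s - \<alpha> * X s w) = drift t - (LINT s:{0..t}|lborel. \<alpha> * X s w)"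
          unfolding drift_def by (rule set_integral_diff(2)[OF bdd_on_integrable[OF L_bdd_on]]) (use iX in simp)
        then show ?thesis using elim(3) that by simp
      qed
      then have "X T w = ou_filter \<alpha> ?k T"
        by (intro ou_filter_unique[OF Xc _ T] continuous_intros drift_cont Bc)
      also have "... = ou_filter \<alpha> (\<lambda>t. \<xi> w + 1 * drift t) T + \<sigma> * ou_filter \<alpha> (\<lambda>t. B t w) T"
        by (intro ou_filter_affine continuous_intros drift_cont Bc)
      also have "ou_filter \<alpha> (\<lambda>t. \<xi> w + 1 * drift t) T = \<xi> w * exp (- \<alpha> * T) + 1 * ou_filter \<alpha> drift T"
        using \<alpha>_pos T by (subst ou_filter_affine) (auto intro!: continuous_intros drift_cont simp: ou_filter_const)
      finally show "X T w = X_version T w" by (simp add: X_version_def h_def Z_def B_version_eq[OF elim(1)])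
    qed
  qed
qed

text \<open>With index \<open>Some i\<close> for the integrand \<open>\<phi> i\<close> and \<open>None\<close> for the integrand \<open>X\<close>, the integrand is
  \<open>\<xi> * coeff\<^sub>\<xi> + coeff\<^sub>1 + coeff\<^sub>Z * Z\<close>.\<close>

definition coeff_\<xi> :: "'p option => real => real" where
  "coeff_\<xi> j = (case j of Some i => (\<lambda>_. 0) | None => (\<lambda>s. exp (- \<alpha> * s)))"

definition coeff_1 :: "'p option => real => real" where "coeff_1 j = (case j of Some i => \<phi> i | None => h)"

definition coeff_Z :: "'p option => real" where "coeff_Z j = (case j of Some i => 0 | None => \<sigma>)"

lemma coeff_half_line: "bdd_half_line (coeff_\<xi> j)" "bdd_half_line (coeff_1 j)"
  using exp_half_line h_half_line \<phi>_half_line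
  by (auto simp: coeff_\<xi>_def coeff_1_def bdd_half_line_def split: option.split)

definition divergence_value :: "'p option => nat => 'a => real" where
  "divergence_value j n w = \<xi> w * wiener_int (real n) (coeff_\<xi> j) w + wiener_int (real n) (coeff_1 j) w + coeff_Z j * Z_div (real n) w"

lemma divergence_value_measurable: "divergence_value j n \<in> borel_measurable M"
proof -
  have [measurable]: "wiener_int (real n) (coeff_\<xi> j) \<in> borel_measurable M" "wiener_int (real n) (coeff_1 j) \<in> borel_measurable M"
    using coeff_half_line[THEN subquadratic_wiener_int] by (auto simp: subquadratic_def)
  show ?thesis unfolding divergence_value_def[abs_def] by measurable
qed

lemma skorohod_integral_value:
  assumes u: "AE w in M. \<forall>s\<ge>0. u s w = \<xi> w * coeff_\<xi> j s + coeff_1 j s + coeff_Z j * Z w s"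
  shows "AE w in M. skorohod_integral M H B \<xi> (real n) u w = divergence_value j n w"
proof -
  obtain C where C: "C \<ge> 0" "\<And>s. s \<ge> 0 ==> \<bar>coeff_\<xi> j s\<bar> \<le> C" and m: "coeff_\<xi> j \<in> borel_measurable borel" "coeff_1 j \<in> borel_measurable borel"
    using coeff_half_line[of j] by (auto simp: bdd_half_line_def)
  obtain D where D: "D \<ge> 0" "\<And>s. s \<ge> 0 ==> \<bar>coeff_1 j s\<bar> \<le> D" using coeff_half_line[of j] by (auto simp: bdd_half_line_def)
  note w = coeff_half_line[THEN wiener_int, of "real n" j, simplified]
  have C': "\<bar>coeff_\<xi> j s\<bar> \<le> C + D" "\<bar>coeff_1 j s\<bar> \<le> C + D" if "s \<in> {0..real n}" for s
    using C(1) D(1) C(2)[of s] D(2)[of s] that by auto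
  have CD: "0 \<le> C + D" using C D by simp
  have dv: "div_value (real n) (coeff_Z j) (wiener_int (real n) (coeff_\<xi> j)) (wiener_int (real n) (coeff_1 j)) = divergence_value j n"
    unfolding fun_eq_iff divergence_value_def
    by (intro allI div_value_def[OF of_nat_0_le_iff CD m(1) _ m(2) _ w]) (use C' in auto)
  have "AE w in M. \<forall>s\<in>{0..real n}. u s w = \<xi> w * coeff_\<xi> j s + coeff_1 j s + coeff_Z j * Z w s"
    using u by eventually_elim auto
  then have "has_skorohod_integral M H B \<xi> (\<lambda>w s. indicator {0..real n} s * u s w) (divergence_value j n)"
    unfolding dv[symmetric] by (intro has_skorohod_integral_affine[OF of_nat_0_le_iff CD m(1) _ m(2) _ w]) (use C' in auto)
  then show ?thesis by (rule skorohod_integral_AE_eq)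
qed

section \<open>A measurable version of the estimator\<close>

text \<open>The vector P with the chosen Skorohod integrals replaced by their explicit values. It
  agrees with P almost surely and is measurable for M.\<close>

definition P_version :: "nat => 'a => real^('p option)" where
  "P_version n w = (\<chi> j. case j of
     Some i => (LINT t:{0..real n}|lborel. \<phi> i t * (L t - \<alpha> * X_version t w)) + \<sigma> * divergence_value (Some i) n w
   | None => - ((LINT t:{0..real n}|lborel. X_version t w * (L t - \<alpha> * X_version t w)) + \<sigma> * divergence_value None n w))"

definition estimator_version :: "nat => 'a => real^('p option)" where
  "estimator_version n w = matrix_inv (lse_Q \<phi> X_version n w) *v P_version n w"

lemma estimator_version_eq:
  "AE w in M. least_squares_estimator M H B \<sigma> \<phi> \<mu> \<alpha> \<xi> X n w = estimator_version n w"
proof -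
  have s1: "AE w in M. skorohod_integral M H B \<xi> (real n) (\<lambda>t w. \<phi> i t) w = divergence_value (Some i) n w" for i
    by (rule skorohod_integral_value) (simp add: coeff_\<xi>_def coeff_1_def coeff_Z_def)
  have "AE w in M. \<forall>i\<in>UNIV. skorohod_integral M H B \<xi> (real n) (\<lambda>t w. \<phi> i t) w = divergence_value (Some i) n w"
    by (rule AE_finite_allI) (use s1 in auto)
  moreover have "AE w in M. skorohod_integral M H B \<xi> (real n) X w = divergence_value None n w"
    by (rule skorohod_integral_value) (use X_version_eq in \<open>simp add: coeff_\<xi>_def coeff_1_def coeff_Z_def X_version_def\<close>)
  ultimately show ?thesis using X_version_eq
  proof eventually_elim
    case (elim w)
    have c: "(LINT t:{0..real n}|lborel. F t (X t w)) = (LINT t:{0..real n}|lborel. F t (X_version t w))" for F :: "real => real => real"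
      by (rule set_lebesgue_integral_cong) (use elim(3) in auto)
    have "lse_P M H B \<sigma> \<phi> \<mu> \<alpha> \<xi> X n w = P_version n w"
      unfolding lse_P_def P_version_def vec_eq_iff
    proof
      fix j show "(\<chi> j. case j of None => - fou_integral M H B \<sigma> \<phi> \<mu> \<alpha> \<xi> X (real n) X w | Some i => fou_integral M H B \<sigma> \<phi> \<mu> \<alpha> \<xi> X (real n) (\<lambda>t w. \<phi> i t) w) $ j =
        (\<chi> j. case j of Some i => (LINT t:{0..real n}|lborel. \<phi> i t * (L t - \<alpha> * X_version t w)) + \<sigma> * divergence_value (Some i) n w
          | None => - ((LINT t:{0..real n}|lborel. X_version t w * (L t - \<alpha> * X_version t w)) + \<sigma> * divergence_value None n w)) $ j"
        using c[of "\<lambda>t x. x * (L t - \<alpha> * x)"] c[of "\<lambda>t x. \<phi> (the j) t * (L t - \<alpha> * x)"] elim(1,2)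
        by (cases j) (simp_all add: fou_integral_def)
    qed
    moreover have "lse_Q \<phi> X n w = lse_Q \<phi> X_version n w"
    proof -
      have "lse_b X n w = lse_b X_version n w" using c[of "\<lambda>t x. x\<^sup>2"] by (simp add: lse_b_def)
      moreover have "lse_a \<phi> X n w = lse_a \<phi> X_version n w"
        using c[of "\<lambda>t x. \<phi> _ t * x"] by (simp add: lse_a_def)
      ultimately have "lse_Q \<phi> X n w $ j $ k = lse_Q \<phi> X_version n w $ j $ k" for j k
        by (cases j; cases k) (simp_all add: lse_Q_def)
      then show ?thesis by (simp add: vec_eq_iff)
    qed
    ultimately show ?case by (simp add: least_squares_estimator_def estimator_version_def)
  qed
qed

lemma estimator_version_measurable: "estimator_version n \<in> borel_measurable M"
proof -
  note [measurable] = X_version_measurable divergence_value_measurable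
  have a: "(\<lambda>w. lse_a \<phi> X_version n w $ i) \<in> borel_measurable M" for i
    unfolding lse_a_def by (simp, rule process_integral_measurable) measurable
  have b: "(\<lambda>w. lse_b X_version n w) \<in> borel_measurable M"
    unfolding lse_b_def by (rule process_integral_measurable) measurable
  have p1: "(\<lambda>w. LINT t:{0..real n}|lborel. \<phi> i t * (L t - \<alpha> * X_version t w)) \<in> borel_measurable M" for i
    by (rule process_integral_measurable) measurable
  have p2: "(\<lambda>w. LINT t:{0..real n}|lborel. X_version t w * (L t - \<alpha> * X_version t w)) \<in> borel_measurable M"
    by (rule process_integral_measurable) measurable
  have "(\<lambda>w. P_version n w $ j) \<in> borel_measurable M" for j
    unfolding P_version_def using p1 p2 by (cases j) (simp_all, measurable)
  moreover have "(\<lambda>w. lse_Q \<phi> X_version n w $ j $ k) \<in> borel_measurable M" for j k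
    using a b by (cases j; cases k) (simp_all add: lse_Q_def)
  ultimately show ?thesis unfolding estimator_version_def[abs_def] by (intro borel_measurable_matrix_inv_mult)
qed

lemma good_X_bdd_on: assumes "good w" "w \<in> space M" shows "bdd_on T (\<lambda>t. X_version t w)"
  unfolding X_version_def
  by (intro bdd_on_intros good_Z_bdd_on[OF assms] bdd_half_line_bdd_on[OF exp_half_line] bdd_half_line_bdd_on[OF h_half_line])

text \<open>With \<open>f = \<phi> i\<close> and with \<open>f = x\<close> the right-hand side is,
  up to sign in the second case, the corresponding row of Q applied to the parameter vector.\<close>

lemma set_integral_L_mult:
  assumes f: "bdd_on T f" and x: "bdd_on T x"
  shows "(LINT t:{0..T}|lborel. f t * (L t - \<alpha> * x t)) =
    (\<Sum>i\<in>UNIV. \<mu> $ i * (LINT t:{0..T}|lborel. \<phi> i t * f t)) - \<alpha> * (LINT t:{0..T}|lborel. x t * f t)"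
proof -
  have "(LINT t:{0..T}|lborel. f t * (L t - \<alpha> * x t)) = (LINT t:{0..T}|lborel. (\<Sum>i\<in>UNIV. \<mu> $ i * (\<phi> i t * f t)) - \<alpha> * (x t * f t))"
    by (rule arg_cong[where f="\<lambda>g. set_lebesgue_integral lborel {0..T} g"])
      (simp add: fun_eq_iff periodic_mean_def sum_distrib_left right_diff_distrib mult_ac)
  also have "... = (LINT t:{0..T}|lborel. \<Sum>i\<in>UNIV. \<mu> $ i * (\<phi> i t * f t)) - (LINT t:{0..T}|lborel. \<alpha> * (x t * f t))"
    by (intro set_integral_diff(2) bdd_on_integrable bdd_on_intros f x \<phi>_bdd_on)
  also have "(LINT t:{0..T}|lborel. \<Sum>i\<in>UNIV. \<mu> $ i * (\<phi> i t * f t)) = (\<Sum>i\<in>UNIV. LINT t:{0..T}|lborel. \<mu> $ i * (\<phi> i t * f t))"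
  proof -
    have "integrable lborel (\<lambda>t. indicator {0..T} t *\<^sub>R (\<mu> $ i * (\<phi> i t * f t)))" for i
      using bdd_on_integrable[OF bdd_on_mult[OF bdd_on_const bdd_on_mult[OF \<phi>_bdd_on f]]] unfolding set_integrable_def .
    then show ?thesis unfolding set_lebesgue_integral_def scaleR_sum_right by (rule Bochner_Integration.integral_sum)
  qed
  finally show ?thesis by simp
qed

lemma estimator_residual:
  assumes w: "good w" "w \<in> space M"
  shows "P_version n w - lse_Q \<phi> X_version n w *v parameter_vector \<mu> \<alpha> =
    (\<chi> j. (case j of Some i => \<sigma> | None => - \<sigma>) * divergence_value j n w)"
proof -
  note x = good_X_bdd_on[OF w, of "real n"]
  have "(P_version n w - lse_Q \<phi> X_version n w *v parameter_vector \<mu> \<alpha>) $ j = (case j of Some i => \<sigma> | None => - \<sigma>) * divergence_value j n w" for j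
  proof (cases j)
    case None
    then show ?thesis
      using set_integral_L_mult[OF x x]
      by (simp add: lse_Q_mult parameter_vector_def P_version_def lse_a_def lse_b_def power2_eq_square mult.commute)
  next
    case (Some i)
    have o: "(LINT t:{0..real n}|lborel. \<phi> l t * \<phi> i t) = (if l = i then real n else 0)" for l
      by (subst set_integral_periodic) (auto intro!: bdd_on_mult \<phi>_bdd_on simp: \<phi>_per \<phi>_orth)
    show ?thesis
      using set_integral_L_mult[OF \<phi>_bdd_on[of "real n" i] x] Some
      by (simp add: lse_Q_mult parameter_vector_def P_version_def lse_a_def o mult.commute if_distrib cong: if_cong)
  qed
  then show ?thesis by (simp add: vec_eq_iff)
qed

section \<open>Convergence along single paths\<close>

text \<open>The finitely many sequences whose convergence to 0 after division by n is the only
  probabilistic input for a single path. \<xi> does not occur in them; it reenters as a fixed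
  factor.\<close>

definition errors :: "(nat => 'a => real) set" where
  "errors = range (\<lambda>j n. wiener_int (real n) (coeff_\<xi> j)) \<union> range (\<lambda>j n. wiener_int (real n) (coeff_1 j)) \<union>
     range (\<lambda>j n w. LINT s:{0..real n}|lborel. coeff_1 j s * Z w s) \<union>
     {\<lambda>n w. LINT s:{0..real n}|lborel. exp (- \<alpha> * s) * Z w s, \<lambda>n w. LINT s:{0..real n}|lborel. Z2 w s, \<lambda>n w. Z2 w (real n)}"

lemma errors_subquadratic: "V \<in> errors ==> subquadratic V"
  unfolding errors_def
  using subquadratic_wiener_int[OF coeff_half_line(1)] subquadratic_wiener_int[OF coeff_half_line(2)]
    subquadratic_average[OF coeff_half_line(2)] subquadratic_average[OF exp_half_line] subquadratic_Z2_average subquadratic_Z2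
  by blast

lemma finite_errors: "finite errors" unfolding errors_def by simp

text \<open>With the path fixed, the error solves a deterministic linear system whose right-hand
  side, divided by n, tends to 0. It remains to see that the Schur complement stays away from 0 and
  that the off-diagonal entries cannot spoil null sequences.\<close>

lemma estimator_version_limit:
  assumes w: "good w" "w \<in> space M" and r: "strict_mono r"
    and V: "\<And>V. V \<in> errors ==> (\<lambda>n. V (r n) w / real (r n)) \<longlonglongrightarrow> 0"
  shows "(\<lambda>n. dist (estimator_version (r n) w) (parameter_vector \<mu> \<alpha>)) \<longlonglongrightarrow> 0"
proof -
  define N where "N n = real (r n)" for n
  define m where "m s = \<xi> w * exp (- \<alpha> * s) + h s" for s
  define x where "x s = X_version s w" for s
  have xe: "x = (\<lambda>s. m s + \<sigma> * Z w s)" by (simp add: fun_eq_iff x_def m_def X_version_def)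
  note z = good_Z_bdd_on[OF w]
  have e: "bdd_on T (\<lambda>s. exp (- \<alpha> * s))" and hb: "bdd_on T h" for T
    by (intro bdd_half_line_bdd_on exp_half_line h_half_line)+
  have m: "bdd_on T m" for T unfolding m_def[abs_def] by (intro bdd_on_intros e hb)
  have x: "bdd_on T x" for T unfolding xe by (intro bdd_on_intros m z)
  have rn: "r n \<ge> 1" if "n \<ge> 1" for n using seq_suble[OF r, of n] that by simp
  have Npos: "N n > 0" if "n \<ge> 1" for n using rn[OF that] by (simp add: N_def)
  have Nlim: "(\<lambda>n. 1 / N n) \<longlonglongrightarrow> 0"
    using LIMSEQ_subseq_LIMSEQ[OF lim_1_over_n r] by (simp add: o_def N_def)
  have zphi: "(\<lambda>n. mean_prod (N n) (Z w) (\<phi> i)) \<longlonglongrightarrow> 0" for i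
  proof -
    have "(\<lambda>n w. LINT s:{0..real n}|lborel. coeff_1 (Some i) s * Z w s) \<in> errors" unfolding errors_def by blast
    from V[OF this] show ?thesis by (simp add: mean_prod_def N_def coeff_1_def mult.commute)
  qed
  have mz: "(\<lambda>n. mean_prod (N n) m (Z w)) \<longlonglongrightarrow> 0"
  proof -
    have "(\<lambda>n w. LINT s:{0..real n}|lborel. exp (- \<alpha> * s) * Z w s) \<in> errors"
      "(\<lambda>n w. LINT s:{0..real n}|lborel. coeff_1 None s * Z w s) \<in> errors" unfolding errors_def by blast+
    note l = this[THEN V]
    have "(\<lambda>n. \<xi> w * mean_prod (N n) (\<lambda>s. exp (- \<alpha> * s)) (Z w) + mean_prod (N n) h (Z w)) \<longlonglongrightarrow> \<xi> w * 0 + 0"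
      using l unfolding mean_prod_def N_def coeff_1_def by (intro tendsto_intros) simp_all
    moreover have "mean_prod (N n) m (Z w) = \<xi> w * mean_prod (N n) (\<lambda>s. exp (- \<alpha> * s)) (Z w) + mean_prod (N n) h (Z w)" for n
      unfolding m_def[abs_def] mean_prod_add[OF bdd_on_mult[OF bdd_on_const e] hb z] mean_prod_scale ..
    ultimately show ?thesis by simp
  qed
  \<comment> \<open>These means are only bounded, by a constant that depends on the path through
    \<xi>; they enter only in products with null sequences.\<close>
  have null_mult: "(\<lambda>n. mean_prod (N n) m (\<phi> i) * g n) \<longlonglongrightarrow> 0" if g: "g \<longlonglongrightarrow> 0" for i g
  proof -
    obtain C where C: "C \<ge> 0" "\<And>t. \<bar>\<phi> i t\<bar> \<le> C" by (rule \<phi>_bound[of i]) (rule that)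
    obtain D where D: "\<forall>s\<ge>0. \<bar>h s\<bar> \<le> D" using h_half_line by (auto simp: bdd_half_line_def)
    have "\<bar>m s\<bar> \<le> \<bar>\<xi> w\<bar> + D" if "s \<ge> 0" for s
    proof -
      have "\<bar>\<xi> w * exp (- \<alpha> * s)\<bar> \<le> \<bar>\<xi> w\<bar>" using that \<alpha>_pos by (simp add: abs_mult mult_left_le)
      then show ?thesis using D that abs_triangle_ineq[of "\<xi> w * exp (- \<alpha> * s)" "h s"] unfolding m_def by fastforce
    qed
    then have b: "\<bar>mean_prod (N n) m (\<phi> i)\<bar> \<le> (\<bar>\<xi> w\<bar> + D) * C" if "n \<ge> 1" for n
      by (intro mean_prod_abs_le Npos that m \<phi>_bdd_on C(2)) auto
    show ?thesis
    proof (rule Lim_null_comparison)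
      show "\<forall>\<^sub>F n in sequentially. norm (mean_prod (N n) m (\<phi> i) * g n) \<le> (\<bar>\<xi> w\<bar> + D) * C * \<bar>g n\<bar>"
        using b by (intro eventually_sequentiallyI[of 1]) (auto simp: abs_mult intro!: mult_right_mono)
      show "(\<lambda>n. (\<bar>\<xi> w\<bar> + D) * C * \<bar>g n\<bar>) \<longlonglongrightarrow> 0" using tendsto_mult_right_zero[OF tendsto_rabs_zero[OF g]] .
    qed
  qed
  define a where "a i n = mean_prod (N n) x (\<phi> i)" for i n
  define s where "s n = mean_prod (N n) x x - (\<Sum>i\<in>UNIV. (a i n)\<^sup>2)" for n
  have a_null: "(\<lambda>n. a i n * g n) \<longlonglongrightarrow> 0" if g: "g \<longlonglongrightarrow> 0" for i g
  proof -
    have "a i n * g n = mean_prod (N n) m (\<phi> i) * g n + \<sigma> * (mean_prod (N n) (Z w) (\<phi> i) * g n)" for n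
      unfolding a_def xe mean_prod_add[OF m bdd_on_mult[OF bdd_on_const z] \<phi>_bdd_on] mean_prod_scale by (simp add: algebra_simps)
    moreover have "(\<lambda>n. mean_prod (N n) m (\<phi> i) * g n + \<sigma> * (mean_prod (N n) (Z w) (\<phi> i) * g n)) \<longlonglongrightarrow> 0 + \<sigma> * (0 * 0)"
      by (intro tendsto_intros null_mult g zphi)
    ultimately show ?thesis by simp
  qed
  \<comment> \<open>Half of the limit of the lower bound \<open>t\<close> below, so that the bound
    eventually exceeds it strictly.\<close>
  define c0 where "c0 = \<sigma>\<^sup>2 * exp (- 2 * \<alpha>) / 2"
  have c0: "c0 > 0" using \<sigma>_pos by (simp add: c0_def)
  have s_ev: "\<forall>\<^sub>F n in sequentially. c0 < s n"
  proof -
    have "(\<lambda>n w. LINT s:{0..real n}|lborel. Z2 w s) \<in> errors" unfolding errors_def by blast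
    note W = V[OF this]
    \<comment> \<open>The lower bound of \<open>residual_mean_prod_ge\<close> with c = \<sigma>, in
      which the mean square of Z is replaced by its own lower bound from
      \<open>mean_prod_Z_ge\<close>. Everything tends to 0 except the term with exp(-2
      \<alpha>).\<close>
    define t where "t n = 2 * \<sigma> * (mean_prod (N n) m (Z w) - (\<Sum>i\<in>UNIV. mean_prod (N n) m (\<phi> i) * mean_prod (N n) (Z w) (\<phi> i))) +
      \<sigma>\<^sup>2 * ((LINT s:{0..N n}|lborel. Z2 w s) / N n + exp (- 2 * \<alpha>) * (1 - 1 / N n) - (\<Sum>i\<in>UNIV. (mean_prod (N n) (Z w) (\<phi> i))\<^sup>2))" for n
    have "t \<longlonglongrightarrow> 2 * \<sigma> * (0 - (\<Sum>i\<in>(UNIV :: 'p set). 0)) + \<sigma>\<^sup>2 * (0 + exp (- 2 * \<alpha>) * (1 - 0) - (\<Sum>i\<in>(UNIV :: 'p set). 0\<^sup>2))"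
      unfolding t_def[abs_def] by (intro tendsto_intros mz null_mult zphi Nlim W[folded N_def])
    then have "t \<longlonglongrightarrow> \<sigma>\<^sup>2 * exp (- 2 * \<alpha>)" by simp
    moreover have "c0 < \<sigma>\<^sup>2 * exp (- 2 * \<alpha>)" using \<sigma>_pos by (simp add: c0_def)
    ultimately have "\<forall>\<^sub>F n in sequentially. c0 < t n" by (rule order_tendstoD(1))
    then show ?thesis using eventually_ge_at_top[of 1]
    proof eventually_elim
      case (elim n)
      have orth: "mean_prod (N n) (\<phi> i) (\<phi> j) = (if i = j then 1 else 0)" for i j
        unfolding N_def by (rule \<phi>_mean_prod) (use rn[OF elim(2)] in simp)
      have "\<sigma>\<^sup>2 * ((LINT s:{0..N n}|lborel. Z2 w s) / N n + exp (- 2 * \<alpha>) * (1 - 1 / N n)) \<le> \<sigma>\<^sup>2 * mean_prod (N n) (Z w) (Z w)"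
        unfolding N_def by (intro mult_left_mono mean_prod_Z_ge[OF w rn[OF elim(2)]]) simp
      then have "t n \<le> s n"
        using residual_mean_prod_ge[OF Npos[OF elim(2)] \<phi>_bdd_on orth m z, of \<sigma>, folded xe]
        unfolding t_def s_def a_def by (simp only: right_diff_distrib)
      then show ?case using elim(1) by simp
    qed
  qed
  \<comment> \<open>The residual of the linear system divided by n. The last component carries the
    opposite sign because P contains minus the integral of X.\<close>
  define d where "d j n = (case j of Some i => \<sigma> | None => - \<sigma>) * divergence_value j (r n) w / N n" for j n
  have d: "d j \<longlonglongrightarrow> 0" for j
  proof -
    have "(\<lambda>n. wiener_int (real n) (coeff_\<xi> j)) \<in> errors" "(\<lambda>n. wiener_int (real n) (coeff_1 j)) \<in> errors"
      "(\<lambda>n w. LINT s:{0..real n}|lborel. Z2 w s) \<in> errors" "(\<lambda>n w. Z2 w (real n)) \<in> errors" unfolding errors_def by blast+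
    note l = this[THEN V, folded N_def]
    let ?c = "case j of Some i => \<sigma> | None => - \<sigma>"
    have "(\<lambda>n. ?c * (\<xi> w * (wiener_int (N n) (coeff_\<xi> j) w / N n) + wiener_int (N n) (coeff_1 j) w / N n +
        coeff_Z j * (Z2 w (N n) / N n / 2 + \<alpha> * ((LINT s:{0..N n}|lborel. Z2 w s) / N n)))) \<longlonglongrightarrow>
        ?c * (\<xi> w * 0 + 0 + coeff_Z j * (0 / 2 + \<alpha> * 0))"
      by (intro tendsto_intros l) simp
    moreover have lin: "y * (x1 * x2 + x3 + x4 * (x5 / 2 + \<alpha> * x6)) / q = y * (x1 * (x2 / q) + x3 / q + x4 * (x5 / q / 2 + \<alpha> * (x6 / q)))"
      for y x1 x2 x3 x4 x5 x6 q :: real unfolding divide_inverse by (simp only: distrib_left distrib_right mult.assoc mult.left_commute mult.commute)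
    have "d j = (\<lambda>n. ?c * (\<xi> w * (wiener_int (N n) (coeff_\<xi> j) w / N n) + wiener_int (N n) (coeff_1 j) w / N n +
        coeff_Z j * (Z2 w (N n) / N n / 2 + \<alpha> * ((LINT s:{0..N n}|lborel. Z2 w s) / N n))))"
      unfolding d_def[abs_def] divergence_value_def Z_div_def N_def[symmetric] by (simp only: lin)
    ultimately show ?thesis by simp
  qed
  define v where "v n = estimator_version (r n) w - parameter_vector \<mu> \<alpha>" for n
  have v: "v n $ None = (d None n + (\<Sum>i\<in>UNIV. a i n * d (Some i) n)) / s n" "v n $ Some i = d (Some i) n + a i n * v n $ None"
    if "n \<ge> 1" "c0 < s n" for n i
  proof -
    let ?Q = "lse_Q \<phi> X_version (r n) w"
    define D where "D = (\<chi> j. (case j of Some i => \<sigma> | None => - \<sigma>) * divergence_value j (r n) w)"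
    have ai: "lse_a \<phi> X_version (r n) w $ i / real (r n) = a i n" for i
      by (simp add: lse_a_def a_def mean_prod_def x_def N_def mult.commute)
    have sn: "lse_b X_version (r n) w / real (r n) - (\<Sum>i\<in>UNIV. (lse_a \<phi> X_version (r n) w $ i / real (r n))\<^sup>2) = s n"
      unfolding ai by (simp add: s_def lse_b_def mean_prod_def x_def N_def power2_eq_square)
    have rp: "r n > 0" using rn[OF that(1)] by simp
    have sp: "lse_b X_version (r n) w / real (r n) - (\<Sum>i\<in>UNIV. (lse_a \<phi> X_version (r n) w $ i / real (r n))\<^sup>2) > 0"
      unfolding sn using that(2) c0 by simp
    have inv: "invertible ?Q" by (rule lse_Q_solve(3)[OF rp sp refl])
    have "P_version (r n) w = ?Q *v parameter_vector \<mu> \<alpha> + D"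
      using estimator_residual[OF w, of "r n"] by (simp add: D_def algebra_simps)
    \<comment> \<open>The residual identity turns the estimator into the true parameter plus the
      inverse applied to D, as Q is invertible here.\<close>
    then have "estimator_version (r n) w = (matrix_inv ?Q ** ?Q) *v parameter_vector \<mu> \<alpha> + matrix_inv ?Q *v D"
      by (simp add: estimator_version_def matrix_vector_right_distrib matrix_vector_mul_assoc)
    then have vD: "v n = matrix_inv ?Q *v D" by (simp add: v_def matrix_inv_left[OF inv])
    have Dd: "D $ j / real (r n) = d j n" for j by (simp add: D_def d_def N_def)
    show "v n $ None = (d None n + (\<Sum>i\<in>UNIV. a i n * d (Some i) n)) / s n"
      using lse_Q_solve(1)[OF rp sp vD, unfolded sn] unfolding ai Dd .
    show "v n $ Some i = d (Some i) n + a i n * v n $ None"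
      using lse_Q_solve(2)[OF rp sp vD] unfolding ai Dd .
  qed
  have ev: "\<forall>\<^sub>F n in sequentially. n \<ge> 1 \<and> c0 < s n" by (intro eventually_conj eventually_ge_at_top s_ev)
  have v0: "(\<lambda>n. v n $ None) \<longlonglongrightarrow> 0"
  proof (rule Lim_null_comparison)
    show "\<forall>\<^sub>F n in sequentially. norm (v n $ None) \<le> \<bar>d None n + (\<Sum>i\<in>UNIV. a i n * d (Some i) n)\<bar> / c0"
      using ev
    proof eventually_elim
      case (elim n)
      then show ?case unfolding v(1)[OF elim[THEN conjunct1] elim[THEN conjunct2]] using c0
        by (simp add: abs_divide frac_le)
    qed
    have "(\<lambda>n. d None n + (\<Sum>i\<in>UNIV. a i n * d (Some i) n)) \<longlonglongrightarrow> 0 + (\<Sum>i\<in>(UNIV :: 'p set). 0)"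
      by (intro tendsto_add tendsto_sum d a_null)
    then have "(\<lambda>n. \<bar>d None n + (\<Sum>i\<in>UNIV. a i n * d (Some i) n)\<bar> / c0) \<longlonglongrightarrow> 0 / c0"
      using c0 by (intro tendsto_divide tendsto_const tendsto_rabs_zero) auto
    then show "(\<lambda>n. \<bar>d None n + (\<Sum>i\<in>UNIV. a i n * d (Some i) n)\<bar> / c0) \<longlonglongrightarrow> 0" by simp
  qed
  have vj: "(\<lambda>n. v n $ j) \<longlonglongrightarrow> 0" for j
  proof (cases j)
    case None then show ?thesis using v0 by simp
  next
    case (Some i)
    have "(\<lambda>n. d (Some i) n + a i n * v n $ None) \<longlonglongrightarrow> 0 + 0" by (intro tendsto_add d a_null v0)
    moreover have "\<forall>\<^sub>F n in sequentially. d (Some i) n + a i n * v n $ None = v n $ j"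
      using ev by eventually_elim (simp add: v(2) Some)
    ultimately show ?thesis using Lim_transform_eventually by fastforce
  qed
  have "v \<longlonglongrightarrow> 0" by (rule vec_tendstoI) (simp add: vj)
  then have "(\<lambda>n. norm (v n)) \<longlonglongrightarrow> 0" by (rule tendsto_norm_zero)
  then show ?thesis by (simp add: v_def dist_norm)
qed

lemma least_squares_estimator_consistent:
  "tendsto_in_probability M (least_squares_estimator M H B \<sigma> \<phi> \<mu> \<alpha> \<xi> X) (parameter_vector \<mu> \<alpha>)"
proof (rule tendsto_in_probability_AE_version[OF estimator_version_measurable estimator_version_eq])
  note [measurable] = estimator_version_measurable
  have dm: "(\<lambda>w. dist (estimator_version n w) (parameter_vector \<mu> \<alpha>)) \<in> borel_measurable M" for n by measurable
  have imp: "AE w in M. \<forall>r. strict_mono r --> (\<forall>V\<in>errors. (\<lambda>n. V (r n) w / real (r n)) \<longlonglongrightarrow> 0) -->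
      (\<lambda>n. dist (estimator_version (r n) w) (parameter_vector \<mu> \<alpha>)) \<longlonglongrightarrow> 0"
    using AE_good AE_space
  proof eventually_elim
    case (elim w)
    show ?case
    proof (intro allI impI)
      fix r :: "nat => nat" assume "strict_mono r" "\<forall>V\<in>errors. (\<lambda>n. V (r n) w / real (r n)) \<longlonglongrightarrow> 0"
      then show "(\<lambda>n. dist (estimator_version (r n) w) (parameter_vector \<mu> \<alpha>)) \<longlonglongrightarrow> 0"
        by (intro estimator_version_limit elim) auto
    qed
  qed
  show "(\<lambda>n. prob {w \<in> space M. dist (estimator_version n w) (parameter_vector \<mu> \<alpha>) > \<epsilon>}) \<longlonglongrightarrow> 0" if "\<epsilon> > 0" for \<epsilon>
    by (rule tendsto_prob_of_subquadratic[OF finite_errors _ dm imp that]) (rule errors_subquadratic)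
qed

end

theorem theorem1:
  fixes M :: "'a measure" and H \<sigma> \<alpha> :: real
    and B X :: "real \<Rightarrow> 'a \<Rightarrow> real" and \<xi> :: "'a \<Rightarrow> real"
    and \<phi> :: "'p::finite \<Rightarrow> real \<Rightarrow> real" and \<mu> :: "real^'p"
  assumes prob: "prob_space M"
    and H: "1/2 < H" "H < 3/4"
    and \<sigma>: "\<sigma> > 0"
    and \<alpha>: "\<alpha> > 0"
    and fbm: "fractional_brownian_motion M H B"
    and \<xi>: "\<xi> \<in> borel_measurable M"
    and indep: "prob_space.indep_set M
          (sets (vimage_algebra (space M) \<xi> borel))
          (sets (vimage_algebra (space M) (\<lambda>\<omega> t. B t \<omega>) (Pi\<^sub>M UNIV (\<lambda>_. borel))))"
    and \<phi>_meas: "\<And>i. \<phi> i \<in> borel_measurable borel"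
    and \<phi>_bdd: "\<And>i. bounded (range (\<phi> i))"
    and \<phi>_per: "\<And>i t. \<phi> i (t + 1) = \<phi> i t"
    and \<phi>_orth: "\<And>i j. (LINT t:{0..1}|lborel. \<phi> i t * \<phi> j t) = (if i = j then 1 else 0)"
    and X: "fou_process M B \<sigma> \<phi> \<mu> \<alpha> \<xi> X"
  shows "tendsto_in_probability M (least_squares_estimator M H B \<sigma> \<phi> \<mu> \<alpha> \<xi> X)
           (parameter_vector \<mu> \<alpha>)"
proof -
  interpret prob_space M by (rule prob)
  interpret fou_estimation M H B \<alpha> \<xi> \<sigma> \<phi> \<mu> X
    using H \<sigma> \<alpha> fbm \<xi> indep \<phi>_meas \<phi>_bdd \<phi>_per \<phi>_orth X by unfold_locales auto
  show ?thesis by (rule least_squares_estimator_consistent)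
qed

end
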